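(* Let $X$ be a Banach space, $A$ a sectorial operator on $X$, $0\le\alpha<1$, and $f:X^\alpha\to X$ globally Lipschitz with Lipschitz constant $L_f$. Let $\lambda_0$, $\beta$, $J$, the decomposition $X=X^1\oplus X^2\oplus X^3$ (with $X^1,X^2$ finite dimensional) and the constant $M$ be as in the context. Let $\mu\in(\frac14\beta,\frac34\beta)$ be fixed and assume $F_\mu L_f<1$, where $$F_\mu=M\Big[\int_0^\infty e^{-(\mu-\frac14\beta)s}\,ds+\int_0^\infty(1+s^{-\alpha})e^{-(\frac34\beta-\mu)s}\,ds\Big].$$ Then there exists a Lipschitz continuous mapping $\xi_\lambda$ from $X^\alpha_2$ to $X^\alpha_{13}$ for $\lambda\in J$, such that for each $\lambda\in J$ the system $$u_t+A_\lambda u=f(u),\qquad A_\lambda=A-\lambda I,$$ has a global invariant manifold $\mathcal{M}_\lambda$, which is represented as $$\mathcal{M}_\lambda=\{w+\xi_\lambda(w):w\in X^\alpha_2\}.$$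
   Context: A sectorial operator $A$ on $X$ is a closed densely defined linear operator for which there are $\phi\in(0,\pi/2)$, $a\in\mathbb{R}$, $M_0\ge1$ such that the sector $\{\lambda:\phi\le|\arg(\lambda-a)|\le\pi,\ \lambda\ne a\}$ lies in the resolvent set and $\|(\lambda I-A)^{-1}\|\le M_0/|\lambda-a|$ there. Let $\Lambda=A+aI$ with $a>0$ such that $\mathrm{Re}\,\sigma(\Lambda)>0$; $X^\alpha=D(\Lambda^\alpha)$ with norm $\|u\|_\alpha=\|\Lambda^\alpha u\|$. Standing spectral assumptions: $\lambda_0$ is an isolated eigenvalue of $A$ with finite multiplicity, and $\sigma(A)=\sigma^1\cup\sigma^2\cup\sigma^3$ with $\sigma^1=\sigma(A)\cap\{\mathrm{Re}\,\lambda\le\beta_1\}$, $\sigma^2=\{\lambda_0\}$, $\sigma^3=\sigma(A)\cap\{\mathrm{Re}\,\lambda\ge\beta_2\}$, where $\beta_1,\beta_2\in\mathbb{R}$ and $\beta_1<\mathrm{Re}\,\lambda_0<\beta_2$ (so $\mathrm{Re}\,\sigma(A)\cap(\beta_1,\beta_2)=\{\mathrm{Re}\,\lambda_0\}$). $X=X^1\oplus X^2\oplus X^3$ is the corresponding spectral decomposition, with projections $P_i:X\to X^i$; $X^2$ is finite dimensional and $X^1$ is assumed finite dimensional. Fix $\beta>0$ with $\beta<\min\{\mathrm{Re}\,\lambda_0-\beta_1,\beta_2-\mathrm{Re}\,\lambda_0\}$ and put $J=(\mathrm{Re}\,\lambda_0-\frac14\beta,\mathrm{Re}\,\lambda_0+\frac14\beta)\subset\mathbb{R}$.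 For $\lambda\in J$ let $A_\lambda=A-\lambda I$, $A^i=A_\lambda|_{X^i}$. $M>0$ is a constant (depending on $A$) such that for all $\lambda\in J$: $\|\Lambda^\alpha e^{-A^1t}\|\le Me^{\frac34\beta t}$, $\|e^{-A^1t}\|\le Me^{\frac34\beta t}$ for $t\le0$; $\|\Lambda^\alpha e^{-A^2t}\|\le Me^{\frac14\beta|t|}$, $\|e^{-A^2t}\|\le Me^{\frac14\beta|t|}$ for $t\in\mathbb{R}$; $\|\Lambda^\alpha e^{-A^3t}P_3\Lambda^{-\alpha}\|\le Me^{-\frac34\beta t}$, $\|\Lambda^\alpha e^{-A^3t}\|\le Mt^{-\alpha}e^{-\frac34\beta t}$ for $t>0$. $X^\alpha_i=X^i\cap X^\alpha$ and $X^\alpha_{13}=X^\alpha_1\oplus X^\alpha_3$. The equation $u_t+A_\lambda u=f(u)$ generates a semiflow $\Phi_\lambda$ on $X^\alpha$. That $\mathcal{M}_\lambda$ is a global invariant manifold means that it is a graph over all of $X_2^\alpha$ as displayed and is invariant: $\Phi_\lambda(t)\mathcal{M}_\lambda=\mathcal{M}_\lambda$ for all $t\ge0$.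
   Formalization: The bounds defining M for e^{-A^1t}, e^{-A^2t} and Λ^α e^{-A^3t} are taken as norms on X of these operators composed with the projections P_i, not of the restrictions to X^i; with the restrictions alone the theorem is false. *)

theory Defs
  imports "HOL-Analysis.Analysis"
begin

section \<open>Complex Banach spaces\<close>

text \<open>The distribution has only real normed spaces; spectral theory needs complex scalars.\<close>

class complex_banach = banach +
  fixes scaleC :: "complex \<Rightarrow> 'a \<Rightarrow> 'a"  (infixr "*\<^sub>C" 75)
  assumes scaleC_add_right: "c *\<^sub>C (x + y) = c *\<^sub>C x + c *\<^sub>C y"
    and scaleC_add_left: "(c + d) *\<^sub>C x = c *\<^sub>C x + d *\<^sub>C x"
    and scaleC_scaleC: "c *\<^sub>C (d *\<^sub>C x) = (c * d) *\<^sub>C x"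
    and scaleC_of_real: "complex_of_real r *\<^sub>C x = r *\<^sub>R x"
    and norm_scaleC: "norm (c *\<^sub>C x) = cmod c * norm x"

instantiation complex :: complex_banach
begin
definition scaleC_complex :: "complex \<Rightarrow> complex \<Rightarrow> complex"
  where "scaleC_complex c x = c * x"
instance
  by standard (simp_all add: scaleC_complex_def algebra_simps norm_mult scaleR_conv_of_real)
end

definition csubspace :: "'a::complex_banach set \<Rightarrow> bool" where
  "csubspace V \<longleftrightarrow> 0 \<in> V \<and> (\<forall>x\<in>V. \<forall>y\<in>V. x + y \<in> V) \<and> (\<forall>c. \<forall>x\<in>V. c *\<^sub>C x \<in> V)"

definition clinear_on :: "'a::complex_banach set \<Rightarrow> ('a \<Rightarrow> 'a) \<Rightarrow> bool" where
  "clinear_on V g \<longleftrightarrow>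
     (\<forall>x\<in>V. \<forall>y\<in>V. g (x + y) = g x + g y) \<and> (\<forall>c. \<forall>x\<in>V. g (c *\<^sub>C x) = c *\<^sub>C g x)"

definition bounded_clinear :: "('a::complex_banach \<Rightarrow> 'a) \<Rightarrow> bool" where
  "bounded_clinear g \<longleftrightarrow> bounded_linear g \<and> clinear_on UNIV g"

text \<open>\<open>span\<close> is the real span; a complex subspace has finite real dimension iff it has finite
  complex dimension.\<close>

definition finite_dim :: "'a::real_vector set \<Rightarrow> bool" where
  "finite_dim V \<longleftrightarrow> (\<exists>B. finite B \<and> V \<subseteq> span B)"


section \<open>Unbounded operators\<close>

text \<open>An unbounded operator is given by its domain \<open>D\<close> and a function \<open>A\<close>. The values of \<open>A\<close>
  outside \<open>D\<close> are irrelevant for all notions below.\<close>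

definition closed_densely_defined :: "'a::complex_banach set \<Rightarrow> ('a \<Rightarrow> 'a) \<Rightarrow> bool" where
  "closed_densely_defined D A \<longleftrightarrow>
     csubspace D \<and> clinear_on D A \<and> closed ((\<lambda>x. (x, A x)) ` D) \<and> closure D = UNIV"

text \<open>\<open>A + c I\<close> for real \<open>c\<close>, with the same domain as \<open>A\<close>.\<close>

definition op_shift :: "('a::real_vector \<Rightarrow> 'a) \<Rightarrow> real \<Rightarrow> 'a \<Rightarrow> 'a" where
  "op_shift A c x = A x + c *\<^sub>R x"

text \<open>Resolvent set and spectrum of the part of \<open>A\<close> in an invariant closed subspace \<open>V\<close>, with
  domain \<open>D \<inter> V\<close>; the case \<open>V = UNIV\<close> is the operator itself. The estimate says that the inverse
  of \<open>z I - A\<close> on \<open>V\<close> is bounded.\<close>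

definition resolvent_set :: "'a::complex_banach set \<Rightarrow> 'a set \<Rightarrow> ('a \<Rightarrow> 'a) \<Rightarrow> complex set" where
  "resolvent_set V D A =
     {z. bij_betw (\<lambda>x. z *\<^sub>C x - A x) (D \<inter> V) V \<and>
         (\<exists>C. \<forall>x \<in> D \<inter> V. norm x \<le> C * norm (z *\<^sub>C x - A x))}"

definition spectrum :: "'a::complex_banach set \<Rightarrow> 'a set \<Rightarrow> ('a \<Rightarrow> 'a) \<Rightarrow> complex set" where
  "spectrum V D A = - resolvent_set V D A"

definition resolvent :: "'a::complex_banach set \<Rightarrow> ('a \<Rightarrow> 'a) \<Rightarrow> complex \<Rightarrow> 'a \<Rightarrow> 'a" where
  "resolvent D A z = inv_into D (\<lambda>x. z *\<^sub>C x - A x)"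

definition sectorial :: "'a::complex_banach set \<Rightarrow> ('a \<Rightarrow> 'a) \<Rightarrow> bool" where
  "sectorial D A \<longleftrightarrow> closed_densely_defined D A \<and>
     (\<exists>\<phi> a M0. 0 < \<phi> \<and> \<phi> < pi / 2 \<and> 1 \<le> M0 \<and>
        (\<forall>z. z \<noteq> complex_of_real a \<and>
             \<phi> \<le> \<bar>Arg (z - complex_of_real a)\<bar> \<and> \<bar>Arg (z - complex_of_real a)\<bar> \<le> pi \<longrightarrow>
             z \<in> resolvent_set UNIV D A \<and>
             (\<forall>x. norm (resolvent D A z x) \<le> M0 / cmod (z - complex_of_real a) * norm x)))"

definition eigenvalue :: "'a::complex_banach set \<Rightarrow> ('a \<Rightarrow> 'a) \<Rightarrow> complex \<Rightarrow> bool" where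
  "eigenvalue D A z \<longleftrightarrow> (\<exists>x\<in>D. x \<noteq> 0 \<and> A x = z *\<^sub>C x)"

text \<open>\<open>P i\<close> (\<open>i \<in> I\<close>) are the projections of the spectral decomposition corresponding to the
  splitting of the spectrum into the sets \<open>S i\<close>: they are complementary bounded projections, they
  decompose \<open>A\<close>, and the part of \<open>A\<close> in \<open>range (P i)\<close> has spectrum \<open>S i\<close>.\<close>

definition spectral_decomposition ::
    "'a::complex_banach set \<Rightarrow> ('a \<Rightarrow> 'a) \<Rightarrow> nat set \<Rightarrow> (nat \<Rightarrow> complex set) \<Rightarrow> (nat \<Rightarrow> 'a \<Rightarrow> 'a) \<Rightarrow> bool" where
  "spectral_decomposition D A I S P \<longleftrightarrow>
     (\<forall>i\<in>I. bounded_clinear (P i)) \<and>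
     (\<forall>i\<in>I. \<forall>j\<in>I. \<forall>x. P i (P j x) = (if i = j then P i x else 0)) \<and>
     (\<forall>x. (\<Sum>i\<in>I. P i x) = x) \<and>
     (\<forall>i\<in>I. \<forall>x\<in>D. P i x \<in> D \<and> A (P i x) = P i (A x)) \<and>
     (\<forall>i\<in>I. spectrum (range (P i)) D A = S i)"


section \<open>Operator exponentials and fractional powers\<close>

definition c0_semigroup :: "(real \<Rightarrow> 'a::complex_banach \<Rightarrow> 'a) \<Rightarrow> bool" where
  "c0_semigroup T \<longleftrightarrow>
     (\<forall>t\<ge>0. bounded_clinear (T t)) \<and> (\<forall>x. T 0 x = x) \<and>
     (\<forall>s\<ge>0. \<forall>t\<ge>0. \<forall>x. T (s + t) x = T s (T t x)) \<and>
     (\<forall>x. ((\<lambda>t. T t x) \<longlongrightarrow> x) (at_right 0))"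

text \<open>The infinitesimal generator of \<open>T\<close>, including its domain, is \<open>- A\<close> (sic: minus \<open>A\<close>).\<close>

definition neg_generator ::
    "'a::complex_banach set \<Rightarrow> ('a \<Rightarrow> 'a) \<Rightarrow> (real \<Rightarrow> 'a \<Rightarrow> 'a) \<Rightarrow> bool" where
  "neg_generator D A T \<longleftrightarrow>
     (\<forall>x y. ((\<lambda>t. (1 / t) *\<^sub>R (T t x - x)) \<longlongrightarrow> y) (at_right 0) \<longleftrightarrow> x \<in> D \<and> y = - A x)"

text \<open>The semigroup \<open>exp (- A t)\<close>, \<open>t \<ge> 0\<close>. Only the values for \<open>t \<ge> 0\<close> are determined.\<close>

definition semigroup_exp ::
    "'a::complex_banach set \<Rightarrow> ('a \<Rightarrow> 'a) \<Rightarrow> real \<Rightarrow> 'a \<Rightarrow> 'a" where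
  "semigroup_exp D A = (SOME T. c0_semigroup T \<and> neg_generator D A T)"

text \<open>The group \<open>exp (- A t)\<close>, \<open>t\<close> any real, on a finite dimensional \<open>A\<close>-invariant subspace of
  the domain.\<close>

definition group_exp :: "('a::complex_banach \<Rightarrow> 'a) \<Rightarrow> real \<Rightarrow> 'a \<Rightarrow> 'a" where
  "group_exp A t x = (\<Sum>n. ((- t) ^ n / fact n) *\<^sub>R (A ^^ n) x)"

text \<open>\<open>L\<^sup>-\<^sup>\<alpha> = 1 / \<Gamma>(\<alpha>) \<integral> t\<^sup>\<alpha>\<^sup>-\<^sup>1 exp (- L t) dt\<close> over \<open>t > 0\<close>, for \<open>L\<close> sectorial with
  spectrum in the open right half plane; \<open>L\<^sup>\<alpha>\<close> is the inverse of the injective map \<open>L\<^sup>-\<^sup>\<alpha>\<close>.\<close>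

definition neg_frac_pow ::
    "real \<Rightarrow> 'a::complex_banach set \<Rightarrow> ('a \<Rightarrow> 'a) \<Rightarrow> 'a \<Rightarrow> 'a" where
  "neg_frac_pow \<alpha> D L x =
     (if \<alpha> = 0 then x
      else (1 / Gamma \<alpha>) *\<^sub>R integral {0<..} (\<lambda>t. (t powr (\<alpha> - 1)) *\<^sub>R semigroup_exp D L t x))"

definition frac_dom :: "real \<Rightarrow> 'a::complex_banach set \<Rightarrow> ('a \<Rightarrow> 'a) \<Rightarrow> 'a set" where
  "frac_dom \<alpha> D L = range (neg_frac_pow \<alpha> D L)"

definition frac_pow :: "real \<Rightarrow> 'a::complex_banach set \<Rightarrow> ('a \<Rightarrow> 'a) \<Rightarrow> 'a \<Rightarrow> 'a" where
  "frac_pow \<alpha> D L = inv_into UNIV (neg_frac_pow \<alpha> D L)"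

definition frac_norm :: "real \<Rightarrow> 'a::complex_banach set \<Rightarrow> ('a \<Rightarrow> 'a) \<Rightarrow> 'a \<Rightarrow> real" where
  "frac_norm \<alpha> D L u = norm (frac_pow \<alpha> D L u)"

text \<open>\<open>\<parallel>L\<^sup>\<alpha> S\<parallel> \<le> C\<close> for an everywhere defined operator \<open>S\<close>; this entails that \<open>S\<close> maps into the
  domain of \<open>L\<^sup>\<alpha>\<close>.\<close>

definition frac_op_norm_le ::
    "real \<Rightarrow> 'a::complex_banach set \<Rightarrow> ('a \<Rightarrow> 'a) \<Rightarrow> ('a \<Rightarrow> 'a) \<Rightarrow> real \<Rightarrow> bool" where
  "frac_op_norm_le \<alpha> D L S C \<longleftrightarrow>
     (\<forall>x. S x \<in> frac_dom \<alpha> D L \<and> norm (frac_pow \<alpha> D L (S x)) \<le> C * norm x)"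

definition op_norm_le :: "('a::complex_banach \<Rightarrow> 'a) \<Rightarrow> real \<Rightarrow> bool" where
  "op_norm_le S C \<longleftrightarrow> (\<forall>x. norm (S x) \<le> C * norm x)"

text \<open>Lipschitz continuity from the domain of \<open>L\<^sup>\<alpha>\<close>, with \<open>frac_norm\<close>, into \<open>X\<close>, respectively into
  the domain of \<open>L\<^sup>\<alpha>\<close>.\<close>

definition frac_lipschitz_into_X ::
    "real \<Rightarrow> 'a::complex_banach set \<Rightarrow> ('a \<Rightarrow> 'a) \<Rightarrow> real \<Rightarrow> ('a \<Rightarrow> 'a) \<Rightarrow> bool" where
  "frac_lipschitz_into_X \<alpha> D L K f \<longleftrightarrow> 0 \<le> K \<and>
     (\<forall>u \<in> frac_dom \<alpha> D L. \<forall>v \<in> frac_dom \<alpha> D L. norm (f u - f v) \<le> K * frac_norm \<alpha> D L (u - v))"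

definition frac_lipschitz_on ::
    "real \<Rightarrow> 'a::complex_banach set \<Rightarrow> ('a \<Rightarrow> 'a) \<Rightarrow> real \<Rightarrow> 'a set \<Rightarrow> ('a \<Rightarrow> 'a) \<Rightarrow> bool" where
  "frac_lipschitz_on \<alpha> D L K V g \<longleftrightarrow> 0 \<le> K \<and>
     (\<forall>u \<in> V. \<forall>v \<in> V. frac_norm \<alpha> D L (g u - g v) \<le> K * frac_norm \<alpha> D L (u - v))"


section \<open>The semiflow of \<open>u\<^sub>t + B u = f(u)\<close> on the domain of \<open>L\<^sup>\<alpha>\<close>\<close>

text \<open>Solutions are understood in the usual sense of the variation of constants formula. They are
  continuous with respect to \<open>frac_norm\<close>, that is, \<open>L\<^sup>\<alpha> u\<close> is continuous.\<close>

definition mild_solution ::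
    "real \<Rightarrow> 'a::complex_banach set \<Rightarrow> ('a \<Rightarrow> 'a) \<Rightarrow> ('a \<Rightarrow> 'a) \<Rightarrow> ('a \<Rightarrow> 'a) \<Rightarrow> 'a \<Rightarrow> (real \<Rightarrow> 'a) \<Rightarrow> bool" where
  "mild_solution \<alpha> D L B f u0 u \<longleftrightarrow>
     (\<forall>t\<ge>0. u t \<in> frac_dom \<alpha> D L) \<and>
     continuous_on {0..} (\<lambda>t. frac_pow \<alpha> D L (u t)) \<and>
     (\<forall>t\<ge>0. u t = semigroup_exp D B t u0
                + integral {0..t} (\<lambda>s. semigroup_exp D B (t - s) (f (u s))))"

definition semiflow ::
    "real \<Rightarrow> 'a::complex_banach set \<Rightarrow> ('a \<Rightarrow> 'a) \<Rightarrow> ('a \<Rightarrow> 'a) \<Rightarrow> ('a \<Rightarrow> 'a) \<Rightarrow> real \<Rightarrow> 'a \<Rightarrow> 'a" where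
  "semiflow \<alpha> D L B f t u0 = (THE y. \<exists>u. mild_solution \<alpha> D L B f u0 u \<and> y = u t)"

definition graph_over :: "'a::plus set \<Rightarrow> ('a \<Rightarrow> 'a) \<Rightarrow> 'a set" where
  "graph_over V \<xi> = {w + \<xi> w |w. w \<in> V}"


section \<open>The parameter interval and the contraction constant\<close>

definition J_interval :: "complex \<Rightarrow> real \<Rightarrow> real set" where
  "J_interval lam0 \<beta> = {Re lam0 - \<beta> / 4 <..< Re lam0 + \<beta> / 4}"

definition F_const :: "real \<Rightarrow> real \<Rightarrow> real \<Rightarrow> real \<Rightarrow> real" where
  "F_const M \<alpha> \<beta> \<mu> =
     M * (integral {0<..} (\<lambda>s. exp (- (\<mu> - \<beta> / 4) * s))
        + integral {0<..} (\<lambda>s. (1 + s powr (- \<alpha>)) * exp (- (3 / 4 * \<beta> - \<mu>) * s)))"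

end

theory Submission
  imports Defs "HOL-Real_Asymp.Real_Asymp"
begin

text \<open>The proof is the Lyapunov--Perron method. Solutions with growth at most \<open>exp (\<mu> \<bar>t\<bar>)\<close> on the whole
  line are the fixed points of a map obtained from the variation of constants formula, integrating
  from \<open>0\<close> in \<open>X\<^sup>2\<close>, from \<open>\<infinity>\<close> in \<open>X\<^sup>1\<close> and from \<open>-\<infinity>\<close> in \<open>X\<^sup>3\<close>; the exponential bounds make it a contraction
  with constant \<open>F\<^sub>\<mu> L\<^sub>f\<close> in the norm with weight \<open>exp (- \<mu> \<bar>t\<bar>)\<close>. The fixed point is determined by its
  \<open>X\<^sup>2\<close> component at time \<open>0\<close>, on which it depends in a Lipschitz continuous way, and the set of its values at time \<open>0\<close>
  is the manifold. Translation in time maps fixed points to fixed points, whence invariance.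

  This needs the semigroup of \<open>- A\<close> and injectivity of \<open>L\<^sup>-\<^sup>\<alpha>\<close>. The implicit Euler scheme converges to
  the semigroup because the powers of \<open>\<kappa> R(\<kappa>)\<close> are uniformly bounded, which follows from a
  representation of \<open>R(\<kappa>)\<^sup>n\<close> by line integrals of the square of the resolvent.\<close>

text \<open>The definitions shape the work. \<open>integral\<close> is the gauge integral with
  values in a Banach space, so improper integrals with a singularity at \<open>0\<close> must be
  shown to exist by domination. \<open>semigroup_exp\<close> is a choice; it carries information
  only once some semigroup has exactly the generator \<open>- A\<close>, domain included, and
  uniqueness identifies the chosen one. \<open>frac_pow\<close> is an inverse taken by choice, so
  the norm of the fractional power space is meaningful only once \<open>neg_frac_pow\<close> is
  injective; instead of composing fractional powers, injectivity is read off from the dependence of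
  (L + z)^(-\<alpha>) on a real shift z. \<open>semiflow\<close> is a definite description, so
  invariance rests on uniqueness of mild solutions for t \<ge> 0, about which the fixed point on the
  whole line says nothing: a competing solution has no past and no prescribed growth. Equality in
  the invariance statement, rather than mere inclusion, comes from the backward half of the orbits
  on the graph. Semigroups are only known to be strongly continuous, so product rules and joint
  continuity are proved from uniform norm bounds.\<close>

section \<open>Gauge integrals and derivatives of Banach space valued functions\<close>

text \<open>Riemann sums of \<open>f\<close> and \<open>h\<close> over a fine division differ by at
  most the corresponding sum of \<open>k\<close>, which is close to its small integral; so the
  Cauchy criterion for \<open>h\<close> passes to \<open>f\<close>. The argument stays inside that
  criterion and so works for values in any Banach space.\<close>

lemma integrable_squeeze_cbox:
  fixes f :: "'n::euclidean_space \<Rightarrow> 'b::banach"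
  assumes "\<And>e. e > 0 \<Longrightarrow> \<exists>h k. h integrable_on cbox a b \<and> k integrable_on cbox a b \<and>
      integral (cbox a b) k < (e::real) \<and> (\<forall>x\<in>cbox a b. norm (f x - h x) \<le> k x)"
  shows "f integrable_on cbox a b"
  unfolding integrable_Cauchy
proof (intro allI impI)
  fix e :: real assume "e > 0"
  then have e6: "e / 6 > 0" by simp
  from assms[OF this] obtain h and k :: "'n \<Rightarrow> real" where
    h: "h integrable_on cbox a b" and k: "k integrable_on cbox a b"
    and kint: "integral (cbox a b) k < e / 6" and fhk: "\<And>x. x \<in> cbox a b \<Longrightarrow> norm (f x - h x) \<le> k x"
    by blast
  from h[unfolded integrable_Cauchy] e6 obtain \<gamma>1 where g1: "gauge \<gamma>1" and H: "\<And>D1 D2.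
       D1 tagged_division_of cbox a b \<Longrightarrow> \<gamma>1 fine D1 \<Longrightarrow> D2 tagged_division_of cbox a b \<Longrightarrow> \<gamma>1 fine D2 \<Longrightarrow>
       norm ((\<Sum>(x,K)\<in>D1. measure lborel K *\<^sub>R h x) - (\<Sum>(x,K)\<in>D2. measure lborel K *\<^sub>R h x)) < e / 6"
    by meson
  from integrable_integral[OF k, unfolded has_integral] e6 obtain \<gamma>2 where g2: "gauge \<gamma>2" and K: "\<And>D.
       D tagged_division_of cbox a b \<Longrightarrow> \<gamma>2 fine D \<Longrightarrow>
       norm ((\<Sum>(x,K)\<in>D. measure lborel K *\<^sub>R k x) - integral (cbox a b) k) < e / 6"
    by meson
  have fh: "norm ((\<Sum>(x,K)\<in>D. measure lborel K *\<^sub>R f x) - (\<Sum>(x,K)\<in>D. measure lborel K *\<^sub>R h x)) < e / 3"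
    if D: "D tagged_division_of cbox a b" "\<gamma>2 fine D" for D
  proof -
    have "norm ((\<Sum>(x,K)\<in>D. measure lborel K *\<^sub>R f x) - (\<Sum>(x,K)\<in>D. measure lborel K *\<^sub>R h x))
        = norm (\<Sum>(x,K)\<in>D. measure lborel K *\<^sub>R (f x - h x))"
      by (simp add: sum_subtractf[symmetric] case_prod_unfold scaleR_diff_right)
    also have "\<dots> \<le> (\<Sum>(x,K)\<in>D. measure lborel K *\<^sub>R k x)"
    proof (rule sum_norm_le, clarify)
      fix x K assume "(x, K) \<in> D"
      then have "x \<in> cbox a b" using tagged_division_ofD(2,3)[OF D(1)] by blast
      then show "norm (measure lborel K *\<^sub>R (f x - h x)) \<le> measure lborel K *\<^sub>R k x"
        by (auto intro!: mult_left_mono fhk)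
    qed
    also have "\<dots> < e / 3" using K[OF D] kint by (simp add: abs_if split: if_splits)
    finally show ?thesis .
  qed
  show "\<exists>\<gamma>. gauge \<gamma> \<and> (\<forall>D1 D2. D1 tagged_division_of cbox a b \<and> \<gamma> fine D1 \<and>
          D2 tagged_division_of cbox a b \<and> \<gamma> fine D2 \<longrightarrow>
          norm ((\<Sum>(x,K)\<in>D1. measure lborel K *\<^sub>R f x) - (\<Sum>(x,K)\<in>D2. measure lborel K *\<^sub>R f x)) < e)"
  proof (intro exI conjI allI impI)
    show "gauge (\<lambda>x. \<gamma>1 x \<inter> \<gamma>2 x)" using g1 g2 by (rule gauge_Int)
  next
    fix D1 D2
    assume *: "D1 tagged_division_of cbox a b \<and> (\<lambda>x. \<gamma>1 x \<inter> \<gamma>2 x) fine D1 \<and>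
      D2 tagged_division_of cbox a b \<and> (\<lambda>x. \<gamma>1 x \<inter> \<gamma>2 x) fine D2"
    define S where "S g D = (\<Sum>(x,K)\<in>D. measure lborel K *\<^sub>R g x)" for g :: "'n \<Rightarrow> 'b" and D :: "('n \<times> 'n set) set"
    from * have "norm (S f D1 - S h D1) < e / 3" "norm (S f D2 - S h D2) < e / 3"
      "norm (S h D1 - S h D2) < e / 6"
      using fh H by (auto simp: fine_Int S_def)
    moreover have "S f D1 - S f D2 = (S f D1 - S h D1) + (S h D1 - S h D2) - (S f D2 - S h D2)" by simp
    ultimately have "norm (S f D1 - S f D2) < e"
      using \<open>e > 0\<close> norm_triangle_ineq4[of "(S f D1 - S h D1) + (S h D1 - S h D2)" "S f D2 - S h D2"]
        norm_triangle_ineq[of "S f D1 - S h D1" "S h D1 - S h D2"] by simp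
    then show "norm ((\<Sum>(x,K)\<in>D1. measure lborel K *\<^sub>R f x) - (\<Sum>(x,K)\<in>D2. measure lborel K *\<^sub>R f x)) < e"
      by (simp add: S_def)
  qed
qed

text \<open>The only possible singularity in a bounded interval is at \<open>0\<close>: cutting
  \<open>f\<close> off to zero below a small \<open>\<delta>\<close> leaves an integrable function,
  and the error is dominated by \<open>g\<close> next to \<open>0\<close>. Infinity is handled by
  the domination criterion for all intervals.\<close>

lemma integrable_dominated_continuous:
  fixes f :: "real \<Rightarrow> 'b::banach"
  assumes cont: "continuous_on {0<..} f"
    and bound: "\<And>x. x > 0 \<Longrightarrow> norm (f x) \<le> g x"
    and g: "g integrable_on {0<..}"
  shows "f integrable_on {0<..}"
proof (rule integrable_on_all_intervals_integrable_bound[OF _ _ g])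
  show "norm (f x) \<le> g x" if "x \<in> {0<..}" for x using that bound by simp
next
  fix a b :: real
  define f' where "f' = (\<lambda>x. if x \<in> {0<..} then f x else 0)"
  define g' where "g' = (\<lambda>x. if x \<in> {0<..} then g x else 0)"
  have g'0: "0 \<le> g' x" for x unfolding g'_def using bound[of x] order_trans[OF norm_ge_zero[of "f x"], of "g x"] by simp
  have fg': "norm (f' x) \<le> g' x" for x using bound by (auto simp: f'_def g'_def)
  have g'i: "g' integrable_on {c..d}" for c d
    unfolding g'_def box_real(2)[symmetric]
    by (rule integrable_on_subcbox[OF _ subset_UNIV]) (rule iffD2[OF integrable_restrict_UNIV g])
  have main: "f' integrable_on cbox a b"
  proof (cases "b \<le> 0")
    case True
    then have "\<And>x. x \<in> cbox a b \<Longrightarrow> f' x = 0" by (auto simp: f'_def)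
    then show ?thesis using integrable_eq[OF integrable_0[of "cbox a b"], of f'] by simp
  next
    case b: False
    show ?thesis
    proof (rule integrable_squeeze_cbox)
      fix e :: real assume e: "e > 0"
      \<comment> \<open>The indefinite integral of \<open>g'\<close> is continuous, so
        \<open>g\<close> carries less than \<open>e\<close> on a short interval next to
        \<open>0\<close>; this fixes \<open>\<delta>\<close>.\<close>
      have "continuous_on {0..b} (\<lambda>x. integral {0..x} g')"
        by (rule indefinite_integral_continuous_1[OF g'i])
      then obtain d where d: "d > 0" "\<And>x. x \<in> {0..b} \<Longrightarrow> dist x 0 < d \<Longrightarrow>
          dist (integral {0..x} g') (integral {0..0} g') < e"
        using e b unfolding continuous_on_iff by (metis atLeastAtMost_iff linear order_refl)
      define \<delta> where "\<delta> = min (d / 2) b"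
      have \<delta>: "0 < \<delta>" "\<delta> \<le> b" "integral {0..\<delta>} g' < e"
        using d(1) b d(2)[of \<delta>] by (auto simp: \<delta>_def dist_real_def abs_if min_def split: if_splits)
      define h where "h = (\<lambda>x. if x \<in> {\<delta>..} then f' x else 0)"
      define k where "k = (\<lambda>x. if x \<in> {0..\<delta>} then g' x else 0)"
      have eq: "{\<delta>..} \<inter> cbox a b = {max \<delta> a..b}" by auto
      have "continuous_on {max \<delta> a..b} f'"
        using continuous_on_subset[OF cont, of "{max \<delta> a..b}"] \<delta>(1)
        by (subst continuous_on_cong[OF refl, of _ f' f]) (auto simp: f'_def subset_iff)
      then have h: "h integrable_on cbox a b"
        unfolding h_def integrable_restrict_Int eq by (rule integrable_continuous_real)
      have eq2: "{0..\<delta>} \<inter> cbox a b = {max 0 a..min \<delta> b}" by auto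
      have k: "k integrable_on cbox a b"
        unfolding k_def integrable_restrict_Int eq2 by (rule g'i)
      have "integral (cbox a b) k = integral {max 0 a..min \<delta> b} g'"
        unfolding k_def integral_restrict_Int eq2 ..
      also have "\<dots> \<le> integral {0..\<delta>} g'"
        by (rule integral_subset_le) (auto simp: g'i g'0)
      finally have "integral (cbox a b) k < e" using \<delta>(3) by simp
      moreover have "norm (f' x - h x) \<le> k x" for x
        using fg'[of x] g'0[of x] \<delta>(1) by (auto simp: h_def k_def f'_def)
      ultimately show "\<exists>h k. h integrable_on cbox a b \<and> k integrable_on cbox a b \<and>
          integral (cbox a b) k < e \<and> (\<forall>x\<in>cbox a b. norm (f' x - h x) \<le> k x)"
        using h k by blast
    qed
  qed
  then show "(\<lambda>x. if x \<in> {0<..} then f x else 0) integrable_on cbox a b" by (simp add: f'_def)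
qed

lemma integrable_on_greaterThan_subinterval:
  fixes g :: "real \<Rightarrow> 'b::banach"
  assumes g: "g integrable_on {0<..}" and c: "0 < c"
  shows "g integrable_on {c..d}"
proof -
  have "(\<lambda>x. if x \<in> {0<..} then g x else 0) integrable_on cbox c d"
    by (rule integrable_on_subcbox[OF _ subset_UNIV]) (rule iffD2[OF integrable_restrict_UNIV g])
  moreover have "{0<..} \<inter> cbox c d = {c..d}" using c by auto
  ultimately show ?thesis unfolding integrable_restrict_Int by simp
qed

lemma integral_truncate_tendsto:
  fixes g :: "real \<Rightarrow> real"
  assumes g: "g integrable_on {0<..}" and nonneg: "\<And>x. x > 0 \<Longrightarrow> 0 \<le> g x"
  shows "(\<lambda>n. integral {inverse (real (Suc n))..real (Suc n)} g) \<longlonglongrightarrow> integral {0<..} g"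
proof -
  define gn where "gn n x = (if x \<in> {inverse (real (Suc n))..real (Suc n)} then g x else 0)" for n x
  have sub: "{inverse (real (Suc n))..real (Suc n)} \<inter> {0<..} = {inverse (real (Suc n))..real (Suc n)}" for n
    by (auto intro: less_le_trans[of 0 "inverse (real (Suc n))"])
  have gi: "g integrable_on {inverse (real (Suc n))..real (Suc n)}" for n
    by (rule integrable_on_greaterThan_subinterval[OF g]) simp
  have "(\<lambda>n. integral {0<..} (gn n)) \<longlonglongrightarrow> integral {0<..} g"
  proof (rule dominated_convergence(2)[OF _ g])
    show "gn n integrable_on {0<..}" for n
      unfolding gn_def integrable_restrict_Int sub by (rule gi)
    show "norm (gn n x) \<le> g x" if "x \<in> {0<..}" for n x
      using that nonneg by (auto simp: gn_def)
    show "(\<lambda>n. gn n x) \<longlonglongrightarrow> g x" if x: "x \<in> {0<..}" for x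
    proof (rule tendsto_eventually)
      have x0: "x > 0" using x by simp
      have "\<forall>\<^sub>F n in sequentially. inverse (real (Suc n)) < x"
        by (rule order_tendstoD(2)[OF LIMSEQ_inverse_real_of_nat x0])
      moreover have "\<forall>\<^sub>F n in sequentially. x < real (Suc n)"
      proof -
        obtain N where "x < real N" using reals_Archimedean2 by blast
        then show ?thesis by (intro eventually_sequentiallyI[of N]) auto
      qed
      ultimately show "\<forall>\<^sub>F n in sequentially. gn n x = g x"
        by eventually_elim (auto simp: gn_def)
    qed
  qed
  then show ?thesis unfolding gn_def integral_restrict_Int sub .
qed

text \<open>\<open>f\<close> has values in a Banach space, but its integral outside the
  \<open>n\<close>th interval is bounded by that of the scalar majorant \<open>g\<close>, and the
  latter vanishes in the limit by scalar dominated convergence.\<close>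

lemma integral_truncate_dominated:
  fixes f :: "real \<Rightarrow> 'b::banach"
  assumes cont: "continuous_on {0<..} f"
    and bound: "\<And>r. r > 0 \<Longrightarrow> norm (f r) \<le> g r"
    and g: "g integrable_on {0<..}"
  defines "I \<equiv> \<lambda>n. {inverse (real (Suc n))..real (Suc n)}"
  shows "norm (integral {0<..} f - integral (I n) f) \<le> integral {0<..} g - integral (I n) g"
    and "(\<lambda>n. integral (I n) f) \<longlonglongrightarrow> integral {0<..} f"
proof -
  have g0: "0 \<le> g r" if "r > 0" for r using bound[OF that] norm_ge_zero order_trans by blast
  have I0: "r > 0" if "r \<in> I n" for r n
    using that by (auto simp: I_def intro: less_le_trans[of 0 "inverse (real (Suc n))"])
  have I': "I n \<inter> {0<..} = I n" for n using I0 by auto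
  have fi: "f integrable_on {0<..}"
    by (rule integrable_dominated_continuous[OF cont bound g])
  have fIi: "f integrable_on I n" for n
    unfolding I_def by (rule integrable_continuous_real, rule continuous_on_subset[OF cont])
      (use I0 in \<open>auto simp: I_def\<close>)
  have gIi: "g integrable_on I n" for n
    unfolding I_def by (rule integrable_on_greaterThan_subinterval[OF g]) simp
  show diff: "norm (integral {0<..} f - integral (I n) f) \<le> integral {0<..} g - integral (I n) g" for n
  proof -
    let ?f = "\<lambda>r. if r \<in> I n then f r else 0" and ?g = "\<lambda>r. if r \<in> I n then g r else 0"
    have f1: "?f integrable_on {0<..}" "integral {0<..} ?f = integral (I n) f"
      using fIi by (simp_all only: integrable_restrict_Int integral_restrict_Int I')
    have g1: "?g integrable_on {0<..}" "integral {0<..} ?g = integral (I n) g"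
      using gIi by (simp_all only: integrable_restrict_Int integral_restrict_Int I')
    have "norm (integral {0<..} (\<lambda>r. f r - ?f r)) \<le> integral {0<..} (\<lambda>r. g r - ?g r)"
      by (rule integral_norm_bound_integral) (auto intro!: integrable_diff fi f1 g g1 bound)
    then show ?thesis
      by (simp add: integral_diff[OF fi f1(1)] integral_diff[OF g g1(1)] f1(2) g1(2))
  qed
  have "(\<lambda>n. integral {0<..} g - integral (I n) g) \<longlonglongrightarrow> integral {0<..} g - integral {0<..} g"
    unfolding I_def by (intro tendsto_intros integral_truncate_tendsto[OF g g0])
  then have lim: "(\<lambda>n. integral {0<..} g - integral (I n) g) \<longlonglongrightarrow> 0" by simp
  have "(\<lambda>n. integral {0<..} f - integral (I n) f) \<longlonglongrightarrow> 0"
    by (rule Lim_null_comparison[OF _ lim]) (simp add: diff)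
  then show "(\<lambda>n. integral (I n) f) \<longlonglongrightarrow> integral {0<..} f"
    using tendsto_diff[OF tendsto_const[of "integral {0<..} f"], of _ 0] by fastforce
qed

text \<open>Each truncated integral depends continuously on the parameter by compactness, and the
  truncation error is bounded by the tail of \<open>g\<close>, the same for all parameters, so the
  convergence is uniform.\<close>

lemma continuous_on_integral_dominated:
  fixes f :: "'a::metric_space \<Rightarrow> real \<Rightarrow> 'b::banach"
  assumes cont: "continuous_on (S \<times> {0<..}) (\<lambda>(t, r). f t r)"
    and bound: "\<And>t r. t \<in> S \<Longrightarrow> r > 0 \<Longrightarrow> norm (f t r) \<le> g r"
    and g: "g integrable_on {0<..}"
  shows "continuous_on S (\<lambda>t. integral {0<..} (f t))"
proof (cases "S = {}")
  case False
  then obtain t0 where t0: "t0 \<in> S" by blast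
  have g0: "0 \<le> g r" if "r > 0" for r using bound[OF t0 that] norm_ge_zero order_trans by blast
  define I where "I n = {inverse (real (Suc n))..real (Suc n)}" for n
  have I0: "r > 0" if "r \<in> I n" for r n
    using that by (auto simp: I_def intro: less_le_trans[of 0 "inverse (real (Suc n))"])
  have contt: "continuous_on {0<..} (f t)" if "t \<in> S" for t
    using continuous_on_compose2[OF cont, of "{0<..}" "\<lambda>r. (t, r)"] that
    by (auto intro: continuous_on_Pair[OF continuous_on_const continuous_on_id])
  have lim: "(\<lambda>n. integral (I n) g) \<longlonglongrightarrow> integral {0<..} g"
    unfolding I_def by (rule integral_truncate_tendsto[OF g g0])
  have diff: "norm (integral {0<..} (f t) - integral (I n) (f t)) \<le> integral {0<..} g - integral (I n) g"
    if t: "t \<in> S" for t n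
    unfolding I_def by (rule integral_truncate_dominated(1)[OF contt[OF t] bound[OF t] g])
  show ?thesis
  proof (rule uniform_limit_theorem[where F = sequentially])
    show "\<forall>\<^sub>F n in sequentially. continuous_on S (\<lambda>t. integral (I n) (f t))"
    proof (rule always_eventually, rule allI)
      fix n
      have "continuous_on (S \<times> cbox (inverse (real (Suc n))) (real (Suc n))) (\<lambda>(t, r). f t r)"
        by (rule continuous_on_subset[OF cont]) (use I0 in \<open>auto simp: I_def\<close>)
      from integral_continuous_on_param[OF this]
      show "continuous_on S (\<lambda>t. integral (I n) (f t))" by (simp add: I_def)
    qed
    show "uniform_limit S (\<lambda>n t. integral (I n) (f t)) (\<lambda>t. integral {0<..} (f t)) sequentially"
    proof (rule uniform_limitI)
      fix e :: real assume "e > 0"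
      from tendstoD[OF lim this]
      show "\<forall>\<^sub>F n in sequentially. \<forall>t\<in>S. dist (integral (I n) (f t)) (integral {0<..} (f t)) < e"
      proof eventually_elim
        case (elim n)
        show ?case
        proof
          fix t assume "t \<in> S"
          from diff[OF this, of n] elim
          show "dist (integral (I n) (f t)) (integral {0<..} (f t)) < e"
            by (simp add: dist_norm norm_minus_commute abs_if split: if_splits)
        qed
      qed
    qed
  qed simp
qed simp

text \<open>At most one of the two integrals is over a nondegenerate interval, so their difference
  is the oriented integral from \<open>0\<close> to \<open>t\<close> for either sign of
  \<open>t\<close>. Locally it equals an integral from a base point left of both \<open>0\<close>
  and \<open>t\<close>, up to a constant.\<close>

lemma antiderivative_signed_integral:
  fixes g :: "real \<Rightarrow> 'b::banach"
  assumes "continuous_on UNIV g"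
  shows "((\<lambda>t. integral {0..t} g - integral {t..0} g) has_vector_derivative g t) (at t)"
proof -
  define a where "a = - \<bar>t\<bar> - 1"
  define b where "b = \<bar>t\<bar> + 1"
  have ab: "a < t" "t < b" "a < 0" "0 < b" by (auto simp: a_def b_def)
  have gi: "g integrable_on {c..d}" for c d
    by (rule integrable_continuous_real, rule continuous_on_subset[OF assms]) simp
  have eq: "integral {0..s} g - integral {s..0} g = integral {a..s} g - integral {a..0} g"
    if "s \<in> {a<..<b}" for s :: real
  proof (cases "0 \<le> s")
    case True
    then show ?thesis using Henstock_Kurzweil_Integration.integral_combine[where a = a and c = 0 and b = s and f = g] gi ab that
      by (cases "s = 0") (auto simp: algebra_simps)
  next
    case False
    then show ?thesis using Henstock_Kurzweil_Integration.integral_combine[where a = a and c = s and b = 0 and f = g] gi ab that by (auto simp: algebra_simps)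
  qed
  have "((\<lambda>s. integral {a..s} g) has_vector_derivative g t) (at t within {a..b})"
    by (rule integral_has_vector_derivative) (use ab assms in \<open>auto intro: continuous_on_subset\<close>)
  then have "((\<lambda>s. integral {a..s} g) has_vector_derivative g t) (at t within {a<..<b})"
    by (rule has_vector_derivative_within_subset) auto
  then have "((\<lambda>s. integral {a..s} g) has_vector_derivative g t) (at t)"
    using ab by (simp add: at_within_open[of t "{a<..<b}"])
  then have "((\<lambda>s. integral {a..s} g - integral {a..0} g) has_vector_derivative g t) (at t)"
    using has_vector_derivative_diff[OF _ has_vector_derivative_const] by fastforce
  then show ?thesis
    by (rule has_vector_derivative_transform_within_open[where S = "{a<..<b}"]) (use ab eq in auto)
qed

text \<open>Generators are defined through difference quotients; this form moves their limits into
  and out of the derivative calculus.\<close>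

lemma has_vector_derivative_iff_quotient :
  fixes f :: "real \<Rightarrow> 'b::real_normed_vector"
  shows "(f has_vector_derivative f') (at x within S) \<longleftrightarrow>
    ((\<lambda>y. (1 / (y - x)) *\<^sub>R (f y - f x)) \<longlongrightarrow> f') (at x within S)"
proof -
  have eq: "norm ((f y - f x) - (y - x) *\<^sub>R f') / norm (y - x)
      = norm ((1 / (y - x)) *\<^sub>R (f y - f x) - f')" if "y \<noteq> x" for y
  proof -
    have "(1 / (y - x)) *\<^sub>R (f y - f x) - f' = (1 / (y - x)) *\<^sub>R ((f y - f x) - (y - x) *\<^sub>R f')"
      using that by (simp add: scaleR_diff_right)
    then show ?thesis by (simp add: divide_inverse)
  qed
  have ev: "\<forall>\<^sub>F y in at x within S. norm ((f y - f x) - (y - x) *\<^sub>R f') / norm (y - x)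
      = norm ((1 / (y - x)) *\<^sub>R (f y - f x) - f')"
    unfolding eventually_at_filter by (rule always_eventually) (use eq in blast)
  show ?thesis
    unfolding has_vector_derivative_def has_derivative_iff_norm
    using tendsto_cong[OF ev, of 0]
    by (simp add: bounded_linear_scaleR_left LIM_zero_iff tendsto_norm_zero_iff)
qed

text \<open>A product rule for operators that are only strongly continuous: differentiability of
  \<open>F\<close> is asked for along the fixed vector \<open>y s0\<close>, not in operator norm.
  The other part of the quotient is \<open>F s\<close> applied to the quotient of \<open>y\<close>,
  and the uniform bound \<open>K\<close> lets its limit pass through.\<close>

lemma has_vector_derivative_operator_apply:
  fixes F :: "real \<Rightarrow> 'a::real_normed_vector \<Rightarrow> 'b::real_normed_vector"
  assumes lin: "\<And>s. s \<in> S \<Longrightarrow> bounded_linear (F s)"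
    and bound: "\<And>s v. s \<in> S \<Longrightarrow> norm (F s v) \<le> K * norm v"
    and cont: "\<And>v. ((\<lambda>s. F s v) \<longlongrightarrow> F s0 v) (at s0 within S)"
    and d1: "((\<lambda>s. F s (y s0)) has_vector_derivative d1) (at s0 within S)"
    and y: "(y has_vector_derivative y') (at s0 within S)"
    and s0: "s0 \<in> S"
  shows "((\<lambda>s. F s (y s)) has_vector_derivative d1 + F s0 y') (at s0 within S)"
proof -
  define q where "q s = (1 / (s - s0)) *\<^sub>R (y s - y s0)" for s
  have q: "(q \<longlongrightarrow> y') (at s0 within S)"
    using y unfolding has_vector_derivative_iff_quotient q_def .
  have inS: "\<forall>\<^sub>F s in at s0 within S. s \<in> S" by (simp add: eventually_at_filter)
  have "((\<lambda>s. K * norm (q s - y')) \<longlongrightarrow> K * norm (y' - y')) (at s0 within S)"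
    by (intro tendsto_intros q)
  then have "((\<lambda>s. K * norm (q s - y')) \<longlongrightarrow> 0) (at s0 within S)" by simp
  then have "((\<lambda>s. F s (q s - y')) \<longlongrightarrow> 0) (at s0 within S)"
    by (rule Lim_null_comparison[rotated]) (use inS bound in \<open>auto elim: eventually_mono\<close>)
  from tendsto_add[OF tendsto_add[OF d1[unfolded has_vector_derivative_iff_quotient] this] cont[of y']]
  have "((\<lambda>s. (1 / (s - s0)) *\<^sub>R (F s (y s0) - F s0 (y s0)) + F s (q s - y') + F s y')
      \<longlongrightarrow> d1 + F s0 y') (at s0 within S)" by simp
  moreover have "\<forall>\<^sub>F s in at s0 within S.
      (1 / (s - s0)) *\<^sub>R (F s (y s0) - F s0 (y s0)) + F s (q s - y') + F s y'
      = (1 / (s - s0)) *\<^sub>R (F s (y s) - F s0 (y s0))"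
    using inS
  proof eventually_elim
    case (elim s)
    interpret bounded_linear "F s" by (rule lin[OF elim])
    show ?case unfolding q_def diff scaleR by (simp add: scaleR_diff_right)
  qed
  ultimately show ?thesis
    unfolding has_vector_derivative_iff_quotient by (rule Lim_transform_eventually)
qed

section \<open>Complex scalars and linear maps on complex subspaces\<close>

lemma scaleC_zero_left [simp]: "0 *\<^sub>C (x :: 'a::complex_banach) = 0"
  using scaleC_of_real[of 0 x] by simp

lemma scaleC_one [simp]: "1 *\<^sub>C (x :: 'a::complex_banach) = x"
  using scaleC_of_real[of 1 x] by simp

text \<open>Once multiplication by complex scalars is bounded bilinear over the reals, the real
  rules for limits, continuity and derivatives apply to it.\<close>

lemma bounded_bilinear_scaleC: "bounded_bilinear (scaleC :: complex \<Rightarrow> 'a::complex_banach \<Rightarrow> 'a)"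
proof (rule bounded_bilinear.intro)
  fix a a' :: complex and b b' :: 'a and r :: real
  show "(a + a') *\<^sub>C b = a *\<^sub>C b + a' *\<^sub>C b" by (rule scaleC_add_left)
  show "a *\<^sub>C (b + b') = a *\<^sub>C b + a *\<^sub>C b'" by (rule scaleC_add_right)
  show "(r *\<^sub>R a) *\<^sub>C b = r *\<^sub>R (a *\<^sub>C b)"
    unfolding scaleR_conv_of_real scaleC_scaleC[symmetric] scaleC_of_real ..
  show "a *\<^sub>C (r *\<^sub>R b) = r *\<^sub>R (a *\<^sub>C b)"
    by (simp only: scaleC_of_real[symmetric] scaleC_scaleC mult.commute)
  show "\<exists>K. \<forall>a (b::'a). norm (a *\<^sub>C b) \<le> norm a * norm b * K"
    by (intro exI[of _ 1]) (simp add: norm_scaleC)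
qed

lemmas scaleC_diff_left = bounded_bilinear.diff_left[OF bounded_bilinear_scaleC]
lemmas scaleC_diff_right = bounded_bilinear.diff_right[OF bounded_bilinear_scaleC]
lemmas scaleC_minus_left = bounded_bilinear.minus_left[OF bounded_bilinear_scaleC]
lemmas scaleC_minus_right = bounded_bilinear.minus_right[OF bounded_bilinear_scaleC]
lemmas scaleC_zero_right = bounded_bilinear.zero_right[OF bounded_bilinear_scaleC]
lemmas scaleC_scaleR_left = bounded_bilinear.scaleR_left[OF bounded_bilinear_scaleC]
lemmas scaleC_scaleR_right = bounded_bilinear.scaleR_right[OF bounded_bilinear_scaleC]
lemmas scaleC_tendsto = bounded_bilinear.tendsto[OF bounded_bilinear_scaleC]
lemmas scaleC_has_vector_derivative = bounded_bilinear.has_vector_derivative[OF bounded_bilinear_scaleC]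
lemmas scaleC_continuous_on = bounded_bilinear.continuous_on[OF bounded_bilinear_scaleC]
lemmas scaleC_bounded_linear_right = bounded_bilinear.bounded_linear_right[OF bounded_bilinear_scaleC]

lemma csubspace_scaleR: "csubspace V \<Longrightarrow> x \<in> V \<Longrightarrow> r *\<^sub>R x \<in> V"
  unfolding csubspace_def by (metis scaleC_of_real)

lemma csubspace_diff: "csubspace V \<Longrightarrow> x \<in> V \<Longrightarrow> y \<in> V \<Longrightarrow> x - y \<in> V"
  using csubspace_scaleR[of V y "-1"] unfolding csubspace_def by (metis diff_conv_add_uminus scaleR_minus1_left)

lemma clinear_on_scaleR: "clinear_on V g \<Longrightarrow> x \<in> V \<Longrightarrow> g (r *\<^sub>R x) = r *\<^sub>R g x"
  unfolding clinear_on_def by (metis scaleC_of_real)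

lemma clinear_on_diff:
  assumes "csubspace V" "clinear_on V g" "x \<in> V" "y \<in> V"
  shows "g (x - y) = g x - g y"
proof -
  have "g (x + (- 1) *\<^sub>R y) = g x + g ((- 1) *\<^sub>R y)"
    using assms csubspace_scaleR[OF assms(1,4)] by (simp only: clinear_on_def)
  then show ?thesis using clinear_on_scaleR[OF assms(2,4), of "- 1"] by simp
qed

section \<open>Resolvent bounds on a half plane and power boundedness\<close>

text \<open>The signs are such that \<open>z + L\<close> is inverted for \<open>z\<close> in the
  right half plane, so that \<open>- L\<close> will be the generator. The bound decays in the full
  modulus of \<open>z\<close>, not only in its real part; this makes products of two resolvents
  absolutely integrable along vertical lines.\<close>

locale half_plane_resolvent =
  fixes D :: "'a::complex_banach set" and L :: "'a \<Rightarrow> 'a" and M :: real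
  assumes csub: "csubspace D" and clin: "clinear_on D L" and dense: "closure D = UNIV"
    and bij: "\<And>z. 0 < Re z \<Longrightarrow> bij_betw (\<lambda>x. z *\<^sub>C x + L x) D UNIV"
    and bound: "\<And>z x. 0 < Re z \<Longrightarrow> x \<in> D \<Longrightarrow> norm x \<le> M / cmod z * norm (z *\<^sub>C x + L x)"
    and M_pos: "0 < M"
begin

definition R :: "complex \<Rightarrow> 'a \<Rightarrow> 'a" where
  "R z = inv_into D (\<lambda>x. z *\<^sub>C x + L x)"

lemma D_add: "x \<in> D \<Longrightarrow> y \<in> D \<Longrightarrow> x + y \<in> D" and D_scaleC: "x \<in> D \<Longrightarrow> c *\<^sub>C x \<in> D"
  and D_scaleR: "x \<in> D \<Longrightarrow> r *\<^sub>R x \<in> D" and D_diff: "x \<in> D \<Longrightarrow> y \<in> D \<Longrightarrow> x - y \<in> D"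
  using csub csubspace_scaleR[OF csub] csubspace_diff[OF csub] unfolding csubspace_def by blast+

lemma L_add: "x \<in> D \<Longrightarrow> y \<in> D \<Longrightarrow> L (x + y) = L x + L y"
  and L_scaleC: "x \<in> D \<Longrightarrow> L (c *\<^sub>C x) = c *\<^sub>C L x"
  and L_scaleR: "x \<in> D \<Longrightarrow> L (r *\<^sub>R x) = r *\<^sub>R L x"
  using clin clinear_on_scaleR[OF clin] clinear_on_diff[OF csub clin] unfolding clinear_on_def by blast+

lemma R_in: assumes "0 < Re z" shows "R z x \<in> D"
  unfolding R_def by (rule inv_into_into) (use bij[OF assms] in \<open>simp add: bij_betw_def\<close>)

lemma R_right: assumes "0 < Re z" shows "z *\<^sub>C R z x + L (R z x) = x"
  unfolding R_def by (rule f_inv_into_f) (use bij[OF assms] in \<open>simp add: bij_betw_def\<close>)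

lemma R_left: assumes "0 < Re z" "x \<in> D" shows "R z (z *\<^sub>C x + L x) = x"
  unfolding R_def
  using inv_into_f_f[of "\<lambda>x. z *\<^sub>C x + L x" D x] bij[OF assms(1)] assms(2)
  by (simp only: bij_betw_def)

lemma R_eqI: "0 < Re z \<Longrightarrow> x \<in> D \<Longrightarrow> z *\<^sub>C x + L x = y \<Longrightarrow> R z y = x"
  using R_left by blast

lemma L_R: "0 < Re z \<Longrightarrow> L (R z x) = x - z *\<^sub>C R z x"
  using R_right[of z x] by (simp add: algebra_simps)

lemma R_norm: "0 < Re z \<Longrightarrow> norm (R z x) \<le> M / cmod z * norm x"
  using bound[OF _ R_in[of z x], of z] by (simp add: R_right)

lemma R_add: assumes "0 < Re z" shows "R z (x + y) = R z x + R z y"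
proof (rule R_eqI[OF assms])
  show "R z x + R z y \<in> D" by (intro D_add R_in assms)
  have "z *\<^sub>C (R z x + R z y) + L (R z x + R z y) = (z *\<^sub>C R z x + L (R z x)) + (z *\<^sub>C R z y + L (R z y))"
    by (simp add: L_add R_in assms scaleC_add_right algebra_simps)
  then show "z *\<^sub>C (R z x + R z y) + L (R z x + R z y) = x + y" by (simp add: R_right assms)
qed

lemma R_scaleC: assumes "0 < Re z" shows "R z (c *\<^sub>C x) = c *\<^sub>C R z x"
proof (rule R_eqI[OF assms])
  show "c *\<^sub>C R z x \<in> D" by (intro D_scaleC R_in assms)
  have "z *\<^sub>C (c *\<^sub>C R z x) + L (c *\<^sub>C R z x) = c *\<^sub>C (z *\<^sub>C R z x + L (R z x))"
    by (simp add: L_scaleC R_in assms scaleC_add_right scaleC_scaleC mult.commute)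
  then show "z *\<^sub>C (c *\<^sub>C R z x) + L (c *\<^sub>C R z x) = c *\<^sub>C x" by (simp add: R_right assms)
qed

lemma R_scaleR: "0 < Re z \<Longrightarrow> R z (r *\<^sub>R x) = r *\<^sub>R R z x"
  by (metis R_scaleC scaleC_of_real)

lemma R_bounded_linear: "0 < Re z \<Longrightarrow> bounded_linear (R z)"
proof (rule bounded_linear_intro[where K = "M / cmod z"])
  show "norm (R z x) \<le> norm x * (M / cmod z)" if "0 < Re z" for x
    using R_norm[OF that, of x] by (simp only: mult.commute)
qed (simp_all add: R_add R_scaleR)

lemma R_diff: "0 < Re z \<Longrightarrow> R z (x - y) = R z x - R z y"
  using R_bounded_linear bounded_linear.linear linear_diff by blast

lemma resolvent_identity:
  assumes z: "0 < Re z" and w: "0 < Re w"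
  shows "R z x = R w x + (w - z) *\<^sub>C R w (R z x)"
proof -
  have "R w (w *\<^sub>C R z x + L (R z x)) = R z x" by (rule R_left[OF w R_in[OF z]])
  moreover have "w *\<^sub>C R z x + L (R z x) = x + (w - z) *\<^sub>C R z x"
    by (simp add: L_R[OF z] scaleC_diff_left)
  ultimately show ?thesis by (simp add: R_add[OF w] R_scaleC[OF w])
qed

lemma R_commute:
  assumes z: "0 < Re z" and w: "0 < Re w"
  shows "R z (R w x) = R w (R z x)"
proof (cases "z = w")
  case False
  have "(w - z) *\<^sub>C R w (R z x) = R z x - R w x"
    using resolvent_identity[OF z w, of x] by (metis add_diff_cancel_left')
  moreover have "(z - w) *\<^sub>C R z (R w x) = R w x - R z x"
    using resolvent_identity[OF w z, of x] by (metis add_diff_cancel_left')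
  ultimately have "(w - z) *\<^sub>C R w (R z x) = (w - z) *\<^sub>C R z (R w x)"
    by (metis minus_diff_eq scaleC_minus_left)
  then have "inverse (w - z) *\<^sub>C ((w - z) *\<^sub>C R w (R z x)) = inverse (w - z) *\<^sub>C ((w - z) *\<^sub>C R z (R w x))"
    by simp
  then show ?thesis using False by (simp add: scaleC_scaleC)
qed simp

lemma R_difference:
  assumes z: "0 < Re z" and w: "0 < Re w"
  shows "R z x - R w x = (w - z) *\<^sub>C R z (R w x)"
  unfolding R_commute[OF z w] using resolvent_identity[OF z w, of x] by (metis add_diff_cancel_left')

lemma L_commute_R:
  assumes z: "0 < Re z" and x: "x \<in> D"
  shows "L (R z x) = R z (L x)"
proof -
  have "R z (z *\<^sub>C x + L x) = x" by (rule R_left[OF z x])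
  then have "z *\<^sub>C R z x + R z (L x) = x" by (simp add: R_add[OF z] R_scaleC[OF z])
  then show ?thesis using L_R[OF z, of x] by (metis add_diff_cancel_left')
qed

text \<open>By the resolvent identity the difference of two resolvents carries the factor
  \<open>z - g s\<close>, which tends to \<open>0\<close>.\<close>

lemma R_tendsto:
  assumes g: "(g \<longlongrightarrow> z) F" and z: "0 < Re z" and ev: "\<forall>\<^sub>F s in F. 0 < Re (g s)"
  shows "((\<lambda>s. R (g s) x) \<longlongrightarrow> R z x) F"
proof -
  have z0: "z \<noteq> 0" using z by auto
  have "((\<lambda>s. cmod (z - g s) * (M / cmod (g s) * (M / cmod z * norm x)))
      \<longlongrightarrow> cmod (z - z) * (M / cmod z * (M / cmod z * norm x))) F"
    by (intro tendsto_intros g) (use z0 in auto)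
  then have lim: "((\<lambda>s. cmod (z - g s) * (M / cmod (g s) * (M / cmod z * norm x))) \<longlongrightarrow> 0) F" by simp
  have "((\<lambda>s. R (g s) x - R z x) \<longlongrightarrow> 0) F"
  proof (rule Lim_null_comparison[OF _ lim])
    show "\<forall>\<^sub>F s in F. norm (R (g s) x - R z x) \<le> cmod (z - g s) * (M / cmod (g s) * (M / cmod z * norm x))"
      using ev
    proof eventually_elim
      case (elim s)
      have "R (g s) x - R z x = (z - g s) *\<^sub>C R (g s) (R z x)"
        by (rule R_difference[OF elim z])
      moreover have "norm (R (g s) (R z x)) \<le> M / cmod (g s) * (M / cmod z * norm x)"
        by (rule order_trans[OF R_norm[OF elim] mult_left_mono[OF R_norm[OF z]]]) (use M_pos in simp)
      ultimately show ?case by (metis norm_scaleC mult_left_mono norm_ge_zero)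
    qed
  qed
  then show ?thesis by (simp add: LIM_zero_iff)
qed

text \<open>The derivative of the resolvent is minus its square. An arbitrary curve \<open>g\<close>
  is allowed because both horizontal and vertical lines are needed.\<close>

lemma R_has_vector_derivative:
  assumes g: "(g has_vector_derivative g') (at t within S)" and t: "t \<in> S"
    and S: "\<And>s. s \<in> S \<Longrightarrow> 0 < Re (g s)"
  shows "((\<lambda>s. R (g s) x) has_vector_derivative - (g' *\<^sub>C R (g t) (R (g t) x))) (at t within S)"
proof -
  have inS: "\<forall>\<^sub>F s in at t within S. s \<in> S" by (simp add: eventually_at_filter)
  have gt: "(g \<longlongrightarrow> g t) (at t within S)"
    using has_vector_derivative_continuous[OF g] by (simp add: continuous_within)
  have ev: "\<forall>\<^sub>F s in at t within S. 0 < Re (g s)" using inS by eventually_elim (rule S)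
  have "((\<lambda>s. - (((1 / (s - t)) *\<^sub>R (g s - g t)) *\<^sub>C R (g s) (R (g t) x)))
      \<longlongrightarrow> - (g' *\<^sub>C R (g t) (R (g t) x))) (at t within S)"
    by (intro tendsto_minus scaleC_tendsto R_tendsto gt ev S t
        g[unfolded has_vector_derivative_iff_quotient])
  moreover have "\<forall>\<^sub>F s in at t within S. - (((1 / (s - t)) *\<^sub>R (g s - g t)) *\<^sub>C R (g s) (R (g t) x))
      = (1 / (s - t)) *\<^sub>R (R (g s) x - R (g t) x)"
    using ev
  proof eventually_elim
    case (elim s)
    have "R (g s) x - R (g t) x = (g t - g s) *\<^sub>C R (g s) (R (g t) x)"
      by (rule R_difference[OF elim S[OF t]])
    then show ?case
      by (simp add: scaleC_scaleR_left scaleC_diff_left scaleR_diff_right)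
  qed
  ultimately show ?thesis
    unfolding has_vector_derivative_iff_quotient by (rule Lim_transform_eventually)
qed

lemma R_continuous_on:
  assumes "continuous_on S g" "\<And>s. s \<in> S \<Longrightarrow> 0 < Re (g s)"
  shows "continuous_on S (\<lambda>s. R (g s) x)"
  using assms by (auto simp: continuous_on_def eventually_at_filter intro!: R_tendsto)

lemma RR_continuous_on:
  assumes g: "continuous_on S g" "\<And>s. s \<in> S \<Longrightarrow> 0 < Re (g s)"
  shows "continuous_on S (\<lambda>s. R (g s) (R (g s) x))"
  unfolding continuous_on_def
proof
  fix s0 assume s0: "s0 \<in> S"
  have inS: "\<forall>\<^sub>F s in at s0 within S. s \<in> S" by (simp add: eventually_at_filter)
  have gt: "(g \<longlongrightarrow> g s0) (at s0 within S)" using g(1) s0 by (simp add: continuous_on_def)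
  have ev: "\<forall>\<^sub>F s in at s0 within S. 0 < Re (g s)" using inS by eventually_elim (rule g(2))
  have w: "((\<lambda>s. R (g s) x - R (g s0) x) \<longlongrightarrow> 0) (at s0 within S)"
    using R_tendsto[OF gt g(2)[OF s0] ev] by (simp add: LIM_zero_iff)
  have nz: "g s0 \<noteq> 0" using g(2)[OF s0] by auto
  have "((\<lambda>s. M / cmod (g s) * norm (R (g s) x - R (g s0) x)) \<longlongrightarrow> M / cmod (g s0) * norm (0::'a)) (at s0 within S)"
    by (intro tendsto_intros gt w) (use nz in auto)
  then have "((\<lambda>s. M / cmod (g s) * norm (R (g s) x - R (g s0) x)) \<longlongrightarrow> 0) (at s0 within S)" by simp
  then have "((\<lambda>s. R (g s) (R (g s) x - R (g s0) x)) \<longlongrightarrow> 0) (at s0 within S)"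
    by (rule Lim_null_comparison[rotated]) (use ev R_norm in \<open>auto elim: eventually_mono\<close>)
  from tendsto_add[OF this R_tendsto[OF gt g(2)[OF s0] ev, of "R (g s0) x"]]
  have "((\<lambda>s. R (g s) (R (g s) x - R (g s0) x) + R (g s) (R (g s0) x)) \<longlongrightarrow> R (g s0) (R (g s0) x)) (at s0 within S)"
    by simp
  moreover have "\<forall>\<^sub>F s in at s0 within S. R (g s) (R (g s) x - R (g s0) x) + R (g s) (R (g s0) x) = R (g s) (R (g s) x)"
    using ev by eventually_elim (simp add: R_diff)
  ultimately show "((\<lambda>s. R (g s) (R (g s) x)) \<longlongrightarrow> R (g s0) (R (g s0) x)) (at s0 within S)"
    by (rule Lim_transform_eventually)
qed

end

section \<open>Scalar integrals along vertical lines\<close>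

lemma integral_inverse_square_le:
  fixes c :: real
  assumes c: "0 < c" and Y: "0 \<le> Y"
  shows "(\<lambda>y. 1 / (c\<^sup>2 + y\<^sup>2)) integrable_on {-Y..Y}"
    and "integral {-Y..Y} (\<lambda>y. 1 / (c\<^sup>2 + y\<^sup>2)) \<le> pi / c"
proof -
  have "((\<lambda>y. 1 / (c\<^sup>2 + y\<^sup>2)) has_integral (arctan (Y / c) / c - arctan (- Y / c) / c)) {-Y..Y}"
  proof (rule fundamental_theorem_of_calculus)
    fix y
    have "((\<lambda>y. arctan (y / c) / c) has_real_derivative (inverse (1 + (y / c)\<^sup>2) * (1 / c)) / c) (at y within {-Y..Y})"
      using c by (auto intro!: derivative_eq_intros)
    moreover have "(inverse (1 + (y / c)\<^sup>2) * (1 / c)) / c = 1 / (c\<^sup>2 + y\<^sup>2)"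
    proof -
      have "c\<^sup>2 + y\<^sup>2 \<noteq> 0" using c by (simp add: add_pos_nonneg less_imp_neq[symmetric])
      moreover have "1 + (y / c)\<^sup>2 = (c\<^sup>2 + y\<^sup>2) / c\<^sup>2" using c by (simp add: field_simps power_divide)
      ultimately show ?thesis using c by (simp add: power2_eq_square)
    qed
    ultimately show "((\<lambda>y. arctan (y / c) / c) has_vector_derivative 1 / (c\<^sup>2 + y\<^sup>2)) (at y within {-Y..Y})"
      by (simp add: has_real_derivative_iff_has_vector_derivative)
  qed (use Y in simp)
  then have I: "((\<lambda>y. 1 / (c\<^sup>2 + y\<^sup>2)) has_integral 2 * arctan (Y / c) / c) {-Y..Y}"
    by (simp add: arctan_minus)
  then show "(\<lambda>y. 1 / (c\<^sup>2 + y\<^sup>2)) integrable_on {-Y..Y}" by blast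
  have "2 * arctan (Y / c) \<le> pi" using arctan_ubound[of "Y / c"] by simp
  then show "integral {-Y..Y} (\<lambda>y. 1 / (c\<^sup>2 + y\<^sup>2)) \<le> pi / c"
    using integral_unique[OF I] c by (simp add: divide_right_mono)
qed

text \<open>The integral converges only as a principal value: over a symmetric interval the
  logarithm in the antiderivative cancels and the arctangent leaves \<open>pi\<close>, half of a
  full residue. The sign \<open>\<sigma>\<close> covers both 1 / z and 1 / (\<kappa> - z) along the
  line.\<close>

lemma integral_inverse_vertical_tendsto:
  fixes d \<sigma> :: real
  assumes d: "0 < d" and \<sigma>: "\<sigma> = 1 \<or> \<sigma> = -1"
  shows "((\<lambda>Y. integral {-Y..Y} (\<lambda>y. 1 / Complex d (\<sigma> * y))) \<longlongrightarrow> of_real pi) at_top"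
proof -
  define F where "F y = complex_of_real (arctan (y / d)) - \<i> * of_real (\<sigma> / 2 * ln (d\<^sup>2 + y\<^sup>2))" for y
  have pos: "d\<^sup>2 + y\<^sup>2 > 0" for y using d by (simp add: add_pos_nonneg)
  have F: "(F has_vector_derivative 1 / Complex d (\<sigma> * y)) (at y within S)" for y S
  proof -
    have r: "((\<lambda>y. arctan (y / d)) has_real_derivative (inverse (1 + (y / d)\<^sup>2) * (1 / d))) (at y within S)"
      "((\<lambda>y. \<sigma> / 2 * ln (d\<^sup>2 + y\<^sup>2)) has_real_derivative \<sigma> / 2 * (2 * y / (d\<^sup>2 + y\<^sup>2))) (at y within S)"
      using pos[of y] d by (auto intro!: derivative_eq_intros simp: field_simps)
    have "inverse (1 + (y / d)\<^sup>2) * (1 / d) = d / (d\<^sup>2 + y\<^sup>2)"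
      using d pos[of y] by (simp add: field_simps power2_eq_square)
    then have "complex_of_real (inverse (1 + (y / d)\<^sup>2) * (1 / d)) - \<i> * of_real (\<sigma> / 2 * (2 * y / (d\<^sup>2 + y\<^sup>2)))
        = 1 / Complex d (\<sigma> * y)"
      using \<sigma> pos[of y] by (auto simp: complex_eq_iff Re_divide Im_divide power2_eq_square[of "d\<^sup>2 + y\<^sup>2"])
    then show ?thesis unfolding F_def
      using has_vector_derivative_diff[OF has_vector_derivative_of_real[OF r(1)]
          has_vector_derivative_mult_right[OF has_vector_derivative_of_real[OF r(2)]], of \<i>] by simp
  qed
  have I: "integral {-Y..Y} (\<lambda>y. 1 / Complex d (\<sigma> * y)) = of_real (2 * arctan (Y / d))" if "0 \<le> Y" for Y
  proof -
    have "((\<lambda>y. 1 / Complex d (\<sigma> * y)) has_integral F Y - F (- Y)) {-Y..Y}"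
      by (rule fundamental_theorem_of_calculus[OF _ F]) (use that in simp)
    then show ?thesis by (simp add: integral_unique F_def arctan_minus)
  qed
  have "filterlim (\<lambda>Y::real. Y / d) at_top at_top"
    using d filterlim_tendsto_pos_mult_at_top[OF tendsto_const, of "1 / d" "\<lambda>Y. Y" at_top]
    by (simp add: filterlim_ident)
  then have "((\<lambda>Y. complex_of_real (2 * arctan (Y / d))) \<longlongrightarrow> of_real (2 * (pi / 2))) at_top"
    by (intro tendsto_intros filterlim_compose[OF tendsto_arctan_at_top])
  then have lim: "((\<lambda>Y. complex_of_real (2 * arctan (Y / d))) \<longlongrightarrow> of_real pi) at_top" by simp
  show ?thesis
    by (rule Lim_transform_eventually[OF lim])
      (use I in \<open>auto intro!: eventually_mono[OF eventually_ge_at_top[of 0]]\<close>)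
qed

text \<open>From the second power on there is an antiderivative that tends to \<open>0\<close> in
  both directions, so these integrals leave no contribution in the limit.\<close>

lemma integral_inverse_power_vertical_tendsto:
  fixes d :: real
  assumes d: "0 < d"
  shows "((\<lambda>Y. integral {-Y..Y} (\<lambda>y. 1 / Complex d (- y) ^ Suc (Suc n))) \<longlongrightarrow> 0) at_top"
proof -
  define F where "F y = - \<i> / of_nat (Suc n) * (1 / Complex d (- y) ^ Suc n)" for y
  have nz: "Complex d (- y) \<noteq> 0" for y using d by (simp add: complex_eq_iff)
  have g: "((\<lambda>y. Complex d (- y)) has_vector_derivative - \<i>) (at y within S)" for y S
  proof -
    have "((\<lambda>y. complex_of_real d - \<i> * of_real y) has_vector_derivative 0 - \<i> * 1) (at y within S)"
      by (intro derivative_intros has_vector_derivative_of_real) (auto intro!: derivative_eq_intros)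
    moreover have "(\<lambda>y. complex_of_real d - \<i> * of_real y) = (\<lambda>y. Complex d (- y))"
      by (auto simp: complex_eq_iff)
    ultimately show ?thesis by simp
  qed
  have F: "(F has_vector_derivative 1 / Complex d (- y) ^ Suc (Suc n)) (at y within S)" for y S
  proof -
    have "((\<lambda>z. - \<i> / of_nat (Suc n) * (1 / z ^ Suc n)) has_field_derivative
        - \<i> / of_nat (Suc n) * (- of_nat (Suc n) / z ^ Suc (Suc n))) (at z)"
      if "z \<noteq> 0" for z :: complex
    proof -
      have "((\<lambda>z. inverse (z ^ Suc n)) has_field_derivative
          - (inverse (z ^ Suc n) * (of_nat (Suc n) * z ^ n) * inverse (z ^ Suc n))) (at z)"
        using DERIV_inverse'[OF DERIV_power[OF DERIV_ident, where n = "Suc n" and x = z and s = UNIV]] that by simp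
      moreover have "inverse (z ^ Suc n) * (of_nat (Suc n) * z ^ n) * inverse (z ^ Suc n)
          = of_nat (Suc n) / z ^ Suc (Suc n)"
        using that by (simp add: field_simps del: of_nat_Suc)
      ultimately have "((\<lambda>z. 1 / z ^ Suc n) has_field_derivative - of_nat (Suc n) / z ^ Suc (Suc n)) (at z)"
        by (simp add: inverse_eq_divide del: of_nat_Suc power_Suc)
      then show ?thesis by (rule DERIV_cmult)
    qed
    from field_vector_diff_chain_within[OF g has_field_derivative_at_within[OF this[OF nz]]]
    have "(F has_vector_derivative - \<i> * (- \<i> / of_nat (Suc n) * (- of_nat (Suc n) / Complex d (- y) ^ Suc (Suc n)))) (at y within S)"
      by (simp add: F_def[abs_def] o_def)
    moreover have "- \<i> * (- \<i> / of_nat (Suc n) * (- of_nat (Suc n) / Complex d (- y) ^ Suc (Suc n)))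
        = 1 / Complex d (- y) ^ Suc (Suc n)"
      by (simp add: field_simps del: of_nat_Suc power_Suc)
    ultimately show ?thesis by simp
  qed
  have F_lim: "(F \<longlongrightarrow> 0) at_infinity"
  proof (rule Lim_null_comparison)
    show "((\<lambda>y::real. inverse (norm y)) \<longlongrightarrow> 0) at_infinity"
      by (intro tendsto_inverse_0_at_top filterlim_norm_at_top)
    show "\<forall>\<^sub>F y in at_infinity. norm (F y) \<le> inverse (norm y)"
      unfolding eventually_at_infinity
    proof (intro exI[of _ 1] allI impI)
      fix y :: real assume y: "1 \<le> norm y"
      have a: "\<bar>y\<bar> \<le> cmod (Complex d (- y))" using abs_Im_le_cmod[of "Complex d (- y)"] by simp
      then have "1 \<le> cmod (Complex d (- y))" using y by simp
      then have "cmod (Complex d (- y)) \<le> cmod (Complex d (- y)) ^ Suc n"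
        by (metis le_add1 plus_1_eq_Suc power_increasing power_one_right)
      with a have "\<bar>y\<bar> \<le> cmod (Complex d (- y)) ^ Suc n" by simp
      then have le: "norm (1 / Complex d (- y) ^ Suc n) \<le> 1 / \<bar>y\<bar>"
        using y unfolding norm_divide norm_power by (intro frac_le) auto
      have "norm (- \<i> / of_nat (Suc n) :: complex) \<le> 1"
        by (simp add: norm_divide del: of_nat_Suc)
      then have "norm (F y) \<le> 1 * (1 / \<bar>y\<bar>)"
        unfolding F_def norm_mult by (intro mult_mono le) auto
      then show "norm (F y) \<le> inverse (norm y)" by (simp add: inverse_eq_divide)
    qed
  qed
  have l: "(F \<longlongrightarrow> 0) at_top" "(F \<longlongrightarrow> 0) at_bot"
    using F_lim by (auto simp: at_infinity_eq_at_top_bot filterlim_def le_sup_iff filtermap_sup)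
  have "((\<lambda>Y. F Y - F (- Y)) \<longlongrightarrow> 0 - 0) at_top"
    by (intro tendsto_diff l filterlim_compose[OF l(2)] filterlim_uminus_at_bot_at_top)
  moreover have "\<forall>\<^sub>F Y in at_top. F Y - F (- Y) = integral {-Y..Y} (\<lambda>y. 1 / Complex d (- y) ^ Suc (Suc n))"
    using eventually_ge_at_top[of 0]
  proof eventually_elim
    case (elim Y)
    have "((\<lambda>y. 1 / Complex d (- y) ^ Suc (Suc n)) has_integral F Y - F (- Y)) {-Y..Y}"
      by (rule fundamental_theorem_of_calculus[OF _ F]) (use elim in simp)
    then show ?case by (rule integral_unique[symmetric])
  qed
  ultimately show ?thesis using Lim_transform_eventually by fastforce
qed

lemma has_vector_derivative_Complex_Im:
  "((\<lambda>y. Complex c y) has_vector_derivative \<i>) (at y within S)"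
proof -
  have "((\<lambda>y. complex_of_real c + \<i> * of_real y) has_vector_derivative 0 + \<i> * 1) (at y within S)"
    by (intro derivative_intros has_vector_derivative_of_real) (auto intro!: derivative_eq_intros)
  moreover have "(\<lambda>y. complex_of_real c + \<i> * of_real y) = (\<lambda>y. Complex c y)"
    by (auto simp: complex_eq_iff)
  ultimately show ?thesis by simp
qed

lemma has_vector_derivative_Complex_Re:
  "((\<lambda>c. Complex c y) has_vector_derivative 1) (at c within S)"
proof -
  have "((\<lambda>c. of_real c + \<i> * of_real y) has_vector_derivative 1 + 0) (at c within S)"
    by (intro derivative_intros has_vector_derivative_of_real) (auto intro!: derivative_eq_intros)
  moreover have "(\<lambda>c. of_real c + \<i> * of_real y) = (\<lambda>c. Complex c y)"
    by (auto simp: complex_eq_iff)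
  ultimately show ?thesis by simp
qed

lemma continuous_on_Complex_pair: "continuous_on S (\<lambda>(c, y). Complex c y)"
proof -
  have "continuous_on S (\<lambda>p. complex_of_real (fst p) + \<i> * of_real (snd p))"
    by (intro continuous_intros)
  moreover have "(\<lambda>p. complex_of_real (fst p) + \<i> * of_real (snd p)) = (\<lambda>(c, y). Complex c y)"
    by (auto simp: complex_eq_iff)
  ultimately show ?thesis by (simp only:)
qed

lemma continuous_on_Complex_Im: "continuous_on S (Complex c)"
  using has_vector_derivative_continuous[OF has_vector_derivative_Complex_Im]
  by (simp add: continuous_on_eq_continuous_within)

section \<open>Line integrals of the resolvent and bounds for its powers\<close>

context half_plane_resolvent
begin

text \<open>\<open>G\<close> is the remainder in
  \<open>R z x = (1 / z) *\<^sub>C x - G (L x) z\<close> for \<open>x\<close> in \<open>D\<close>.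
  It decays quadratically, one order better than the resolvent, so its line integrals converge
  absolutely. \<open>G'\<close> is its complex derivative.\<close>

definition G where "G v z = (1 / z) *\<^sub>C R z v"
definition G' where "G' v z = - ((1 / z\<^sup>2) *\<^sub>C R z v + (1 / z) *\<^sub>C R z (R z v))"

lemma G_has_vector_derivative:
  assumes g: "(g has_vector_derivative g') (at t within S)" and t: "t \<in> S"
    and S: "\<And>s. s \<in> S \<Longrightarrow> 0 < Re (g s)"
  shows "((\<lambda>s. G v (g s)) has_vector_derivative g' *\<^sub>C G' v (g t)) (at t within S)"
proof -
  have nz: "g t \<noteq> 0" using S[OF t] by auto
  have "((\<lambda>z. 1 / z) has_field_derivative - (1 / (g t)\<^sup>2)) (at (g t) within g ` S)"
    using nz by (auto intro!: derivative_eq_intros simp: power2_eq_square)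
  from field_vector_diff_chain_within[OF g this]
  have inv: "((\<lambda>s. 1 / g s) has_vector_derivative g' * - (1 / (g t)\<^sup>2)) (at t within S)"
    by (simp add: o_def)
  have "((\<lambda>s. (1 / g s) *\<^sub>C R (g s) v) has_vector_derivative
      (1 / g t) *\<^sub>C - (g' *\<^sub>C R (g t) (R (g t) v)) + (g' * - (1 / (g t)\<^sup>2)) *\<^sub>C R (g t) v) (at t within S)"
    by (rule scaleC_has_vector_derivative[OF inv R_has_vector_derivative[OF g t S]])
  moreover have "(1 / g t) *\<^sub>C - (g' *\<^sub>C R (g t) (R (g t) v)) + (g' * - (1 / (g t)\<^sup>2)) *\<^sub>C R (g t) v
      = g' *\<^sub>C G' v (g t)"
    by (simp add: G'_def scaleC_minus_right scaleC_minus_left scaleC_scaleC scaleC_add_right mult.commute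
        scaleC_diff_right)
  ultimately show ?thesis by (simp add: G_def)
qed

lemma G_norm: assumes "0 < Re z" shows "norm (G v z) \<le> M * norm v / (cmod z)\<^sup>2"
proof -
  have z: "cmod z > 0" using assms by auto
  have "norm (G v z) \<le> 1 / cmod z * (M / cmod z * norm v)"
    unfolding G_def norm_scaleC norm_divide norm_one by (intro mult_left_mono R_norm assms) simp
  then show ?thesis by (simp add: power2_eq_square)
qed

lemma continuous_on_vertical:
  assumes "0 < c"
  shows "continuous_on S (\<lambda>y. R (Complex c y) x)" "continuous_on S (\<lambda>y. R (Complex c y) (R (Complex c y) x))"
    "continuous_on S (\<lambda>y. G x (Complex c y))"
proof -
  show 1: "continuous_on S (\<lambda>y. R (Complex c y) x)"
    by (rule R_continuous_on) (use assms in \<open>auto intro: continuous_on_Complex_Im\<close>)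
  show "continuous_on S (\<lambda>y. R (Complex c y) (R (Complex c y) x))"
    by (rule RR_continuous_on) (use assms in \<open>auto intro: continuous_on_Complex_Im\<close>)
  show "continuous_on S (\<lambda>y. G x (Complex c y))"
    unfolding G_def
    by (intro scaleC_continuous_on 1 continuous_on_divide continuous_on_const continuous_on_Complex_Im)
      (use assms in \<open>auto simp: complex_eq_iff\<close>)
qed

lemma cmod_Complex_squared: "(cmod (Complex c y))\<^sup>2 = c\<^sup>2 + y\<^sup>2"
  by (simp add: cmod_power2)

lemma integral_G_bound:
  assumes c: "0 < c" and Y: "0 \<le> Y"
  shows "norm (integral {-Y..Y} (\<lambda>y. G v (Complex c y))) \<le> M * norm v * (pi / c)"
proof -
  have i: "(\<lambda>y. M * norm v * (1 / (c\<^sup>2 + y\<^sup>2))) integrable_on {-Y..Y}"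
    by (rule integrable_on_mult_right[OF integral_inverse_square_le(1)[OF c Y]])
  have "norm (integral {-Y..Y} (\<lambda>y. G v (Complex c y)))
      \<le> integral {-Y..Y} (\<lambda>y. M * norm v * (1 / (c\<^sup>2 + y\<^sup>2)))"
  proof (rule integral_norm_bound_integral[OF _ i])
    show "(\<lambda>y. G v (Complex c y)) integrable_on {-Y..Y}"
      by (rule integrable_continuous_real[OF continuous_on_vertical(3)[OF c]])
    show "norm (G v (Complex c y)) \<le> M * norm v * (1 / (c\<^sup>2 + y\<^sup>2))" for y
      using G_norm[of "Complex c y" v] c by (simp add: cmod_Complex_squared)
  qed
  also have "\<dots> = M * norm v * integral {-Y..Y} (\<lambda>y. 1 / (c\<^sup>2 + y\<^sup>2))"
    by (rule integral_mult_right)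
  also have "\<dots> \<le> M * norm v * (pi / c)"
    by (rule mult_left_mono[OF integral_inverse_square_le(2)[OF c Y]]) (use M_pos in simp)
  finally show ?thesis .
qed

text \<open>Cauchy's theorem for a rectangle: moving the vertical line from real part \<open>c\<close> to real part
  \<open>Y\<close> costs only the two horizontal sides.\<close>

lemma integral_G_tendsto:
  assumes c: "0 < c"
  shows "((\<lambda>Y. integral {-Y..Y} (\<lambda>y. G v (Complex c y))) \<longlongrightarrow> 0) at_top"
proof (rule Lim_null_comparison)
  let ?K = "M * norm v * (2 + pi)"
  show "((\<lambda>Y::real. ?K * inverse Y) \<longlongrightarrow> 0) at_top"
    using tendsto_mult[OF tendsto_const[of ?K] tendsto_inverse_0_at_top[OF filterlim_ident[of at_top]]] by simp
  show "\<forall>\<^sub>F Y in at_top. norm (integral {-Y..Y} (\<lambda>y. G v (Complex c y))) \<le> ?K * inverse Y"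
    using eventually_ge_at_top[of c]
  proof eventually_elim
    case (elim Y)
    then have Y: "0 < Y" using c by simp
    \<comment> \<open>\<open>Y\<close> is both the half height of the segment and the real part to
      which it is moved. The horizontal sides then have length at most \<open>Y\<close> and carry an
      integrand of order 1 / Y^2.\<close>
    define W where "W b = integral (cbox (-Y) Y) (\<lambda>y. G v (Complex b y))" for b
    define W' where "W' b = integral (cbox (-Y) Y) (\<lambda>y. G' v (Complex b y))" for b
    \<comment> \<open>Cauchy's theorem by differentiation under the integral sign: the derivative in
      the real part is the integral of a complex derivative along the vertical segment, hence a
      difference of two end values.\<close>
    have W: "(W has_vector_derivative W' b) (at b within {0<..})" if b: "b \<in> {0<..}" for b
      unfolding W_def[abs_def] W'_def
    proof (rule leibniz_rule_vector_derivative[OF _ _ _ b])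
      show "((\<lambda>b. G v (Complex b y)) has_vector_derivative G' v (Complex b y)) (at b within {0<..})"
        if "b \<in> {0<..}" for b y
        using G_has_vector_derivative[OF has_vector_derivative_Complex_Re[of y b "{0<..}"] that, of v] by simp
      show "(\<lambda>y. G v (Complex b y)) integrable_on cbox (-Y) Y" if "b \<in> {0<..}" for b
        using that by (auto intro!: integrable_continuous_real continuous_on_vertical)
      show "continuous_on ({0<..} \<times> cbox (- Y) Y) (\<lambda>(b, y). G' v (Complex b y))"
        unfolding G'_def case_prod_unfold
        by (intro continuous_intros scaleC_continuous_on R_continuous_on RR_continuous_on
            continuous_on_Complex_pair[unfolded case_prod_unfold])
          (auto simp: Complex_eq_0)
    qed auto
    have W'_bound: "norm (W' b) \<le> 2 * (M * norm v / Y\<^sup>2)" if b: "b > 0" for b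
    proof -
      have "((\<lambda>y. \<i> *\<^sub>C G' v (Complex b y)) has_integral G v (Complex b Y) - G v (Complex b (-Y))) {-Y..Y}"
        by (rule fundamental_theorem_of_calculus[OF _ G_has_vector_derivative[OF has_vector_derivative_Complex_Im]])
          (use Y b in auto)
      from has_integral_linear[OF this scaleC_bounded_linear_right[of "-\<i>"]]
      have "((\<lambda>y. G' v (Complex b y)) has_integral
          (-\<i>) *\<^sub>C (G v (Complex b Y) - G v (Complex b (-Y)))) {-Y..Y}"
        by (simp add: o_def scaleC_scaleC)
      then have "W' b = (-\<i>) *\<^sub>C (G v (Complex b Y) - G v (Complex b (-Y)))"
        by (simp add: W'_def integral_unique)
      then have "norm (W' b) \<le> norm (G v (Complex b Y)) + norm (G v (Complex b (-Y)))"
        by (simp add: norm_scaleC norm_triangle_ineq4)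
      moreover have "norm (G v (Complex b y)) \<le> M * norm v / Y\<^sup>2" if "\<bar>y\<bar> = Y" for y
      proof -
        have "Y\<^sup>2 = y\<^sup>2" using that by auto
        then have "Y\<^sup>2 \<le> (cmod (Complex b y))\<^sup>2" by (simp add: cmod_Complex_squared)
        then have "M * norm v / (cmod (Complex b y))\<^sup>2 \<le> M * norm v / Y\<^sup>2"
          using M_pos Y by (intro divide_left_mono mult_pos_pos) (auto intro: less_le_trans[of 0 "Y\<^sup>2"])
        then show ?thesis using G_norm[of "Complex b y" v] b by simp
      qed
      ultimately show ?thesis using Y by (smt (verit) abs_minus_cancel abs_of_pos)
    qed
    have "(W' has_integral W Y - W c) {c..Y}"
      by (rule fundamental_theorem_of_calculus[OF elim])
        (use c in \<open>auto intro!: has_vector_derivative_within_subset[OF W]\<close>)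
    then have "norm (W Y - W c) \<le> 2 * (M * norm v / Y\<^sup>2) * measure lborel {c..Y}"
      by (rule has_integral_bound_real[OF _ finite.emptyI, rotated]) (use M_pos c W'_bound in auto)
    also have "\<dots> \<le> 2 * (M * norm v / Y\<^sup>2) * Y"
      by (rule mult_left_mono) (use M_pos elim c in auto)
    also have "\<dots> = M * norm v * 2 * inverse Y" using Y by (simp add: power2_eq_square field_simps)
    finally have "norm (W Y - W c) \<le> M * norm v * 2 * inverse Y" .
    moreover have "norm (W Y) \<le> M * norm v * pi * inverse Y"
      using integral_G_bound[OF Y, of Y v] Y by (simp add: W_def divide_inverse)
    moreover have "norm (W c) \<le> norm (W Y) + norm (W Y - W c)" by (metis norm_minus_commute norm_triangle_sub)
    ultimately have "norm (W c) \<le> ?K * inverse Y" by (simp add: distrib_left distrib_right)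
    then show ?case by (simp add: W_def)
  qed
qed

text \<open>For \<open>x\<close> in \<open>D\<close> the resolvent splits into 1 / z times
  \<open>x\<close>, whose principal value is \<open>pi\<close>, and the term \<open>G (L x)\<close>,
  whose integral vanishes in the limit.\<close>

lemma integral_R_tendsto:
  assumes c: "0 < c" and x: "x \<in> D"
  shows "((\<lambda>Y. integral {-Y..Y} (\<lambda>y. R (Complex c y) x)) \<longlongrightarrow> pi *\<^sub>R x) at_top"
proof -
  have nz: "Complex c y \<noteq> 0" for y using c by (simp add: complex_eq_iff)
  have dec: "R (Complex c y) x = (1 / Complex c y) *\<^sub>C x - G (L x) (Complex c y)" for y
  proof -
    have re: "0 < Re (Complex c y)" using c by simp
    have "Complex c y *\<^sub>C R (Complex c y) x + R (Complex c y) (L x) = x"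
      using R_left[OF re x] by (simp add: R_add[OF re] R_scaleC[OF re])
    then have "Complex c y *\<^sub>C R (Complex c y) x = x - R (Complex c y) (L x)"
      by (simp add: algebra_simps)
    then have "(1 / Complex c y) *\<^sub>C (Complex c y *\<^sub>C R (Complex c y) x)
        = (1 / Complex c y) *\<^sub>C (x - R (Complex c y) (L x))" by simp
    then show ?thesis by (simp add: scaleC_scaleC nz G_def scaleC_diff_right)
  qed
  have blx: "bounded_linear (\<lambda>a. a *\<^sub>C x)"
    by (rule bounded_bilinear.bounded_linear_left[OF bounded_bilinear_scaleC])
  have ci: "(\<lambda>y. 1 / Complex c y) integrable_on {-Y..Y}" for Y
    by (intro integrable_continuous_real continuous_on_divide continuous_on_const continuous_on_Complex_Im)
      (use nz in blast)
  have "integral {-Y..Y} (\<lambda>y. R (Complex c y) x)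
      = integral {-Y..Y} (\<lambda>y. 1 / Complex c y) *\<^sub>C x - integral {-Y..Y} (\<lambda>y. G (L x) (Complex c y))" for Y
  proof -
    have "((\<lambda>y. (1 / Complex c y) *\<^sub>C x) has_integral integral {-Y..Y} (\<lambda>y. 1 / Complex c y) *\<^sub>C x) {-Y..Y}"
      using has_integral_linear[OF integrable_integral[OF ci] blx] by (simp add: o_def)
    moreover have "(\<lambda>y. G (L x) (Complex c y)) integrable_on {-Y..Y}"
      by (rule integrable_continuous_real[OF continuous_on_vertical(3)[OF c]])
    ultimately show ?thesis
      unfolding dec by (intro integral_unique has_integral_diff integrable_integral)
  qed
  moreover have "((\<lambda>Y. integral {-Y..Y} (\<lambda>y. 1 / Complex c y) *\<^sub>C x
      - integral {-Y..Y} (\<lambda>y. G (L x) (Complex c y))) \<longlongrightarrow> of_real pi *\<^sub>C x - 0) at_top"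
    using integral_inverse_vertical_tendsto[OF c, of 1]
    by (intro tendsto_diff integral_G_tendsto c scaleC_tendsto tendsto_const) auto
  ultimately show ?thesis by (simp add: scaleC_of_real)
qed

text \<open>The recursion behind the formula \<open>n R(\<kappa>)\<^sup>n\<^sup>+\<^sup>1 = 1 / (2 \<pi> i) \<integral> R(z)\<^sup>2 / (\<kappa> - z)\<^sup>n dz\<close>, whose right hand
  side, unlike Cauchy's formula for \<open>R(\<kappa>)\<^sup>n\<^sup>+\<^sup>1\<close> with a single resolvent, converges absolutely and is
  of order \<open>n \<kappa>\<^sup>-\<^sup>n\<^sup>-\<^sup>1\<close> on the line with real part \<open>\<kappa> / (n + 1)\<close>.\<close>

lemma integral_R_power_tendsto:
  assumes c: "0 < c" "c < \<kappa>" and x: "x \<in> D"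
  shows "((\<lambda>Y. integral {-Y..Y} (\<lambda>y. (1 / (of_real \<kappa> - Complex c y) ^ n) *\<^sub>C R (Complex c y) (R (Complex c y) x)))
    \<longlongrightarrow> (2 * pi * n) *\<^sub>R (R (of_real \<kappa>) ^^ Suc n) x) at_top"
proof -
  define S where "S = R (of_real \<kappa>)"
  define z where "z y = Complex c y" for y
  define w where "w y = Complex (\<kappa> - c) (- y)" for y
  define K where "K n Y = integral {-Y..Y} (\<lambda>y. (1 / w y ^ n) *\<^sub>C R (z y) x)" for n Y
  define k where "k n Y = integral {-Y..Y} (\<lambda>y. 1 / w y ^ n)" for n Y
  define I where "I n Y = integral {-Y..Y} (\<lambda>y. (1 / w y ^ n) *\<^sub>C R (z y) (R (z y) x))" for n Y
  have re: "0 < Re (complex_of_real \<kappa>)" "0 < Re (z y)" for y using c by (auto simp: z_def)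
  have w: "complex_of_real \<kappa> - z y = w y" for y by (simp add: z_def w_def complex_eq_iff)
  have wnz: "w y \<noteq> 0" for y using c by (simp add: w_def complex_eq_iff)
  have S: "bounded_linear S" unfolding S_def by (rule R_bounded_linear[OF re(1)])
  have Sz: "S (a *\<^sub>C v) = a *\<^sub>C S v" "S (u + v) = S u + S v" "S (r *\<^sub>R v) = r *\<^sub>R S v" for a u v r
    unfolding S_def by (rule R_scaleC[OF re(1)] R_add[OF re(1)] R_scaleR[OF re(1)])+
  have wc: "continuous_on U w" for U
  proof -
    have "w y = of_real \<kappa> - z y" for y by (simp add: w)
    then have "w = (\<lambda>y. of_real \<kappa> - Complex c y)" by (auto simp: z_def)
    then show ?thesis by (simp add: continuous_intros continuous_on_Complex_Im)
  qed
  have wi: "continuous_on U (\<lambda>y. 1 / w y ^ n)" for U n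
    by (intro continuous_intros wc) (use wnz in auto)
  have Ki: "(\<lambda>y. (1 / w y ^ n) *\<^sub>C R (z y) v) integrable_on {-Y..Y}" for n Y v
    unfolding z_def by (intro integrable_continuous_real scaleC_continuous_on wi continuous_on_vertical(1) c)
  have Ii: "(\<lambda>y. (1 / w y ^ n) *\<^sub>C R (z y) (R (z y) x)) integrable_on {-Y..Y}" for n Y
    unfolding z_def by (intro integrable_continuous_real scaleC_continuous_on wi continuous_on_vertical(2) c)
  have ki: "(\<lambda>y. 1 / w y ^ n) integrable_on {-Y..Y}" for n Y
    by (intro integrable_continuous_real wi)
  \<comment> \<open>The resolvent identity between z and \<kappa>, divided by a power of \<kappa> -
    z, lowers the exponent by one at the cost of one factor \<open>S\<close> and a term with a
    single resolvent.\<close>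
  have I_rec: "I (Suc n) Y = S (K (Suc n) Y + I n Y)" for n Y
  proof -
    have "(1 / w y ^ Suc n) *\<^sub>C R (z y) (R (z y) x)
        = S ((1 / w y ^ Suc n) *\<^sub>C R (z y) x + (1 / w y ^ n) *\<^sub>C R (z y) (R (z y) x))" for y
      using arg_cong[OF resolvent_identity[OF re(2) re(1), of y "R (z y) x"], of "(*\<^sub>C) (1 / w y ^ Suc n)"] wnz[of y]
      unfolding Sz S_def[symmetric] w scaleC_add_right scaleC_scaleC by simp
    moreover have "((\<lambda>y. S ((1 / w y ^ Suc n) *\<^sub>C R (z y) x + (1 / w y ^ n) *\<^sub>C R (z y) (R (z y) x)))
        has_integral S (K (Suc n) Y + I n Y)) {-Y..Y}"
      unfolding K_def I_def
      by (rule has_integral_linear[OF has_integral_add[OF integrable_integral[OF Ki] integrable_integral[OF Ii]] S, unfolded o_def])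
    ultimately show ?thesis by (simp add: I_def integral_unique)
  qed
  have K_rec: "K (Suc n) Y = k (Suc n) Y *\<^sub>C S x + S (K n Y)" for n Y
  proof -
    have e: "(1 / w y ^ Suc n) *\<^sub>C R (z y) x = (1 / w y ^ Suc n) *\<^sub>C S x + S ((1 / w y ^ n) *\<^sub>C R (z y) x)" for y
      using arg_cong[OF resolvent_identity[OF re(2) re(1), of y x], of "(*\<^sub>C) (1 / w y ^ Suc n)"] wnz[of y]
      unfolding Sz S_def[symmetric] w scaleC_add_right scaleC_scaleC by simp
    have "((\<lambda>y. (1 / w y ^ Suc n) *\<^sub>C S x) has_integral k (Suc n) Y *\<^sub>C S x) {-Y..Y}"
      unfolding k_def
      by (rule has_integral_linear[OF integrable_integral[OF ki]
          bounded_bilinear.bounded_linear_left[OF bounded_bilinear_scaleC], unfolded o_def])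
    moreover have "((\<lambda>y. S ((1 / w y ^ n) *\<^sub>C R (z y) x)) has_integral S (K n Y)) {-Y..Y}"
      unfolding K_def by (rule has_integral_linear[OF integrable_integral[OF Ki] S, unfolded o_def])
    ultimately show ?thesis unfolding K_def e by (intro integral_unique has_integral_add)
  qed
  \<comment> \<open>Two half residues, one from 1 / w and one from the resolvent, give 2 pi in the
    first step; the later scalar integrals vanish and only a factor \<open>S\<close> is
    added.\<close>
  have K_lim: "(K (Suc n) \<longlongrightarrow> (2 * pi) *\<^sub>R (S ^^ Suc n) x) at_top" for n
  proof (induction n)
    case 0
    have "(k 1 \<longlongrightarrow> of_real pi) at_top"
      using integral_inverse_vertical_tendsto[of "\<kappa> - c" "-1"] c by (simp add: k_def[abs_def] w_def)
    moreover have "(K 0 \<longlongrightarrow> pi *\<^sub>R x) at_top"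
      using integral_R_tendsto[OF c(1) x] by (simp add: K_def[abs_def] z_def)
    ultimately have "((\<lambda>Y. k (Suc 0) Y *\<^sub>C S x + S (K 0 Y)) \<longlongrightarrow> of_real pi *\<^sub>C S x + S (pi *\<^sub>R x)) at_top"
      by (intro tendsto_add scaleC_tendsto tendsto_const bounded_linear.tendsto[OF S]) auto
    then show ?case by (simp add: K_rec Sz scaleC_of_real scaleR_left.add[symmetric] flip: K_rec)
  next
    case (Suc n)
    have "(k (Suc (Suc n)) \<longlongrightarrow> 0) at_top"
      using integral_inverse_power_vertical_tendsto[of "\<kappa> - c" n] c by (simp add: k_def[abs_def] w_def)
    then have "((\<lambda>Y. k (Suc (Suc n)) Y *\<^sub>C S x + S (K (Suc n) Y)) \<longlongrightarrow> 0 *\<^sub>C S x + S ((2 * pi) *\<^sub>R (S ^^ Suc n) x)) at_top"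
      by (intro tendsto_add scaleC_tendsto tendsto_const bounded_linear.tendsto[OF S] Suc)
    then show ?case by (simp add: K_rec[of "Suc n", abs_def] Sz)
  qed
  \<comment> \<open>At exponent \<open>0\<close> the integrand is a complete derivative and the
    limit is \<open>0\<close>. Every recursion step adds 2 pi times the next power of
    \<open>S\<close>, which produces the factor \<open>n\<close>.\<close>
  have I_lim: "(I n \<longlongrightarrow> (2 * pi * n) *\<^sub>R (S ^^ Suc n) x) at_top" for n
  proof (induction n)
    case 0
    define F where "F y = \<i> *\<^sub>C R (z y) x" for y
    have F: "(F has_vector_derivative R (z y) (R (z y) x)) (at y within U)" for y U
    proof -
      have "((\<lambda>y. R (z y) x) has_vector_derivative - (\<i> *\<^sub>C R (z y) (R (z y) x))) (at y within UNIV)"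
        unfolding z_def by (rule R_has_vector_derivative[OF has_vector_derivative_Complex_Im]) (use c in auto)
      from bounded_linear.has_vector_derivative[OF scaleC_bounded_linear_right this, of \<i>]
      have "(F has_vector_derivative R (z y) (R (z y) x)) (at y)"
        by (simp add: F_def[abs_def] scaleC_minus_right scaleC_scaleC scaleC_minus_left)
      then show ?thesis by (rule has_vector_derivative_at_within)
    qed
    have "((\<lambda>Y::real. 2 * M * norm x * inverse Y) \<longlongrightarrow> 2 * M * norm x * 0) at_top"
      by (intro tendsto_intros tendsto_inverse_0_at_top filterlim_ident)
    then have lim: "((\<lambda>Y::real. 2 * M * norm x * inverse Y) \<longlongrightarrow> 0) at_top" by simp
    have "(I 0 \<longlongrightarrow> 0) at_top"
    proof (rule Lim_null_comparison[OF _ lim])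
      show "\<forall>\<^sub>F Y in at_top. norm (I 0 Y) \<le> 2 * M * norm x * inverse Y"
        using eventually_gt_at_top[of 0]
      proof eventually_elim
        case (elim Y)
        have b: "norm (F y) \<le> M * norm x * inverse Y" if "\<bar>y\<bar> = Y" for y
        proof -
          have "Y \<le> cmod (z y)" using abs_Im_le_cmod[of "z y"] that by (simp add: z_def)
          then have "M / cmod (z y) * norm x \<le> M / Y * norm x"
            using elim M_pos by (intro mult_right_mono frac_le) auto
          then show ?thesis using R_norm[OF re(2), of y x] by (simp add: F_def norm_scaleC divide_inverse mult_ac)
        qed
        have "((\<lambda>y. R (z y) (R (z y) x)) has_integral F Y - F (- Y)) {-Y..Y}"
          by (rule fundamental_theorem_of_calculus[OF _ F]) (use elim in simp)
        then have "norm (I 0 Y) \<le> norm (F Y) + norm (F (-Y))"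
          by (simp add: I_def integral_unique norm_triangle_ineq4)
        then show ?case using b[of Y] b[of "-Y"] elim by simp
      qed
    qed
    then show ?case by simp
  next
    case (Suc n)
    have "((\<lambda>Y. S (K (Suc n) Y + I n Y)) \<longlongrightarrow> S ((2 * pi) *\<^sub>R (S ^^ Suc n) x + (2 * pi * n) *\<^sub>R (S ^^ Suc n) x)) at_top"
      by (intro bounded_linear.tendsto[OF S] tendsto_add K_lim Suc)
    moreover have "S ((2 * pi) *\<^sub>R (S ^^ Suc n) x + (2 * pi * n) *\<^sub>R (S ^^ Suc n) x) = (2 * pi * Suc n) *\<^sub>R (S ^^ Suc (Suc n)) x"
      by (simp add: Sz scaleR_left.add[symmetric] distrib_left del: scaleR_left_distrib flip: scaleR_left_distrib)
    ultimately show ?case by (simp add: I_rec[abs_def])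
  qed
  show ?thesis using I_lim[of n] unfolding I_def S_def w[symmetric] z_def .
qed

text \<open>The factor \<open>n\<close> in the limit of the line integrals cancels the one in
  \<open>pi / c\<close>, so that the constant does not depend on \<open>n\<close>.\<close>

lemma R_power_norm_D:
  assumes \<kappa>: "0 < \<kappa>" and x: "x \<in> D" and n: "0 < n"
  shows "norm ((R (of_real \<kappa>) ^^ Suc n) x) \<le> M\<^sup>2 * exp 1 / \<kappa> ^ Suc n * norm x"
proof -
  \<comment> \<open>This value maximises \<open>c * (\<kappa> - c) ^ n\<close> and hence minimises
    the bound \<open>B\<close>.\<close>
  define c where "c = \<kappa> / Suc n"
  have c: "0 < c" "c < \<kappa>" using \<kappa> n by (auto simp: c_def field_simps)
  have cl: "\<kappa> - c = \<kappa> * (n / Suc n)" by (simp add: c_def field_simps)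
  define B where "B = M\<^sup>2 * norm x / (\<kappa> - c) ^ n * (pi / c)"
  have "norm (integral {-Y..Y} (\<lambda>y. (1 / (of_real \<kappa> - Complex c y) ^ n) *\<^sub>C R (Complex c y) (R (Complex c y) x))) \<le> B"
    if Y: "0 \<le> Y" for Y
  proof -
    let ?f = "\<lambda>y. (1 / (of_real \<kappa> - Complex c y) ^ n) *\<^sub>C R (Complex c y) (R (Complex c y) x)"
    let ?g = "\<lambda>y. M\<^sup>2 * norm x / (\<kappa> - c) ^ n * (1 / (c\<^sup>2 + y\<^sup>2))"
    have nz: "of_real \<kappa> - Complex c y \<noteq> 0" for y using c by (simp add: complex_eq_iff)
    have "norm (integral {-Y..Y} ?f) \<le> integral {-Y..Y} ?g"
    proof (rule integral_norm_bound_integral)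
      show "?f integrable_on {-Y..Y}"
        by (intro integrable_continuous_real scaleC_continuous_on continuous_on_vertical(2) c
            continuous_intros continuous_on_Complex_Im) (use nz in auto)
      show "?g integrable_on {-Y..Y}"
        by (rule integrable_on_mult_right[OF integral_inverse_square_le(1)[OF c(1) Y]])
      fix y
      let ?z = "Complex c y"
      have re: "0 < Re ?z" using c by simp
      have "\<kappa> - c \<le> cmod (of_real \<kappa> - ?z)" using complex_Re_le_cmod[of "of_real \<kappa> - ?z"] by simp
      then have "(\<kappa> - c) ^ n \<le> cmod (of_real \<kappa> - ?z) ^ n" using c by (intro power_mono) auto
      then have 1: "1 / cmod (of_real \<kappa> - ?z) ^ n \<le> 1 / (\<kappa> - c) ^ n"
        using c by (intro frac_le) auto
      have "norm (R ?z (R ?z x)) \<le> M / cmod ?z * (M / cmod ?z * norm x)"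
        by (rule order_trans[OF R_norm[OF re] mult_left_mono[OF R_norm[OF re]]]) (use M_pos in simp)
      also have "\<dots> = M\<^sup>2 * norm x * (1 / (c\<^sup>2 + y\<^sup>2))"
        unfolding cmod_Complex_squared[symmetric] by (simp add: power2_eq_square)
      finally have 2: "norm (R ?z (R ?z x)) \<le> M\<^sup>2 * norm x * (1 / (c\<^sup>2 + y\<^sup>2))" .
      have "norm (?f y) \<le> (1 / (\<kappa> - c) ^ n) * (M\<^sup>2 * norm x * (1 / (c\<^sup>2 + y\<^sup>2)))"
        unfolding norm_scaleC norm_divide norm_power norm_one by (rule mult_mono[OF 1 2]) (use c in auto)
      then show "norm (?f y) \<le> ?g y" by simp
    qed
    also have "\<dots> = M\<^sup>2 * norm x / (\<kappa> - c) ^ n * integral {-Y..Y} (\<lambda>y. 1 / (c\<^sup>2 + y\<^sup>2))"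
      by (rule integral_mult_right)
    also have "\<dots> \<le> B" unfolding B_def
      by (rule mult_left_mono[OF integral_inverse_square_le(2)[OF c(1) Y]]) (use c in simp)
    finally show ?thesis .
  qed
  then have "norm ((2 * pi * n) *\<^sub>R (R (of_real \<kappa>) ^^ Suc n) x) \<le> B"
    by (intro tendsto_upperbound[OF tendsto_norm[OF integral_R_power_tendsto[OF c x, of n]]])
      (auto intro: eventually_mono[OF eventually_ge_at_top[of 0]])
  then have a: "2 * pi * n * norm ((R (of_real \<kappa>) ^^ Suc n) x) \<le> B" using n by simp
  have "(1 + 1 / real n) ^ n \<le> exp (1 / real n) ^ n"
    by (intro power_mono exp_ge_add_one_self) simp
  also have "\<dots> = exp 1" using n by (simp add: exp_of_nat_mult[symmetric])
  finally have e: "(1 + 1 / real n) ^ n \<le> exp 1" .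
  have "1 / (\<kappa> - c) ^ n = (1 + 1 / real n) ^ n / \<kappa> ^ n"
    using n \<kappa> by (simp add: cl field_simps power_divide flip: power_mult_distrib)
  then have "B = M\<^sup>2 * norm x * ((1 + 1 / real n) ^ n / \<kappa> ^ n) * (pi * Suc n / \<kappa>)"
    unfolding B_def c_def by (metis (no_types, lifting) divide_divide_eq_right divide_inverse mult.assoc mult_1)
  \<comment> \<open>Besides the bound \<open>exp 1\<close> for the power,
    \<open>Suc n \<le> 2 * n\<close> is used, which needs \<open>n\<close> positive.\<close>
  also have "\<dots> \<le> M\<^sup>2 * norm x * (exp 1 / \<kappa> ^ n) * (pi * (2 * n) / \<kappa>)"
    using n \<kappa> e by (intro mult_mono divide_right_mono) auto
  also have "\<dots> = 2 * pi * n * (M\<^sup>2 * exp 1 / \<kappa> ^ Suc n * norm x)"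
    by (simp add: field_simps)
  finally have "2 * pi * n * norm ((R (of_real \<kappa>) ^^ Suc n) x)
      \<le> 2 * pi * n * (M\<^sup>2 * exp 1 / \<kappa> ^ Suc n * norm x)" by (rule order_trans[OF a])
  then show ?thesis by (rule mult_left_le_imp_le) (use n in simp)
qed

text \<open>This is the Hille--Yosida condition for powers. The line integrals cover exponents from
  2 on; for \<open>0\<close> and \<open>1\<close> the constants \<open>1\<close> and
  \<open>M\<close> are direct, and the three constants are added. Density of \<open>D\<close>
  extends the bound to the whole space.\<close>

lemma R_power_norm:
  assumes \<kappa>: "0 < \<kappa>"
  shows "norm ((R (of_real \<kappa>) ^^ n) x) \<le> (1 + M + M\<^sup>2 * exp 1) / \<kappa> ^ n * norm x"
proof -
  let ?K = "1 + M + M\<^sup>2 * exp 1"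
  have re: "0 < Re (complex_of_real \<kappa>)" using \<kappa> by simp
  have D: "norm ((R (of_real \<kappa>) ^^ n) x) \<le> ?K / \<kappa> ^ n * norm x" if x: "x \<in> D" for x
  proof -
    consider "n = 0" | "n = 1" | m where "n = Suc m" "0 < m" by (cases n; cases "n - 1") auto
    then show ?thesis
    proof cases
      case 1
      have "1 * norm x \<le> ?K * norm x" by (rule mult_right_mono) (use M_pos in auto)
      then show ?thesis using 1 by simp
    next
      case 2
      have "M / \<kappa> * norm x \<le> ?K / \<kappa> * norm x"
        by (intro mult_right_mono divide_right_mono) (use M_pos \<kappa> in auto)
      then show ?thesis using R_norm[OF re, of x] \<kappa> 2 by simp
    next
      case 3
      have "M\<^sup>2 * exp 1 / \<kappa> ^ n * norm x \<le> ?K / \<kappa> ^ n * norm x"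
        by (intro mult_right_mono divide_right_mono) (use M_pos \<kappa> in auto)
      then show ?thesis using R_power_norm_D[OF \<kappa> x 3(2)] 3 by simp
    qed
  qed
  have bl: "bounded_linear (R (of_real \<kappa>) ^^ n)"
    by (induction n) (auto intro!: bounded_linear_compose[OF R_bounded_linear[OF re]] bounded_linear_ident
        simp: o_def id_def)
  have "x \<in> closure D" by (simp add: dense)
  then obtain s where s: "\<And>k. s k \<in> D" "s \<longlonglongrightarrow> x" unfolding closure_sequential by blast
  show ?thesis
    by (rule LIMSEQ_le[OF tendsto_norm[OF bounded_linear.tendsto[OF bl s(2)]]
          tendsto_mult[OF tendsto_const tendsto_norm[OF s(2)]]]) (use D s(1) in blast)
qed

end

section \<open>Strongly continuous semigroups\<close>

text \<open>Banach--Steinhaus for a sequence. By Baire one of the closed sets \<open>C k\<close>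
  contains a ball; any vector, suitably scaled, is a difference of two of its points, which turns
  the bound \<open>k\<close> into \<open>4 * real k / r\<close>.\<close>

lemma uniform_boundedness:
  fixes F :: "nat \<Rightarrow> 'a::banach \<Rightarrow> 'b::real_normed_vector"
  assumes lin: "\<And>n. bounded_linear (F n)" and ptw: "\<And>x. \<exists>B. \<forall>n. norm (F n x) \<le> B"
  shows "\<exists>B. \<forall>n x. norm (F n x) \<le> B * norm x"
proof -
  define C where "C k = {x. \<forall>m. norm (F m x) \<le> real k}" for k :: nat
  have cl: "closed (C k)" for k
  proof -
    have "C k = (\<Inter>m. {x. norm (F m x) \<le> real k})" by (auto simp: C_def)
    moreover have "closed {x. norm (F m x) \<le> real k}" for m
      by (intro closed_Collect_le continuous_on_norm continuous_on_const
          linear_continuous_on[OF lin])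
    ultimately show ?thesis by auto
  qed
  have "\<exists>k. x \<in> C k" for x
  proof -
    obtain B where "\<forall>n. norm (F n x) \<le> B" using ptw by blast
    moreover obtain k :: nat where "B \<le> real k" using real_arch_simple by blast
    ultimately have "x \<in> C k" unfolding C_def using order_trans by blast
    then show ?thesis ..
  qed
  then have un: "\<Union>(range C) = UNIV" by auto
  have "\<exists>k. interior (C k) \<noteq> {}"
  proof (rule ccontr)
    assume "\<nexists>k. interior (C k) \<noteq> {}"
    then have "(euclidean :: 'a topology) interior_of \<Union>(range C) = {}"
      by (intro Baire_category_alt) (auto simp: completely_metrizable_space_euclidean cl)
    then show False unfolding un by simp
  qed
  then obtain k x0 where "x0 \<in> interior (C k)" by blast
  then obtain r where r: "r > 0" "ball x0 r \<subseteq> C k" unfolding mem_interior by blast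
  have "norm (F n x) \<le> (4 * real k / r) * norm x" for n x
  proof (cases "x = 0")
    case True
    then show ?thesis using linear_0[OF bounded_linear.linear[OF lin]] by simp
  next
    case False
    interpret F: bounded_linear "F n" by (rule lin)
    define c where "c = r / (2 * norm x)"
    have c: "c > 0" "c * norm x = r / 2" using False r by (auto simp: c_def)
    have "x0 + c *\<^sub>R x \<in> C k" "x0 \<in> C k" using r c by (auto simp: dist_norm intro!: subsetD[OF r(2)])
    then have "norm (F n (x0 + c *\<^sub>R x)) \<le> k" "norm (F n x0) \<le> k" by (auto simp: C_def)
    moreover have "c *\<^sub>R F n x = F n (x0 + c *\<^sub>R x) - F n x0" by (simp add: F.add F.scaleR)
    ultimately have "norm (c *\<^sub>R F n x) \<le> 2 * k"
      using norm_triangle_ineq4[of "F n (x0 + c *\<^sub>R x)" "F n x0"] by simp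
    then have "c * norm (F n x) \<le> 2 * k" using c by simp
    then show ?thesis using False r by (simp add: c_def field_simps)
  qed
  then show ?thesis by blast
qed

lemma bounded_clinear_bounded_linear: "bounded_clinear g \<Longrightarrow> bounded_linear g"
  by (simp add: bounded_clinear_def)

lemma bounded_linear_eq_on_dense:
  assumes f: "bounded_linear f" and g: "bounded_linear g" and dense: "closure D = UNIV"
    and eq: "\<And>x. x \<in> D \<Longrightarrow> f x = g x"
  shows "f x = g x"
proof -
  have "x \<in> closure D" using dense by simp
  then obtain s where s: "\<And>n. s n \<in> D" "s \<longlonglongrightarrow> x" unfolding closure_sequential by blast
  have "(\<lambda>n. f (s n)) \<longlonglongrightarrow> f x" "(\<lambda>n. g (s n)) \<longlonglongrightarrow> g x"
    by (rule bounded_linear.tendsto[OF f s(2)], rule bounded_linear.tendsto[OF g s(2)])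
  then show ?thesis using LIMSEQ_unique eq[OF s(1)] by simp
qed

context
  fixes T :: "real \<Rightarrow> 'a::complex_banach \<Rightarrow> 'a"
  assumes T: "c0_semigroup T"
begin

lemma c0_lin: "0 \<le> t \<Longrightarrow> bounded_linear (T t)"
  and c0_zero: "T 0 x = x"
  and c0_add: "0 \<le> s \<Longrightarrow> 0 \<le> t \<Longrightarrow> T (s + t) x = T s (T t x)"
  and c0_right: "((\<lambda>t. T t x) \<longlongrightarrow> x) (at_right 0)"
  using T by (auto simp: c0_semigroup_def bounded_clinear_def)

lemma c0_linear: "0 \<le> t \<Longrightarrow> linear (T t)"
  using c0_lin bounded_linear.linear by blast

lemma c0_tendsto_zero:
  assumes g: "(g \<longlongrightarrow> 0) F" and ev: "\<forall>\<^sub>F s in F. 0 \<le> g s"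
  shows "((\<lambda>s. T (g s) x) \<longlongrightarrow> x) F"
proof (rule tendstoI)
  fix e :: real assume e: "e > 0"
  from c0_right[of x] e have "\<forall>\<^sub>F t in at_right 0. dist (T t x) x < e" by (rule tendstoD)
  then obtain d where d: "d > 0" "\<And>t. 0 < t \<Longrightarrow> t < d \<Longrightarrow> dist (T t x) x < e"
    unfolding eventually_at_right_field by blast
  from order_tendstoD(2)[OF g d(1)] ev
  show "\<forall>\<^sub>F s in F. dist (T (g s) x) x < e"
  proof eventually_elim
    case (elim s)
    then show ?case using d(2)[of "g s"] e by (cases "g s = 0") (auto simp: c0_zero)
  qed
qed

text \<open>If no bound held near \<open>0\<close>, operators at times tending to \<open>0\<close>
  would have unbounded norms although all their orbits converge, against uniform boundedness. The
  semigroup law then carries the bound from one short interval to any finite one.\<close>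

lemma c0_locally_bounded:
  obtains K where "1 \<le> K" "\<And>s x. 0 \<le> s \<Longrightarrow> s \<le> t \<Longrightarrow> norm (T s x) \<le> K * norm x"
proof -
  have "\<exists>n::nat. \<forall>s x. 0 \<le> s \<and> s \<le> inverse (real (Suc n)) \<longrightarrow> norm (T s x) \<le> real (Suc n) * norm x"
  proof (rule ccontr)
    assume "\<not> ?thesis"
    then have "\<forall>n. \<exists>s x. 0 \<le> s \<and> s \<le> inverse (real (Suc n)) \<and> real (Suc n) * norm x < norm (T s x)"
      by (auto simp: not_le)
    then obtain s x where s: "\<And>n. 0 \<le> s n" "\<And>n. s n \<le> inverse (real (Suc n))"
      and sx: "\<And>n. real (Suc n) * norm (x n) < norm (T (s n) (x n))" by metis
    have "s \<longlonglongrightarrow> 0"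
      by (rule tendsto_sandwich[OF _ _ tendsto_const LIMSEQ_inverse_real_of_nat]) (use s in auto)
    then have "(\<lambda>n. T (s n) y) \<longlonglongrightarrow> y" for y by (rule c0_tendsto_zero) (use s in auto)
    then have "Bseq (\<lambda>n. T (s n) y)" for y using convergentI convergent_imp_Bseq by blast
    then have "\<exists>B. \<forall>n. norm (T (s n) y) \<le> B" for y unfolding Bseq_def by blast
    then obtain B where B: "\<And>n y. norm (T (s n) y) \<le> B * norm y"
      using uniform_boundedness[of "\<lambda>n. T (s n)"] c0_lin s(1) by blast
    obtain n :: nat where n: "B \<le> real n" using real_arch_simple by blast
    have "real (Suc n) * norm (x n) < B * norm (x n)" using sx[of n] B[of n "x n"] by simp
    moreover have "B * norm (x n) \<le> real (Suc n) * norm (x n)" using n by (intro mult_right_mono) auto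
    ultimately show False by simp
  qed
  then obtain n :: nat where n: "\<And>s x. 0 \<le> s \<Longrightarrow> s \<le> inverse (real (Suc n)) \<Longrightarrow> norm (T s x) \<le> real (Suc n) * norm x"
    by blast
  define h where "h = inverse (real (Suc n))"
  have h: "0 < h" by (simp add: h_def)
  have step: "norm (T s x) \<le> real (Suc n) ^ Suc k * norm x" if "0 \<le> s" "s \<le> real (Suc k) * h" for s k x
    using that
  proof (induction k arbitrary: s)
    case 0
    then show ?case using n[of s x] by (simp add: h_def)
  next
    case (Suc k)
    show ?case
    proof (cases "s \<le> real (Suc k) * h")
      case True
      have "real (Suc n) ^ Suc k * norm x \<le> real (Suc n) ^ Suc (Suc k) * norm x"
        by (intro mult_right_mono power_increasing) auto
      then show ?thesis using order_trans[OF Suc.IH[OF Suc.prems(1) True]] by blast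
    next
      case False
      have s': "0 \<le> s - h" "s - h \<le> real (Suc k) * h"
      proof -
        have "real (Suc (Suc k)) * h = real (Suc k) * h + h" "h \<le> real (Suc k) * h"
          using h by (simp_all add: distrib_right)
        then show "0 \<le> s - h" "s - h \<le> real (Suc k) * h" using False Suc.prems by linarith+
      qed
      have "T s x = T h (T (s - h) x)" using c0_add[of h "s - h" x] s' h by simp
      also have "norm \<dots> \<le> real (Suc n) * norm (T (s - h) x)"
        by (rule n) (use h in \<open>auto simp: h_def\<close>)
      also have "\<dots> \<le> real (Suc n) * (real (Suc n) ^ Suc k * norm x)"
        by (rule mult_left_mono[OF Suc.IH[OF s']]) simp
      finally show ?thesis by (simp add: mult_ac)
    qed
  qed
  obtain k :: nat where "t / h \<le> real k" using real_arch_simple by blast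
  then have k: "t \<le> real (Suc k) * h" using h by (simp add: field_simps)
  show ?thesis
  proof (rule that)
    show "1 \<le> real (Suc n) ^ Suc k" by (rule one_le_power) simp
    show "norm (T s x) \<le> real (Suc n) ^ Suc k * norm x" if "0 \<le> s" "s \<le> t" for s x
      using step[of s k x] that k by simp
  qed
qed

text \<open>Factoring out the semigroup at the smaller of the two times leaves an increment at a
  nonnegative time, so continuity from both sides reduces to right continuity at \<open>0\<close>
  and local boundedness.\<close>

lemma c0_continuous_on: "continuous_on {0..} (\<lambda>t. T t x)"
  unfolding continuous_on_def
proof
  fix t0 :: real assume t0: "t0 \<in> {0..}"
  obtain K where K: "1 \<le> K" "\<And>s x. 0 \<le> s \<Longrightarrow> s \<le> t0 + 1 \<Longrightarrow> norm (T s x) \<le> K * norm x"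
    using c0_locally_bounded by blast
  have "((\<lambda>s. \<bar>s - t0\<bar>) \<longlongrightarrow> \<bar>t0 - t0\<bar>) (at t0 within {0..})" by (intro tendsto_intros)
  then have "((\<lambda>s. T \<bar>s - t0\<bar> x) \<longlongrightarrow> x) (at t0 within {0..})" by (intro c0_tendsto_zero) auto
  then have "((\<lambda>s. K * norm (T \<bar>s - t0\<bar> x - x)) \<longlongrightarrow> K * norm (x - x)) (at t0 within {0..})"
    by (intro tendsto_intros)
  then have "((\<lambda>s. K * norm (T \<bar>s - t0\<bar> x - x)) \<longlongrightarrow> 0) (at t0 within {0..})" by simp
  moreover have "\<forall>\<^sub>F s in at t0 within {0..}. norm (T s x - T t0 x) \<le> K * norm (T \<bar>s - t0\<bar> x - x)"
    unfolding eventually_at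
  proof (intro exI[of _ 1] conjI ballI impI)
    fix s assume s: "s \<in> {0..}" "s \<noteq> t0 \<and> dist s t0 < 1"
    define m where "m = min s t0"
    have m: "0 \<le> m" "m \<le> t0 + 1" using s t0 by (auto simp: m_def)
    interpret bounded_linear "T m" by (rule c0_lin[OF m(1)])
    have "norm (T s x - T t0 x) = norm (T (m + \<bar>s - t0\<bar>) x - T m x)"
      by (auto simp: m_def min_def norm_minus_commute)
    also have "T (m + \<bar>s - t0\<bar>) x - T m x = T m (T \<bar>s - t0\<bar> x - x)"
      using m by (simp add: c0_add diff)
    finally show "norm (T s x - T t0 x) \<le> K * norm (T \<bar>s - t0\<bar> x - x)" using K(2)[OF m] by simp
  qed simp
  ultimately have "((\<lambda>s. T s x - T t0 x) \<longlongrightarrow> 0) (at t0 within {0..})"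
    by (rule Lim_null_comparison[rotated])
  then show "((\<lambda>s. T s x) \<longlongrightarrow> T t0 x) (at t0 within {0..})" by (simp add: LIM_zero_iff)
qed

text \<open>The orbit of a point where the one-sided derivative at \<open>0\<close> exists is differentiable from both
  sides; the left derivative uses the local boundedness of the semigroup.\<close>

lemma c0_orbit_derivative:
  assumes q: "((\<lambda>h. (1 / h) *\<^sub>R (T h x - x)) \<longlongrightarrow> y) (at_right 0)" and t: "0 \<le> t"
  shows "((\<lambda>s. T s x) has_vector_derivative T t y) (at t within {0..})"
  unfolding has_vector_derivative_iff_quotient
proof -
  obtain K where K: "1 \<le> K" "\<And>s x. 0 \<le> s \<Longrightarrow> s \<le> t + 1 \<Longrightarrow> norm (T s x) \<le> K * norm x"
    using c0_locally_bounded by blast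
  define q where "q h = (1 / h) *\<^sub>R (T h x - x)" for h
  let ?F = "at t within {0..}"
  have "((\<lambda>s. \<bar>s - t\<bar>) \<longlongrightarrow> \<bar>t - t\<bar>) ?F" by (intro tendsto_intros)
  then have "filterlim (\<lambda>s. \<bar>s - t\<bar>) (at_right 0) ?F"
    by (auto simp: filterlim_at eventually_at_filter)
  from filterlim_compose[OF q[folded q_def] this]
  have "((\<lambda>s. q \<bar>s - t\<bar>) \<longlongrightarrow> y) ?F" .
  then have "((\<lambda>s. K * norm (q \<bar>s - t\<bar> - y)) \<longlongrightarrow> K * norm (y - y)) ?F" by (intro tendsto_intros)
  then have lim0: "((\<lambda>s. K * norm (q \<bar>s - t\<bar> - y)) \<longlongrightarrow> 0) ?F" by simp
  have near: "\<forall>\<^sub>F s in ?F. 0 \<le> s \<and> s \<le> t + 1 \<and> s \<noteq> t"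
    unfolding eventually_at by (intro exI[of _ 1]) (auto simp: dist_real_def)
  have lim1: "((\<lambda>s. T (min s t) (q \<bar>s - t\<bar> - y)) \<longlongrightarrow> 0) ?F"
  proof (rule Lim_null_comparison[OF _ lim0])
    show "\<forall>\<^sub>F s in ?F. norm (T (min s t) (q \<bar>s - t\<bar> - y)) \<le> K * norm (q \<bar>s - t\<bar> - y)"
      using near by eventually_elim (use t K(2) in auto)
  qed
  have "continuous_on {0..} (\<lambda>s. T (min s t) y)"
    by (rule continuous_on_compose2[OF c0_continuous_on, of _ "\<lambda>s. min s t"])
      (use t in \<open>auto intro!: continuous_intros\<close>)
  then have lim2: "((\<lambda>s. T (min s t) y) \<longlongrightarrow> T t y) ?F"
    using t by (auto simp: continuous_on_def dest!: bspec[of _ _ t])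
  have "((\<lambda>s. T (min s t) (q \<bar>s - t\<bar> - y) + T (min s t) y) \<longlongrightarrow> T t y) ?F"
    using tendsto_add[OF lim1 lim2] by simp
  moreover have "\<forall>\<^sub>F s in ?F. T (min s t) (q \<bar>s - t\<bar> - y) + T (min s t) y = (1 / (s - t)) *\<^sub>R (T s x - T t x)"
    using near
  proof eventually_elim
    case (elim s)
    define m where "m = min s t"
    have m: "0 \<le> m" using elim t by (simp add: m_def)
    interpret bounded_linear "T m" by (rule c0_lin[OF m])
    have "T m (q \<bar>s - t\<bar> - y) + T m y = (1 / \<bar>s - t\<bar>) *\<^sub>R (T (m + \<bar>s - t\<bar>) x - T m x)"
      using m by (simp add: q_def diff scaleR c0_add)
    also have "\<dots> = (1 / (s - t)) *\<^sub>R (T s x - T t x)"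
    proof (cases "s < t")
      case True
      then have "m = s" "\<bar>s - t\<bar> = t - s" by (auto simp: m_def)
      moreover have "(1 / (t - s)) *\<^sub>R (T t x - T s x) = (1 / (s - t)) *\<^sub>R (T s x - T t x)"
      proof -
        have "1 / (t - s) = - (1 / (s - t))" using elim by (simp add: field_simps)
        then show ?thesis by (simp add: scaleR_diff_right)
      qed
      ultimately show ?thesis by simp
    next
      case False
      then have "m = t" "\<bar>s - t\<bar> = s - t" by (auto simp: m_def)
      then show ?thesis by simp
    qed
    finally show ?case by (simp add: m_def)
  qed
  ultimately show "((\<lambda>s. (1 / (s - t)) *\<^sub>R (T s x - T t x)) \<longlongrightarrow> T t y) ?F"
    by (rule Lim_transform_eventually)
qed

context
  fixes D :: "'a set" and L :: "'a \<Rightarrow> 'a"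
  assumes gen: "neg_generator D L T"
begin

lemma generator_orbit:
  assumes x: "x \<in> D" and t: "0 \<le> t"
  shows "T t x \<in> D" "L (T t x) = T t (L x)"
    "((\<lambda>s. T s x) has_vector_derivative - T t (L x)) (at t within {0..})"
proof -
  interpret bounded_linear "T t" by (rule c0_lin[OF t])
  have q: "((\<lambda>h. (1 / h) *\<^sub>R (T h x - x)) \<longlongrightarrow> - L x) (at_right 0)"
    using gen x by (auto simp: neg_generator_def)
  from tendsto[OF this]
  have "((\<lambda>h. T t ((1 / h) *\<^sub>R (T h x - x))) \<longlongrightarrow> - T t (L x)) (at_right 0)" by (simp add: neg)
  moreover have "\<forall>\<^sub>F h in at_right 0. T t ((1 / h) *\<^sub>R (T h x - x)) = (1 / h) *\<^sub>R (T h (T t x) - T t x)"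
    using eventually_at_right_less[of 0]
  proof eventually_elim
    case (elim h)
    then have "T t (T h x) = T h (T t x)" using c0_add[of t h x] c0_add[of h t x] t by (simp add: add.commute)
    then show ?case by (simp add: scaleR diff)
  qed
  ultimately have "((\<lambda>h. (1 / h) *\<^sub>R (T h (T t x) - T t x)) \<longlongrightarrow> - T t (L x)) (at_right 0)"
    by (rule Lim_transform_eventually)
  then have "T t x \<in> D \<and> - T t (L x) = - L (T t x)" using gen by (auto simp: neg_generator_def)
  then show "T t x \<in> D" "L (T t x) = T t (L x)" by auto
  show "((\<lambda>s. T s x) has_vector_derivative - T t (L x)) (at t within {0..})"
    using c0_orbit_derivative[OF q t] by (simp add: neg)
qed

text \<open>The function \<open>T (t - s) (y s)\<close> of \<open>s\<close> has derivative zero, so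
  its values at \<open>0\<close> and \<open>t\<close> agree. This is the source of the later
  identifications and commutation relations of semigroups.\<close>

lemma cauchy_problem_unique:
  assumes t: "0 \<le> t" and y: "\<And>s. s \<in> {0..t} \<Longrightarrow> y s \<in> D"
    and y': "\<And>s. s \<in> {0..t} \<Longrightarrow> (y has_vector_derivative - L (y s)) (at s within {0..t})"
  shows "y t = T t (y 0)"
proof -
  obtain K where K: "1 \<le> K" "\<And>s x. 0 \<le> s \<Longrightarrow> s \<le> t \<Longrightarrow> norm (T s x) \<le> K * norm x"
    using c0_locally_bounded by blast
  have "((\<lambda>s. T (t - s) (y s)) has_vector_derivative 0) (at s within {0..t})" if s: "s \<in> {0..t}" for s
  proof -
    have "((\<lambda>s. T (t - s) (y s)) has_vector_derivative T (t - s) (L (y s)) + T (t - s) (- L (y s)))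
        (at s within {0..t})"
    proof (rule has_vector_derivative_operator_apply[OF _ _ _ _ y'[OF s] s])
      show "bounded_linear (T (t - r))" if "r \<in> {0..t}" for r using that by (simp add: c0_lin)
      show "norm (T (t - r) v) \<le> K * norm v" if "r \<in> {0..t}" for r v using that by (simp add: K(2))
      show "((\<lambda>r. T (t - r) v) \<longlongrightarrow> T (t - s) v) (at s within {0..t})" for v
      proof -
        have "continuous_on {0..t} (\<lambda>r. T (t - r) v)"
          by (rule continuous_on_compose2[OF c0_continuous_on, of _ "\<lambda>r. t - r"])
            (auto intro!: continuous_intros)
        then show ?thesis using s by (auto simp: continuous_on_def)
      qed
      have r: "((\<lambda>r. t - r) has_vector_derivative -1) (at s within {0..t})"
        by (auto intro!: derivative_eq_intros)
      have "((\<lambda>r. T r (y s)) has_vector_derivative - T (t - s) (L (y s))) (at (t - s) within (\<lambda>r. t - r) ` {0..t})"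
        by (rule has_vector_derivative_within_subset[OF generator_orbit(3)[OF y[OF s]]]) (use s in auto)
      from vector_diff_chain_within[OF r this]
      show "((\<lambda>r. T (t - r) (y s)) has_vector_derivative T (t - s) (L (y s))) (at s within {0..t})"
        by (simp add: o_def)
    qed
    then show ?thesis using linear_neg[OF c0_linear[of "t - s"]] s by simp
  qed
  then obtain c where "\<And>s. s \<in> {0..t} \<Longrightarrow> T (t - s) (y s) = c"
    using has_vector_derivative_zero_constant[OF convex_real_interval(5)[of 0 t], of "\<lambda>s. T (t - s) (y s)"] by blast
  from this[of t] this[of 0] have "T (t - t) (y t) = T (t - 0) (y 0)" using t by simp
  then show ?thesis by (simp add: c0_zero)
qed

text \<open>For \<open>x\<close> in \<open>D\<close> the curve \<open>P (T s x)\<close> solves the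
  same Cauchy problem as \<open>T s (P x)\<close>; density covers the rest. It will be applied to
  resolvents, spectral projections and the groups on finite dimensional subspaces.\<close>

lemma c0_commute:
  assumes P: "bounded_linear P" and inv: "\<And>x. x \<in> D \<Longrightarrow> P x \<in> D \<and> L (P x) = P (L x)"
    and dense: "closure D = UNIV" and t: "0 \<le> t"
  shows "T t (P x) = P (T t x)"
proof (rule bounded_linear_eq_on_dense[of "\<lambda>x. T t (P x)" "\<lambda>x. P (T t x)", OF _ _ dense])
  interpret P: bounded_linear P by (rule P)
  show "bounded_linear (\<lambda>x. T t (P x))" "bounded_linear (\<lambda>x. P (T t x))"
    by (intro bounded_linear_compose[OF c0_lin[OF t] P] bounded_linear_compose[OF P c0_lin[OF t]])+
  fix x assume x: "x \<in> D"
  have "P (T t x) = T t (P (T 0 x))"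
  proof (rule cauchy_problem_unique[OF t])
    fix s assume s: "s \<in> {0..t}"
    show "P (T s x) \<in> D" using generator_orbit(1)[OF x] inv s by simp
    have "((\<lambda>s. T s x) has_vector_derivative - T s (L x)) (at s within {0..t})"
      by (rule has_vector_derivative_within_subset[OF generator_orbit(3)[OF x]]) (use s in auto)
    from P.has_vector_derivative[OF this]
    have "((\<lambda>s. P (T s x)) has_vector_derivative P (- T s (L x))) (at s within {0..t})" .
    moreover have "P (- T s (L x)) = - L (P (T s x))"
      using inv generator_orbit(1,2)[OF x, of s] s by (simp add: P.neg)
    ultimately show "((\<lambda>s. P (T s x)) has_vector_derivative - L (P (T s x))) (at s within {0..t})" by simp
  qed
  then show "T t (P x) = P (T t x)" by (simp add: c0_zero)
qed

end

end

text \<open>This pins down \<open>semigroup_exp\<close>, which is only chosen, at nonnegative times: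
  any semigroup with the right generator has the same values there.\<close>

lemma c0_semigroup_unique:
  assumes T: "c0_semigroup T" "neg_generator D L T" and S: "c0_semigroup S" "neg_generator D L S"
    and dense: "closure D = UNIV" and t: "0 \<le> t"
  shows "S t x = T t x"
proof (rule bounded_linear_eq_on_dense[OF c0_lin[OF S(1) t] c0_lin[OF T(1) t] dense])
  fix x assume x: "x \<in> D"
  have "S t x = T t (S 0 x)"
  proof (rule cauchy_problem_unique[OF T t])
    fix s assume s: "s \<in> {0..t}"
    show "S s x \<in> D" using generator_orbit(1)[OF S x] s by simp
    have "((\<lambda>s. S s x) has_vector_derivative - S s (L x)) (at s within {0..t})"
      by (rule has_vector_derivative_within_subset[OF generator_orbit(3)[OF S x]]) (use s in auto)
    then show "((\<lambda>s. S s x) has_vector_derivative - L (S s x)) (at s within {0..t})"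
      using generator_orbit(2)[OF S x] s by simp
  qed
  then show "S t x = T t x" by (simp add: c0_zero[OF S(1)])
qed

lemma scaled_quotient_tendsto:
  fixes T :: "real \<Rightarrow> 'a::real_normed_vector \<Rightarrow> 'a" and c :: real
  assumes "((\<lambda>t. (1 / t) *\<^sub>R (T t x - x)) \<longlongrightarrow> y) (at_right 0)"
  shows "((\<lambda>t. (1 / t) *\<^sub>R (exp (- (c * t)) *\<^sub>R T t x - x)) \<longlongrightarrow> y - c *\<^sub>R x) (at_right 0)"
proof -
  have "((\<lambda>t. exp (- (c * t))) has_vector_derivative - c) (at 0 within {0<..})"
    unfolding has_real_derivative_iff_has_vector_derivative[symmetric]
    by (auto intro!: derivative_eq_intros)
  then have r: "((\<lambda>t. (1 / t) *\<^sub>R (exp (- (c * t)) - 1)) \<longlongrightarrow> - c) (at_right 0)"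
    by (simp add: has_vector_derivative_iff_quotient)
  have "((\<lambda>t. exp (- (c * t))) \<longlongrightarrow> exp (- (c * 0))) (at_right 0)" by (intro tendsto_intros)
  then have "((\<lambda>t. exp (- (c * t)) *\<^sub>R ((1 / t) *\<^sub>R (T t x - x)) + ((1 / t) *\<^sub>R (exp (- (c * t)) - 1)) *\<^sub>R x)
      \<longlongrightarrow> 1 *\<^sub>R y + (- c) *\<^sub>R x) (at_right 0)"
    by (intro tendsto_intros assms r) simp
  then show ?thesis by (simp add: algebra_simps diff_divide_distrib)
qed

lemma c0_semigroup_scale:
  assumes T: "c0_semigroup T" "neg_generator D L T"
  shows "c0_semigroup (\<lambda>t x. exp (- (c * t)) *\<^sub>R T t x)"
    and "neg_generator D (op_shift L c) (\<lambda>t x. exp (- (c * t)) *\<^sub>R T t x)"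
proof -
  let ?S = "\<lambda>t x. exp (- (c * t)) *\<^sub>R T t x"
  have "bounded_clinear (?S t)" if t: "0 \<le> t" for t
  proof -
    have "bounded_linear (?S t)"
      using bounded_linear_compose[OF bounded_linear_scaleR_right c0_lin[OF T(1) t]] by simp
    moreover have "clinear_on UNIV (T t)" using T(1) t by (auto simp: c0_semigroup_def bounded_clinear_def)
    ultimately show ?thesis
      by (auto simp: bounded_clinear_def clinear_on_def scaleR_add_right scaleC_scaleR_right)
  qed
  moreover have "?S (s + t) x = ?S s (?S t x)" if "0 \<le> s" "0 \<le> t" for s t x
    using that linear_scale[OF c0_linear[OF T(1) that(1)]] c0_add[OF T(1) that]
    by (simp add: distrib_left exp_add[symmetric])
  moreover have "((\<lambda>t. ?S t x) \<longlongrightarrow> x) (at_right 0)" for x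
  proof -
    have "((\<lambda>t. ?S t x) \<longlongrightarrow> exp (- (c * 0)) *\<^sub>R x) (at_right 0)"
      by (intro tendsto_intros c0_right[OF T(1)])
    then show ?thesis by simp
  qed
  ultimately show "c0_semigroup ?S" unfolding c0_semigroup_def by (simp add: c0_zero[OF T(1)])
  show "neg_generator D (op_shift L c) ?S"
    unfolding neg_generator_def
  proof (intro allI iffI)
    fix x y assume "((\<lambda>t. (1 / t) *\<^sub>R (?S t x - x)) \<longlongrightarrow> y) (at_right 0)"
    \<comment> \<open>Scaling back with the opposite sign recovers the quotient of \<open>T\<close>,
      so the domain of the generator cannot grow.\<close>
    from scaled_quotient_tendsto[where T = ?S and c = "- c", OF this]
    have "((\<lambda>t. (1 / t) *\<^sub>R (T t x - x)) \<longlongrightarrow> y + c *\<^sub>R x) (at_right 0)"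
      by (simp add: exp_add[symmetric])
    then have "x \<in> D \<and> y + c *\<^sub>R x = - L x" using T(2) by (auto simp: neg_generator_def)
    then show "x \<in> D \<and> y = - op_shift L c x" by (auto simp: op_shift_def algebra_simps)
  next
    fix x y assume xy: "x \<in> D \<and> y = - op_shift L c x"
    then have "((\<lambda>t. (1 / t) *\<^sub>R (T t x - x)) \<longlongrightarrow> - L x) (at_right 0)"
      using T(2) by (auto simp: neg_generator_def)
    from scaled_quotient_tendsto[where T = T and c = c, OF this]
    show "((\<lambda>t. (1 / t) *\<^sub>R (?S t x - x)) \<longlongrightarrow> y) (at_right 0)"
      using xy by (simp add: op_shift_def)
  qed
qed

lemma convergent_on_dense:
  fixes F :: "nat \<Rightarrow> 'a::real_normed_vector \<Rightarrow> 'b::banach"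
  assumes lin: "\<And>n. linear (F n)" and bound: "\<And>n x. norm (F n x) \<le> K * norm x"
    and conv: "\<And>x. x \<in> S \<Longrightarrow> convergent (\<lambda>n. F n x)" and dense: "closure S = UNIV"
  shows "convergent (\<lambda>n. F n x)"
proof -
  have "Cauchy (\<lambda>n. F n x)"
  proof (rule CauchyI)
    fix e :: real assume e: "e > 0"
    define K' where "K' = \<bar>K\<bar> + 1"
    have K': "K' > 0" "norm (F n v) \<le> K' * norm v" for n v
      using order_trans[OF bound[of n v] mult_right_mono[of K K' "norm v"]] by (auto simp: K'_def)
    have "x \<in> closure S" using dense by simp
    then obtain y where y: "y \<in> S" "dist y x < e / (3 * K')"
      using e K'(1) unfolding closure_approachable by (meson divide_pos_pos mult_pos_pos zero_less_numeral)
    have small: "norm (F n x - F n y) < e / 3" for n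
    proof -
      have "norm (F n x - F n y) \<le> K' * norm (x - y)" using K'(2)[of n "x - y"] by (simp add: linear_diff[OF lin])
      also have "\<dots> < K' * (e / (3 * K'))"
        using y(2) K'(1) by (intro mult_strict_left_mono) (auto simp: dist_norm norm_minus_commute)
      finally show ?thesis using K'(1) by simp
    qed
    have "Cauchy (\<lambda>n. F n y)" using conv[OF y(1)] by (simp add: convergent_Cauchy)
    from CauchyD[OF this, of "e / 3"] e obtain N where
      N: "\<And>m n. m \<ge> N \<Longrightarrow> n \<ge> N \<Longrightarrow> norm (F m y - F n y) < e / 3" by auto
    show "\<exists>N. \<forall>m\<ge>N. \<forall>n\<ge>N. norm (F m x - F n x) < e"
    proof (intro exI allI impI)
      fix m n assume mn: "m \<ge> N" "n \<ge> N"
      have "F m x - F n x = (F m x - F m y) + (F m y - F n y) - (F n x - F n y)" by simp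
      also have "norm \<dots> \<le> norm (F m x - F m y) + norm (F m y - F n y) + norm (F n x - F n y)"
        by (rule order_trans[OF norm_triangle_ineq4]) (intro add_mono norm_triangle_ineq order_refl)
      finally show "norm (F m x - F n x) < e" using small[of m] small[of n] N[OF mn] by simp
    qed
  qed
  then show ?thesis by (simp add: Cauchy_convergent_iff)
qed

section \<open>The implicit Euler scheme and its limit\<close>

context half_plane_resolvent
begin

definition K where "K = 1 + M + M\<^sup>2 * exp 1"

text \<open>\<open>V h\<close> is (I + h L)^(-1), one step of length \<open>h\<close> of the
  implicit Euler scheme for y' = - L y.\<close>

definition V where "V h x = (1 / h) *\<^sub>R R (of_real (1 / h)) x"

lemma K_ge: "1 \<le> K" using M_pos by (simp add: K_def)

context
  fixes h :: real
  assumes h: "0 < h"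
begin

lemma Re_inverse_pos: "0 < Re (complex_of_real (1 / h))" using h by simp

lemma V_bl: "bounded_linear (V h)"
  unfolding V_def[abs_def]
  by (rule bounded_linear_compose[OF bounded_linear_scaleR_right R_bounded_linear[OF Re_inverse_pos]])

lemma V_scaleC: "V h (c *\<^sub>C x) = c *\<^sub>C V h x"
  by (simp only: V_def R_scaleC[OF Re_inverse_pos] scaleC_scaleR_right)

lemma V_add: "V h (x + y) = V h x + V h y" and V_diff: "V h (x - y) = V h x - V h y"
  and V_scaleR: "V h (r *\<^sub>R x) = r *\<^sub>R V h x"
  using V_bl by (simp_all add: linear_simps)

lemma V_in: "V h x \<in> D" unfolding V_def by (intro D_scaleR R_in Re_inverse_pos)

lemma V_right: "V h x + h *\<^sub>R L (V h x) = x"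
  using R_right[OF Re_inverse_pos, of x] h
  by (simp add: V_def L_scaleR[OF R_in[OF Re_inverse_pos]] scaleC_of_real del: of_real_divide)

lemma V_L: "x \<in> D \<Longrightarrow> L (V h x) = V h (L x)"
  unfolding V_def by (simp only: L_scaleR[OF R_in[OF Re_inverse_pos]] L_commute_R[OF Re_inverse_pos])

lemma V_left: assumes x: "x \<in> D" shows "V h (x + h *\<^sub>R L x) = x"
  using V_right[of x] by (simp add: V_add V_scaleR V_L[OF x])

lemma V_minus: assumes x: "x \<in> D" shows "V h x - x = - (h *\<^sub>R V h (L x))"
  using V_right[of x] by (simp add: V_L[OF x] algebra_simps add_eq_0_iff)

lemma V_pow_bl: "bounded_linear (V h ^^ n)"
  by (induction n) (auto intro!: bounded_linear_compose[OF V_bl] bounded_linear_ident simp: o_def id_def)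

lemma V_pow_scaleC: "(V h ^^ n) (c *\<^sub>C x) = c *\<^sub>C (V h ^^ n) x"
  by (induction n) (simp_all add: V_scaleC)

text \<open>Stability: \<open>n\<close> steps of length \<open>h\<close> are the \<open>n\<close>th
  power of \<kappa> R(\<kappa>) with \<kappa> = 1 / h, so the bound depends neither on
  \<open>h\<close> nor on \<open>n\<close>.\<close>

lemma V_pow_norm: "norm ((V h ^^ n) x) \<le> K * norm x"
proof -
  have "(V h ^^ n) x = (1 / h) ^ n *\<^sub>R (R (of_real (1 / h)) ^^ n) x"
    by (induction n) (simp_all only: funpow.simps o_apply id_apply V_def R_scaleR[OF Re_inverse_pos] scaleR_scaleR
        power_0 power_Suc scaleR_one)
  then show ?thesis using R_power_norm[of "1 / h" n x] h
    by (simp add: K_def power_one_over field_simps del: of_real_divide)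
qed

lemma V_pow_in: "x \<in> D \<Longrightarrow> (V h ^^ n) x \<in> D \<and> L ((V h ^^ n) x) = (V h ^^ n) (L x)"
  by (induction n) (auto simp: V_in V_L)

lemma V_pow_step:
  assumes x: "x \<in> D"
  shows "norm ((V h ^^ (m + k)) x - (V h ^^ m) x) \<le> k * h * (K * norm (L x))"
proof (induction k)
  case (Suc k)
  have "(V h ^^ (m + Suc k)) x - (V h ^^ (m + k)) x = - (h *\<^sub>R (V h ^^ (Suc (m + k))) (L x))"
    using V_minus[of "(V h ^^ (m + k)) x"] V_pow_in[OF x, of "m + k"] by simp
  then have step: "norm ((V h ^^ (m + Suc k)) x - (V h ^^ (m + k)) x) \<le> h * (K * norm (L x))"
    using V_pow_norm[of "Suc (m + k)" "L x"] h by (simp del: funpow.simps)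
  have "norm (((V h ^^ (m + Suc k)) x - (V h ^^ (m + k)) x) + ((V h ^^ (m + k)) x - (V h ^^ m) x))
      \<le> h * (K * norm (L x)) + k * h * (K * norm (L x))"
    by (rule norm_triangle_le[OF add_mono[OF step Suc]])
  then show ?case by (simp add: algebra_simps)
qed simp

text \<open>Consistency: each step subtracts \<open>h\<close> times a power of \<open>V h\<close>
  applied to \<open>L x\<close>, and \<open>B\<close> bounds how far these are from
  \<open>L x\<close> itself.\<close>

lemma V_pow_derivative:
  assumes x: "x \<in> D" and B: "\<And>j. j \<le> k \<Longrightarrow> norm ((V h ^^ j) (L x) - L x) \<le> B"
  shows "norm ((V h ^^ k) x - x + (k * h) *\<^sub>R L x) \<le> k * h * B"
  using B
proof (induction k)
  case (Suc k)
  have e: "(V h ^^ Suc k) x - (V h ^^ k) x = - (h *\<^sub>R (V h ^^ (Suc k)) (L x))"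
    using V_minus[of "(V h ^^ k) x"] V_pow_in[OF x, of k] by simp
  have "(V h ^^ Suc k) x - x + (Suc k * h) *\<^sub>R L x
      = ((V h ^^ k) x - x + (k * h) *\<^sub>R L x) + (((V h ^^ Suc k) x - (V h ^^ k) x) + h *\<^sub>R L x)"
    by (simp add: algebra_simps del: funpow.simps)
  also have "\<dots> = ((V h ^^ k) x - x + (k * h) *\<^sub>R L x) - h *\<^sub>R ((V h ^^ (Suc k)) (L x) - L x)"
    unfolding e by (simp add: algebra_simps del: funpow.simps)
  also have "norm \<dots> \<le> k * h * B + h * B"
  proof (rule norm_triangle_le_diff[OF add_mono])
    show "norm ((V h ^^ k) x - x + (k * h) *\<^sub>R L x) \<le> k * h * B" using Suc by simp
    show "norm (h *\<^sub>R ((V h ^^ (Suc k)) (L x) - L x)) \<le> h * B"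
      using Suc.prems[of "Suc k"] h by (simp del: funpow.simps)
  qed
  finally show ?case by (simp add: algebra_simps del: funpow.simps)
qed simp

text \<open>For arbitrary \<open>y\<close> the scheme is compared with its action on a nearby
  \<open>y'\<close> in the domain, where every step moves the point only by order
  \<open>h\<close>.\<close>

lemma V_pow_near:
  assumes y': "y' \<in> D"
  shows "norm ((V h ^^ j) y - y) \<le> (K + 1) * norm (y - y') + j * h * (K * norm (L y'))"
proof -
  interpret bounded_linear "V h ^^ j" by (rule V_pow_bl)
  have "(V h ^^ j) y - y = (V h ^^ j) (y - y') - (y - y') + ((V h ^^ j) y' - y')" by (simp add: diff)
  also have "norm \<dots> \<le> (K * norm (y - y') + norm (y - y')) + j * h * (K * norm (L y'))"
    using V_pow_norm[of j "y - y'"] V_pow_step[OF y', of 0 j]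
    by (intro norm_triangle_le[OF add_mono] norm_triangle_le_diff[OF add_mono]) auto
  finally show ?thesis by (simp add: algebra_simps)
qed

end

text \<open>The square of I + h L exceeds I + 2 h L by h^2 L^2, which is the local error between one
  long step and two short ones.\<close>

lemma V_double:
  assumes h: "0 < h" and x: "x \<in> D" "L x \<in> D"
  shows "V (2 * h) x = V h (V h x) + h\<^sup>2 *\<^sub>R V (2 * h) (V h (V h (L (L x))))"
proof -
  have h2: "0 < 2 * h" using h by simp
  define u where "u = V h (V h x)"
  have u: "u \<in> D" by (simp add: u_def V_in h)
  have Lu: "L u = V h (V h (L x))" using V_L[OF h] V_in[OF h] x by (simp add: u_def)
  have LLu: "L (L u) = V h (V h (L (L x)))" using V_L[OF h] V_in[OF h] x by (simp add: Lu)
  have "x = V h x + h *\<^sub>R L (V h x)" by (rule V_right[OF h, symmetric])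
  also have "V h x = u + h *\<^sub>R L u" unfolding u_def by (rule V_right[OF h, symmetric])
  also have "L (u + h *\<^sub>R L u) = L u + h *\<^sub>R L (L u)"
    using u by (simp add: L_add L_scaleR D_scaleR Lu V_in h)
  finally have "x = (u + (2 * h) *\<^sub>R L u) + h\<^sup>2 *\<^sub>R L (L u)"
    by (simp add: algebra_simps power2_eq_square scaleR_2[symmetric])
  then have "V (2 * h) x = V (2 * h) ((u + (2 * h) *\<^sub>R L u) + h\<^sup>2 *\<^sub>R L (L u))" by simp
  also have "\<dots> = u + h\<^sup>2 *\<^sub>R V (2 * h) (L (L u))"
    by (simp only: V_add[OF h2, of "u + (2 * h) *\<^sub>R L u"] V_left[OF h2 u] V_scaleR[OF h2])
  finally show ?thesis unfolding LLu unfolding u_def .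
qed

text \<open>Each of the \<open>k\<close> long steps contributes one local error of order h^2, which
  stability keeps from growing. The \<open>j\<close> short steps taken beforehand are there for the
  induction, which converts long steps from the inside.\<close>

lemma V_double_pow:
  assumes h: "0 < h" and x: "x \<in> D" "L x \<in> D"
  shows "norm ((V (2 * h) ^^ k) ((V h ^^ j) x) - (V h ^^ (2 * k + j)) x) \<le> k * (K * K * h\<^sup>2 * norm (L (L x)))"
proof (induction k arbitrary: j)
  case (Suc k)
  have h2: "0 < 2 * h" using h by simp
  interpret B: bounded_linear "V (2 * h) ^^ k" by (rule V_pow_bl[OF h2])
  define y where "y = (V h ^^ j) x"
  have y: "y \<in> D" "L y \<in> D" "L (L y) = (V h ^^ j) (L (L x))"
    using V_pow_in[OF h x(1), of j] V_pow_in[OF h x(2), of j] by (auto simp: y_def)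
  have "(V (2 * h) ^^ Suc k) y = (V (2 * h) ^^ k) (V (2 * h) y)" by (simp add: funpow_swap1)
  also have "\<dots> = (V (2 * h) ^^ k) ((V h ^^ (j + 2)) x) + h\<^sup>2 *\<^sub>R (V (2 * h) ^^ Suc k) ((V h ^^ (j + 2)) (L (L x)))"
    unfolding V_double[OF h y(1,2)] by (simp only: B.add B.scaleR y(3)) (simp add: y_def funpow_swap1)
  finally have e: "(V (2 * h) ^^ Suc k) y - (V h ^^ (2 * Suc k + j)) x
     = ((V (2 * h) ^^ k) ((V h ^^ (j + 2)) x) - (V h ^^ (2 * k + (j + 2))) x)
       + h\<^sup>2 *\<^sub>R (V (2 * h) ^^ Suc k) ((V h ^^ (j + 2)) (L (L x)))"
    by (simp add: ac_simps del: funpow.simps)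
  have "norm ((V (2 * h) ^^ Suc k) ((V h ^^ (j + 2)) (L (L x)))) \<le> K * (K * norm (L (L x)))"
    using order_trans[OF V_pow_norm[OF h2] mult_left_mono[OF V_pow_norm[OF h]]] K_ge by (metis order_trans zero_le_one)
  then have step: "norm (h\<^sup>2 *\<^sub>R (V (2 * h) ^^ Suc k) ((V h ^^ (j + 2)) (L (L x)))) \<le> h\<^sup>2 * (K * (K * norm (L (L x))))"
    by (simp add: mult_left_mono del: funpow.simps)
  have "norm ((V (2 * h) ^^ Suc k) y - (V h ^^ (2 * Suc k + j)) x)
      \<le> k * (K * K * h\<^sup>2 * norm (L (L x))) + h\<^sup>2 * (K * (K * norm (L (L x))))"
    unfolding e by (rule norm_triangle_le[OF add_mono[OF Suc[of "j + 2"] step]])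
  then show ?case by (simp add: y_def algebra_simps del: funpow.simps)
qed simp

definition D2 where "D2 = {x \<in> D. L x \<in> D}"

text \<open>\<open>V h\<close> commutes with \<open>L\<close> and maps into \<open>D\<close>, so it
  maps \<open>D\<close> into \<open>D2\<close>, and \<open>V h x\<close> tends to \<open>x\<close>
  as \<open>h\<close> tends to \<open>0\<close>.\<close>

lemma D2_dense: "closure D2 = UNIV"
proof -
  have "x \<in> closure D2" if x: "x \<in> D" for x
    unfolding closure_sequential
  proof (intro exI conjI allI)
    let ?h = "\<lambda>n. inverse (real (Suc n))"
    show "V (?h n) x \<in> D2" for n by (simp add: D2_def V_in V_L x)
    have "(\<lambda>n. ?h n * (K * norm (L x))) \<longlonglongrightarrow> 0 * (K * norm (L x))"
      by (intro tendsto_mult tendsto_const LIMSEQ_inverse_real_of_nat)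
    then have l: "(\<lambda>n. ?h n * (K * norm (L x))) \<longlonglongrightarrow> 0" by simp
    have "norm (V (?h n) x - x) \<le> ?h n * (K * norm (L x))" for n
      using V_pow_step[of "?h n" x 0 1] x by simp
    then have "(\<lambda>n. V (?h n) x - x) \<longlonglongrightarrow> 0" by (intro Lim_null_comparison[OF _ l]) simp
    then show "(\<lambda>n. V (?h n) x) \<longlonglongrightarrow> x" by (simp add: LIM_zero_iff)
  qed
  then have "closure D \<subseteq> closure D2" by (intro closure_minimal) auto
  then show ?thesis using dense by auto
qed

text \<open>Dyadic step lengths are used because a halving turns every long step into exactly two
  short ones, so that consecutive approximations \<open>E n\<close> can be compared.
  \<open>N n t\<close> rounds down; the neglected remainder is shorter than one step.\<close>

definition \<tau> :: "nat \<Rightarrow> real" where "\<tau> n = 1 / 2 ^ n"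
definition N :: "nat \<Rightarrow> real \<Rightarrow> nat" where "N n t = nat \<lfloor>t * 2 ^ n\<rfloor>"
definition E where "E n t = V (\<tau> n) ^^ N n t"
definition T where "T t x = lim (\<lambda>n. E n t x)"

lemma \<tau>_pos: "0 < \<tau> n" and \<tau>_Suc: "\<tau> n = 2 * \<tau> (Suc n)" and \<tau>_tendsto: "\<tau> \<longlonglongrightarrow> 0"
proof -
  show "0 < \<tau> n" "\<tau> n = 2 * \<tau> (Suc n)" by (simp_all add: \<tau>_def)
  show "\<tau> \<longlonglongrightarrow> 0" using LIMSEQ_realpow_zero[of "1/2::real"] by (simp add: \<tau>_def[abs_def] power_one_over)
qed

lemma N_bounds: assumes "0 \<le> t" shows "real (N n t) * \<tau> n \<le> t" "t < real (N n t) * \<tau> n + \<tau> n"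
proof -
  have "real (N n t) = of_int \<lfloor>t * 2 ^ n\<rfloor>" using assms by (simp add: N_def)
  then have "real (N n t) \<le> t * 2 ^ n" "t * 2 ^ n < real (N n t) + 1" by linarith+
  then show "real (N n t) * \<tau> n \<le> t" "t < real (N n t) * \<tau> n + \<tau> n"
    by (simp_all add: \<tau>_def field_simps)
qed

lemma N_Suc: assumes "0 \<le> t" shows "N (Suc n) t = 2 * N n t \<or> N (Suc n) t = 2 * N n t + 1"
proof -
  have "real (2 * N n t) * \<tau> (Suc n) < real (N (Suc n) t + 1) * \<tau> (Suc n)"
    "real (N (Suc n) t) * \<tau> (Suc n) < real (2 * N n t + 2) * \<tau> (Suc n)"
    using N_bounds[OF assms, of n] N_bounds[OF assms, of "Suc n"] \<tau>_Suc[of n] by (simp_all add: algebra_simps)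
  then have "real (2 * N n t) < real (N (Suc n) t + 1)" "real (N (Suc n) t) < real (2 * N n t + 2)"
    using \<tau>_pos[of "Suc n"] mult_less_cancel_right_pos by blast+
  then show ?thesis by linarith
qed

lemma N_add: assumes s: "0 \<le> s" and t: "0 \<le> t" shows "N n (s + t) = N n s + N n t \<or> N n (s + t) = N n s + N n t + 1"
proof -
  have "real (N n s + N n t) * \<tau> n < real (N n (s + t) + 1) * \<tau> n"
    "real (N n (s + t)) * \<tau> n < real (N n s + N n t + 2) * \<tau> n"
    using N_bounds[OF s, of n] N_bounds[OF t, of n] N_bounds[of "s + t" n] s t by (simp_all add: algebra_simps)
  then have "real (N n s + N n t) < real (N n (s + t) + 1)" "real (N n (s + t)) < real (N n s + N n t + 2)"
    using \<tau>_pos[of n] mult_less_cancel_right_pos by blast+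
  then show ?thesis by linarith
qed

lemma E_bl: "bounded_linear (E n t)" unfolding E_def by (rule V_pow_bl[OF \<tau>_pos])
lemma E_norm: "norm (E n t x) \<le> K * norm x" unfolding E_def by (rule V_pow_norm[OF \<tau>_pos])

text \<open>On \<open>D2\<close> consecutive approximations differ by the accumulated halving error,
  of order \<open>t\<close> times the step length, and by at most one step due to rounding. Both are
  of order 2^(-n), hence summable; stability extends the convergence to all
  \<open>x\<close>.\<close>

lemma E_convergent: assumes t: "0 \<le> t" shows "convergent (\<lambda>n. E n t x)"
proof (rule convergent_on_dense[OF bounded_linear.linear[OF E_bl] E_norm _ D2_dense])
  fix x assume "x \<in> D2"
  then have x: "x \<in> D" "L x \<in> D" by (auto simp: D2_def)
  define C where "C = t * (K * K * norm (L (L x))) + K * norm (L x)"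
  have "norm (E (Suc n) t x - E n t x) \<le> C * (1 / 2) ^ n" for n
  proof -
    let ?h = "\<tau> (Suc n)"
    have h: "0 < ?h" by (rule \<tau>_pos)
    have 1: "norm (E (Suc n) t x - (V ?h ^^ (2 * N n t)) x) \<le> ?h * (K * norm (L x))"
    proof (cases "N (Suc n) t = 2 * N n t")
      case True
      then show ?thesis using h K_ge by (simp add: E_def)
    next
      case False
      then have "N (Suc n) t = 2 * N n t + 1" using N_Suc[OF t, of n] by simp
      then show ?thesis using V_pow_step[OF h x(1), of "2 * N n t" 1] by (simp add: E_def)
    qed
    have "norm (E n t x - (V ?h ^^ (2 * N n t)) x) \<le> N n t * (K * K * ?h\<^sup>2 * norm (L (L x)))"
      using V_double_pow[OF h x, of "N n t" 0] \<tau>_Suc[of n] by (simp add: E_def)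
    also have "\<dots> = (N n t * ?h) * (?h * (K * K * norm (L (L x))))" by (simp add: power2_eq_square)
    also have "\<dots> \<le> t * (?h * (K * K * norm (L (L x))))"
    proof (rule mult_right_mono)
      have "N n t * ?h \<le> N n t * \<tau> n" using h by (simp add: \<tau>_Suc[of n])
      then show "N n t * ?h \<le> t" using N_bounds(1)[OF t, of n] by linarith
      show "0 \<le> ?h * (K * K * norm (L (L x)))" using h K_ge by simp
    qed
    finally have 2: "norm (E n t x - (V ?h ^^ (2 * N n t)) x) \<le> t * (?h * (K * K * norm (L (L x))))" .
    have "E (Suc n) t x - E n t x = (E (Suc n) t x - (V ?h ^^ (2 * N n t)) x) - (E n t x - (V ?h ^^ (2 * N n t)) x)"
      by simp
    also have "norm \<dots> \<le> ?h * (K * norm (L x)) + t * (?h * (K * K * norm (L (L x))))"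
      by (rule norm_triangle_le_diff[OF add_mono[OF 1 2]])
    also have "\<dots> = C * ?h" by (simp add: C_def algebra_simps)
    also have "\<dots> \<le> C * (1 / 2) ^ n"
    proof (rule mult_left_mono)
      show "?h \<le> (1 / 2) ^ n" by (simp add: \<tau>_def power_one_over frac_le)
      show "0 \<le> C" unfolding C_def using t K_ge by (intro add_nonneg_nonneg mult_nonneg_nonneg) auto
    qed
    finally show ?thesis .
  qed
  then have "summable (\<lambda>n. E (Suc n) t x - E n t x)"
    by (intro summable_comparison_test'[OF summable_mult[OF summable_geometric[of "1 / 2 :: real"]]]) simp_all
  then have "convergent (\<lambda>n. \<Sum>k<n. E (Suc k) t x - E k t x)" by (simp add: summable_iff_convergent)
  then have "convergent (\<lambda>n. E n t x - E 0 t x)"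
    using sum_lessThan_telescope[of "\<lambda>n. E n t x"] by (simp only:)
  then show "convergent (\<lambda>n. E n t x)" by (simp add: convergent_diff_const_right_iff)
qed

lemma E_tendsto: "0 \<le> t \<Longrightarrow> (\<lambda>n. E n t x) \<longlonglongrightarrow> T t x"
  unfolding T_def using E_convergent by (simp add: convergent_LIMSEQ_iff)

lemma T_norm: "0 \<le> t \<Longrightarrow> norm (T t x) \<le> K * norm x"
  by (rule tendsto_upperbound[OF tendsto_norm[OF E_tendsto]]) (auto simp: E_norm)

lemma T_add: assumes t: "0 \<le> t" shows "T t (x + y) = T t x + T t y"
proof -
  have "(\<lambda>n. E n t (x + y)) \<longlonglongrightarrow> T t x + T t y"
    using tendsto_add[OF E_tendsto[OF t] E_tendsto[OF t]] by (simp add: linear_simps[OF E_bl])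
  then show ?thesis using E_tendsto[OF t] LIMSEQ_unique by blast
qed

lemma T_scaleC: assumes t: "0 \<le> t" shows "T t (c *\<^sub>C x) = c *\<^sub>C T t x"
proof -
  have "(\<lambda>n. c *\<^sub>C E n t x) \<longlonglongrightarrow> c *\<^sub>C T t x" by (intro scaleC_tendsto tendsto_const E_tendsto t)
  then have "(\<lambda>n. E n t (c *\<^sub>C x)) \<longlonglongrightarrow> c *\<^sub>C T t x" by (simp add: E_def V_pow_scaleC \<tau>_pos)
  then show ?thesis using E_tendsto[OF t] LIMSEQ_unique by blast
qed

lemma T_bl: assumes t: "0 \<le> t" shows "bounded_linear (T t)"
proof (rule bounded_linear_intro)
  show "T t (x + y) = T t x + T t y" for x y by (rule T_add[OF t])
  show "T t (r *\<^sub>R x) = r *\<^sub>R T t x" for r x using T_scaleC[OF t, of "of_real r" x] by (simp add: scaleC_of_real)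
  show "norm (T t x) \<le> norm x * K" for x using T_norm[OF t, of x] by (simp add: mult.commute)
qed

lemma T_zero: "T 0 x = x"
proof (rule LIMSEQ_unique[OF E_tendsto[OF order_refl]])
  show "(\<lambda>n. E n 0 x) \<longlonglongrightarrow> x" by (simp add: E_def N_def)
qed

lemma T_near: assumes y: "y \<in> D" and t: "0 \<le> t"
  shows "norm (T t x - x) \<le> (K + 1) * norm (x - y) + t * (K * norm (L y))"
proof (rule tendsto_upperbound[OF tendsto_norm[OF tendsto_diff[OF E_tendsto[OF t] tendsto_const]]])
  show "\<forall>\<^sub>F n in sequentially. norm (E n t x - x) \<le> (K + 1) * norm (x - y) + t * (K * norm (L y))"
  proof (rule always_eventually, rule allI)
    fix n
    have "norm (E n t x - x) \<le> (K + 1) * norm (x - y) + N n t * \<tau> n * (K * norm (L y))"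
      unfolding E_def by (rule V_pow_near[OF \<tau>_pos y])
    also have "\<dots> \<le> (K + 1) * norm (x - y) + t * (K * norm (L y))"
      by (intro add_left_mono mult_right_mono N_bounds t) (use K_ge in simp)
    finally show "norm (E n t x - x) \<le> (K + 1) * norm (x - y) + t * (K * norm (L y))" .
  qed
qed simp

text \<open>The rounded step numbers of \<open>s\<close> and \<open>t\<close> add up to that of
  \<open>s + t\<close> within one step, whose effect on a point of \<open>D\<close> vanishes with
  the step length.\<close>

lemma T_semigroup: assumes s: "0 \<le> s" and t: "0 \<le> t" shows "T (s + t) x = T s (T t x)"
proof (rule bounded_linear_eq_on_dense[OF T_bl bounded_linear_compose[OF T_bl[OF s] T_bl[OF t]] dense])
  show "0 \<le> s + t" using s t by simp
  fix x assume x: "x \<in> D"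
  have "(\<lambda>n. K * norm (E n t x - T t x) + norm (E n s (T t x) - T s (T t x))) \<longlonglongrightarrow> K * norm (T t x - T t x) + norm (T s (T t x) - T s (T t x))"
    by (intro tendsto_intros E_tendsto s t)
  then have l: "(\<lambda>n. K * norm (E n t x - T t x) + norm (E n s (T t x) - T s (T t x))) \<longlonglongrightarrow> 0" by simp
  have "norm (E n s (E n t x) - T s (T t x)) \<le> K * norm (E n t x - T t x) + norm (E n s (T t x) - T s (T t x))" for n
  proof -
    have "E n s (E n t x) - T s (T t x) = E n s (E n t x - T t x) + (E n s (T t x) - T s (T t x))"
      by (simp add: linear_simps[OF E_bl])
    then show ?thesis by (simp only:) (rule norm_triangle_le[OF add_mono[OF E_norm order_refl]])
  qed
  then have "(\<lambda>n. E n s (E n t x) - T s (T t x)) \<longlonglongrightarrow> 0" by (intro Lim_null_comparison[OF _ l]) simp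
  then have a: "(\<lambda>n. E n s (E n t x)) \<longlonglongrightarrow> T s (T t x)" by (simp add: LIM_zero_iff)
  have "norm (E n (s + t) x - E n s (E n t x)) \<le> \<tau> n * (K * norm (L x))" for n
    using N_add[OF s t, of n]
  proof
    assume "N n (s + t) = N n s + N n t"
    then show ?thesis using \<tau>_pos[of n] K_ge by (simp add: E_def funpow_add)
  next
    assume "N n (s + t) = N n s + N n t + 1"
    then show ?thesis using V_pow_step[OF \<tau>_pos[of n] x, where m = "N n s + N n t" and k = 1] by (simp add: E_def funpow_add)
  qed
  then have b: "(\<lambda>n. E n (s + t) x - E n s (E n t x)) \<longlonglongrightarrow> 0"
    by (intro Lim_null_comparison[OF _ tendsto_mult_left_zero[OF \<tau>_tendsto, of "K * norm (L x)"]]) simp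
  have "(\<lambda>n. E n (s + t) x) \<longlonglongrightarrow> T s (T t x)" using tendsto_add[OF a b] by simp
  moreover have "(\<lambda>n. E n (s + t) x) \<longlonglongrightarrow> T (s + t) x" using s t by (intro E_tendsto) simp
  ultimately show "T (s + t) x = T s (T t x)" by (rule LIMSEQ_unique[rotated])
qed

lemma T_tendsto_zero: "((\<lambda>t. T t x) \<longlongrightarrow> x) (at_right 0)"
proof (rule tendstoI)
  fix e :: real assume e: "e > 0"
  have "x \<in> closure D" using dense by simp
  moreover have "e / (2 * (K + 1)) > 0" using e K_ge by simp
  ultimately obtain y where y: "y \<in> D" "norm (x - y) < e / (2 * (K + 1))"
    unfolding closure_approachable dist_norm by (subst (asm) norm_minus_commute) blast
  have 1: "(K + 1) * norm (x - y) < e / 2" using y(2) K_ge by (simp add: field_simps)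
  have "((\<lambda>t. t * (K * norm (L y))) \<longlongrightarrow> 0 * (K * norm (L y))) (at_right 0)" by (intro tendsto_intros)
  then have "\<forall>\<^sub>F t in at_right 0. t * (K * norm (L y)) < e / 2"
    by (rule order_tendstoD) (use e in simp)
  then show "\<forall>\<^sub>F t in at_right 0. dist (T t x) x < e"
    using eventually_at_right_less[of 0]
  proof eventually_elim
    case (elim t)
    then show ?case using T_near[OF y(1), of t x] 1 by (simp add: dist_norm)
  qed
qed

lemma T_c0: "c0_semigroup T"
  unfolding c0_semigroup_def bounded_clinear_def clinear_on_def
  using T_bl T_zero T_semigroup T_tendsto_zero T_add T_scaleC by auto

text \<open>The quotient differs from \<open>- L x\<close> by at most the deviation from
  \<open>L x\<close> of the Euler steps started there, up to time \<open>t\<close>. As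
  \<open>L x\<close> need not lie in \<open>D\<close>, it is first approximated by some
  \<open>y\<close> in \<open>D\<close>.\<close>

lemma T_derivative:
  assumes x: "x \<in> D"
  shows "((\<lambda>t. (1 / t) *\<^sub>R (T t x - x)) \<longlongrightarrow> - L x) (at_right 0)"
proof (rule tendstoI)
  fix e :: real assume e: "e > 0"
  have "L x \<in> closure D" using dense by simp
  moreover have "e / (2 * (K + 1)) > 0" using e K_ge by simp
  ultimately obtain y where y: "y \<in> D" "norm (L x - y) < e / (2 * (K + 1))"
    unfolding closure_approachable dist_norm by (subst (asm) norm_minus_commute) blast
  have 1: "(K + 1) * norm (L x - y) < e / 2" using y(2) K_ge by (simp add: field_simps)
  define B where "B t = (K + 1) * norm (L x - y) + t * (K * norm (L y))" for t
  have "((\<lambda>t. t * (K * norm (L y))) \<longlongrightarrow> 0 * (K * norm (L y))) (at_right 0)" by (intro tendsto_intros)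
  then have "\<forall>\<^sub>F t in at_right 0. t * (K * norm (L y)) < e / 2"
    by (rule order_tendstoD) (use e in simp)
  then show "\<forall>\<^sub>F t in at_right 0. dist ((1 / t) *\<^sub>R (T t x - x)) (- L x) < e"
    using eventually_at_right_less[of 0]
  proof eventually_elim
    case (elim t)
    then have t: "0 < t" by simp
    have B0: "0 \<le> B t" using t K_ge by (simp add: B_def)
    have Nt: "(\<lambda>n. N n t * \<tau> n) \<longlonglongrightarrow> t"
    proof (rule tendsto_sandwich[of "\<lambda>n. t - \<tau> n" _ _ "\<lambda>n. t"])
      have "(\<lambda>n. t - \<tau> n) \<longlonglongrightarrow> t - 0" by (intro tendsto_intros \<tau>_tendsto)
      then show "(\<lambda>n. t - \<tau> n) \<longlonglongrightarrow> t" by simp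
    qed (use N_bounds[of t] t in \<open>auto intro!: always_eventually simp: less_imp_le algebra_simps\<close>)
    have "norm (T t x - x + t *\<^sub>R L x) \<le> t * B t"
    proof (rule tendsto_upperbound)
      show "(\<lambda>n. norm (E n t x - x + (N n t * \<tau> n) *\<^sub>R L x)) \<longlonglongrightarrow> norm (T t x - x + t *\<^sub>R L x)"
        using t by (intro tendsto_intros E_tendsto Nt) simp
      have "norm (E n t x - x + (N n t * \<tau> n) *\<^sub>R L x) \<le> t * B t" for n
      proof -
        have Nn: "N n t * \<tau> n \<le> t" using N_bounds(1)[of t n] t by simp
        have "norm (E n t x - x + (N n t * \<tau> n) *\<^sub>R L x) \<le> N n t * \<tau> n * B t"
          unfolding E_def
        proof (rule V_pow_derivative[OF \<tau>_pos x])
          fix j assume "j \<le> N n t"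
          then have "real j * \<tau> n \<le> real (N n t) * \<tau> n" using \<tau>_pos[of n] by (intro mult_right_mono) auto
          then have "j * \<tau> n \<le> t" using Nn by linarith
          then have "j * \<tau> n * (K * norm (L y)) \<le> t * (K * norm (L y))"
            using K_ge by (intro mult_right_mono) auto
          then show "norm ((V (\<tau> n) ^^ j) (L x) - L x) \<le> B t"
            using V_pow_near[OF \<tau>_pos[of n] y(1), where j = j and y = "L x"] unfolding B_def by linarith
        qed
        also have "\<dots> \<le> t * B t" by (rule mult_right_mono[OF Nn B0])
        finally show ?thesis .
      qed
      then show "\<forall>\<^sub>F n in sequentially. norm (E n t x - x + (N n t * \<tau> n) *\<^sub>R L x) \<le> t * B t" by simp
    qed simp
    then have "(1 / t) * norm (T t x - x + t *\<^sub>R L x) \<le> B t" using t by (simp add: field_simps)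
    moreover have "(1 / t) *\<^sub>R (T t x - x) - (- L x) = (1 / t) *\<^sub>R (T t x - x + t *\<^sub>R L x)"
      using t by (simp add: scaleR_add_right)
    ultimately have "norm ((1 / t) *\<^sub>R (T t x - x) - (- L x)) \<le> B t"
      using t by (simp only: norm_scaleR abs_of_pos zero_less_divide_1_iff)
    then show ?case using 1 elim by (simp add: dist_norm B_def)
  qed
qed

text \<open>An eigenvector of the generator for the eigenvalue \<open>1\<close> would have an orbit
  growing like exp (s), which the uniform bound \<open>K\<close> excludes; the time
  \<open>ln (2 * K)\<close> is enough for the contradiction.\<close>

lemma T_fixed_quotient:
  assumes q: "((\<lambda>h. (1 / h) *\<^sub>R (T h z - z)) \<longlongrightarrow> z) (at_right 0)"
  shows "z = 0"
proof -
  have d: "((\<lambda>s. exp (- s) *\<^sub>R T s z) has_vector_derivative 0) (at s within {0..})" if "s \<in> {0..}" for s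
  proof -
    have "((\<lambda>s. exp (- s)) has_field_derivative - exp (- s)) (at s within {0..})"
      by (auto intro!: derivative_eq_intros)
    from has_vector_derivative_scaleR[OF this c0_orbit_derivative[OF T_c0 q]] that
    show ?thesis by simp
  qed
  obtain c where c: "\<And>s. s \<in> {0..} \<Longrightarrow> exp (- s) *\<^sub>R T s z = c"
    using has_vector_derivative_zero_constant[OF convex_real_interval(1)[of 0] d] by blast
  have "norm z \<le> exp (- s) * (K * norm z)" if s: "0 \<le> s" for s
  proof -
    have "z = exp (- s) *\<^sub>R T s z" using c[of 0] c[of s] s by (simp add: T_zero)
    then have "norm z = exp (- s) * norm (T s z)" by (metis abs_exp_cancel norm_scaleR)
    also have "\<dots> \<le> exp (- s) * (K * norm z)" by (intro mult_left_mono T_norm s) simp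
    finally show ?thesis .
  qed
  from this[of "ln (2 * K)"] K_ge have "norm z \<le> norm z / 2" by (simp add: exp_minus ln_ge_zero field_simps)
  then show ?thesis by simp
qed

text \<open>The generator extends \<open>- L\<close>. The extension is not proper: since
  \<open>1 + L\<close> is onto, some \<open>x'\<close> in \<open>D\<close> has the same image as
  \<open>x\<close> under the identity minus the generator, and \<open>T_fixed_quotient\<close> shows
  that \<open>x - x'\<close> vanishes.\<close>

lemma T_generator: "neg_generator D L T"
  unfolding neg_generator_def
proof (intro allI iffI)
  fix x y assume "x \<in> D \<and> y = - L x"
  then show "((\<lambda>t. (1 / t) *\<^sub>R (T t x - x)) \<longlongrightarrow> y) (at_right 0)" using T_derivative by simp
next
  fix x y assume q: "((\<lambda>t. (1 / t) *\<^sub>R (T t x - x)) \<longlongrightarrow> y) (at_right 0)"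
  define x' where "x' = R 1 (x - y)"
  have x': "x' \<in> D" "x' + L x' = x - y" using R_in[of 1 "x - y"] R_right[of 1 "x - y"] by (auto simp: x'_def)
  have "((\<lambda>t. (1 / t) *\<^sub>R (T t x - x) - (1 / t) *\<^sub>R (T t x' - x')) \<longlongrightarrow> y - (- L x')) (at_right 0)"
    by (intro tendsto_diff q T_derivative x')
  moreover have "y - (- L x') = x - x'" using x'(2) by (simp add: algebra_simps)
  moreover have "\<forall>\<^sub>F t in at_right 0. (1 / t) *\<^sub>R (T t x - x) - (1 / t) *\<^sub>R (T t x' - x')
      = (1 / t) *\<^sub>R (T t (x - x') - (x - x'))"
    using eventually_at_right_less[of 0]
    by eventually_elim (simp add: linear_simps[OF T_bl] algebra_simps)
  ultimately have "((\<lambda>t. (1 / t) *\<^sub>R (T t (x - x') - (x - x'))) \<longlongrightarrow> x - x') (at_right 0)"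
    by (simp add: tendsto_cong)
  then have "x = x'" using T_fixed_quotient[of "x - x'"] by simp
  then show "x \<in> D \<and> y = - L x" using x' by (simp add: algebra_simps add_eq_0_iff)
qed

theorem half_plane_resolvent_generates:
  "\<exists>T K. c0_semigroup T \<and> neg_generator D L T \<and> (\<forall>t\<ge>0. \<forall>x. norm (T t x) \<le> K * norm x)"
  using T_c0 T_generator T_norm by blast

end

section \<open>Sectorial operators generate exponentially stable semigroups\<close>

text \<open>Membership in the resolvent set with the constant made explicit, so that it can be
  followed through perturbation and compactness.\<close>

definition lower_bounded_resolvent_point ::
    "'a::complex_banach set \<Rightarrow> ('a \<Rightarrow> 'a) \<Rightarrow> real \<Rightarrow> complex \<Rightarrow> bool" where
  "lower_bounded_resolvent_point D A C w \<longleftrightarrow> bij_betw (\<lambda>x. w *\<^sub>C x - A x) D UNIV \<and>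
     (\<forall>x\<in>D. norm x \<le> C * norm (w *\<^sub>C x - A x))"

lemma resolvent_set_UNIV_iff:
  "w \<in> resolvent_set UNIV D A \<longleftrightarrow> (\<exists>C. lower_bounded_resolvent_point D A C w)"
  by (auto simp: resolvent_set_def lower_bounded_resolvent_point_def)

lemma lower_bounded_resolvent_point_mono:
  "lower_bounded_resolvent_point D A C w \<Longrightarrow> C \<le> C' \<Longrightarrow> lower_bounded_resolvent_point D A C' w"
  unfolding lower_bounded_resolvent_point_def by (meson mult_right_mono norm_ge_zero order_trans)

text \<open>Solving at \<open>w'\<close> is a fixed point equation for the inverse at
  \<open>w\<close> with contraction factor \<open>1 / 2\<close>. In the estimate the perturbation
  absorbs half of the left side, which doubles the constant.\<close>

lemma lower_bounded_resolvent_point_perturb: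
  assumes D: "csubspace D" and A: "clinear_on D A" and w: "lower_bounded_resolvent_point D A C w"
    and C: "0 < C" and near: "cmod (w' - w) * C \<le> 1 / 2"
  shows "lower_bounded_resolvent_point D A (2 * C) w'"
proof -
  let ?f = "\<lambda>x. w *\<^sub>C x - A x" and ?g = "\<lambda>x. w' *\<^sub>C x - A x"
  have fb: "norm x \<le> C * norm (?f x)" if "x \<in> D" for x
    using w that by (simp add: lower_bounded_resolvent_point_def)
  have diff: "?g x - ?g y = ?g (x - y)" "?f x - ?f y = ?f (x - y)" if "x \<in> D" "y \<in> D" for x y
    using that by (simp_all add: clinear_on_diff[OF D A] scaleC_diff_right)
  have gb: "norm x \<le> 2 * C * norm (?g x)" if x: "x \<in> D" for x
  proof -
    have "?f x = ?g x - (w' - w) *\<^sub>C x" by (simp add: scaleC_diff_left)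
    then have "norm (?f x) \<le> norm (?g x) + cmod (w' - w) * norm x"
      by (metis norm_scaleC norm_triangle_ineq4)
    then have "C * norm (?f x) \<le> C * (norm (?g x) + cmod (w' - w) * norm x)"
      using C by (intro mult_left_mono) auto
    then have "norm x \<le> C * norm (?g x) + (cmod (w' - w) * C) * norm x"
      using fb[OF x] by (simp add: algebra_simps)
    moreover have "(cmod (w' - w) * C) * norm x \<le> (1 / 2) * norm x"
      by (rule mult_right_mono[OF near]) simp
    ultimately show ?thesis by simp
  qed
  have inj: "inj_on ?g D"
  proof (rule inj_onI)
    fix x y assume xy: "x \<in> D" "y \<in> D" "?g x = ?g y"
    then have "?g (x - y) = 0" using diff(1)[of x y] by simp
    then show "x = y" using gb[of "x - y"] csubspace_diff[OF D xy(1,2)] by simp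
  qed
  have "y \<in> ?g ` D" for y
  proof -
    define S where "S = inv_into D ?f"
    have S: "S u \<in> D" "?f (S u) = u" for u
      using w inv_into_into[of u ?f D] f_inv_into_f[of u ?f D]
      by (auto simp: S_def lower_bounded_resolvent_point_def bij_betw_def)
    have "\<exists>!x. S (y - (w' - w) *\<^sub>C x) = x"
    proof (rule banach_fix_type[of "1 / 2"]; (intro allI)?)
      fix u v
      let ?u = "y - (w' - w) *\<^sub>C u" and ?v = "y - (w' - w) *\<^sub>C v"
      have "norm (S ?u - S ?v) \<le> C * norm (?f (S ?u - S ?v))"
        by (rule fb) (intro csubspace_diff[OF D] S)
      also have "?f (S ?u - S ?v) = ?u - ?v" using diff(2)[OF S(1) S(1), of ?u ?v] by (simp only: S(2))
      also have "?u - ?v = - ((w' - w) *\<^sub>C (u - v))" by (simp add: scaleC_diff_right)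
      also have "C * norm \<dots> = (cmod (w' - w) * C) * norm (u - v)" by (simp add: norm_scaleC)
      also have "\<dots> \<le> (1 / 2) * norm (u - v)" by (rule mult_right_mono[OF near]) simp
      finally show "dist (S ?u) (S ?v) \<le> 1 / 2 * dist u v" by (simp add: dist_norm)
    qed simp_all
    then obtain x where x: "S (y - (w' - w) *\<^sub>C x) = x" by blast
    have "x \<in> D" using S(1)[of "y - (w' - w) *\<^sub>C x"] by (simp only: x)
    moreover have "?f x = y - (w' - w) *\<^sub>C x" using S(2)[of "y - (w' - w) *\<^sub>C x"] by (simp only: x)
    then have "y = ?g x" by (simp add: scaleC_diff_left algebra_simps)
    ultimately show ?thesis by blast
  qed
  then have "?g ` D = UNIV" by blast
  then show ?thesis using inj gb by (simp add: lower_bounded_resolvent_point_def bij_betw_def)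
qed

text \<open>A finite cover gives one constant for all of \<open>S\<close> and, through the margin
  \<open>e\<close>, also for points slightly outside. This margin is what later produces exponential
  decay.\<close>

lemma lower_bounded_resolvent_point_compact:
  assumes D: "csubspace D" and A: "clinear_on D A" and S: "compact S"
    and pts: "\<And>w. w \<in> S \<Longrightarrow> w \<in> resolvent_set UNIV D A"
  obtains e C where "0 < e" "0 < C"
    "\<And>w w'. w \<in> S \<Longrightarrow> dist w w' < e \<Longrightarrow> lower_bounded_resolvent_point D A C w'"
proof -
  have "\<exists>C>0. lower_bounded_resolvent_point D A C w" if w: "w \<in> S" for w
  proof -
    obtain C where "lower_bounded_resolvent_point D A C w"
      using pts[OF w] by (auto simp: resolvent_set_UNIV_iff)
    then have "lower_bounded_resolvent_point D A (max C 1) w"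
      by (rule lower_bounded_resolvent_point_mono) simp
    then show ?thesis by (intro exI[of _ "max C 1"]) simp
  qed
  then obtain c where c: "\<And>w. w \<in> S \<Longrightarrow> 0 < c w" "\<And>w. w \<in> S \<Longrightarrow> lower_bounded_resolvent_point D A (c w) w"
    by metis
  let ?b = "\<lambda>w. ball w (1 / (2 * c w))"
  have "S \<subseteq> (\<Union>w\<in>S. ?b w)" using c(1) by force
  then obtain F where F: "F \<subseteq> S" "finite F" "S \<subseteq> (\<Union>w\<in>F. ?b w)"
    using compactE_image[OF S, of S ?b] by auto
  have "open (\<Union>w\<in>F. ?b w)" by auto
  then obtain e where e: "e > 0" "(\<Union>w\<in>S. ball w e) \<subseteq> (\<Union>w\<in>F. ?b w)"
    using compact_subset_open_imp_ball_epsilon_subset[OF S _ F(3)] by blast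
  \<comment> \<open>The sum dominates each single constant, and the added \<open>1\<close> keeps
    \<open>C\<close> positive even if \<open>F\<close> is empty.\<close>
  define C where "C = 1 + (\<Sum>w\<in>F. 2 * c w)"
  have nn: "0 \<le> (\<Sum>w\<in>F. 2 * c w)" using c(1) F(1) by (intro sum_nonneg) (auto simp: less_imp_le)
  show ?thesis
  proof (rule that[OF e(1), of C])
    show "0 < C" using nn by (simp add: C_def)
    fix w w' assume "w \<in> S" "dist w w' < e"
    then have "w' \<in> (\<Union>w\<in>S. ball w e)" by auto
    then have "w' \<in> (\<Union>w\<in>F. ?b w)" using e(2) by blast
    then obtain v where v: "v \<in> F" "dist v w' < 1 / (2 * c v)" by auto
    then have cv: "0 < c v" using c F by auto
    have "cmod (w' - v) * c v \<le> 1 / 2" using v(2) cv by (simp add: dist_norm norm_minus_commute field_simps)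
    with v have "lower_bounded_resolvent_point D A (2 * c v) w'"
      using c F by (intro lower_bounded_resolvent_point_perturb[OF D A _ cv]) auto
    moreover have "2 * c v \<le> (\<Sum>w\<in>F. 2 * c w)"
      using c(1) F v by (intro member_le_sum) (auto simp: less_imp_le)
    ultimately show "lower_bounded_resolvent_point D A C w'"
      by (elim lower_bounded_resolvent_point_mono) (simp add: C_def)
  qed
qed

lemma le_abs_Arg_if_Re_le:
  assumes "v \<noteq> 0" "0 < \<phi>" "\<phi> < pi / 2" "Re v \<le> cos \<phi> * cmod v"
  shows "\<phi> \<le> \<bar>Arg v\<bar>"
proof (rule ccontr)
  assume "\<not> \<phi> \<le> \<bar>Arg v\<bar>"
  then have "cos \<phi> < cos \<bar>Arg v\<bar>" using assms by (intro cos_monotone_0_pi) auto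
  also have "cos \<bar>Arg v\<bar> = Re v / cmod v" using cos_Arg[OF assms(1)] by (simp add: abs_if)
  finally show False using assms(1,4) by (simp add: field_simps)
qed

text \<open>Outside a disc the whole half plane lies in the given sector; the remaining compact part of the
  half plane lies in the resolvent set by the spectral assumption, with some room to spare.\<close>

lemma sectorial_half_plane_resolvent:
  assumes sec: "sectorial D A" and spec: "\<forall>z \<in> spectrum UNIV D (op_shift A a). 0 < Re z"
  obtains \<delta> M where "0 < \<delta>" "half_plane_resolvent D (op_shift A (a - \<delta>)) M"
proof -
  from sec obtain \<phi> a0 M0 where \<phi>: "0 < \<phi>" "\<phi> < pi / 2" and M0: "1 \<le> M0" and
    sector: "\<And>z. z \<noteq> complex_of_real a0 \<Longrightarrow> \<phi> \<le> \<bar>Arg (z - of_real a0)\<bar> \<Longrightarrow> z \<in> resolvent_set UNIV D A \<and>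
             (\<forall>x. norm (resolvent D A z x) \<le> M0 / cmod (z - of_real a0) * norm x)"
    unfolding sectorial_def using Arg_le_pi mpi_less_Arg by (metis abs_le_iff less_eq_real_def minus_le_iff)
  from sec have D: "csubspace D" and A: "clinear_on D A" and dense: "closure D = UNIV"
    by (auto simp: sectorial_def closed_densely_defined_def)
  have far: "lower_bounded_resolvent_point D A (M0 / cmod (w - of_real a0)) w"
    if w: "w \<noteq> of_real a0" "Re (w - of_real a0) \<le> cos \<phi> * cmod (w - of_real a0)" for w
  proof -
    have "w \<in> resolvent_set UNIV D A" and R: "norm (resolvent D A w x) \<le> M0 / cmod (w - of_real a0) * norm x" for x
      using sector[OF w(1) le_abs_Arg_if_Re_le[OF _ \<phi> w(2)]] w(1) by auto
    then have bij: "bij_betw (\<lambda>x. w *\<^sub>C x - A x) D UNIV"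
      by (auto simp: resolvent_set_UNIV_iff lower_bounded_resolvent_point_def)
    have "norm x \<le> M0 / cmod (w - of_real a0) * norm (w *\<^sub>C x - A x)" if x: "x \<in> D" for x
    proof -
      have "resolvent D A w (w *\<^sub>C x - A x) = x"
        unfolding resolvent_def using inv_into_f_f[of "\<lambda>x. w *\<^sub>C x - A x" D x] bij x
        by (simp only: bij_betw_def)
      then show ?thesis using R[of "w *\<^sub>C x - A x"] by simp
    qed
    then show ?thesis using bij by (simp add: lower_bounded_resolvent_point_def)
  qed
  have left: "w \<in> resolvent_set UNIV D A" if "Re w \<le> - a" for w
  proof -
    have "w + of_real a \<notin> spectrum UNIV D (op_shift A a)" using spec that by fastforce
    then obtain C where "lower_bounded_resolvent_point D (op_shift A a) C (w + of_real a)"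
      by (auto simp: spectrum_def resolvent_set_UNIV_iff)
    moreover have "(w + of_real a) *\<^sub>C x - op_shift A a x = w *\<^sub>C x - A x" for x
      by (simp add: op_shift_def scaleC_add_left scaleC_of_real)
    ultimately have "lower_bounded_resolvent_point D A C w"
      by (simp add: lower_bounded_resolvent_point_def)
    then show ?thesis by (auto simp: resolvent_set_UNIV_iff)
  qed
  define \<kappa> where "\<kappa> = cos \<phi>"
  have \<kappa>: "0 < \<kappa>" using \<phi> by (auto simp: \<kappa>_def intro!: cos_gt_zero)
  \<comment> \<open>If w is farther than \<open>\<rho>\<close> from a0 and Re w < 1 - a, then Re (w
    - a0) is at most \<open>\<kappa>\<close> times that distance, which places w in the
    sector.\<close>
  define \<rho> where "\<rho> = max 1 ((1 - a - a0) / \<kappa>)"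
  define S where "S = cball (complex_of_real a0) (\<rho> + 1) \<inter> {w. Re w \<le> - a}"
  have "compact S" unfolding S_def by (intro compact_Int_closed compact_cball closed_halfspace_Re_le)
  then obtain e C where e: "0 < e" and C: "0 < C" and near:
    "\<And>w w'. w \<in> S \<Longrightarrow> dist w w' < e \<Longrightarrow> lower_bounded_resolvent_point D A C w'"
    using lower_bounded_resolvent_point_compact[OF D A _ left] by (metis Int_iff S_def mem_Collect_eq)
  \<comment> \<open>\<open>\<delta>\<close> stays below the margin \<open>e\<close> of the compact
    part and at most \<open>1\<close>, as presumed by \<open>\<rho>\<close>. Below, \<open>q\<close>
    is the distance between the vertices a0 and \<delta> - a and converts bounds relative to one
    into bounds relative to the other.\<close>
  define \<delta> where "\<delta> = min (e / 2) 1"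
  have \<delta>: "0 < \<delta>" "\<delta> < e" "\<delta> \<le> 1" using e by (auto simp: \<delta>_def)
  define q where "q = \<bar>a0 - (\<delta> - a)\<bar>"
  define M where "M = C * (\<rho> + q) + M0 * (1 + q)"
  have q: "0 \<le> q" by (simp add: q_def)
  have \<rho>: "1 \<le> \<rho>" by (simp add: \<rho>_def)
  have pos: "0 < C * (\<rho> + q)" "0 < M0 * (1 + q)" using C M0 \<rho> q by (auto intro!: mult_pos_pos)
  have M: "0 < M" using pos by (simp add: M_def)
  have main: "lower_bounded_resolvent_point D A (M / cmod (w - of_real (\<delta> - a))) w" if w: "Re w < \<delta> - a" for w
  proof -
    define v where "v = cmod (w - of_real (\<delta> - a))"
    define u where "u = cmod (w - of_real a0)"
    have "w \<noteq> of_real (\<delta> - a)" using w by auto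
    then have v: "0 < v" by (simp add: v_def)
    have "w - of_real (\<delta> - a) = (w - of_real a0) + of_real (a0 - (\<delta> - a))" by simp
    then have "v \<le> u + cmod (of_real (a0 - (\<delta> - a)))" unfolding v_def u_def by (metis norm_triangle_ineq)
    then have vu: "v \<le> u + q" unfolding norm_of_real q_def .
    show ?thesis
    proof (cases "u \<le> \<rho>")
      case True
      \<comment> \<open>\<open>w'\<close> is the nearest point with real part at most
        \<open>- a\<close>; it lies in \<open>S\<close> and within the margin of
        \<open>w\<close>.\<close>
      define w' where "w' = Complex (min (Re w) (- a)) (Im w)"
      have "w' - w = of_real (min (Re w) (- a) - Re w)" by (simp add: w'_def complex_eq_iff)
      then have d: "dist w' w \<le> \<delta>" using w \<delta>(1) unfolding dist_norm by (simp only: norm_of_real)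
      have "dist w' (of_real a0) \<le> dist w' w + dist w (of_real a0)" by (rule dist_triangle)
      then have "w' \<in> S" using d True \<delta>(3) by (auto simp: S_def w'_def u_def dist_norm norm_minus_commute)
      then have g: "lower_bounded_resolvent_point D A C w" using near d \<delta>(2) by force
      have "C * v \<le> C * (\<rho> + q)" using vu True C by (intro mult_left_mono) auto
      then have "C * v \<le> M" using pos by (simp add: M_def)
      then have "C \<le> M / v" using v by (simp add: field_simps)
      then show ?thesis using lower_bounded_resolvent_point_mono[OF g] by (simp add: v_def)
    next
      case False
      then have u: "1 < u" "w \<noteq> of_real a0" using \<rho> by (auto simp: u_def)
      have "Re (w - of_real a0) \<le> \<kappa> * ((1 - a - a0) / \<kappa>)" using w \<delta>(3) \<kappa> by simp
      also have "\<dots> \<le> \<kappa> * u" using False \<kappa> by (intro mult_left_mono) (auto simp: \<rho>_def)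
      finally have g: "lower_bounded_resolvent_point D A (M0 / u) w"
        using far[OF u(2)] by (simp add: u_def \<kappa>_def)
      have "v \<le> u * (1 + q)" using vu u q mult_right_mono[of 1 u q] by (simp add: distrib_left)
      then have "M0 * v \<le> M0 * (1 + q) * u" using M0 by (simp add: mult.assoc mult.commute mult_left_mono)
      also have "\<dots> \<le> M * u" using u pos by (intro mult_right_mono) (auto simp: M_def)
      finally have "M0 / u \<le> M / v" using u v by (simp add: field_simps)
      then show ?thesis using lower_bounded_resolvent_point_mono[OF g] by (simp add: v_def)
    qed
  qed
  \<comment> \<open>The substitution \<delta> - a - z turns the right half plane for the shifted
    operator into the half plane left of \<delta> - a for \<open>A\<close>.\<close>
  have eq: "z *\<^sub>C x + op_shift A (a - \<delta>) x = - ((of_real (\<delta> - a) - z) *\<^sub>C x - A x)" for z x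
  proof -
    have "of_real (\<delta> - a) *\<^sub>C x = - ((a - \<delta>) *\<^sub>R x)"
      unfolding scaleC_of_real by (simp add: scaleR_diff_left)
    then show ?thesis by (simp add: op_shift_def scaleC_diff_left)
  qed
  have "half_plane_resolvent D (op_shift A (a - \<delta>)) M"
  proof (rule half_plane_resolvent.intro)
    show "csubspace D" by (rule D)
    show "clinear_on D (op_shift A (a - \<delta>))"
      using A by (auto simp: clinear_on_def op_shift_def scaleR_add_right scaleC_add_right scaleC_scaleR_right)
    show "closure D = UNIV" by (rule dense)
    show "0 < M" by (rule M)
    fix z :: complex assume z: "0 < Re z"
    let ?w = "complex_of_real (\<delta> - a) - z"
    have g: "lower_bounded_resolvent_point D A (M / cmod (?w - of_real (\<delta> - a))) ?w"
      using main[of ?w] z by simp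
    have "bij_betw (uminus \<circ> (\<lambda>x. ?w *\<^sub>C x - A x)) D UNIV"
      using g by (intro bij_betw_trans[of _ _ UNIV] bij_uminus)
        (auto simp: lower_bounded_resolvent_point_def)
    then show "bij_betw (\<lambda>x. z *\<^sub>C x + op_shift A (a - \<delta>) x) D UNIV" by (simp add: o_def eq)
    fix x assume "x \<in> D"
    then have "norm x \<le> M / cmod (?w - of_real (\<delta> - a)) * norm (?w *\<^sub>C x - A x)"
      using g by (simp add: lower_bounded_resolvent_point_def)
    then show "norm x \<le> M / cmod z * norm (z *\<^sub>C x + op_shift A (a - \<delta>) x)"
      unfolding eq by (simp add: norm_minus_commute)
  qed
  then show ?thesis using that \<delta>(1) by blast
qed

lemma op_shift_op_shift: "op_shift (op_shift A b) c = op_shift A (b + c)"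
  by (auto simp: op_shift_def scaleR_add_left)

lemma semigroup_exp_I:
  assumes "c0_semigroup T" "neg_generator D L T"
  shows "c0_semigroup (semigroup_exp D L)" "neg_generator D L (semigroup_exp D L)"
  using someI[of "\<lambda>T. c0_semigroup T \<and> neg_generator D L T" T] assms by (auto simp: semigroup_exp_def)

section \<open>Negative fractional powers\<close>

lemma powr_exp_integrable:
  fixes \<beta> \<epsilon> :: real
  assumes "0 < \<beta>" "0 < \<epsilon>"
  shows "(\<lambda>t. t powr (\<beta> - 1) * exp (- (\<epsilon> * t))) integrable_on {0<..}"
proof -
  have "(\<lambda>t. complex_of_real t powr (of_real \<beta> - 1) / of_real (exp (\<epsilon> * t))) absolutely_integrable_on {0<..}"
    by (rule absolutely_integrable_Gamma_integral) (use assms in auto)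
  then have "(\<lambda>t. norm (complex_of_real t powr (of_real \<beta> - 1) / of_real (exp (\<epsilon> * t)))) integrable_on {0<..}"
    unfolding absolutely_integrable_on_def by blast
  then show ?thesis
  proof (rule integrable_eq)
    fix t :: real assume t: "t \<in> {0<..}"
    have "complex_of_real t powr (of_real \<beta> - 1) = of_real (t powr (\<beta> - 1))"
      using t powr_of_real[of t "\<beta> - 1"] by simp
    then show "norm (complex_of_real t powr (of_real \<beta> - 1) / of_real (exp (\<epsilon> * t))) = t powr (\<beta> - 1) * exp (- (\<epsilon> * t))"
      by (simp only: of_real_divide[symmetric] norm_of_real) (simp add: exp_minus divide_inverse)
  qed
qed

lemma powr_exp_integral_pos:
  fixes \<beta> \<epsilon> :: real
  assumes "0 < \<beta>" "0 < \<epsilon>"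
  shows "0 < integral {0<..} (\<lambda>t. t powr (\<beta> - 1) * exp (- (\<epsilon> * t)))"
proof -
  let ?f = "\<lambda>t. t powr (\<beta> - 1) * exp (- (\<epsilon> * t))"
  \<comment> \<open>The minimum over both end points covers either sign of
    \<open>\<beta> - 1\<close>, on which the monotonicity of the power depends.\<close>
  define m where "m = min (1 powr (\<beta> - 1)) (2 powr (\<beta> - 1)) * exp (- (\<epsilon> * 2))"
  have m: "0 < m" by (simp add: m_def)
  have i: "?f integrable_on {1..2}"
    by (rule integrable_on_greaterThan_subinterval[OF powr_exp_integrable[OF assms]]) simp
  have "m * 1 = integral {1..2::real} (\<lambda>t. m)" by simp
  also have "\<dots> \<le> integral {1..2} ?f"
  proof (rule integral_le[OF _ i])
    fix t :: real assume t: "t \<in> {1..2}"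
    have "min (1 powr (\<beta> - 1)) (2 powr (\<beta> - 1)) \<le> t powr (\<beta> - 1)"
    proof (cases "\<beta> \<ge> 1")
      case True
      have "1 powr (\<beta> - 1) \<le> t powr (\<beta> - 1)" using t True by (intro powr_mono2) auto
      then show ?thesis by (simp only: min_le_iff_disj) simp
    next
      case False
      have "2 powr (\<beta> - 1) \<le> t powr (\<beta> - 1)" using t False by (intro powr_mono2') auto
      then show ?thesis by (simp only: min_le_iff_disj) simp
    qed
    then show "m \<le> ?f t" unfolding m_def using t assms by (intro mult_mono) auto
  qed (rule integrable_const_ivl)
  also have "\<dots> \<le> integral {0<..} ?f"
    by (rule integral_subset_le) (use i powr_exp_integrable[OF assms] in auto)
  finally show ?thesis using m by simp
qed

lemma powr_exp_tendsto_zero: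
  fixes \<alpha> \<epsilon> :: real
  assumes "0 < \<alpha>" "0 < \<epsilon>"
  shows "((\<lambda>t. t powr \<alpha> * exp (- (\<epsilon> * t))) \<longlongrightarrow> 0) at_top"
    and "((\<lambda>t. t powr \<alpha> * exp (- (\<epsilon> * t))) \<longlongrightarrow> 0) (at_right 0)"
proof -
  show "((\<lambda>t. t powr \<alpha> * exp (- (\<epsilon> * t))) \<longlongrightarrow> 0) at_top" using assms by real_asymp
  show "((\<lambda>t. t powr \<alpha> * exp (- (\<epsilon> * t))) \<longlongrightarrow> 0) (at_right 0)" using assms by real_asymp
qed

text \<open>Integration by parts on truncated intervals; the boundary term vanishes at
  \<open>0\<close> because of the positive power and at infinity because of the exponential. It
  serves the semigroup and the scalar weight alike.\<close>

lemma integral_powr_by_parts: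
  fixes u v :: "real \<Rightarrow> 'b::banach"
  assumes \<alpha>: "0 < \<alpha>" and \<epsilon>: "0 < \<epsilon>"
    and u: "\<And>t. 0 < t \<Longrightarrow> (u has_vector_derivative - v t) (at t)"
    and v: "continuous_on {0<..} v"
    and ub: "\<And>t. 0 < t \<Longrightarrow> norm (u t) \<le> C * exp (- (\<epsilon> * t))"
    and vb: "\<And>t. 0 < t \<Longrightarrow> norm (v t) \<le> C * exp (- (\<epsilon> * t))"
  shows "integral {0<..} (\<lambda>t. t powr \<alpha> *\<^sub>R v t) = \<alpha> *\<^sub>R integral {0<..} (\<lambda>t. t powr (\<alpha> - 1) *\<^sub>R u t)"
proof -
  define I where "I n = {inverse (real (Suc n))..real (Suc n)}" for n
  have I0: "r > 0" if "r \<in> I n" for r n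
    using that by (auto simp: I_def intro: less_le_trans[of 0 "inverse (real (Suc n))"])
  have Ile: "inverse (real (Suc n)) \<le> real (Suc n)" for n
    by (rule order_trans[of _ 1]) (auto simp: inverse_le_1_iff)
  have uc: "continuous_on {0<..} u"
    by (auto simp: continuous_on_eq_continuous_within
        intro!: continuous_at_imp_continuous_at_within has_vector_derivative_continuous[OF u])
  have l1: "(\<lambda>n. integral (I n) (\<lambda>t. t powr \<alpha> *\<^sub>R v t)) \<longlonglongrightarrow> integral {0<..} (\<lambda>t. t powr \<alpha> *\<^sub>R v t)"
    unfolding I_def
  proof (rule integral_truncate_dominated(2))
    show "continuous_on {0<..} (\<lambda>t. t powr \<alpha> *\<^sub>R v t)"
      by (intro continuous_intros v) auto
    show "(\<lambda>t. C * (t powr ((\<alpha> + 1) - 1) * exp (- (\<epsilon> * t)))) integrable_on {0<..}"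
      by (intro integrable_on_mult_right powr_exp_integrable) (use \<alpha> \<epsilon> in auto)
    show "norm (t powr \<alpha> *\<^sub>R v t) \<le> C * (t powr ((\<alpha> + 1) - 1) * exp (- (\<epsilon> * t)))" if "0 < t" for t
      using mult_left_mono[OF vb[OF that], of "t powr \<alpha>"] by (simp add: mult_ac)
  qed
  have dom2: "continuous_on {0<..} (\<lambda>t. t powr (\<alpha> - 1) *\<^sub>R u t)"
    "(\<lambda>t. C * (t powr (\<alpha> - 1) * exp (- (\<epsilon> * t)))) integrable_on {0<..}"
    "\<And>t. 0 < t \<Longrightarrow> norm (t powr (\<alpha> - 1) *\<^sub>R u t) \<le> C * (t powr (\<alpha> - 1) * exp (- (\<epsilon> * t)))"
  proof -
    show "continuous_on {0<..} (\<lambda>t. t powr (\<alpha> - 1) *\<^sub>R u t)" by (intro continuous_intros uc) auto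
    show "(\<lambda>t. C * (t powr (\<alpha> - 1) * exp (- (\<epsilon> * t)))) integrable_on {0<..}"
      by (intro integrable_on_mult_right powr_exp_integrable \<alpha> \<epsilon>)
    show "norm (t powr (\<alpha> - 1) *\<^sub>R u t) \<le> C * (t powr (\<alpha> - 1) * exp (- (\<epsilon> * t)))" if "0 < t" for t
      using mult_left_mono[OF ub[OF that], of "t powr (\<alpha> - 1)"] by (simp add: mult_ac)
  qed
  have l2: "(\<lambda>n. integral (I n) (\<lambda>t. t powr (\<alpha> - 1) *\<^sub>R u t)) \<longlonglongrightarrow> integral {0<..} (\<lambda>t. t powr (\<alpha> - 1) *\<^sub>R u t)"
    unfolding I_def by (rule integral_truncate_dominated(2)[OF dom2(1,3,2)])
  define F where "F t = t powr \<alpha> *\<^sub>R u t" for t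
  have eq: "integral (I n) (\<lambda>t. t powr \<alpha> *\<^sub>R v t)
      = \<alpha> *\<^sub>R integral (I n) (\<lambda>t. t powr (\<alpha> - 1) *\<^sub>R u t) - (F (real (Suc n)) - F (inverse (real (Suc n))))" for n
  proof -
    have F: "(F has_vector_derivative \<alpha> *\<^sub>R (t powr (\<alpha> - 1) *\<^sub>R u t) - t powr \<alpha> *\<^sub>R v t) (at t within I n)"
      if t: "t \<in> I n" for t
    proof -
      have "((\<lambda>t. t powr \<alpha>) has_real_derivative \<alpha> * t powr (\<alpha> - 1)) (at t within I n)"
        using I0[OF t] by (auto intro!: derivative_eq_intros)
      from has_vector_derivative_scaleR[OF this has_vector_derivative_at_within[OF u[OF I0[OF t]]]]
      show ?thesis by (simp add: F_def[abs_def] algebra_simps)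
    qed
    have h1: "((\<lambda>t. \<alpha> *\<^sub>R (t powr (\<alpha> - 1) *\<^sub>R u t) - t powr \<alpha> *\<^sub>R v t) has_integral
        F (real (Suc n)) - F (inverse (real (Suc n)))) (I n)"
      unfolding I_def by (rule fundamental_theorem_of_calculus[OF Ile]) (use F in \<open>simp add: I_def\<close>)
    have h2: "((\<lambda>t. \<alpha> *\<^sub>R (t powr (\<alpha> - 1) *\<^sub>R u t)) has_integral
        \<alpha> *\<^sub>R integral (I n) (\<lambda>t. t powr (\<alpha> - 1) *\<^sub>R u t)) (I n)"
      unfolding I_def
      by (intro has_integral_cmul integrable_integral integrable_continuous_real continuous_on_subset[OF dom2(1)])
        (use I0 in \<open>auto simp: I_def\<close>)
    show ?thesis using integral_unique[OF has_integral_diff[OF h2 h1]] by simp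
  qed
  have Fb: "norm (F t) \<le> C * (t powr \<alpha> * exp (- (\<epsilon> * t)))" if "0 < t" for t
    using mult_left_mono[OF ub[OF that], of "t powr \<alpha>"] by (simp add: F_def mult_ac)
  have b1: "(\<lambda>n. F (real (Suc n))) \<longlonglongrightarrow> 0"
  proof (rule Lim_null_comparison[OF _ tendsto_mult_right_zero[where c = C]])
    show "(\<lambda>n. real (Suc n) powr \<alpha> * exp (- (\<epsilon> * real (Suc n)))) \<longlonglongrightarrow> 0"
      by (rule filterlim_compose[OF powr_exp_tendsto_zero(1)[OF \<alpha> \<epsilon>]])
        (rule filterlim_compose[OF filterlim_real_sequentially filterlim_Suc])
  qed (use Fb in auto)
  have b2: "(\<lambda>n. F (inverse (real (Suc n)))) \<longlonglongrightarrow> 0"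
  proof (rule Lim_null_comparison[OF _ tendsto_mult_right_zero[where c = C]])
    show "(\<lambda>n. inverse (real (Suc n)) powr \<alpha> * exp (- (\<epsilon> * inverse (real (Suc n))))) \<longlonglongrightarrow> 0"
      by (rule filterlim_compose[OF powr_exp_tendsto_zero(2)[OF \<alpha> \<epsilon>]])
        (use LIMSEQ_inverse_real_of_nat in \<open>auto simp: filterlim_at\<close>)
  qed (use Fb in auto)
  have "(\<lambda>n. integral (I n) (\<lambda>t. t powr \<alpha> *\<^sub>R v t)) \<longlonglongrightarrow> \<alpha> *\<^sub>R integral {0<..} (\<lambda>t. t powr (\<alpha> - 1) *\<^sub>R u t) - (0 - 0)"
    unfolding eq by (intro tendsto_diff tendsto_scaleR tendsto_const l2 b1 b2)
  then show ?thesis using LIMSEQ_unique[OF l1] by simp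
qed

text \<open>On an interval of length \<open>1 / (2 * d)\<close> starting at a zero, the maximum of
  the norm is at most half of itself and so vanishes; such intervals exhaust the half line.\<close>

lemma linear_ode_zero:
  fixes y :: "real \<Rightarrow> 'b::banach"
  assumes y: "\<And>t. 0 \<le> t \<Longrightarrow> (y has_vector_derivative y' t) (at t within {0..})"
    and bound: "\<And>t. 0 \<le> t \<Longrightarrow> norm (y' t) \<le> c * norm (y t)" and y0: "y 0 = 0" and t: "0 \<le> t"
  shows "y t = 0"
proof -
  define d where "d = \<bar>c\<bar> + 1"
  have d: "0 < d" by (simp add: d_def)
  have b: "norm (y' t) \<le> d * norm (y t)" if "0 \<le> t" for t
    by (rule order_trans[OF bound[OF that] mult_right_mono]) (auto simp: d_def)
  define h where "h = 1 / (2 * d)"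
  have h: "0 < h" using d by (simp add: h_def)
  have cont: "continuous_on {0..} y"
    using has_vector_derivative_continuous[OF y] by (auto simp: continuous_on_eq_continuous_within)
  have step: "y s = 0" if z: "0 \<le> z" "y z = 0" and s: "s \<in> {z..z + h}" for z s
  proof -
    have "continuous_on {z..z + h} (\<lambda>s. norm (y s))"
      by (intro continuous_on_norm continuous_on_subset[OF cont]) (use z in auto)
    then obtain x where x: "x \<in> {z..z + h}" "\<And>s. s \<in> {z..z + h} \<Longrightarrow> norm (y s) \<le> norm (y x)"
      using continuous_attains_sup[of "{z..z + h}" "\<lambda>s. norm (y s)"] h by auto
    have int: "(y' has_integral y x - y z) {z..x}"
      by (rule fundamental_theorem_of_calculus)
        (use x z in \<open>auto intro!: has_vector_derivative_within_subset[OF y]\<close>)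
    have "norm (y x - y z) \<le> d * norm (y x) * measure lborel {z..x}"
    proof (rule has_integral_bound_real[OF _ finite.emptyI int])
      show "0 \<le> d * norm (y x)" using d by simp
      fix s assume s: "s \<in> {z..x} - {}"
      have "norm (y' s) \<le> d * norm (y s)" using b s z by simp
      also have "\<dots> \<le> d * norm (y x)" using x s d by (intro mult_left_mono) auto
      finally show "norm (y' s) \<le> d * norm (y x)" .
    qed
    also have "\<dots> \<le> d * norm (y x) * h" using x d by (intro mult_left_mono) auto
    also have "\<dots> = norm (y x) / 2" using d by (simp add: h_def)
    finally have "norm (y x) \<le> norm (y x) / 2" using z by simp
    then show ?thesis using x(2)[OF s] by simp
  qed
  have "\<forall>s\<in>{0..real n * h}. y s = 0" for n
  proof (induction n)
    case 0
    then show ?case using y0 by simp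
  next
    case (Suc n)
    show ?case
    proof
      fix s assume s: "s \<in> {0..real (Suc n) * h}"
      show "y s = 0"
      proof (cases "s \<le> real n * h")
        case True
        then show ?thesis using Suc s by simp
      next
        case False
        have "real n * h \<ge> 0" using h by simp
        then show ?thesis using step[of "real n * h" s] Suc s False by (simp add: algebra_simps)
      qed
    qed
  qed
  moreover obtain n :: nat where "t / h \<le> real n" using real_arch_simple by blast
  ultimately show ?thesis using t h by (auto simp: field_simps)
qed

text \<open>A second order Taylor estimate in the rate. The remainder is bounded by a polynomial in
  \<open>t\<close>, so it can be multiplied with the decaying semigroup and integrated.\<close>

lemma exp_second_order_bound:
  fixes z w t :: real
  assumes "0 \<le> z" "0 \<le> w" "0 \<le> t"
  shows "\<bar>exp (- (w * t)) - exp (- (z * t)) + (w - z) * (t * exp (- (z * t)))\<bar> \<le> (w - z)\<^sup>2 * t\<^sup>2"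
proof -
  define u where "u = (w - z) * t"
  have tangent: "exp (- a) - exp (- b) \<le> (b - a) * exp (- a)" for a b :: real
  proof -
    have "exp (- a) * (1 + (a - b)) \<le> exp (- a) * exp (a - b)" by (intro mult_left_mono exp_ge_add_one_self) simp
    then show ?thesis by (simp add: exp_add[symmetric] algebra_simps)
  qed
  have lip: "exp (- a) - exp (- b) \<le> \<bar>b - a\<bar>" if "0 \<le> a" for a b :: real
  proof -
    have "(b - a) * exp (- a) \<le> \<bar>b - a\<bar> * 1" using that by (intro mult_mono) auto
    then show ?thesis using tangent[of a b] by simp
  qed
  let ?A = "exp (- (w * t))" and ?B = "exp (- (z * t))"
  have nn: "0 \<le> z * t" "0 \<le> w * t" using assms by auto
  have u: "w * t - z * t = u" by (simp add: u_def algebra_simps)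
  have 1: "0 \<le> ?A - ?B + u * ?B" using tangent[of "z * t" "w * t"] unfolding u by simp
  have 2: "?A - ?B \<le> - u * ?A" using tangent[of "w * t" "z * t"] u by (simp add: minus_diff_eq[of "w * t", symmetric])
  have "?A - ?B + u * ?B \<le> u * (?B - ?A)" using 2 by (simp add: algebra_simps)
  also have "\<dots> \<le> \<bar>u\<bar> * \<bar>?B - ?A\<bar>" by (metis abs_ge_self abs_mult)
  also have "\<dots> \<le> \<bar>u\<bar> * \<bar>u\<bar>"
    using lip[OF nn(1), of "w * t"] lip[OF nn(2), of "z * t"] u by (intro mult_left_mono) auto
  finally have "?A - ?B + u * ?B \<le> u\<^sup>2" by (simp add: power2_eq_square)
  then show ?thesis using 1 by (simp add: u_def power_mult_distrib mult_ac)
qed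

text \<open>\<open>R z\<close> is the inverse of \<open>z + L\<close> for real
  \<open>z \<ge> 0\<close>. The value \<open>z = 0\<close> is included and \<open>C\<close> is
  uniform, because the argument for injectivity moves along the whole half line starting at
  \<open>0\<close>.\<close>

locale exp_stable_semigroup =
  fixes T :: "real \<Rightarrow> 'a::complex_banach \<Rightarrow> 'a" and D :: "'a set" and L :: "'a \<Rightarrow> 'a"
    and K \<delta> C :: real and R :: "real \<Rightarrow> 'a \<Rightarrow> 'a"
  assumes c0: "c0_semigroup T" and gen: "neg_generator D L T"
    and decay: "\<And>t x. 0 \<le> t \<Longrightarrow> norm (T t x) \<le> K * exp (- (\<delta> * t)) * norm x" and \<delta>: "0 < \<delta>" and K: "0 < K"
    and R_lin: "\<And>z. 0 \<le> z \<Longrightarrow> bounded_linear (R z)" and R_norm: "\<And>z x. 0 \<le> z \<Longrightarrow> norm (R z x) \<le> C * norm x"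
    and R_in: "\<And>z x. 0 \<le> z \<Longrightarrow> R z x \<in> D" and R_eq: "\<And>z x. 0 \<le> z \<Longrightarrow> z *\<^sub>R R z x + L (R z x) = x"
    and R_comm: "\<And>z t x. 0 \<le> z \<Longrightarrow> 0 \<le> t \<Longrightarrow> T t (R z x) = R z (T t x)"
begin

text \<open>Up to a factor \<open>\<Gamma>(\<beta>)\<close>, \<open>\<Phi> \<beta> z\<close> is the power \<open>(L + z)\<^sup>-\<^sup>\<beta>\<close>.\<close>

definition \<Phi> where "\<Phi> \<beta> z x = integral {0<..} (\<lambda>t. (t powr (\<beta> - 1) * exp (- (z * t))) *\<^sub>R T t x)"

lemma orbit_continuous: "continuous_on {0<..} (\<lambda>t. T t x)"
  by (rule continuous_on_subset[OF c0_continuous_on[OF c0]]) auto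

lemma integrand_dominated:
  fixes \<beta> z :: real
  assumes \<beta>: "0 < \<beta>" and z: "0 \<le> z"
  shows "continuous_on {0<..} (\<lambda>t. (t powr (\<beta> - 1) * exp (- (z * t))) *\<^sub>R T t x)"
    and "\<And>t. 0 < t \<Longrightarrow> norm ((t powr (\<beta> - 1) * exp (- (z * t))) *\<^sub>R T t x)
        \<le> K * norm x * (t powr (\<beta> - 1) * exp (- (\<delta> * t)))"
    and "(\<lambda>t. K * norm x * (t powr (\<beta> - 1) * exp (- (\<delta> * t)))) integrable_on {0<..}"
proof -
  show "continuous_on {0<..} (\<lambda>t. (t powr (\<beta> - 1) * exp (- (z * t))) *\<^sub>R T t x)"
    by (intro continuous_intros orbit_continuous) auto
  show "(\<lambda>t. K * norm x * (t powr (\<beta> - 1) * exp (- (\<delta> * t)))) integrable_on {0<..}"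
    by (intro integrable_on_mult_right powr_exp_integrable \<beta> \<delta>)
  fix t :: real assume t: "0 < t"
  have "exp (- (z * t)) * norm (T t x) \<le> 1 * (K * exp (- (\<delta> * t)) * norm x)"
    using t z by (intro mult_mono decay) auto
  from mult_left_mono[OF this, of "t powr (\<beta> - 1)"]
  show "norm ((t powr (\<beta> - 1) * exp (- (z * t))) *\<^sub>R T t x) \<le> K * norm x * (t powr (\<beta> - 1) * exp (- (\<delta> * t)))"
    by (simp add: mult_ac)
qed

lemma \<Phi>_has_integral:
  assumes "0 < \<beta>" "0 \<le> z"
  shows "((\<lambda>t. (t powr (\<beta> - 1) * exp (- (z * t))) *\<^sub>R T t x) has_integral \<Phi> \<beta> z x) {0<..}"
  unfolding \<Phi>_def
  by (rule integrable_integral[OF integrable_dominated_continuous[OF integrand_dominated[OF assms]]])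

lemma \<Phi>_commute:
  assumes "0 < \<beta>" "0 \<le> z" and P: "bounded_linear P" and comm: "\<And>t. 0 < t \<Longrightarrow> T t (P x) = P (T t x)"
  shows "\<Phi> \<beta> z (P x) = P (\<Phi> \<beta> z x)"
proof -
  interpret bounded_linear P by (rule P)
  have "((\<lambda>t. P ((t powr (\<beta> - 1) * exp (- (z * t))) *\<^sub>R T t x)) has_integral P (\<Phi> \<beta> z x)) {0<..}"
    by (rule has_integral_linear[OF \<Phi>_has_integral[OF assms(1,2)] P, unfolded o_def])
  then have "((\<lambda>t. (t powr (\<beta> - 1) * exp (- (z * t))) *\<^sub>R T t (P x)) has_integral P (\<Phi> \<beta> z x)) {0<..}"
    by (rule has_integral_eq[rotated]) (simp add: scaleR comm)
  then show ?thesis using \<Phi>_has_integral[OF assms(1,2)] has_integral_unique by blast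
qed

lemma \<Phi>_bounded_linear:
  assumes "0 < \<beta>" "0 \<le> z"
  shows "bounded_linear (\<Phi> \<beta> z)"
proof (rule bounded_linear_intro)
  fix x y and r :: real
  have "((\<lambda>t. (t powr (\<beta> - 1) * exp (- (z * t))) *\<^sub>R T t x + (t powr (\<beta> - 1) * exp (- (z * t))) *\<^sub>R T t y)
      has_integral \<Phi> \<beta> z x + \<Phi> \<beta> z y) {0<..}"
    by (intro has_integral_add \<Phi>_has_integral assms)
  then have "((\<lambda>t. (t powr (\<beta> - 1) * exp (- (z * t))) *\<^sub>R T t (x + y)) has_integral \<Phi> \<beta> z x + \<Phi> \<beta> z y) {0<..}"
    by (rule has_integral_eq[rotated]) (simp add: linear_add[OF c0_linear[OF c0]] scaleR_add_right)
  then show "\<Phi> \<beta> z (x + y) = \<Phi> \<beta> z x + \<Phi> \<beta> z y" using \<Phi>_has_integral[OF assms] has_integral_unique by blast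
  show "\<Phi> \<beta> z (r *\<^sub>R x) = r *\<^sub>R \<Phi> \<beta> z x"
    by (rule \<Phi>_commute[OF assms bounded_linear_scaleR_right]) (simp add: linear_scale[OF c0_linear[OF c0]])
  have "norm (\<Phi> \<beta> z x) \<le> integral {0<..} (\<lambda>t. K * norm x * (t powr (\<beta> - 1) * exp (- (\<delta> * t))))"
    unfolding \<Phi>_def
    by (rule integral_norm_bound_integral[OF integrable_dominated_continuous[OF integrand_dominated[OF assms]]
          integrand_dominated(3)[OF assms]]) (use integrand_dominated(2)[OF assms] in auto)
  also have "\<dots> = norm x * (K * integral {0<..} (\<lambda>t. t powr (\<beta> - 1) * exp (- (\<delta> * t))))" by simp
  finally show "norm (\<Phi> \<beta> z x) \<le> norm x * (K * integral {0<..} (\<lambda>t. t powr (\<beta> - 1) * exp (- (\<delta> * t))))" .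
qed

text \<open>Integration by parts with the orbit of \<open>R z x\<close>: as \<open>z + L\<close>
  maps \<open>R z x\<close> to \<open>x\<close>, the derivative of its weighted orbit is minus the
  weighted orbit of \<open>x\<close>. Combined with the derivative in \<open>z\<close>, this is the
  linear differential equation used for injectivity.\<close>

lemma \<Phi>_Suc:
  assumes \<alpha>: "0 < \<alpha>" and z: "0 \<le> z"
  shows "\<Phi> (\<alpha> + 1) z x = \<alpha> *\<^sub>R R z (\<Phi> \<alpha> z x)"
proof -
  let ?u = "\<lambda>t. exp (- (z * t)) *\<^sub>R T t (R z x)" and ?v = "\<lambda>t. exp (- (z * t)) *\<^sub>R T t x"
  have "integral {0<..} (\<lambda>t. t powr \<alpha> *\<^sub>R ?v t) = \<alpha> *\<^sub>R integral {0<..} (\<lambda>t. t powr (\<alpha> - 1) *\<^sub>R ?u t)"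
  proof (rule integral_powr_by_parts[OF \<alpha> \<delta>])
    show "continuous_on {0<..} ?v" by (intro continuous_intros orbit_continuous)
    fix t :: real assume t: "0 < t"
    have dT: "((\<lambda>s. T s (R z x)) has_vector_derivative - T t (L (R z x))) (at t)"
    proof -
      have "((\<lambda>s. T s (R z x)) has_vector_derivative - T t (L (R z x))) (at t within {0<..})"
        by (rule has_vector_derivative_within_subset[OF generator_orbit(3)[OF c0 gen R_in[OF z]]]) (use t in auto)
      then show ?thesis using t by (simp add: at_within_open[of t "{0<..}"])
    qed
    have "((\<lambda>s. exp (- (z * s))) has_field_derivative - z * exp (- (z * t))) (at t)"
      by (auto intro!: derivative_eq_intros)
    from has_vector_derivative_scaleR[OF this dT]
    have "(?u has_vector_derivative - (exp (- (z * t)) *\<^sub>R (z *\<^sub>R T t (R z x) + T t (L (R z x))))) (at t)"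
      by (simp add: algebra_simps)
    moreover have "z *\<^sub>R T t (R z x) + T t (L (R z x)) = T t x"
      using t R_eq[OF z, of x] linear_add[OF c0_linear[OF c0], of t] linear_scale[OF c0_linear[OF c0], of t]
      by (metis less_imp_le)
    ultimately show "(?u has_vector_derivative - ?v t) (at t)" by simp
    have e: "norm (exp (- (z * t)) *\<^sub>R T t y) \<le> K * norm y * exp (- (\<delta> * t))" for y
    proof -
      have "exp (- (z * t)) * norm (T t y) \<le> 1 * (K * exp (- (\<delta> * t)) * norm y)"
        using t z by (intro mult_mono decay) auto
      then show ?thesis by (simp add: mult_ac)
    qed
    have "norm (?u t) \<le> K * norm (R z x) * exp (- (\<delta> * t))" by (rule e)
    also have "\<dots> \<le> K * (norm x + norm (R z x)) * exp (- (\<delta> * t))" using K by (intro mult_right_mono mult_left_mono) auto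
    finally show "norm (?u t) \<le> K * (norm x + norm (R z x)) * exp (- (\<delta> * t))" .
    have "norm (?v t) \<le> K * norm x * exp (- (\<delta> * t))" by (rule e)
    also have "\<dots> \<le> K * (norm x + norm (R z x)) * exp (- (\<delta> * t))" using K by (intro mult_right_mono mult_left_mono) auto
    finally show "norm (?v t) \<le> K * (norm x + norm (R z x)) * exp (- (\<delta> * t))" .
  qed
  then have "\<Phi> (\<alpha> + 1) z x = \<alpha> *\<^sub>R \<Phi> \<alpha> z (R z x)" by (simp add: \<Phi>_def)
  also have "\<Phi> \<alpha> z (R z x) = R z (\<Phi> \<alpha> z x)"
    by (rule \<Phi>_commute[OF \<alpha> z R_lin[OF z]]) (simp add: R_comm z)
  finally show ?thesis .
qed

text \<open>Differentiating the weight brings down a factor \<open>- t\<close>, which raises the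
  exponent by one. The remainder carries two factors \<open>t\<close> and is integrable by the decay
  of \<open>T\<close>.\<close>

lemma \<Phi>_derivative:
  assumes \<alpha>: "0 < \<alpha>" and z: "0 \<le> z"
  shows "((\<lambda>z. \<Phi> \<alpha> z x) has_vector_derivative - \<Phi> (\<alpha> + 1) z x) (at z within {0..})"
  unfolding has_vector_derivative_iff_quotient
proof -
  define B where "B = integral {0<..} (\<lambda>t. K * norm x * (t powr ((\<alpha> + 2) - 1) * exp (- (\<delta> * t))))"
  have main: "norm (\<Phi> \<alpha> w x - \<Phi> \<alpha> z x + (w - z) *\<^sub>R \<Phi> (\<alpha> + 1) z x) \<le> (w - z)\<^sup>2 * B" if w: "0 \<le> w" for w
  proof -
    let ?f = "\<lambda>t. (t powr (\<alpha> - 1) * exp (- (w * t))) *\<^sub>R T t x - (t powr (\<alpha> - 1) * exp (- (z * t))) *\<^sub>R T t x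
        + (w - z) *\<^sub>R ((t powr ((\<alpha> + 1) - 1) * exp (- (z * t))) *\<^sub>R T t x)"
    have i: "(?f has_integral \<Phi> \<alpha> w x - \<Phi> \<alpha> z x + (w - z) *\<^sub>R \<Phi> (\<alpha> + 1) z x) {0<..}"
      using \<alpha> by (intro has_integral_add has_integral_diff has_integral_cmul \<Phi>_has_integral w z) auto
    have g: "(\<lambda>t. (w - z)\<^sup>2 * (K * norm x * (t powr ((\<alpha> + 2) - 1) * exp (- (\<delta> * t))))) integrable_on {0<..}"
      using \<alpha> by (intro integrable_on_mult_right powr_exp_integrable \<delta>) auto
    have "norm (integral {0<..} ?f) \<le> integral {0<..} (\<lambda>t. (w - z)\<^sup>2 * (K * norm x * (t powr ((\<alpha> + 2) - 1) * exp (- (\<delta> * t)))))"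
    proof (rule integral_norm_bound_integral[OF _ g])
      show "?f integrable_on {0<..}" using i by blast
      fix t :: real assume "t \<in> {0<..}"
      then have t: "0 < t" by simp
      have p: "t powr \<alpha> = t powr (\<alpha> - 1) * t" "t powr (1 + \<alpha>) = t powr (\<alpha> - 1) * t\<^sup>2"
        using t powr_add[of t "\<alpha> - 1" 1] powr_add[of t "\<alpha> - 1" 2] by (simp_all add: powr_numeral add.commute)
      have "?f t = (t powr (\<alpha> - 1) * (exp (- (w * t)) - exp (- (z * t)) + (w - z) * (t * exp (- (z * t))))) *\<^sub>R T t x"
        by (simp add: p algebra_simps)
      then have "norm (?f t) = t powr (\<alpha> - 1) * (\<bar>exp (- (w * t)) - exp (- (z * t)) + (w - z) * (t * exp (- (z * t)))\<bar> * norm (T t x))"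
        by (simp add: abs_mult)
      also have "\<dots> \<le> t powr (\<alpha> - 1) * (((w - z)\<^sup>2 * t\<^sup>2) * (K * exp (- (\<delta> * t)) * norm x))"
        using t by (intro mult_left_mono mult_mono exp_second_order_bound z w decay) auto
      finally show "norm (?f t) \<le> (w - z)\<^sup>2 * (K * norm x * (t powr ((\<alpha> + 2) - 1) * exp (- (\<delta> * t))))"
        by (simp add: p mult_ac)
    qed
    then show ?thesis using integral_unique[OF i] by (simp add: B_def)
  qed
  have "((\<lambda>w. \<bar>w - z\<bar> * B) \<longlongrightarrow> \<bar>z - z\<bar> * B) (at z within {0..})" by (intro tendsto_intros)
  then have lim: "((\<lambda>w. \<bar>w - z\<bar> * B) \<longlongrightarrow> 0) (at z within {0..})" by simp
  have "((\<lambda>w. (1 / (w - z)) *\<^sub>R (\<Phi> \<alpha> w x - \<Phi> \<alpha> z x) - (- \<Phi> (\<alpha> + 1) z x)) \<longlongrightarrow> 0) (at z within {0..})"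
  proof (rule Lim_null_comparison[OF _ lim])
    have "norm ((1 / (w - z)) *\<^sub>R (\<Phi> \<alpha> w x - \<Phi> \<alpha> z x) - (- \<Phi> (\<alpha> + 1) z x)) \<le> \<bar>w - z\<bar> * B"
      if w: "0 \<le> w" "w \<noteq> z" for w
    proof -
      have "(1 / (w - z)) *\<^sub>R (\<Phi> \<alpha> w x - \<Phi> \<alpha> z x) - (- \<Phi> (\<alpha> + 1) z x)
          = (1 / (w - z)) *\<^sub>R (\<Phi> \<alpha> w x - \<Phi> \<alpha> z x + (w - z) *\<^sub>R \<Phi> (\<alpha> + 1) z x)"
        using w by (simp add: scaleR_add_right)
      also have "norm \<dots> \<le> (1 / \<bar>w - z\<bar>) * ((w - z)\<^sup>2 * B)"
        using mult_left_mono[OF main[OF w(1)], of "1 / \<bar>w - z\<bar>"] by simp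
      also have "\<dots> = \<bar>w - z\<bar> * B" using w by (simp add: power2_eq_square abs_if field_simps)
      finally show ?thesis .
    qed
    then show "\<forall>\<^sub>F w in at z within {0..}. norm ((1 / (w - z)) *\<^sub>R (\<Phi> \<alpha> w x - \<Phi> \<alpha> z x) - (- \<Phi> (\<alpha> + 1) z x)) \<le> \<bar>w - z\<bar> * B"
      by (auto simp: eventually_at_filter)
  qed
  then show "((\<lambda>w. (1 / (w - z)) *\<^sub>R (\<Phi> \<alpha> w x - \<Phi> \<alpha> z x)) \<longlongrightarrow> - \<Phi> (\<alpha> + 1) z x) (at z within {0..})"
    using LIM_zero_iff by blast
qed

text \<open>If \<open>\<Phi> \<alpha> 0 x = 0\<close>, then \<open>\<Phi> \<alpha> z x = 0\<close> for all \<open>z \<ge> 0\<close>, because \<open>z \<mapsto> \<Phi> \<alpha> z x\<close> solves a linear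
  differential equation. For large \<open>z\<close> the weight concentrates at \<open>t = 0\<close>, which forces \<open>x = 0\<close>.\<close>

lemma \<Phi>_injective:
  assumes \<alpha>: "0 < \<alpha>" and x: "\<Phi> \<alpha> 0 x = 0"
  shows "x = 0"
proof -
  have zero: "\<Phi> \<alpha> z x = 0" if z: "0 \<le> z" for z
  proof (rule linear_ode_zero[OF \<Phi>_derivative[OF \<alpha>] _ x z])
    show "norm (- \<Phi> (\<alpha> + 1) w x) \<le> (\<alpha> * C) * norm (\<Phi> \<alpha> w x)" if "0 \<le> w" for w
      using mult_left_mono[OF R_norm[OF that], of \<alpha> "\<Phi> \<alpha> w x"] \<alpha> by (simp add: \<Phi>_Suc[OF \<alpha> that])
  qed
  \<comment> \<open>\<open>G\<close> is the scalar counterpart of \<open>\<Phi>\<close>. The ratio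
    \<alpha> / z of consecutive values is the mean of \<open>t\<close> under the weight and measures
    how the weight concentrates at \<open>0\<close>.\<close>
  define G where "G \<beta> z = integral {0<..} (\<lambda>t. t powr (\<beta> - 1) * exp (- (z * t)))" for \<beta> z :: real
  have G_Suc: "G (\<alpha> + 1) z = \<alpha> / z * G \<alpha> z" if z: "0 < z" for z
  proof -
    have "integral {0<..} (\<lambda>t. t powr \<alpha> *\<^sub>R exp (- (z * t))) = \<alpha> *\<^sub>R integral {0<..} (\<lambda>t. t powr (\<alpha> - 1) *\<^sub>R (exp (- (z * t)) / z))"
    proof (rule integral_powr_by_parts[OF \<alpha> z, where C = "max 1 (1 / z)"])
      show "((\<lambda>t. exp (- (z * t)) / z) has_vector_derivative - exp (- (z * t))) (at t)" for t
        unfolding has_real_derivative_iff_has_vector_derivative[symmetric]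
        using z by (auto intro!: derivative_eq_intros)
      show "continuous_on {0<..} (\<lambda>t. exp (- (z * t)))" by (intro continuous_intros)
      have "norm (exp (- (z * t)) / z) = 1 / z * exp (- (z * t))" for t using z by simp
      also have "1 / z * exp (- (z * t)) \<le> max 1 (1 / z) * exp (- (z * t))" for t by (intro mult_right_mono) auto
      finally show "norm (exp (- (z * t)) / z) \<le> max 1 (1 / z) * exp (- (z * t))" for t .
      have "1 * exp (- (z * t)) \<le> max 1 (1 / z) * exp (- (z * t))" for t by (intro mult_right_mono) auto
      then show "norm (exp (- (z * t))) \<le> max 1 (1 / z) * exp (- (z * t))" for t by simp
    qed
    also have "(\<lambda>t. t powr (\<alpha> - 1) *\<^sub>R (exp (- (z * t)) / z)) = (\<lambda>t. (t powr (\<alpha> - 1) * exp (- (z * t))) / z)" by auto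
    finally show ?thesis by (simp add: G_def)
  qed
  have key: "norm x \<le> e + (K + 1) * norm x * \<alpha> / (\<eta> * z)"
    if \<eta>: "0 < \<eta>" and e: "\<And>t. 0 < t \<Longrightarrow> t < \<eta> \<Longrightarrow> norm (T t x - x) \<le> e" and z: "0 < z" and e0: "0 \<le> e" for e \<eta> z
  proof -
    \<comment> \<open>One bound affine in \<open>t\<close> serves all times: \<open>e\<close> is
      enough below \<open>\<eta>\<close>, and beyond it the crude bound is stretched by the factor
      \<open>t / \<eta>\<close>.\<close>
    have near: "norm (T t x - x) \<le> e + (K + 1) * norm x / \<eta> * t" if t: "0 < t" for t
    proof (cases "t < \<eta>")
      case True
      then show ?thesis using e[OF t True] t \<eta> K by (smt (verit) divide_nonneg_pos mult_nonneg_nonneg norm_ge_zero)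
    next
      case False
      have "norm (T t x) \<le> K * norm x"
      proof -
        have "K * exp (- (\<delta> * t)) * norm x \<le> K * 1 * norm x"
          using t \<delta> K by (intro mult_right_mono mult_left_mono) auto
        then show ?thesis using decay[of t x] t by simp
      qed
      then have "norm (T t x - x) \<le> (K + 1) * norm x" using norm_triangle_ineq4[of "T t x" x] by (simp add: algebra_simps)
      also have "\<dots> = (K + 1) * norm x / \<eta> * \<eta>" using \<eta> by simp
      also have "\<dots> \<le> (K + 1) * norm x / \<eta> * t" using False K \<eta> by (intro mult_left_mono) auto
      finally show ?thesis using e0 by simp
    qed
    have Gi: "(\<lambda>t. t powr (\<beta> - 1) * exp (- (z * t))) integrable_on {0<..}" if "0 < \<beta>" for \<beta>
      by (rule powr_exp_integrable[OF that z])
    have G_pos: "0 < G \<alpha> z" unfolding G_def by (rule powr_exp_integral_pos[OF \<alpha> z])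
    let ?w = "\<lambda>t. t powr (\<alpha> - 1) * exp (- (z * t))"
    have "((\<lambda>t. ?w t *\<^sub>R x) has_integral G \<alpha> z *\<^sub>R x) {0<..}"
      unfolding G_def using has_integral_linear[OF integrable_integral[OF Gi[OF \<alpha>]] bounded_linear_scaleR_left]
      by (simp add: o_def)
    \<comment> \<open>As \<open>\<Phi> \<alpha> z x\<close> vanishes, the weighted integral of
      \<open>T t x - x\<close> is minus the total weight times \<open>x\<close>.\<close>
    from has_integral_diff[OF \<Phi>_has_integral[OF \<alpha> less_imp_le[OF z], of x] this]
    have i: "((\<lambda>t. ?w t *\<^sub>R (T t x - x)) has_integral - (G \<alpha> z *\<^sub>R x)) {0<..}"
      using zero z by (simp add: scaleR_diff_right)
    define B where "B = (K + 1) * norm x / \<eta>"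
    have j: "((\<lambda>t. e * ?w t + B * (t powr ((\<alpha> + 1) - 1) * exp (- (z * t)))) has_integral
        e * G \<alpha> z + B * G (\<alpha> + 1) z) {0<..}"
      unfolding G_def using \<alpha> by (intro has_integral_add has_integral_mult_right integrable_integral Gi) auto
    have "norm (- (G \<alpha> z *\<^sub>R x)) \<le> e * G \<alpha> z + B * G (\<alpha> + 1) z"
      unfolding integral_unique[OF i, symmetric] integral_unique[OF j, symmetric]
    proof (rule integral_norm_bound_integral)
      fix t :: real assume "t \<in> {0<..}"
      then have t: "0 < t" by simp
      have p: "t powr \<alpha> = t powr (\<alpha> - 1) * t" using t powr_add[of t "\<alpha> - 1" 1] by simp
      have "norm (?w t *\<^sub>R (T t x - x)) = ?w t * norm (T t x - x)" by simp
      also have "\<dots> \<le> ?w t * (e + B * t)" using near[OF t] by (intro mult_left_mono) (auto simp: B_def)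
      finally show "norm (?w t *\<^sub>R (T t x - x)) \<le> e * ?w t + B * (t powr ((\<alpha> + 1) - 1) * exp (- (z * t)))"
        by (simp add: p algebra_simps)
    qed (use i j in auto)
    then have "G \<alpha> z * norm x \<le> G \<alpha> z * (e + B * (\<alpha> / z))"
      using G_pos unfolding G_Suc[OF z] by (simp add: algebra_simps abs_of_pos)
    then have "norm x \<le> e + B * (\<alpha> / z)" using G_pos by (simp only: mult_le_cancel_left_pos)
    then show ?thesis by (simp add: B_def)
  qed
  have "norm x \<le> e" if e: "0 < e" for e
  proof -
    have "\<forall>\<^sub>F t in at_right 0. dist (T t x) x < e" by (rule tendstoD[OF c0_right[OF c0] e])
    then obtain \<eta> where \<eta>: "0 < \<eta>" "\<And>t. 0 < t \<Longrightarrow> t < \<eta> \<Longrightarrow> norm (T t x - x) \<le> e"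
      unfolding eventually_at_right_field by (auto simp: dist_norm less_imp_le)
    have "((\<lambda>z. e + (K + 1) * norm x * \<alpha> / \<eta> * inverse z) \<longlongrightarrow> e + (K + 1) * norm x * \<alpha> / \<eta> * 0) at_top"
      by (intro tendsto_intros tendsto_inverse_0_at_top filterlim_ident)
    then have "((\<lambda>z. e + (K + 1) * norm x * \<alpha> / (\<eta> * z)) \<longlongrightarrow> e) at_top" by (simp add: divide_inverse mult_ac)
    then show ?thesis
      by (rule tendsto_lowerbound)
        (use key[OF \<eta>] e in \<open>auto intro!: eventually_mono[OF eventually_gt_at_top[of 0]]\<close>)
  qed
  then show ?thesis by (metis dense_ge_bounded field_lbound_gt_zero leD norm_ge_zero zero_less_norm_iff)
qed

end

section \<open>Finite dimensional invariant subspaces\<close>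

text \<open>Both claims are proved in one induction over \<open>B\<close>: once
  \<open>span B\<close> is closed, a new vector \<open>b\<close> has positive distance
  \<open>d\<close> from it, so the norm controls the coefficient of \<open>b\<close>. This makes the
  coefficients of a convergent sequence Cauchy and linear maps bounded.\<close>

lemma finite_span_closed_and_bounded:
  fixes B :: "'a::banach set"
  assumes "finite B"
  shows "closed (span B)"
    and "\<And>g :: 'a \<Rightarrow> 'b::real_normed_vector. (\<And>x y. x \<in> span B \<Longrightarrow> y \<in> span B \<Longrightarrow> g (x + y) = g x + g y) \<Longrightarrow>
      (\<And>r x. x \<in> span B \<Longrightarrow> g (r *\<^sub>R x) = r *\<^sub>R g x) \<Longrightarrow> \<exists>C\<ge>0. \<forall>x\<in>span B. norm (g x) \<le> C * norm x"
proof -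
  define lin where "lin g B \<longleftrightarrow> (\<forall>x\<in>span B. \<forall>y\<in>span B. g (x + y) = g x + g y) \<and>
      (\<forall>r. \<forall>x\<in>span B. g (r *\<^sub>R x) = r *\<^sub>R g x)" for g :: "'a \<Rightarrow> 'b" and B
  have "closed (span B) \<and> (\<forall>g. lin g B \<longrightarrow> (\<exists>C\<ge>0. \<forall>x\<in>span B. norm (g x) \<le> C * norm x))"
    using assms
  proof (induction B)
    case empty
    have "g 0 = 0" if "lin g {}" for g :: "'a \<Rightarrow> 'b"
      using that unfolding lin_def by (metis insertI1 scaleR_zero_left span_empty)
    then show ?case by auto
  next
    case (insert b B)
    show ?case
    proof (cases "b \<in> span B")
      case True
      then have "span (insert b B) = span B" by (rule span_redundant)
      then show ?thesis using insert by (simp add: lin_def)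
    next
      case False
      define d where "d = infdist b (span B)"
      have ne: "span B \<noteq> {}" using span_zero by blast
      have d: "0 < d"
        unfolding d_def using False insert.IH ne
        by (auto simp: in_closed_iff_infdist_zero less_le infdist_nonneg)
      have coeff: "\<bar>c\<bar> * d \<le> norm (c *\<^sub>R b + v)" if v: "v \<in> span B" for c v
      proof (cases "c = 0")
        case False
        have "- (inverse c *\<^sub>R v) \<in> span B" using v by (intro span_neg span_scale)
        then have "d \<le> dist b (- (inverse c *\<^sub>R v))" unfolding d_def by (rule infdist_le)
        then have "\<bar>c\<bar> * d \<le> \<bar>c\<bar> * norm (b + inverse c *\<^sub>R v)" by (intro mult_left_mono) (auto simp: dist_norm)
        also have "\<dots> = norm (c *\<^sub>R (b + inverse c *\<^sub>R v))" by simp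
        also have "c *\<^sub>R (b + inverse c *\<^sub>R v) = c *\<^sub>R b + v" using False by (simp add: scaleR_add_right)
        finally show ?thesis .
      qed simp
      have dec: "\<exists>c. x - c *\<^sub>R b \<in> span B" if "x \<in> span (insert b B)" for x
        using that by (simp add: span_breakdown_eq)
      have "closed (span (insert b B))"
        unfolding closed_sequential_limits
      proof (intro allI impI, elim conjE)
        fix x l assume x: "\<forall>n. x n \<in> span (insert b B)" and l: "x \<longlonglongrightarrow> l"
        then have "\<forall>n. \<exists>c. x n - c *\<^sub>R b \<in> span B" using dec by blast
        from choice[OF this] obtain c where c: "\<And>n. x n - c n *\<^sub>R b \<in> span B" by blast
        have "Cauchy c"
        proof (rule CauchyI)
          fix e :: real assume "0 < e"
          then have "0 < e * d" using d by simp
          then obtain N where N: "\<And>m n. m \<ge> N \<Longrightarrow> n \<ge> N \<Longrightarrow> norm (x m - x n) < e * d"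
            using CauchyD[OF LIMSEQ_imp_Cauchy[OF l]] by blast
          have "norm (c m - c n) < e" if "m \<ge> N" "n \<ge> N" for m n
          proof -
            have "\<bar>c m - c n\<bar> * d \<le> norm ((c m - c n) *\<^sub>R b + ((x m - c m *\<^sub>R b) - (x n - c n *\<^sub>R b)))"
              by (rule coeff[OF span_diff[OF c c]])
            also have "(c m - c n) *\<^sub>R b + ((x m - c m *\<^sub>R b) - (x n - c n *\<^sub>R b)) = x m - x n"
              by (simp add: algebra_simps)
            finally have "\<bar>c m - c n\<bar> * d < e * d" using N[OF that] by simp
            then show ?thesis using d by simp
          qed
          then show "\<exists>N. \<forall>m\<ge>N. \<forall>n\<ge>N. norm (c m - c n) < e" by blast
        qed
        then obtain c0 where c0: "c \<longlonglongrightarrow> c0" using Cauchy_convergent_iff convergent_def by blast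
        have "(\<lambda>n. x n - c n *\<^sub>R b) \<longlonglongrightarrow> l - c0 *\<^sub>R b" by (intro tendsto_intros l c0)
        then have "l - c0 *\<^sub>R b \<in> span B"
          using insert.IH by (intro closed_sequentially[OF _ c]) auto
        then show "l \<in> span (insert b B)" by (auto simp: span_breakdown_eq)
      qed
      moreover have "\<exists>C\<ge>0. \<forall>x\<in>span (insert b B). norm (g x) \<le> C * norm x" if g: "lin g (insert b B)" for g
      proof -
        have sub: "span B \<subseteq> span (insert b B)" by (intro span_mono) auto
        have "lin g B" using g sub unfolding lin_def by blast
        then obtain C where C: "0 \<le> C" "\<And>x. x \<in> span B \<Longrightarrow> norm (g x) \<le> C * norm x" using insert.IH by blast
        have "norm (g x) \<le> (norm (g b) / d + C * (1 + norm b / d)) * norm x" if x: "x \<in> span (insert b B)" for x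
        proof -
          obtain c where c: "x - c *\<^sub>R b \<in> span B" using dec[OF x] by blast
          have b: "b \<in> span (insert b B)" by (simp add: span_base)
          have "g x = g (c *\<^sub>R b + (x - c *\<^sub>R b))" by simp
          also have "\<dots> = g (c *\<^sub>R b) + g (x - c *\<^sub>R b)"
          proof -
            have "c *\<^sub>R b \<in> span (insert b B)" "x - c *\<^sub>R b \<in> span (insert b B)"
              using span_scale[OF b] c sub by blast+
            then show ?thesis using g unfolding lin_def by blast
          qed
          also have "g (c *\<^sub>R b) = c *\<^sub>R g b" using g b unfolding lin_def by blast
          finally have gx: "norm (g x) \<le> \<bar>c\<bar> * norm (g b) + C * norm (x - c *\<^sub>R b)"
            using C(2)[OF c] norm_triangle_ineq[of "c *\<^sub>R g b" "g (x - c *\<^sub>R b)"] by simp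
          have c1: "\<bar>c\<bar> \<le> norm x / d" using coeff[OF c, of c] d by (simp add: field_simps)
          have "norm (x - c *\<^sub>R b) \<le> norm x + \<bar>c\<bar> * norm b" using norm_triangle_ineq4[of x "c *\<^sub>R b"] by simp
          also have "\<dots> \<le> norm x + norm x / d * norm b" using c1 by (intro add_left_mono mult_right_mono) auto
          finally have "C * norm (x - c *\<^sub>R b) \<le> C * (norm x + norm x / d * norm b)" using C(1) by (rule mult_left_mono)
          moreover have "\<bar>c\<bar> * norm (g b) \<le> norm x / d * norm (g b)" using c1 by (intro mult_right_mono) auto
          ultimately show ?thesis using gx by (simp add: algebra_simps)
        qed
        moreover have "0 \<le> norm (g b) / d + C * (1 + norm b / d)" using d C by simp
        ultimately show ?thesis by blast
      qed
      ultimately show ?thesis by blast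
    qed
  qed
  note main = this
  show "closed (span B)" by (rule conjunct1[OF main])
  fix g :: "'a \<Rightarrow> 'b"
  assume "\<And>x y. x \<in> span B \<Longrightarrow> y \<in> span B \<Longrightarrow> g (x + y) = g x + g y"
    and "\<And>r x. x \<in> span B \<Longrightarrow> g (r *\<^sub>R x) = r *\<^sub>R g x"
  then have "lin g B" unfolding lin_def by blast
  then show "\<exists>C\<ge>0. \<forall>x\<in>span B. norm (g x) \<le> C * norm x" using main by blast
qed

lemma finite_dim_subspace_eq_span:
  assumes "finite_dim V" "subspace V"
  obtains B where "finite B" "V = span B"
proof -
  obtain B0 where B0: "finite B0" "V \<subseteq> span B0" using assms by (auto simp: finite_dim_def)
  obtain B where B: "B \<subseteq> V" "independent B" "V \<subseteq> span B" by (rule maximal_independent_subset)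
  have "finite B" using independent_span_bound[OF B0(1) B(2)] B(1) B0(2) by blast
  moreover have "V = span B" using B span_minimal[OF B(1) assms(2)] by blast
  ultimately show ?thesis using that by blast
qed

text \<open>In the application \<open>S\<close> is unbounded with arbitrary values off its domain,
  so every condition evaluates it on the range of \<open>P\<close> only. \<open>U\<close> is the
  exponential group after projection; it acts on the whole space and is \<open>P\<close>, not the
  identity, at time \<open>0\<close>.\<close>

locale bounded_part =
  fixes P S :: "'a::complex_banach \<Rightarrow> 'a" and C :: real
  assumes P: "bounded_linear P" and PP: "P (P x) = P x" and inv: "P (S (P x)) = S (P x)"
    and add: "S (P x + P y) = S (P x) + S (P y)" and scale: "S (r *\<^sub>R P x) = r *\<^sub>R S (P x)"
    and bound: "norm (S (P x)) \<le> C * norm (P x)" and C: "0 \<le> C"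
begin

definition a where "a t n x = ((- t) ^ n / fact n) *\<^sub>R (S ^^ n) (P x)"
definition U where "U t x = group_exp S t (P x)"

lemma U_eq: "U t x = (\<Sum>n. a t n x)" by (simp add: U_def group_exp_def a_def)

lemma P_simps: "P (x + y) = P x + P y" "P (x - y) = P x - P y" "P (r *\<^sub>R x) = r *\<^sub>R P x" "P 0 = 0"
  using P by (simp_all add: linear_simps)

lemma pow_inv: "P ((S ^^ n) (P x)) = (S ^^ n) (P x)"
proof (induction n)
  case (Suc n)
  then show ?case using inv[of "(S ^^ n) (P x)"] by simp
qed (simp add: PP)

lemma S_fix: "P u = u \<Longrightarrow> P v = v \<Longrightarrow> S (u + v) = S u + S v" "P u = u \<Longrightarrow> S (r *\<^sub>R u) = r *\<^sub>R S u"
  "P u = u \<Longrightarrow> norm (S u) \<le> C * norm u" "P u = u \<Longrightarrow> P (S u) = S u"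
  using add[of u v] scale[of r u] bound[of u] inv[of u] by auto

lemma pow_add: "(S ^^ n) (P (x + y)) = (S ^^ n) (P x) + (S ^^ n) (P y)"
  by (induction n) (simp_all add: P_simps S_fix pow_inv)

lemma pow_scale: "(S ^^ n) (P (r *\<^sub>R x)) = r *\<^sub>R (S ^^ n) (P x)"
  by (induction n) (simp_all add: P_simps S_fix pow_inv)

lemma pow_norm: "norm ((S ^^ n) (P x)) \<le> C ^ n * norm (P x)"
proof (induction n)
  case (Suc n)
  have "norm ((S ^^ Suc n) (P x)) \<le> C * norm ((S ^^ n) (P x))" using S_fix(3)[OF pow_inv] by simp
  also have "\<dots> \<le> C * (C ^ n * norm (P x))" by (rule mult_left_mono[OF Suc C])
  finally show ?case by (simp add: mult.assoc)
qed simp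

lemma a_norm:
  assumes "\<bar>t\<bar> \<le> N"
  shows "norm (a t n x) \<le> (N * C) ^ n /\<^sub>R fact n * norm (P x)"
proof -
  have N: "0 \<le> N" using assms by simp
  have "norm (a t n x) = \<bar>t\<bar> ^ n / fact n * norm ((S ^^ n) (P x))"
    by (simp add: a_def power_abs)
  also have "\<dots> \<le> N ^ n / fact n * (C ^ n * norm (P x))"
    using assms N C by (intro mult_mono pow_norm divide_right_mono power_mono) auto
  finally show ?thesis by (simp add: power_mult_distrib divide_inverse mult_ac)
qed

lemma a_summable_bound: "summable (\<lambda>n. (N * C) ^ n /\<^sub>R fact n * norm (P x))"
  by (rule summable_mult2) (rule summable_exp_generic)

lemma a_summable: "summable (\<lambda>n. a t n x)"
  by (rule summable_comparison_test'[OF a_summable_bound, of 0]) (rule a_norm[OF order_refl])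

lemma U_add: "U t (x + y) = U t x + U t y" and U_scale: "U t (r *\<^sub>R x) = r *\<^sub>R U t x"
proof -
  have "a t n (x + y) = a t n x + a t n y" "a t n (r *\<^sub>R x) = r *\<^sub>R a t n x" for n
    by (simp_all add: a_def pow_add pow_scale scaleR_add_right)
  then show "U t (x + y) = U t x + U t y" "U t (r *\<^sub>R x) = r *\<^sub>R U t x"
    by (simp_all add: U_eq suminf_add[OF a_summable a_summable] suminf_scaleR_right[OF a_summable])
qed

lemma U_norm:
  assumes "\<bar>t\<bar> \<le> N"
  shows "norm (U t x) \<le> exp (N * C) * norm (P x)"
proof -
  have "norm (U t x) \<le> (\<Sum>n. (N * C) ^ n /\<^sub>R fact n * norm (P x))"
    unfolding U_eq by (rule norm_suminf_le[OF a_norm[OF assms] a_summable_bound])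
  also have "\<dots> = exp (N * C) * norm (P x)"
    unfolding exp_def by (rule suminf_mult2[symmetric, OF summable_exp_generic])
  finally show ?thesis .
qed

lemma U_bl: "bounded_linear (U t)"
proof -
  obtain B where B: "\<And>x. norm (P x) \<le> norm x * B" "0 < B" using bounded_linear.pos_bounded[OF P] by blast
  show ?thesis
  proof (rule bounded_linear_intro[where K = "B * exp (\<bar>t\<bar> * C)"])
    fix x
    have "exp (\<bar>t\<bar> * C) * norm (P x) \<le> exp (\<bar>t\<bar> * C) * (norm x * B)" by (intro mult_left_mono B) simp
    then show "norm (U t x) \<le> norm x * (B * exp (\<bar>t\<bar> * C))" using order_trans[OF U_norm[of t "\<bar>t\<bar>" x]] by (simp add: mult_ac)
  qed (simp_all add: U_add U_scale)
qed

lemma U_zero: "U 0 x = P x"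
proof -
  have "U 0 x = (\<Sum>n. if n = 0 then P x else 0)" unfolding U_eq by (rule suminf_cong) (simp add: a_def)
  then show ?thesis using suminf_finite[of "{0}" "\<lambda>n. if n = 0 then P x else 0"] by simp
qed

lemma P_U: "P (U t x) = U t x"
  unfolding U_eq using bounded_linear.suminf[OF P a_summable] by (simp add: a_def P_simps pow_inv)

lemma U_P: "U t (P x) = U t x" by (simp add: U_def PP)

text \<open>\<open>S\<close> after \<open>P\<close> is bounded and linear, so it may be interchanged
  with the exponential series.\<close>

lemma S_U: "S (U t x) = U t (S (P x))"
proof -
  obtain B where B: "\<And>x. norm (P x) \<le> norm x * B" using bounded_linear.bounded[OF P] by blast
  have bl: "bounded_linear (\<lambda>x. S (P x))"
  proof (rule bounded_linear_intro)
    show "norm (S (P x)) \<le> norm x * (B * C)" for x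
      using order_trans[OF bound mult_left_mono[OF B C]] by (simp add: mult_ac)
  qed (simp_all add: P_simps add scale)
  have "S (P (a t n x)) = a t n (S (P x))" for n
    by (simp add: a_def P_simps(3) pow_inv S_fix(2) inv funpow_swap1)
  then show ?thesis
    using bounded_linear.suminf[OF bl a_summable, of t x] P_U[of t x] by (simp add: U_eq[symmetric])
qed

lemma U_derivative: "((\<lambda>t. U t x) has_vector_derivative - S (U t x)) (at t)"
proof -
  define N where "N = \<bar>t\<bar> + 1"
  let ?I = "{-N<..<N}"
  \<comment> \<open>The derivative of the \<open>n\<close>th term is minus the term of index
    \<open>n - 1\<close> at \<open>S (P x)\<close>, and \<open>0\<close> for \<open>n = 0\<close>;
    hence the partial sums of the derivative series are shifted by one.\<close>
  define b where "b s n = (case n of 0 \<Rightarrow> 0 | Suc m \<Rightarrow> - a s m (S (P x)))" for s n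
  have der: "((\<lambda>s. a s n x) has_derivative (\<lambda>h. h *\<^sub>R b s n)) (at s within ?I)" for s n
  proof -
    have c: "((\<lambda>s. (- s) ^ n / fact n) has_real_derivative - (n * (- s) ^ (n - 1)) / fact n) (at s within ?I)"
      by (auto intro!: derivative_eq_intros)
    have h1: "((\<lambda>s. a s n x) has_vector_derivative (- (n * (- s) ^ (n - 1)) / fact n) *\<^sub>R (S ^^ n) (P x)) (at s within ?I)"
      unfolding a_def using has_vector_derivative_scaleR[OF c has_vector_derivative_const] by simp
    have h2: "(- (n * (- s) ^ (n - 1)) / fact n) *\<^sub>R (S ^^ n) (P x) = b s n"
    proof (cases n)
      case (Suc m)
      have "- (real (Suc m) * (- s) ^ m) / fact (Suc m) = - ((- s) ^ m / fact m)"
        by (simp del: of_nat_Suc)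
      moreover have "(S ^^ Suc m) (P x) = (S ^^ m) (P (S (P x)))" by (simp add: inv funpow_swap1)
      ultimately show ?thesis unfolding Suc by (simp add: b_def a_def del: funpow.simps fact_Suc of_nat_Suc)
    qed (simp add: b_def)
    show ?thesis using h1 unfolding h2 has_vector_derivative_def .
  qed
  have sums_b: "(\<Sum>n<Suc k. b s n) = - (\<Sum>n<k. a s n (S (P x)))" for s k
    unfolding sum.lessThan_Suc_shift by (simp add: b_def sum_negf)
  have unif: "uniform_limit ?I (\<lambda>k s. \<Sum>n<k. a s n (S (P x))) (\<lambda>s. U s (S (P x))) sequentially"
    unfolding U_eq by (rule Weierstrass_m_test[OF a_norm[where N = N] a_summable_bound]) auto
  have "\<exists>g. \<forall>s\<in>?I. (\<lambda>n. a s n x) sums (g s) \<and> (g has_derivative (\<lambda>h. h *\<^sub>R - U s (S (P x)))) (at s within ?I)"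
  proof (rule has_derivative_series[OF _ der _ _ summable_sums[OF a_summable, of t]])
    fix e :: real assume e: "0 < e"
    from uniform_limitD[OF unif e]
    have "\<forall>\<^sub>F k in sequentially. \<forall>s\<in>?I. norm ((\<Sum>n<k. a s n (S (P x))) - U s (S (P x))) < e"
      by (simp add: dist_norm)
    then have "\<forall>\<^sub>F k in sequentially. \<forall>s\<in>?I. \<forall>h. norm ((\<Sum>n<Suc k. h *\<^sub>R b s n) - h *\<^sub>R - U s (S (P x))) \<le> e * norm h"
    proof eventually_elim
      case (elim k)
      show ?case
      proof (intro ballI allI)
        fix s h assume s: "s \<in> ?I"
        have "(\<Sum>n<Suc k. h *\<^sub>R b s n) - h *\<^sub>R - U s (S (P x))
            = - (h *\<^sub>R ((\<Sum>n<k. a s n (S (P x))) - U s (S (P x))))"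
          by (simp only: scaleR_sum_right[symmetric] sums_b) (simp add: scaleR_diff_right)
        also have "norm \<dots> \<le> e * norm h"
          using mult_left_mono[OF less_imp_le[OF elim[rule_format, OF s]], of "\<bar>h\<bar>"] by (simp add: mult.commute)
        finally show "norm ((\<Sum>n<Suc k. h *\<^sub>R b s n) - h *\<^sub>R - U s (S (P x))) \<le> e * norm h" .
      qed
    qed
    then show "\<forall>\<^sub>F k in sequentially. \<forall>s\<in>?I. \<forall>h. norm ((\<Sum>n<k. h *\<^sub>R b s n) - h *\<^sub>R - U s (S (P x))) \<le> e * norm h"
      using eventually_sequentially_Suc[of "\<lambda>k. \<forall>s\<in>?I. \<forall>h. norm ((\<Sum>n<k. h *\<^sub>R b s n) - h *\<^sub>R - U s (S (P x))) \<le> e * norm h"]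
      by simp
  next
    show "t \<in> ?I" by (auto simp: N_def)
  qed simp
  then obtain g where g: "\<And>s. s \<in> ?I \<Longrightarrow> (\<lambda>n. a s n x) sums (g s)"
    "\<And>s. s \<in> ?I \<Longrightarrow> (g has_derivative (\<lambda>h. h *\<^sub>R - U s (S (P x)))) (at s within ?I)" by blast
  have t: "t \<in> ?I" by (auto simp: N_def)
  have "(g has_vector_derivative - U t (S (P x))) (at t)"
    using g(2)[OF t] t by (simp add: has_vector_derivative_def at_within_open[of t ?I])
  then have "((\<lambda>t. U t x) has_vector_derivative - U t (S (P x))) (at t)"
    by (rule has_vector_derivative_transform_within_open[where S = ?I])
      (use t sums_unique[OF g(1)] in \<open>auto simp: U_eq\<close>)
  then show ?thesis by (simp add: S_U)
qed

lemma U_continuous_on: "continuous_on I (\<lambda>t. U t x)"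
  using has_vector_derivative_continuous[OF U_derivative] continuous_at_imp_continuous_on by blast

text \<open>\<open>U (s + t - r) (U r x)\<close> is constant in \<open>r\<close>; comparing
  \<open>r = 0\<close> with \<open>r = t\<close> gives the group law without multiplying
  series.\<close>

lemma U_group: "U (s + t) x = U s (U t x)"
proof -
  define N where "N = \<bar>s\<bar> + \<bar>t\<bar>"
  let ?I = "{-N..N}"
  obtain B where B: "\<And>x. norm (P x) \<le> norm x * B" "0 < B" using bounded_linear.pos_bounded[OF P] by blast
  have d: "((\<lambda>r. U (s + t - r) (U r x)) has_vector_derivative 0) (at r within ?I)" if r: "r \<in> ?I" for r
  proof -
    have "((\<lambda>r. U (s + t - r) (U r x)) has_vector_derivative S (U (s + t - r) (U r x)) + U (s + t - r) (- S (U r x)))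
        (at r within ?I)"
    proof (rule has_vector_derivative_operator_apply[OF U_bl _ _ _ has_vector_derivative_at_within[OF U_derivative] r])
      fix q v assume q: "q \<in> ?I"
      have "norm (U (s + t - q) v) \<le> exp ((2 * N) * C) * norm (P v)"
        by (rule U_norm) (use q in \<open>auto simp: N_def\<close>)
      also have "\<dots> \<le> exp ((2 * N) * C) * (norm v * B)" by (intro mult_left_mono B) simp
      finally show "norm (U (s + t - q) v) \<le> (exp ((2 * N) * C) * B) * norm v" by (simp add: mult_ac)
    next
      fix v
      have "continuous_on ?I (\<lambda>q. U (s + t - q) v)"
        by (rule continuous_on_compose2[OF U_continuous_on[of UNIV]]) (auto intro!: continuous_intros)
      then show "((\<lambda>q. U (s + t - q) v) \<longlongrightarrow> U (s + t - r) v) (at r within ?I)"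
        using r by (auto simp: continuous_on_def)
    next
      have m: "((\<lambda>q. s + t - q) has_vector_derivative -1) (at r within ?I)"
        by (auto intro!: derivative_eq_intros)
      from vector_diff_chain_within[OF m has_vector_derivative_at_within[OF U_derivative]]
      show "((\<lambda>q. U (s + t - q) (U r x)) has_vector_derivative S (U (s + t - r) (U r x))) (at r within ?I)"
        by (simp add: o_def)
    qed
    moreover have "S (U (s + t - r) (U r x)) + U (s + t - r) (- S (U r x)) = 0"
      by (simp add: linear_simps[OF U_bl] S_U P_U)
    ultimately show ?thesis by simp
  qed
  obtain c where "\<And>r. r \<in> ?I \<Longrightarrow> U (s + t - r) (U r x) = c"
    using has_vector_derivative_zero_constant[OF convex_real_interval(5)[of "-N" N] d] by blast
  moreover have "0 \<in> ?I" "t \<in> ?I" by (auto simp: N_def)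
  ultimately have "U (s + t - 0) (U 0 x) = U (s + t - t) (U t x)" by metis
  then show ?thesis by (simp add: U_zero U_P)
qed

end

text \<open>The group orbit stays in the range of \<open>P\<close>, hence in the domain, and solves
  the Cauchy problem of the semigroup.\<close>

lemma bounded_part_semigroup:
  fixes T :: "real \<Rightarrow> 'a::complex_banach \<Rightarrow> 'a"
  assumes T: "c0_semigroup T" "neg_generator D S T" and part: "bounded_part P S C"
    and D: "range P \<subseteq> D" and t: "0 \<le> t"
  shows "T t (P x) = bounded_part.U P S t x"
proof -
  interpret bounded_part P S C by (rule part)
  have "U t x = T t (U 0 x)"
  proof (rule cauchy_problem_unique[OF T t])
    show "U s x \<in> D" for s using D P_U[of s x] by (metis rangeI subsetD)
    show "((\<lambda>t. U t x) has_vector_derivative - S (U s x)) (at s within {0..t})" for s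
      by (rule has_vector_derivative_at_within[OF U_derivative])
  qed
  then show ?thesis by (simp add: U_zero)
qed

text \<open>The image of \<open>D\<close> under \<open>P\<close> is finite dimensional, hence
  closed, and it is dense in the range of \<open>P\<close> because \<open>D\<close> is dense. So it
  is the whole range, and it lies in \<open>D\<close>.\<close>

lemma finite_dim_range_subset_domain:
  assumes P: "bounded_clinear P" and fd: "finite_dim (range P)" and D: "csubspace D" "closure D = UNIV"
    and inv: "\<And>x. x \<in> D \<Longrightarrow> P x \<in> D"
  shows "range P \<subseteq> D"
proof -
  have bl: "bounded_linear P" using P by (rule bounded_clinear_bounded_linear)
  have sub: "subspace D"
    using D(1) csubspace_scaleR[OF D(1)] by (auto simp: subspace_def csubspace_def)
  have "subspace (P ` D)" by (rule linear_subspace_image[OF bounded_linear.linear[OF bl] sub])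
  moreover have "finite_dim (P ` D)" using fd unfolding finite_dim_def by blast
  ultimately obtain B where "finite B" "P ` D = span B" using finite_dim_subspace_eq_span by blast
  then have "closed (P ` D)" using finite_span_closed_and_bounded(1) by metis
  moreover have "P ` closure D \<subseteq> closure (P ` D)"
    by (rule closure_bounded_linear_image_subset[OF bl])
  ultimately show ?thesis using D(2) inv by auto
qed

lemma finite_dim_bounded_part:
  assumes P: "bounded_clinear P" and PP: "\<And>x. P (P x) = P x" and fd: "finite_dim (range P)"
    and D: "csubspace D" "range P \<subseteq> D" and A: "clinear_on D A"
    and inv: "\<And>x. x \<in> D \<Longrightarrow> A (P x) = P (A x)"
  obtains C where "bounded_part P (op_shift A c) C"
proof -
  have bl: "bounded_linear P" using P by (rule bounded_clinear_bounded_linear)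
  let ?S = "op_shift A c"
  have PD: "P x \<in> D" for x using D by blast
  have S: "?S (P x + P y) = ?S (P x) + ?S (P y)" "?S (r *\<^sub>R P x) = r *\<^sub>R ?S (P x)" for x y r
    using A PD clinear_on_scaleR[OF A PD] by (auto simp: op_shift_def clinear_on_def scaleR_add_right)
  have "subspace (range P)" by (rule linear_subspace_image[OF bounded_linear.linear[OF bl] subspace_UNIV])
  then obtain B where B: "finite B" "range P = span B" using fd finite_dim_subspace_eq_span by blast
  have "\<exists>C\<ge>0. \<forall>x\<in>span B. norm (?S x) \<le> C * norm x"
    by (rule finite_span_closed_and_bounded(2)[OF B(1)]) (use S B(2)[symmetric] in auto)
  then obtain C where C: "0 \<le> C" "\<And>x. x \<in> range P \<Longrightarrow> norm (?S x) \<le> C * norm x" unfolding B(2) by blast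
  have "bounded_part P ?S C"
  proof (rule bounded_part.intro)
    show "P (?S (P x)) = ?S (P x)" for x
      using inv[OF PD, of x] by (simp add: op_shift_def PP linear_simps[OF bl])
  qed (use bl PP S C in auto)
  then show ?thesis by (rule that)
qed

section \<open>Convolution integrals and the Lyapunov--Perron operator\<close>

lemma has_integral_UNIV_translate:
  fixes f :: "real \<Rightarrow> 'b::banach"
  assumes "(f has_integral I) UNIV"
  shows "((\<lambda>x. f (x + c)) has_integral I) UNIV"
proof -
  have ncb: "\<nexists>a b. (UNIV :: real set) = cbox a b" by (metis bounded_cbox not_bounded_UNIV)
  have alt: "(g has_integral I) UNIV \<longleftrightarrow> (\<forall>e>0. \<exists>B>0. \<forall>a b. ball (0::real) B \<subseteq> cbox a b \<longrightarrow>
      (\<exists>z. (g has_integral z) (cbox a b) \<and> norm (z - I) < e))" for g :: "real \<Rightarrow> 'b"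
    using has_integral_alt[of g I UNIV] ncb by simp
  show ?thesis
    unfolding alt
  proof (intro allI impI)
    fix e :: real assume "0 < e"
    then obtain B where B: "0 < B" "\<And>a b. ball (0::real) B \<subseteq> cbox a b \<Longrightarrow>
        \<exists>z. (f has_integral z) (cbox a b) \<and> norm (z - I) < e"
      using assms unfolding alt by blast
    show "\<exists>B>0. \<forall>a b. ball (0::real) B \<subseteq> cbox a b \<longrightarrow>
      (\<exists>z. ((\<lambda>x. f (x + c)) has_integral z) (cbox a b) \<and> norm (z - I) < e)"
    proof (intro exI[of _ "B + \<bar>c\<bar>"] conjI allI impI)
      fix a b :: real assume ab: "ball (0::real) (B + \<bar>c\<bar>) \<subseteq> cbox a b"
      have "ball (0::real) B \<subseteq> cbox (a + c) (b + c)"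
      proof
        fix x assume "x \<in> ball (0::real) B"
        then have "x - c \<in> ball (0::real) (B + \<bar>c\<bar>)" by auto
        then have "x - c \<in> cbox a b" using ab by blast
        then show "x \<in> cbox (a + c) (b + c)" by auto
      qed
      then obtain z where z: "(f has_integral z) {a + c..b + c}" "norm (z - I) < e" using B(2) by force
      have "((\<lambda>x. f (x + c)) has_integral z) {(a + c) - c..(b + c) - c}"
        by (rule has_integral_shift_real_ivl[OF z(1)])
      then show "\<exists>z. ((\<lambda>x. f (x + c)) has_integral z) (cbox a b) \<and> norm (z - I) < e" using z(2) by auto
    qed (use B(1) in simp)
  qed
qed

lemma integral_greaterThan_split:
  fixes f :: "real \<Rightarrow> 'b::banach"
  assumes f: "f integrable_on {0<..}" "f integrable_on {0..t}" and t: "0 \<le> t"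
  shows "integral {0<..} f = integral {0..t} f + integral {0<..} (\<lambda>r. f (t + r))"
proof -
  let ?r = "\<lambda>S x. if x \<in> S then f x else 0"
  have "(?r {0<..} has_integral integral {0<..} f) UNIV" "(?r {0..t} has_integral integral {0..t} f) UNIV"
    using f by (simp_all only: has_integral_restrict_UNIV integrable_integral)
  from has_integral_diff[OF this]
  have "(?r {t<..} has_integral integral {0<..} f - integral {0..t} f) UNIV"
    by (rule has_integral_spike[OF negligible_sing[of 0], rotated]) (use t in auto)
  from has_integral_UNIV_translate[OF this, of t]
  have "((\<lambda>r. ?r {t<..} (r + t)) has_integral integral {0<..} f - integral {0..t} f) UNIV" .
  moreover have "(\<lambda>r. ?r {t<..} (r + t)) = (\<lambda>r. if r \<in> {0<..} then f (t + r) else 0)"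
    by (auto simp: add.commute)
  ultimately have "((\<lambda>r. f (t + r)) has_integral integral {0<..} f - integral {0..t} f) {0<..}"
    by (simp only: has_integral_restrict_UNIV)
  then show ?thesis by (simp add: integral_unique)
qed

lemma integral_reflect_interval:
  fixes f :: "real \<Rightarrow> 'b::banach"
  shows "integral {0..t} (\<lambda>r. f (t - r)) = integral {0..t} f"
proof -
  have "integral {0..t} (\<lambda>r. f (t - r)) = integral {- t..0} (\<lambda>r. f (t + r))"
    using integral_reflect[where a = "- t" and b = 0 and f = "\<lambda>r. f (t + r)"] by simp
  also have "\<dots> = integral {0..t} f"
    using integral_shift_Icc_real[of "-t" 0 f t] by (simp add: o_def)
  finally show ?thesis .
qed

text \<open>Strong continuity and a norm bound \<open>k\<close> that is continuous, though perhaps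
  unbounded, on \<open>I\<close> suffice for joint continuity; kernels with a singularity at the end
  of \<open>I\<close> are thus covered.\<close>

lemma continuous_on_operator_apply:
  fixes E :: "real \<Rightarrow> 'a::real_normed_vector \<Rightarrow> 'b::real_normed_vector"
    and \<rho> :: "'c::topological_space \<Rightarrow> real"
  assumes lin: "\<And>r. r \<in> I \<Longrightarrow> bounded_linear (E r)" and cont: "\<And>x. continuous_on I (\<lambda>r. E r x)"
    and bound: "\<And>r x. r \<in> I \<Longrightarrow> norm (E r x) \<le> k r * norm x" and k: "continuous_on I k"
    and \<rho>: "continuous_on S \<rho>" "\<rho> ` S \<subseteq> I" and \<psi>: "continuous_on S \<psi>"
  shows "continuous_on S (\<lambda>p. E (\<rho> p) (\<psi> p))"
  unfolding continuous_on_def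
proof
  fix p0 assume p0: "p0 \<in> S"
  let ?F = "at p0 within S"
  have inS: "\<forall>\<^sub>F p in ?F. p \<in> S" by (simp add: eventually_at_filter)
  have k\<rho>: "((\<lambda>p. k (\<rho> p)) \<longlongrightarrow> k (\<rho> p0)) ?F"
    using continuous_on_compose2[OF k \<rho>] p0 by (auto simp: continuous_on_def)
  have c2: "((\<lambda>p. E (\<rho> p) (\<psi> p0)) \<longlongrightarrow> E (\<rho> p0) (\<psi> p0)) ?F"
    using continuous_on_compose2[OF cont \<rho>] p0 by (auto simp: continuous_on_def)
  have "(\<psi> \<longlongrightarrow> \<psi> p0) ?F" using \<psi> p0 by (auto simp: continuous_on_def)
  then have "((\<lambda>p. k (\<rho> p) * norm (\<psi> p - \<psi> p0)) \<longlongrightarrow> k (\<rho> p0) * norm (\<psi> p0 - \<psi> p0)) ?F"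
    by (intro tendsto_intros k\<rho>)
  then have z: "((\<lambda>p. k (\<rho> p) * norm (\<psi> p - \<psi> p0)) \<longlongrightarrow> 0) ?F" by simp
  have "((\<lambda>p. E (\<rho> p) (\<psi> p - \<psi> p0)) \<longlongrightarrow> 0) ?F"
  proof (rule Lim_null_comparison[OF _ z])
    show "\<forall>\<^sub>F p in ?F. norm (E (\<rho> p) (\<psi> p - \<psi> p0)) \<le> k (\<rho> p) * norm (\<psi> p - \<psi> p0)"
      using inS by eventually_elim (use \<rho>(2) bound in blast)
  qed
  from tendsto_add[OF this c2]
  have "((\<lambda>p. E (\<rho> p) (\<psi> p - \<psi> p0) + E (\<rho> p) (\<psi> p0)) \<longlongrightarrow> E (\<rho> p0) (\<psi> p0)) ?F" by simp
  moreover have "\<forall>\<^sub>F p in ?F. E (\<rho> p) (\<psi> p - \<psi> p0) + E (\<rho> p) (\<psi> p0) = E (\<rho> p) (\<psi> p)"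
    using inS
  proof eventually_elim
    case (elim p)
    then have "bounded_linear (E (\<rho> p))" using \<rho>(2) lin by blast
    then show ?case by (simp add: linear_simps)
  qed
  ultimately show "((\<lambda>p. E (\<rho> p) (\<psi> p)) \<longlongrightarrow> E (\<rho> p0) (\<psi> p0)) ?F" by (rule Lim_transform_eventually)
qed

section \<open>Convolutions of functions of exponential growth\<close>

definition weight_bounded :: "real \<Rightarrow> real \<Rightarrow> (real \<Rightarrow> 'a::real_normed_vector) \<Rightarrow> bool" where
  "weight_bounded \<mu> C \<phi> \<longleftrightarrow> continuous_on UNIV \<phi> \<and> (\<forall>s. norm (\<phi> s) \<le> C * exp (\<mu> * \<bar>s\<bar>))"

lemma weight_bounded_nonneg: assumes "weight_bounded \<mu> C \<phi>" shows "0 \<le> C"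
proof -
  have "norm (\<phi> 0) \<le> C * exp (\<mu> * \<bar>0\<bar>)" using assms unfolding weight_bounded_def by blast
  then show ?thesis using order_trans[OF norm_ge_zero[of "\<phi> 0"]] by simp
qed

text \<open>Convolution with the past, from minus infinity to \<open>t\<close>. Integrals over the
  future are reduced to it by reflecting time.\<close>

definition conv where "conv K \<phi> t = integral {0<..} (\<lambda>r. K r (\<phi> (t - r)))"

text \<open>\<open>k\<close> may be singular at \<open>0\<close>, so everything is posed on the open
  half line. Since |t - r| is at most |t| + r, integrability of \<open>k\<close> against exp (\<mu>
  r) is what functions of growth exp (\<mu> |s|) require.\<close>

locale conv_kernel =
  fixes K :: "real \<Rightarrow> 'a::banach \<Rightarrow> 'a" and k :: "real \<Rightarrow> real" and \<mu> :: real
  assumes lin: "\<And>r. 0 < r \<Longrightarrow> bounded_linear (K r)" and cont: "\<And>x. continuous_on {0<..} (\<lambda>r. K r x)"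
    and bound: "\<And>r x. 0 < r \<Longrightarrow> norm (K r x) \<le> k r * norm x" and k: "continuous_on {0<..} k"
    and int: "(\<lambda>r. k r * exp (\<mu> * r)) integrable_on {0<..}"
    and nonneg: "\<And>r. 0 < r \<Longrightarrow> 0 \<le> k r" and \<mu>: "0 \<le> \<mu>"
begin

lemma dominated:
  assumes \<phi>: "weight_bounded \<mu> C \<phi>" and r: "0 < r" and t: "\<bar>t\<bar> \<le> N"
  shows "norm (K r (\<phi> (t - r))) \<le> C * exp (\<mu> * N) * (k r * exp (\<mu> * r))"
proof -
  have C: "0 \<le> C" by (rule weight_bounded_nonneg[OF \<phi>])
  have "norm (K r (\<phi> (t - r))) \<le> k r * (C * exp (\<mu> * \<bar>t - r\<bar>))"
    using bound[OF r] \<phi> nonneg[OF r] by (metis (no_types, lifting) mult_left_mono order_trans weight_bounded_def)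
  also have "\<dots> \<le> k r * (C * exp (\<mu> * (N + r)))"
  proof -
    have "\<mu> * \<bar>t - r\<bar> \<le> \<mu> * (N + r)" using r t \<mu> by (intro mult_left_mono) auto
    then show ?thesis using C nonneg[OF r] by (intro mult_left_mono) auto
  qed
  also have "\<dots> = C * exp (\<mu> * N) * (k r * exp (\<mu> * r))" by (simp add: distrib_left exp_add)
  finally show ?thesis .
qed

lemma joint_continuous:
  assumes \<phi>: "weight_bounded \<mu> C \<phi>"
  shows "continuous_on (S \<times> {0<..}) (\<lambda>(t, r). K r (\<phi> (t - r)))"
proof -
  have c: "continuous_on UNIV \<phi>" using \<phi> by (simp add: weight_bounded_def)
  have "continuous_on (S \<times> {0<..}) (\<lambda>p. K (snd p) (\<phi> (fst p - snd p)))"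
    by (rule continuous_on_operator_apply[where I = "{0<..}" and k = k])
      (auto intro!: lin cont bound k continuous_intros continuous_on_compose2[OF c])
  then show ?thesis by (simp add: case_prod_unfold)
qed

lemma integrand_continuous:
  assumes \<phi>: "weight_bounded \<mu> C \<phi>"
  shows "continuous_on {0<..} (\<lambda>r. K r (\<phi> (t - r)))"
proof -
  have c: "continuous_on UNIV \<phi>" using \<phi> by (simp add: weight_bounded_def)
  show ?thesis
    by (rule continuous_on_operator_apply[where I = "{0<..}" and k = k])
      (auto intro!: lin cont bound k continuous_intros continuous_on_compose2[OF c])
qed

lemma dom_int: "(\<lambda>r. c * (k r * exp (\<mu> * r))) integrable_on {0<..}"
  by (rule integrable_on_mult_right[OF int])

lemma integrable:
  assumes \<phi>: "weight_bounded \<mu> C \<phi>"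
  shows "(\<lambda>r. K r (\<phi> (t - r))) integrable_on {0<..}"
  by (rule integrable_dominated_continuous[OF integrand_continuous[OF \<phi>] dominated[OF \<phi> _ order_refl] dom_int])

lemma conv_norm:
  assumes \<phi>: "weight_bounded \<mu> C \<phi>"
  shows "norm (conv K \<phi> t) \<le> C * exp (\<mu> * \<bar>t\<bar>) * integral {0<..} (\<lambda>r. k r * exp (\<mu> * r))"
proof -
  have "norm (conv K \<phi> t) \<le> integral {0<..} (\<lambda>r. C * exp (\<mu> * \<bar>t\<bar>) * (k r * exp (\<mu> * r)))"
    unfolding conv_def
    by (rule integral_norm_bound_integral[OF integrable[OF \<phi>] dom_int]) (use dominated[OF \<phi>] in auto)
  also have "\<dots> = C * exp (\<mu> * \<bar>t\<bar>) * integral {0<..} (\<lambda>r. k r * exp (\<mu> * r))"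
    by (rule integral_mult_right)
  finally show ?thesis .
qed

lemma conv_continuous:
  assumes \<phi>: "weight_bounded \<mu> C \<phi>"
  shows "continuous_on UNIV (conv K \<phi>)"
proof -
  have "continuous_on {-N<..<N} (conv K \<phi>)" for N
    unfolding conv_def
    by (rule continuous_on_integral_dominated[OF joint_continuous[OF \<phi>] dominated[OF \<phi>, where N = N] dom_int]) auto
  then have on: "continuous_on {- N<..<N} (conv K \<phi>)" for N .
  have "isCont (conv K \<phi>) t" for t
  proof -
    have "t \<in> {- (\<bar>t\<bar> + 1)<..<\<bar>t\<bar> + 1}" by auto
    then show ?thesis
      using on[of "\<bar>t\<bar> + 1"] continuous_on_eq_continuous_at[OF open_greaterThanLessThan] by blast
  qed
  then show ?thesis by (simp add: continuous_at_imp_continuous_on)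
qed

lemma conv_diff:
  assumes \<phi>: "weight_bounded \<mu> C \<phi>" and \<psi>: "weight_bounded \<mu> C' \<psi>"
  shows "conv K (\<lambda>s. \<phi> s - \<psi> s) t = conv K \<phi> t - conv K \<psi> t"
proof -
  have "((\<lambda>r. K r (\<phi> (t - r)) - K r (\<psi> (t - r))) has_integral conv K \<phi> t - conv K \<psi> t) {0<..}"
    unfolding conv_def by (intro has_integral_diff integrable_integral integrable[OF \<phi>] integrable[OF \<psi>])
  then have "((\<lambda>r. K r (\<phi> (t - r) - \<psi> (t - r))) has_integral conv K \<phi> t - conv K \<psi> t) {0<..}"
    by (rule has_integral_eq[rotated]) (simp add: linear_simps[OF lin])
  then show ?thesis by (simp add: conv_def integral_unique)
qed

end

lemma weight_bounded_reflect: "weight_bounded \<mu> C \<phi> \<Longrightarrow> weight_bounded \<mu> C (\<lambda>s. \<phi> (- s))"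
  unfolding weight_bounded_def
  by (auto intro!: continuous_intros intro: continuous_on_compose2[of UNIV \<phi>] dest: spec[of _ "- s" for s])

lemma weight_bounded_shift:
  assumes \<phi>: "weight_bounded \<mu> C \<phi>" and \<mu>: "0 \<le> \<mu>"
  shows "weight_bounded \<mu> (C * exp (\<mu> * \<bar>\<tau>\<bar>)) (\<lambda>s. \<phi> (\<tau> + s))"
  unfolding weight_bounded_def
proof (intro conjI allI)
  have c: "continuous_on UNIV \<phi>" using \<phi> by (simp add: weight_bounded_def)
  show "continuous_on UNIV (\<lambda>s. \<phi> (\<tau> + s))"
    by (rule continuous_on_compose2[OF c]) (auto intro!: continuous_intros)
  fix s
  have C: "0 \<le> C" by (rule weight_bounded_nonneg[OF \<phi>])
  have "norm (\<phi> (\<tau> + s)) \<le> C * exp (\<mu> * \<bar>\<tau> + s\<bar>)" using \<phi> by (simp add: weight_bounded_def)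
  also have "\<dots> \<le> C * exp (\<mu> * (\<bar>\<tau>\<bar> + \<bar>s\<bar>))" 
  proof -
    have "\<mu> * \<bar>\<tau> + s\<bar> \<le> \<mu> * (\<bar>\<tau>\<bar> + \<bar>s\<bar>)" using \<mu> by (intro mult_left_mono) auto
    then show ?thesis using C by (intro mult_left_mono) auto
  qed
  finally show "norm (\<phi> (\<tau> + s)) \<le> C * exp (\<mu> * \<bar>\<tau>\<bar>) * exp (\<mu> * \<bar>s\<bar>)" by (simp add: distrib_left exp_add)
qed

definition sint :: "(real \<Rightarrow> 'a::banach) \<Rightarrow> real \<Rightarrow> 'a" where
  "sint g t = integral {0..t} g - integral {t..0} g"

lemma sint_derivative: "continuous_on UNIV g \<Longrightarrow> (sint g has_vector_derivative g t) (at t)"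
  unfolding sint_def[abs_def] by (rule antiderivative_signed_integral)

lemma sint_zero [simp]: "sint g 0 = 0" by (simp add: sint_def)

lemma sint_unique:
  assumes g: "continuous_on UNIV g" and J: "\<And>t. (J has_vector_derivative g t) (at t)" and J0: "J 0 = 0"
  shows "J t = sint g t"
proof -
  have "((\<lambda>t. J t - sint g t) has_vector_derivative 0) (at t within UNIV)" for t
    using has_vector_derivative_diff[OF J sint_derivative[OF g]] by simp
  then obtain c where "\<And>t. J t - sint g t = c"
    using has_vector_derivative_zero_constant[OF convex_UNIV, of "\<lambda>t. J t - sint g t"] by auto
  from this[of t] this[of 0] show ?thesis using J0 by simp
qed

lemma exp_scaled_has_integral:
  fixes a b c :: real
  assumes "c \<noteq> 0" "a \<le> b"
  shows "((\<lambda>s. exp (c * s)) has_integral (exp (c * b) - exp (c * a)) / c) {a..b}"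
proof -
  have "((\<lambda>s. exp (c * s)) has_integral exp (c * b) / c - exp (c * a) / c) {a..b}"
    by (rule fundamental_theorem_of_calculus[OF assms(2)])
      (use assms(1) in \<open>auto simp: has_real_derivative_iff_has_vector_derivative[symmetric] intro!: derivative_eq_intros\<close>)
  then show ?thesis by (simp add: diff_divide_distrib)
qed

text \<open>\<open>G\<close> acts in the coordinates of the fractional power space, while the
  nonlinearity takes values in the original space; \<open>e\<close> carries the latter over to the
  former. Hence the separate bounds for \<open>G t\<close> alone and after \<open>e\<close>.\<close>

locale group_kernel =
  fixes G :: "real \<Rightarrow> 'a::banach \<Rightarrow> 'a" and e :: "'a \<Rightarrow> 'a" and M b \<mu> :: real
  assumes G_lin: "\<And>t. bounded_linear (G t)" and G_cont: "\<And>x. continuous_on UNIV (\<lambda>t. G t x)"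
    and G_add: "\<And>s t x. G (s + t) x = G s (G t x)" and e_lin: "bounded_linear e"
    and G_norm: "\<And>t x. norm (G t x) \<le> M * exp (b * \<bar>t\<bar>) * norm x"
    and Ge_norm: "\<And>t x. norm (G t (e x)) \<le> M * exp (b * \<bar>t\<bar>) * norm x"
    and b: "0 \<le> b" "b < \<mu>" and M: "0 \<le> M"
begin

lemma apply_continuous:
  assumes "continuous_on S \<rho>" "continuous_on S \<psi>"
  shows "continuous_on S (\<lambda>p. G (\<rho> p) (\<psi> p))"
  by (rule continuous_on_operator_apply[where I = UNIV and k = "\<lambda>r. M * exp (b * \<bar>r\<bar>)"])
    (use assms in \<open>auto intro!: G_lin G_cont G_norm continuous_intros\<close>)

text \<open>This is the oriented integral of \<open>G (t - s) (e (\<phi> s))\<close> from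
  \<open>0\<close> to \<open>t\<close>. With \<open>G t\<close> taken out of the integral, time
  shifts reduce to uniqueness of antiderivatives.\<close>

definition Q where "Q \<phi> t = G t (sint (\<lambda>s. G (- s) (e (\<phi> s))) t)"

lemma integrand_cont: "continuous_on UNIV \<phi> \<Longrightarrow> continuous_on S (\<lambda>s. G (c - s) (e (\<phi> s)))"
  using continuous_on_subset[of UNIV \<phi> S]
  by (intro apply_continuous continuous_intros bounded_linear.continuous_on[OF e_lin]) auto

lemma integrand_cont': "continuous_on UNIV \<phi> \<Longrightarrow> continuous_on S (\<lambda>s. G (- s) (e (\<phi> s)))"
  using integrand_cont[of \<phi> S 0] by simp

lemma Q_eq_integral:
  assumes \<phi>: "continuous_on UNIV \<phi>"
  shows "Q \<phi> t = integral {0..t} (\<lambda>s. G (t - s) (e (\<phi> s))) - integral {t..0} (\<lambda>s. G (t - s) (e (\<phi> s)))"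
proof -
  have i: "G t (integral {c..d} (\<lambda>s. G (- s) (e (\<phi> s)))) = integral {c..d} (\<lambda>s. G (t - s) (e (\<phi> s)))" for c d
  proof -
    have "((\<lambda>s. G t (G (- s) (e (\<phi> s)))) has_integral G t (integral {c..d} (\<lambda>s. G (- s) (e (\<phi> s))))) {c..d}"
      by (rule has_integral_linear[OF _ G_lin, unfolded o_def])
        (intro integrable_integral integrable_continuous_real integrand_cont'[OF \<phi>])
    then show ?thesis by (simp add: integral_unique G_add[symmetric])
  qed
  show ?thesis unfolding Q_def sint_def by (simp add: linear_simps[OF G_lin] i)
qed

lemma Q_continuous:
  assumes \<phi>: "continuous_on UNIV \<phi>"
  shows "continuous_on UNIV (Q \<phi>)"
proof -
  have "continuous_on UNIV (sint (\<lambda>s. G (- s) (e (\<phi> s))))"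
    using has_vector_derivative_continuous[OF sint_derivative[OF integrand_cont'[OF \<phi>]]]
    by (simp add: continuous_at_imp_continuous_on)
  then show ?thesis unfolding Q_def[abs_def] by (intro apply_continuous continuous_intros)
qed

text \<open>Between \<open>0\<close> and \<open>t\<close> the exponents combine to b |t| + (\<mu> -
  b) |s|, and integration of the exponential yields \<open>1 / (\<mu> - b)\<close>, which is the
  first integral in \<open>F_const\<close>.\<close>

lemma Q_norm:
  assumes \<phi>: "weight_bounded \<mu> C \<phi>"
  shows "norm (Q \<phi> t) \<le> C * exp (\<mu> * \<bar>t\<bar>) * (M * (1 / (\<mu> - b)))"
proof -
  have c: "continuous_on UNIV \<phi>" and C: "0 \<le> C"
    using \<phi> weight_bounded_nonneg[OF \<phi>] by (auto simp: weight_bounded_def)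
  have pt: "norm (G (t - s) (e (\<phi> s))) \<le> M * exp (b * \<bar>t - s\<bar>) * (C * exp (\<mu> * \<bar>s\<bar>))" for s
    by (rule order_trans[OF Ge_norm mult_left_mono]) (use \<phi> M in \<open>auto simp: weight_bounded_def\<close>)
  have ii: "(\<lambda>s. G (t - s) (e (\<phi> s))) integrable_on {x..y}" for x y
    by (intro integrable_continuous_real integrand_cont c)
  show ?thesis
  proof (cases "0 \<le> t")
    case True
    have j: "((\<lambda>s. (M * C * exp (b * t)) * exp ((\<mu> - b) * s)) has_integral
        (M * C * exp (b * t)) * ((exp ((\<mu> - b) * t) - exp ((\<mu> - b) * 0)) / (\<mu> - b))) {0..t}"
      by (intro has_integral_mult_right exp_scaled_has_integral) (use b True in auto)
    have "norm (integral {0..t} (\<lambda>s. G (t - s) (e (\<phi> s)))) \<le> (M * C * exp (b * t)) * ((exp ((\<mu> - b) * t) - exp ((\<mu> - b) * 0)) / (\<mu> - b))"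
      unfolding integral_unique[OF j, symmetric]
    proof (rule integral_norm_bound_integral[OF ii])
      show "(\<lambda>s. (M * C * exp (b * t)) * exp ((\<mu> - b) * s)) integrable_on {0..t}" using j by blast
      fix s assume s: "s \<in> {0..t}"
      have "exp (b * t) * exp ((\<mu> - b) * s) = exp (b * \<bar>t - s\<bar>) * exp (\<mu> * \<bar>s\<bar>)"
        using s by (simp add: exp_add[symmetric] algebra_simps)
      then show "norm (G (t - s) (e (\<phi> s))) \<le> (M * C * exp (b * t)) * exp ((\<mu> - b) * s)"
        using pt[of s] by (simp add: mult_ac)
    qed
    also have "\<dots> \<le> (M * C * exp (b * t)) * (exp ((\<mu> - b) * t) / (\<mu> - b))"
      using M C b by (intro mult_left_mono divide_right_mono) auto
    also have "\<dots> = C * (exp (b * t) * exp ((\<mu> - b) * t)) * (M * (1 / (\<mu> - b)))" by simp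
    also have "exp (b * t) * exp ((\<mu> - b) * t) = exp (\<mu> * \<bar>t\<bar>)"
      using True by (simp add: exp_add[symmetric] algebra_simps)
    finally show ?thesis using True unfolding Q_eq_integral[OF c] by (cases "t = 0") auto
  next
    case False
    have j: "((\<lambda>s. (M * C * exp (- (b * t))) * exp (- (\<mu> - b) * s)) has_integral
        (M * C * exp (- (b * t))) * ((exp (- (\<mu> - b) * 0) - exp (- (\<mu> - b) * t)) / - (\<mu> - b))) {t..0}"
      by (intro has_integral_mult_right exp_scaled_has_integral) (use b False in auto)
    have "norm (integral {t..0} (\<lambda>s. G (t - s) (e (\<phi> s)))) \<le> (M * C * exp (- (b * t))) * ((exp (- (\<mu> - b) * 0) - exp (- (\<mu> - b) * t)) / - (\<mu> - b))"
      unfolding integral_unique[OF j, symmetric]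
    proof (rule integral_norm_bound_integral[OF ii])
      show "(\<lambda>s. (M * C * exp (- (b * t))) * exp (- (\<mu> - b) * s)) integrable_on {t..0}" using j by blast
      fix s assume s: "s \<in> {t..0}"
      have "exp (- (b * t)) * exp (- (\<mu> - b) * s) = exp (b * \<bar>t - s\<bar>) * exp (\<mu> * \<bar>s\<bar>)"
        using s by (simp add: exp_add[symmetric] algebra_simps)
      then show "norm (G (t - s) (e (\<phi> s))) \<le> (M * C * exp (- (b * t))) * exp (- (\<mu> - b) * s)"
        using pt[of s] by (simp add: mult_ac)
    qed
    also have "(exp (- (\<mu> - b) * 0) - exp (- (\<mu> - b) * t)) / - (\<mu> - b) = (exp (- (\<mu> - b) * t) - 1) / (\<mu> - b)"
      by (metis (no_types, lifting) exp_zero minus_diff_eq minus_divide_divide mult_zero_right)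
    also have "(M * C * exp (- (b * t))) * ((exp (- (\<mu> - b) * t) - 1) / (\<mu> - b))
        \<le> (M * C * exp (- (b * t))) * (exp (- (\<mu> - b) * t) / (\<mu> - b))"
      using M C b by (intro mult_left_mono divide_right_mono) auto
    also have "\<dots> = C * (exp (- (b * t)) * exp (- (\<mu> - b) * t)) * (M * (1 / (\<mu> - b)))" by simp
    also have "exp (- (b * t)) * exp (- (\<mu> - b) * t) = exp (\<mu> * \<bar>t\<bar>)"
      using False by (simp add: exp_add[symmetric] algebra_simps)
    finally show ?thesis using False unfolding Q_eq_integral[OF c] by simp
  qed
qed

lemma Q_diff:
  assumes "continuous_on UNIV \<phi>" "continuous_on UNIV \<psi>"
  shows "Q (\<lambda>s. \<phi> s - \<psi> s) t = Q \<phi> t - Q \<psi> t"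
proof -
  let ?g = "\<lambda>\<phi> s. G (t - s) (e (\<phi> s))"
  have "integral {x..y} (?g (\<lambda>s. \<phi> s - \<psi> s)) = integral {x..y} (?g \<phi>) - integral {x..y} (?g \<psi>)" for x y
    unfolding integral_diff[OF integrable_continuous_real[OF integrand_cont[OF assms(1)]]
        integrable_continuous_real[OF integrand_cont[OF assms(2)]], symmetric]
    by (simp add: linear_simps[OF e_lin] linear_simps[OF G_lin])
  then show ?thesis using assms by (simp add: Q_eq_integral continuous_on_diff)
qed

text \<open>The variation of constants formula may be restarted at time \<open>\<tau>\<close> from
  the value reached there, because the shifted integrals in \<open>J\<close> have the same
  derivative and both vanish at \<open>0\<close>.\<close>

lemma Q_shift:
  assumes \<phi>: "continuous_on UNIV \<phi>"
  shows "G t (G \<tau> k + Q \<phi> \<tau>) + Q (\<lambda>s. \<phi> (\<tau> + s)) t = G (\<tau> + t) k + Q \<phi> (\<tau> + t)"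
proof -
  let ?g = "\<lambda>s. G (- s) (e (\<phi> s))"
  have \<phi>': "continuous_on UNIV (\<lambda>s. \<phi> (\<tau> + s))"
    by (rule continuous_on_compose2[OF \<phi>]) (auto intro!: continuous_intros)
  have J: "G \<tau> (sint ?g (\<tau> + t)) - G \<tau> (sint ?g \<tau>) = sint (\<lambda>s. G (- s) (e (\<phi> (\<tau> + s)))) t" for t
  proof (rule sint_unique[OF integrand_cont'[OF \<phi>'], where J = "\<lambda>t. G \<tau> (sint ?g (\<tau> + t)) - G \<tau> (sint ?g \<tau>)"])
    fix t
    have s: "((\<lambda>t. \<tau> + t) has_vector_derivative 1) (at t)" by (auto intro!: derivative_eq_intros)
    have "((\<lambda>t. sint ?g (\<tau> + t)) has_vector_derivative ?g (\<tau> + t)) (at t)"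
      using vector_diff_chain_at[OF s sint_derivative[OF integrand_cont'[OF \<phi>]]] by (simp add: o_def)
    from bounded_linear.has_vector_derivative[OF G_lin[of \<tau>] this]
    have "((\<lambda>t. G \<tau> (sint ?g (\<tau> + t))) has_vector_derivative G (- t) (e (\<phi> (\<tau> + t)))) (at t)"
      by (simp add: G_add[symmetric])
    then show "((\<lambda>t. G \<tau> (sint ?g (\<tau> + t)) - G \<tau> (sint ?g \<tau>)) has_vector_derivative G (- t) (e (\<phi> (\<tau> + t)))) (at t)"
      using has_vector_derivative_diff[OF _ has_vector_derivative_const] by fastforce
  qed simp
  show ?thesis
    unfolding Q_def J[symmetric]
    by (simp add: linear_simps[OF G_lin] G_add[symmetric] add.commute)
qed

end

section \<open>The Lyapunov--Perron contraction and its fixed points\<close>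

locale lyapunov_perron =
  K1: conv_kernel K1 k1 \<mu> + K3: conv_kernel K3 k3 \<mu> + G: group_kernel G e M b \<mu>
  for K1 K3 G :: "real \<Rightarrow> 'a::banach \<Rightarrow> 'a" and k1 k3 :: "real \<Rightarrow> real" and e :: "'a \<Rightarrow> 'a" and M b \<mu> :: real +
  fixes F :: "'a \<Rightarrow> 'a" and l :: real
  assumes F_lip: "\<And>x y. norm (F x - F y) \<le> l * norm (x - y)" and l: "0 \<le> l"
    and small: "(integral {0<..} (\<lambda>r. k1 r * exp (\<mu> * r)) + integral {0<..} (\<lambda>r. k3 r * exp (\<mu> * r))
      + M * (1 / (\<mu> - b))) * l < 1"
begin

definition S where "S = integral {0<..} (\<lambda>r. k1 r * exp (\<mu> * r)) + integral {0<..} (\<lambda>r. k3 r * exp (\<mu> * r))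
      + M * (1 / (\<mu> - b))"

lemma S_nonneg: "0 \<le> S"
  unfolding S_def using G.M G.b K1.nonneg K3.nonneg
  by (intro add_nonneg_nonneg integral_nonneg K1.int K3.int mult_nonneg_nonneg) auto

text \<open>\<open>K1 r\<close> is the exponential of the unstable part at time \<open>-r\<close>, so that the second summand is minus
  the integral from \<open>t\<close> to infinity.\<close>

definition LP where
  "LP k \<phi> t = G t k - conv K1 (\<lambda>s. \<phi> (- s)) (- t) + G.Q \<phi> t + conv K3 \<phi> t"

lemma LP_continuous:
  assumes \<phi>: "weight_bounded \<mu> C \<phi>"
  shows "continuous_on UNIV (LP k \<phi>)"
proof -
  have c: "continuous_on UNIV \<phi>" using \<phi> by (simp add: weight_bounded_def)
  have "continuous_on UNIV (\<lambda>t. conv K1 (\<lambda>s. \<phi> (- s)) (- t))"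
    by (rule continuous_on_compose2[OF K1.conv_continuous[OF weight_bounded_reflect[OF \<phi>]]])
      (auto intro!: continuous_intros)
  then show ?thesis unfolding LP_def[abs_def]
    by (intro continuous_on_add continuous_on_diff G.G_cont G.Q_continuous[OF c] K3.conv_continuous[OF \<phi>])
qed

lemma LP_norm:
  assumes \<phi>: "weight_bounded \<mu> C \<phi>"
  shows "norm (LP k \<phi> t) \<le> (M * norm k + C * S) * exp (\<mu> * \<bar>t\<bar>)"
proof -
  let ?w = "exp (\<mu> * \<bar>t\<bar>)"
  have "norm (G t k) \<le> M * exp (b * \<bar>t\<bar>) * norm k" by (rule G.G_norm)
  also have "\<dots> \<le> M * ?w * norm k"
  proof -
    have "b * \<bar>t\<bar> \<le> \<mu> * \<bar>t\<bar>" using G.b by (intro mult_right_mono) auto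
    then show ?thesis using G.M by (intro mult_right_mono mult_left_mono) auto
  qed
  finally have 1: "norm (G t k) \<le> M * ?w * norm k" .
  have 2: "norm (conv K1 (\<lambda>s. \<phi> (- s)) (- t)) \<le> C * ?w * integral {0<..} (\<lambda>r. k1 r * exp (\<mu> * r))"
    using K1.conv_norm[OF weight_bounded_reflect[OF \<phi>], of "- t"] by simp
  have "norm (LP k \<phi> t) \<le> norm (G t k) + norm (conv K1 (\<lambda>s. \<phi> (- s)) (- t)) + norm (G.Q \<phi> t) + norm (conv K3 \<phi> t)"
    unfolding LP_def
    by (intro order_trans[OF norm_triangle_ineq] add_right_mono order_trans[OF norm_triangle_ineq4]) simp
  then show ?thesis
    using 1 2 G.Q_norm[OF \<phi>, of t] K3.conv_norm[OF \<phi>, of t] by (simp add: S_def algebra_simps)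
qed

text \<open>\<open>LP\<close> is linear in the pair of \<open>k\<close> and \<open>\<phi>\<close>,
  so that differences fall under the same norm bound.\<close>

lemma LP_diff:
  assumes \<phi>: "weight_bounded \<mu> C \<phi>" and \<psi>: "weight_bounded \<mu> C' \<psi>"
  shows "LP k \<phi> t - LP k' \<psi> t = LP (k - k') (\<lambda>s. \<phi> s - \<psi> s) t"
proof -
  have c: "continuous_on UNIV \<phi>" "continuous_on UNIV \<psi>" using \<phi> \<psi> by (auto simp: weight_bounded_def)
  show ?thesis
    unfolding LP_def K1.conv_diff[OF weight_bounded_reflect[OF \<phi>] weight_bounded_reflect[OF \<psi>]]
      K3.conv_diff[OF \<phi> \<psi>] G.Q_diff[OF c] linear_simps(2)[OF G.G_lin]
    by simp
qed

lemma F_continuous: "continuous_on UNIV F"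
  unfolding continuous_on_def
proof
  fix x :: 'a
  have "((\<lambda>y. l * norm (y - x)) \<longlongrightarrow> l * norm (x - x)) (at x)" by (intro tendsto_intros)
  then have "((\<lambda>y. l * norm (y - x)) \<longlongrightarrow> 0) (at x)" by simp
  then have "((\<lambda>y. F y - F x) \<longlongrightarrow> 0) (at x)" by (rule Lim_null_comparison[rotated]) (simp add: F_lip)
  then show "(F \<longlongrightarrow> F x) (at x)" by (simp add: LIM_zero_iff)
qed

lemma F_weight_bounded:
  assumes h: "weight_bounded \<mu> C h"
  shows "weight_bounded \<mu> (norm (F 0) + l * C) (\<lambda>s. F (h s))"
  unfolding weight_bounded_def
proof (intro conjI allI)
  show "continuous_on UNIV (\<lambda>s. F (h s))"
    using h by (auto simp: weight_bounded_def intro!: continuous_on_compose2[OF F_continuous])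
  fix s
  have "norm (F (h s)) \<le> norm (F 0) + l * norm (h s)"
    using F_lip[of "h s" 0] norm_triangle_sub[of "F (h s)" "F 0"] by simp
  also have "\<dots> \<le> norm (F 0) * exp (\<mu> * \<bar>s\<bar>) + l * (C * exp (\<mu> * \<bar>s\<bar>))"
  proof (rule add_mono)
    have "1 \<le> exp (\<mu> * \<bar>s\<bar>)" using K1.\<mu> by simp
    then show "norm (F 0) \<le> norm (F 0) * exp (\<mu> * \<bar>s\<bar>)" using mult_left_mono[of 1 _ "norm (F 0)"] by simp
    show "l * norm (h s) \<le> l * (C * exp (\<mu> * \<bar>s\<bar>))"
      using h l by (intro mult_left_mono) (auto simp: weight_bounded_def)
  qed
  finally show "norm (F (h s)) \<le> (norm (F 0) + l * C) * exp (\<mu> * \<bar>s\<bar>)" by (simp add: algebra_simps)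
qed

lemma F_diff_weight_bounded:
  assumes h: "weight_bounded \<mu> C h" and h': "weight_bounded \<mu> C' h'"
    and d: "\<And>s. norm (h s - h' s) \<le> d * exp (\<mu> * \<bar>s\<bar>)"
  shows "weight_bounded \<mu> (l * d) (\<lambda>s. F (h s) - F (h' s))"
  unfolding weight_bounded_def
proof (intro conjI allI)
  show "continuous_on UNIV (\<lambda>s. F (h s) - F (h' s))"
    using F_weight_bounded[OF h] F_weight_bounded[OF h'] by (auto simp: weight_bounded_def intro!: continuous_on_diff)
  show "norm (F (h s) - F (h' s)) \<le> l * d * exp (\<mu> * \<bar>s\<bar>)" for s
    using order_trans[OF F_lip mult_left_mono[OF d l]] by (simp add: mult.assoc)
qed

definition solves where
  "solves k h \<longleftrightarrow> (\<exists>C. weight_bounded \<mu> C h) \<and> (\<forall>t. h t = LP k (\<lambda>s. F (h s)) t)"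

text \<open>The weighted space is represented by bounded continuous functions, multiplied by the
  weight; thus their complete supremum metric is available for the fixed point theorem.\<close>

definition unweight :: "(real \<Rightarrow>\<^sub>C 'a) \<Rightarrow> real \<Rightarrow> 'a" where
  "unweight g s = exp (\<mu> * \<bar>s\<bar>) *\<^sub>R g s"

lemma unweight_bounded: "weight_bounded \<mu> (norm g) (unweight g)"
  unfolding weight_bounded_def unweight_def[abs_def]
  by (auto intro!: continuous_intros continuous_on_apply_bcontfun simp: mult.commute[of "norm g"] norm_bounded)

lemma unweight_diff: "norm (unweight g s - unweight g' s) \<le> dist g g' * exp (\<mu> * \<bar>s\<bar>)"
proof -
  have "norm (unweight g s - unweight g' s) = exp (\<mu> * \<bar>s\<bar>) * dist (g s) (g' s)"
    by (simp add: unweight_def scaleR_diff_right[symmetric] dist_norm)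
  also have "\<dots> \<le> exp (\<mu> * \<bar>s\<bar>) * dist g g'" by (intro mult_left_mono dist_bounded) simp
  finally show ?thesis by (simp add: mult.commute)
qed

lemma weight_inverse: "exp (- (\<mu> * \<bar>t\<bar>)) * exp (\<mu> * \<bar>t\<bar>) = 1" by (simp add: exp_add[symmetric])

lemma weighted_bcontfun:
  assumes "weight_bounded \<mu> C h"
  shows "(\<lambda>t. exp (- (\<mu> * \<bar>t\<bar>)) *\<^sub>R h t) \<in> bcontfun"
proof (rule bcontfun_normI)
  show "continuous_on UNIV (\<lambda>t. exp (- (\<mu> * \<bar>t\<bar>)) *\<^sub>R h t)"
    using assms by (auto simp: weight_bounded_def intro!: continuous_intros)
  show "norm (exp (- (\<mu> * \<bar>t\<bar>)) *\<^sub>R h t) \<le> C" for t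
  proof -
    have "exp (- (\<mu> * \<bar>t\<bar>)) * norm (h t) \<le> exp (- (\<mu> * \<bar>t\<bar>)) * (C * exp (\<mu> * \<bar>t\<bar>))"
      using assms by (intro mult_left_mono) (auto simp: weight_bounded_def)
    also have "\<dots> = C" using weight_inverse[of t] by (simp only: mult.left_commute[of _ C] mult_1_right)
    finally show ?thesis by simp
  qed
qed

lemma LP_weight_bounded:
  assumes "weight_bounded \<mu> C \<phi>"
  shows "weight_bounded \<mu> (M * norm k + C * S) (LP k \<phi>)"
  using LP_continuous[OF assms] LP_norm[OF assms] by (simp add: weight_bounded_def)

text \<open>One estimate gives both the contraction, for \<open>k = k'\<close>, and, at fixed
  points, the Lipschitz dependence on \<open>k\<close>.\<close>

lemma step_estimate:
  "norm (LP k (\<lambda>s. F (unweight g s)) t - LP k' (\<lambda>s. F (unweight g' s)) t)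
    \<le> (M * norm (k - k') + S * l * dist g g') * exp (\<mu> * \<bar>t\<bar>)"
proof -
  have w: "weight_bounded \<mu> (norm (F 0) + l * norm g) (\<lambda>s. F (unweight g s))" for g
    by (rule F_weight_bounded[OF unweight_bounded])
  have d: "weight_bounded \<mu> (l * dist g g') (\<lambda>s. F (unweight g s) - F (unweight g' s))"
    by (rule F_diff_weight_bounded[OF unweight_bounded unweight_bounded unweight_diff])
  show ?thesis unfolding LP_diff[OF w w] using LP_norm[OF d, of "k - k'" t] by (simp add: mult_ac)
qed

lemma solves_ex: "\<exists>h. solves k h"
proof -
  define \<Psi> where "\<Psi> g = Bcontfun (\<lambda>t. exp (- (\<mu> * \<bar>t\<bar>)) *\<^sub>R LP k (\<lambda>s. F (unweight g s)) t)" for g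
  have \<Psi>: "\<Psi> g t = exp (- (\<mu> * \<bar>t\<bar>)) *\<^sub>R LP k (\<lambda>s. F (unweight g s)) t" for g t
    unfolding \<Psi>_def
    by (subst Bcontfun_inverse[OF weighted_bcontfun[OF LP_weight_bounded[OF F_weight_bounded[OF unweight_bounded]]]]) simp
  have "\<exists>!g. \<Psi> g = g"
  proof (rule banach_fix_type[of "S * l"]; (intro allI)?)
    show "0 \<le> S * l" using S_nonneg l by simp
    show "S * l < 1" using small by (simp add: S_def)
    show "dist (\<Psi> g) (\<Psi> g') \<le> S * l * dist g g'" for g g'
    proof (rule dist_bound)
      fix t
      have "dist (\<Psi> g t) (\<Psi> g' t) = exp (- (\<mu> * \<bar>t\<bar>)) * norm (LP k (\<lambda>s. F (unweight g s)) t - LP k (\<lambda>s. F (unweight g' s)) t)"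
        by (simp add: \<Psi> dist_norm scaleR_diff_right[symmetric])
      also have "\<dots> \<le> exp (- (\<mu> * \<bar>t\<bar>)) * ((S * l * dist g g') * exp (\<mu> * \<bar>t\<bar>))"
        using step_estimate[of k g t k g'] by (intro mult_left_mono) auto
      also have "\<dots> = S * l * dist g g'"
        using weight_inverse[of t] by (simp only: mult.left_commute[of _ "S * l * dist g g'"] mult_1_right)
      finally show "dist (\<Psi> g t) (\<Psi> g' t) \<le> S * l * dist g g'" .
    qed
  qed
  then obtain g where g: "\<Psi> g = g" by blast
  have "unweight g t = LP k (\<lambda>s. F (unweight g s)) t" for t
  proof -
    have "unweight g t = exp (\<mu> * \<bar>t\<bar>) *\<^sub>R \<Psi> g t" by (simp only: unweight_def g)
    then show ?thesis using weight_inverse[of t] by (simp add: \<Psi> mult.commute)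
  qed
  then show ?thesis unfolding solves_def using unweight_bounded by blast
qed

lemma solves_lipschitz:
  assumes h: "solves k h" and h': "solves k' h'"
  shows "norm (h t - h' t) \<le> M / (1 - S * l) * norm (k - k') * exp (\<mu> * \<bar>t\<bar>)"
proof -
  have ex: "\<exists>g. h = unweight g" if "solves k h" for k h
  proof -
    obtain C where C: "weight_bounded \<mu> C h" using \<open>solves k h\<close> unfolding solves_def by blast
    have "h t = unweight (Bcontfun (\<lambda>t. exp (- (\<mu> * \<bar>t\<bar>)) *\<^sub>R h t)) t" for t
      unfolding unweight_def Bcontfun_inverse[OF weighted_bcontfun[OF C]] scaleR_scaleR
        mult.commute[of "exp (\<mu> * \<bar>t\<bar>)"] weight_inverse by simp
    then show ?thesis by (intro exI[of _ "Bcontfun (\<lambda>t. exp (- (\<mu> * \<bar>t\<bar>)) *\<^sub>R h t)"] ext)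
  qed
  obtain g g' where g: "h = unweight g" "h' = unweight g'" using ex h h' by blast
  have th: "0 < 1 - S * l" using small by (simp add: S_def)
  have "dist g g' \<le> M * norm (k - k') + S * l * dist g g'"
  proof (rule dist_bound)
    fix t
    have "h t - h' t = LP k (\<lambda>s. F (h s)) t - LP k' (\<lambda>s. F (h' s)) t"
      by (rule arg_cong2[where f = "(-)"]) (use h h' in \<open>unfold solves_def, blast+\<close>)
    then have "norm (h t - h' t) \<le> (M * norm (k - k') + S * l * dist g g') * exp (\<mu> * \<bar>t\<bar>)"
      using step_estimate[of k g t k' g'] by (simp only: g)
    moreover have "norm (h t - h' t) = exp (\<mu> * \<bar>t\<bar>) * dist (g t) (g' t)"
      by (simp add: g unweight_def scaleR_diff_right[symmetric] dist_norm)
    ultimately show "dist (g t) (g' t) \<le> M * norm (k - k') + S * l * dist g g'" by (simp add: mult.commute)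
  qed
  then have "(1 - S * l) * dist g g' \<le> M * norm (k - k')" by (simp add: algebra_simps)
  then have "dist g g' \<le> M / (1 - S * l) * norm (k - k')" using th by (simp add: field_simps)
  then have "dist g g' * exp (\<mu> * \<bar>t\<bar>) \<le> M / (1 - S * l) * norm (k - k') * exp (\<mu> * \<bar>t\<bar>)"
    by (rule mult_right_mono) simp
  then show ?thesis using unweight_diff[of g t g'] by (simp add: g)
qed

lemma solves_unique: "solves k h \<Longrightarrow> solves k h' \<Longrightarrow> h t = h' t"
  using solves_lipschitz[of k h k h' t] by simp

text \<open>The two convolutions commute with time shifts because they do not refer to time
  \<open>0\<close>; only the middle part does, and \<open>G.Q_shift\<close> adapts its initial
  value. The new parameter is the middle component at time \<open>\<tau>\<close>.\<close>

lemma solves_shift: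
  assumes h: "solves k h"
  shows "solves (G \<tau> k + G.Q (\<lambda>s. F (h s)) \<tau>) (\<lambda>s. h (\<tau> + s))"
proof -
  obtain C where C: "weight_bounded \<mu> C h" using h unfolding solves_def by blast
  have c: "continuous_on UNIV (\<lambda>s. F (h s))" using F_weight_bounded[OF C] by (simp add: weight_bounded_def)
  have "h (\<tau> + t) = LP (G \<tau> k + G.Q (\<lambda>s. F (h s)) \<tau>) (\<lambda>s. F (h (\<tau> + s))) t" for t
  proof -
    have 1: "h (\<tau> + t) = LP k (\<lambda>s. F (h s)) (\<tau> + t)" using h unfolding solves_def by blast
    have 2: "conv K3 (\<lambda>s. F (h (\<tau> + s))) t = conv K3 (\<lambda>s. F (h s)) (\<tau> + t)"
      unfolding conv_def by (simp only: add_diff_eq)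
    have "\<tau> + - (- t - r) = - (- (\<tau> + t) - r)" for r by simp
    then have 3: "conv K1 (\<lambda>s. F (h (\<tau> + - s))) (- t) = conv K1 (\<lambda>s. F (h (- s))) (- (\<tau> + t))"
      unfolding conv_def by (simp only:)
    have "a - p + q + r = (a + q) - p + r" for a q p r :: 'a by simp
    then show ?thesis unfolding 1 LP_def 2 3 by (simp only: G.Q_shift[OF c, of t \<tau> k])
  qed
  moreover have "weight_bounded \<mu> (C * exp (\<mu> * \<bar>\<tau>\<bar>)) (\<lambda>s. h (\<tau> + s))"
    by (rule weight_bounded_shift[OF C K1.\<mu>])
  ultimately show ?thesis unfolding solves_def by blast
qed

end

section \<open>The invariant manifold\<close>

text \<open>\<open>B\<close> stands for \<open>L\<^sup>-\<^sup>\<alpha>\<close>. All estimates are carried out for \<open>h = L\<^sup>\<alpha> u\<close>, so that the space on which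
  the semiflow acts becomes \<open>X\<close> itself and the nonlinearity becomes \<open>F = f \<circ> B\<close>.\<close>

locale invariant_manifold =
  fixes T :: "real \<Rightarrow> 'a::complex_banach \<Rightarrow> 'a" and B P1 P2 P3 :: "'a \<Rightarrow> 'a"
    and U1 U2 :: "real \<Rightarrow> 'a \<Rightarrow> 'a" and f :: "'a \<Rightarrow> 'a" and \<alpha> \<beta> \<mu> M l N c :: real
  assumes T: "c0_semigroup T"
    and B: "bounded_linear B" and B_inj: "\<And>x. B x = 0 \<Longrightarrow> x = 0"
    and B_T: "\<And>t x. 0 \<le> t \<Longrightarrow> B (T t x) = T t (B x)"
    and P: "bounded_linear P1" "bounded_linear P2" "bounded_linear P3"
    and P_sum: "\<And>x. P1 x + P2 x + P3 x = x"
    and PP: "\<And>x. P1 (P1 x) = P1 x" "\<And>x. P2 (P2 x) = P2 x" "\<And>x. P3 (P3 x) = P3 x"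
    and B_P: "\<And>x. B (P1 x) = P1 (B x)" "\<And>x. B (P2 x) = P2 (B x)"
    and T_P3: "\<And>t x. 0 \<le> t \<Longrightarrow> T t (P3 x) = P3 (T t x)"
    and U_lin: "\<And>t. bounded_linear (U1 t)" "\<And>t. bounded_linear (U2 t)"
    and U_cont: "\<And>x. continuous_on UNIV (\<lambda>t. U1 t x)" "\<And>x. continuous_on UNIV (\<lambda>t. U2 t x)"
    and U_add: "\<And>s t x. U1 (s + t) x = U1 s (U1 t x)" "\<And>s t x. U2 (s + t) x = U2 s (U2 t x)"
    and U_zero: "\<And>x. U1 0 x = P1 x" "\<And>x. U2 0 x = P2 x"
    and U_T: "\<And>t x. 0 \<le> t \<Longrightarrow> T t (P1 x) = U1 t x" "\<And>t x. 0 \<le> t \<Longrightarrow> T t (P2 x) = U2 t x"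
    and B_U: "\<And>t x. B (U1 t x) = U1 t (B x)" "\<And>t x. B (U2 t x) = U2 t (B x)"
    and U1_growth: "\<And>t x. 0 \<le> t \<Longrightarrow> norm (U1 t x) \<le> N * exp (c * t) * norm x" and N: "0 \<le> N" and c: "0 \<le> c"
    and E1: "\<And>t x. t \<le> 0 \<Longrightarrow> U1 t x \<in> range B \<and> norm (inv B (U1 t x)) \<le> M * exp (3 / 4 * \<beta> * t) * norm x"
    and E2: "\<And>t x. U2 t x \<in> range B \<and> norm (inv B (U2 t x)) \<le> M * exp (1 / 4 * \<beta> * \<bar>t\<bar>) * norm x"
    and E2': "\<And>t x. norm (U2 t x) \<le> M * exp (1 / 4 * \<beta> * \<bar>t\<bar>) * norm x"
    and E3: "\<And>t x. 0 < t \<Longrightarrow> T t (P3 x) \<in> range B \<and>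
      norm (inv B (T t (P3 x))) \<le> M * t powr (- \<alpha>) * exp (- (3 / 4) * \<beta> * t) * norm x"
    and f: "\<And>x y. norm (f (B x) - f (B y)) \<le> l * norm (x - y)" and l: "0 \<le> l"
    and \<alpha>: "0 \<le> \<alpha>" "\<alpha> < 1" and \<beta>: "0 < \<beta>" and \<mu>: "\<beta> / 4 < \<mu>" "\<mu> < 3 / 4 * \<beta>" and M: "0 < M"
    and small: "F_const M \<alpha> \<beta> \<mu> * l < 1"
begin

abbreviation "\<Lambda> \<equiv> inv B"

lemma B_simps: "B (x + y) = B x + B y" "B (x - y) = B x - B y" "B (r *\<^sub>R x) = r *\<^sub>R B x" "B (- x) = - B x" "B 0 = 0"
  using B by (simp_all add: linear_simps)

lemma B_eqD: "B x = B y \<Longrightarrow> x = y"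
  using B_inj[of "x - y"] by (simp add: B_simps)

lemma \<Lambda>_B [simp]: "\<Lambda> (B x) = x"
  by (rule inv_f_f) (auto intro: injI B_eqD)

lemma B_\<Lambda>: "u \<in> range B \<Longrightarrow> B (\<Lambda> u) = u" by (rule f_inv_into_f)

lemma \<Lambda>_linear:
  assumes S: "bounded_linear S" and r: "\<And>x. S x \<in> range B" and n: "\<And>x. norm (\<Lambda> (S x)) \<le> C * norm x"
  shows "bounded_linear (\<lambda>x. \<Lambda> (S x))"
proof (rule bounded_linear_intro[where K = C])
  fix x y s
  have "B (\<Lambda> (S (x + y))) = S x + S y" unfolding B_\<Lambda>[OF r] by (simp add: linear_simps[OF S])
  also have "\<dots> = B (\<Lambda> (S x) + \<Lambda> (S y))" by (simp add: B_simps B_\<Lambda> r)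
  finally show "\<Lambda> (S (x + y)) = \<Lambda> (S x) + \<Lambda> (S y)" by (rule B_eqD)
  have "B (\<Lambda> (S (s *\<^sub>R x))) = s *\<^sub>R S x" unfolding B_\<Lambda>[OF r] by (simp add: linear_simps[OF S])
  also have "\<dots> = B (s *\<^sub>R \<Lambda> (S x))" by (simp add: B_simps B_\<Lambda> r)
  finally show "\<Lambda> (S (s *\<^sub>R x)) = s *\<^sub>R \<Lambda> (S x)" by (rule B_eqD)
  show "norm (\<Lambda> (S x)) \<le> norm x * C" using n[of x] by (simp add: mult.commute)
qed

text \<open>By the estimates at time \<open>0\<close> the inverse of \<open>B\<close> is bounded on
  the ranges of \<open>P1\<close> and \<open>P2\<close>. So \<open>e1\<close>, \<open>e2\<close> and
  the kernel \<open>K1\<close> consist of bounded operators for all times, whereas \<open>K3\<close>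
  is meaningful at positive times.\<close>

definition e1 where "e1 x = \<Lambda> (P1 x)"
definition e2 where "e2 x = \<Lambda> (P2 x)"
definition K1 where "K1 r x = U1 (- r) (e1 x)"
definition K3 where "K3 r x = \<Lambda> (T r (P3 x))"
definition k1 where "k1 r = M * exp (- (3 / 4 * \<beta> * r))"
definition k3 where "k3 r = M * r powr (- \<alpha>) * exp (- (3 / 4 * \<beta> * r))"
definition F where "F x = f (B x)"

lemma B_e: "B (e1 x) = P1 x" "B (e2 x) = P2 x"
  using E1[of 0 x] E2[of 0 x] by (simp_all add: e1_def e2_def B_\<Lambda> U_zero)

lemma U_P: "U1 t (P1 x) = U1 t x" "U2 t (P2 x) = U2 t x" "P1 (U1 t x) = U1 t x" "P2 (U2 t x) = U2 t x"
  using U_add(1)[of t 0 x] U_add(2)[of t 0 x] U_add(1)[of 0 t x] U_add(2)[of 0 t x] by (simp_all add: U_zero)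

lemma B_K1: "B (K1 r x) = U1 (- r) x" by (simp add: K1_def B_U B_e U_P)

lemma B_K3: "0 < r \<Longrightarrow> B (K3 r x) = T r (P3 x)" using E3 by (simp add: K3_def B_\<Lambda>)

lemma e_lin: "bounded_linear e1" "bounded_linear e2"
  unfolding e1_def[abs_def] e2_def[abs_def]
  using E1[of 0] E2[of 0] by (auto intro!: \<Lambda>_linear P simp: U_zero)

lemma U1_e1: "U1 t (e1 x) = \<Lambda> (U1 t x)"
proof -
  have "\<Lambda> (B (U1 t (e1 x))) = \<Lambda> (U1 t x)" by (simp only: B_U B_e U_P)
  then show ?thesis by simp
qed

lemma U2_e2: "U2 t (e2 x) = \<Lambda> (U2 t x)"
proof -
  have "\<Lambda> (B (U2 t (e2 x))) = \<Lambda> (U2 t x)" by (simp only: B_U B_e U_P)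
  then show ?thesis by simp
qed

lemma K3_lin: "0 < r \<Longrightarrow> bounded_linear (K3 r)"
  unfolding K3_def[abs_def]
  by (rule \<Lambda>_linear[OF bounded_linear_compose[OF c0_lin[OF T] P(3)]]) (use E3 in auto)

text \<open>For \<open>r > r0 > 0\<close> one has \<open>L\<^sup>\<alpha> T(r) P3 = T(r - r0) L\<^sup>\<alpha> T(r0) P3\<close>.\<close>

lemma K3_cont: "continuous_on {0<..} (\<lambda>r. K3 r x)"
proof -
  have on: "continuous_on {r0<..} (\<lambda>r. K3 r x)" if r0: "0 < r0" for r0
  proof -
    have eq: "K3 r x = T (r - r0) (K3 r0 x)" if "r \<in> {r0<..}" for r
    proof (rule B_eqD)
      have "T r (P3 x) = T (r - r0) (T r0 (P3 x))" using c0_add[OF T, of "r - r0" r0] that r0 by simp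
      then show "B (K3 r x) = B (T (r - r0) (K3 r0 x))" using that r0 by (simp add: B_K3 B_T)
    qed
    have "continuous_on {r0<..} (\<lambda>r. T (r - r0) (K3 r0 x))"
      by (rule continuous_on_compose2[OF c0_continuous_on[OF T]]) (auto intro!: continuous_intros)
    then show ?thesis by (rule continuous_on_eq) (simp add: eq)
  qed
  have "isCont (\<lambda>r. K3 r x) r" if r: "0 < r" for r
  proof -
    have "r \<in> {r / 2<..}" using r by simp
    then show ?thesis
      using on[OF half_gt_zero[OF r]] continuous_on_eq_continuous_at[OF open_greaterThan] by blast
  qed
  then show ?thesis by (simp add: continuous_at_imp_continuous_on)
qed

lemma \<gamma>_pos: "0 < 3 / 4 * \<beta> - \<mu>" using \<mu> by simp

text \<open>The odd looking exponents, such as \<open>1 - 1\<close>, put both weights into the form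
  of \<open>powr_exp_integrable\<close>.\<close>

lemma k_weight:
  "0 < r \<Longrightarrow> k1 r * exp (\<mu> * r) = M * (r powr (1 - 1) * exp (- ((3 / 4 * \<beta> - \<mu>) * r)))"
  "k3 r * exp (\<mu> * r) = M * (r powr ((1 - \<alpha>) - 1) * exp (- ((3 / 4 * \<beta> - \<mu>) * r)))"
proof -
  have "exp (- (3 / 4 * \<beta> * r)) * exp (\<mu> * r) = exp (- ((3 / 4 * \<beta> - \<mu>) * r))"
    by (simp add: exp_add[symmetric] algebra_simps)
  then show "0 < r \<Longrightarrow> k1 r * exp (\<mu> * r) = M * (r powr (1 - 1) * exp (- ((3 / 4 * \<beta> - \<mu>) * r)))"
    "k3 r * exp (\<mu> * r) = M * (r powr ((1 - \<alpha>) - 1) * exp (- ((3 / 4 * \<beta> - \<mu>) * r)))"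
    by (simp_all add: k1_def k3_def mult.assoc)
qed

lemma k_integrable:
  "(\<lambda>r. k1 r * exp (\<mu> * r)) integrable_on {0<..}" "(\<lambda>r. k3 r * exp (\<mu> * r)) integrable_on {0<..}"
proof -
  have "(\<lambda>r. M * (r powr (1 - 1) * exp (- ((3 / 4 * \<beta> - \<mu>) * r)))) integrable_on {0<..}"
    by (intro integrable_on_mult_right powr_exp_integrable \<gamma>_pos) simp
  then show "(\<lambda>r. k1 r * exp (\<mu> * r)) integrable_on {0<..}"
    by (rule integrable_eq) (simp only: k_weight(1) greaterThan_iff)
  show "(\<lambda>r. k3 r * exp (\<mu> * r)) integrable_on {0<..}"
    unfolding k_weight by (intro integrable_on_mult_right powr_exp_integrable \<gamma>_pos) (use \<alpha> in simp)
qed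

lemma K1_kernel: "conv_kernel K1 k1 \<mu>"
proof (rule conv_kernel.intro)
  show "bounded_linear (K1 r)" for r
    unfolding K1_def[abs_def] by (rule bounded_linear_compose[OF U_lin(1) e_lin(1)])
  show "continuous_on {0<..} (\<lambda>r. K1 r x)" for x
    unfolding K1_def by (rule continuous_on_compose2[OF U_cont(1)]) (auto intro!: continuous_intros)
  show "norm (K1 r x) \<le> k1 r * norm x" if "0 < r" for r x
    using E1[of "- r" x] that by (simp add: K1_def U1_e1 k1_def)
  show "continuous_on {0<..} k1" unfolding k1_def[abs_def] by (intro continuous_intros)
  show "(\<lambda>r. k1 r * exp (\<mu> * r)) integrable_on {0<..}" by (rule k_integrable)
  show "0 \<le> k1 r" for r using M by (simp add: k1_def)
  show "0 \<le> \<mu>" using \<mu> \<beta> by simp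
qed

lemma K3_kernel: "conv_kernel K3 k3 \<mu>"
proof (rule conv_kernel.intro)
  show "norm (K3 r x) \<le> k3 r * norm x" if "0 < r" for r x
    using E3[OF that, of x] by (simp add: K3_def k3_def)
  show "continuous_on {0<..} k3" unfolding k3_def[abs_def] by (intro continuous_intros) auto
  show "0 \<le> k3 r" for r using M by (simp add: k3_def)
  show "0 \<le> \<mu>" using \<mu> \<beta> by simp
qed (auto intro: K3_lin K3_cont k_integrable)

lemma U2_kernel: "group_kernel U2 e2 M (\<beta> / 4) \<mu>"
proof (rule group_kernel.intro)
  show "norm (U2 t x) \<le> M * exp (\<beta> / 4 * \<bar>t\<bar>) * norm x" for t x using E2'[of t x] by simp
  show "norm (U2 t (e2 x)) \<le> M * exp (\<beta> / 4 * \<bar>t\<bar>) * norm x" for t x using E2[of t x] by (simp add: U2_e2)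
qed (use U_lin U_cont U_add e_lin \<beta> \<mu> M in auto)

lemma integral_exp_neg: "0 < d \<Longrightarrow> integral {0<..} (\<lambda>s. exp (- d * s)) = 1 / (d::real)"
proof -
  assume d: "0 < d"
  have "((\<lambda>s. exp (- d * s)) has_integral exp (- d * 0) / d) {0..}"
    by (rule has_integral_exp_minus_to_infinity[OF d])
  then have "((\<lambda>s. exp (- d * s)) has_integral 1 / d) {0<..}"
    by (subst has_integral_spike_set_eq[of _ "{0..}"])
      (auto intro: negligible_subset[OF negligible_sing[of 0]])
  then show ?thesis by (rule integral_unique)
qed

text \<open>The kernels of the outer parts together give the second integral of
  \<open>F_const\<close>, the central group the first; here the smallness assumption meets the
  contraction constant.\<close>

lemma F_const_eq: "integral {0<..} (\<lambda>r. k1 r * exp (\<mu> * r)) + integral {0<..} (\<lambda>r. k3 r * exp (\<mu> * r))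
    + M * (1 / (\<mu> - \<beta> / 4)) = F_const M \<alpha> \<beta> \<mu>"
proof -
  have "integral {0<..} (\<lambda>r. k1 r * exp (\<mu> * r)) + integral {0<..} (\<lambda>r. k3 r * exp (\<mu> * r))
      = integral {0<..} (\<lambda>r. k1 r * exp (\<mu> * r) + k3 r * exp (\<mu> * r))"
    by (rule integral_add[OF k_integrable, symmetric])
  also have "\<dots> = integral {0<..} (\<lambda>s. M * ((1 + s powr (- \<alpha>)) * exp (- (3 / 4 * \<beta> - \<mu>) * s)))"
  proof (rule integral_cong)
    fix r :: real assume r: "r \<in> {0<..}"
    define \<gamma> where "\<gamma> = 3 / 4 * \<beta> - \<mu>"
    have "k1 r * exp (\<mu> * r) + k3 r * exp (\<mu> * r)
        = M * (r powr (1 - 1) * exp (- (\<gamma> * r))) + M * (r powr ((1 - \<alpha>) - 1) * exp (- (\<gamma> * r)))"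
      unfolding \<gamma>_def using r by (simp only: k_weight greaterThan_iff)
    also have "\<dots> = M * ((1 + r powr (- \<alpha>)) * exp (- \<gamma> * r))" using r by (simp add: distrib_left distrib_right)
    finally show "k1 r * exp (\<mu> * r) + k3 r * exp (\<mu> * r)
        = M * ((1 + r powr (- \<alpha>)) * exp (- (3 / 4 * \<beta> - \<mu>) * r))" unfolding \<gamma>_def .
  qed
  also have "\<dots> = M * integral {0<..} (\<lambda>s. (1 + s powr (- \<alpha>)) * exp (- (3 / 4 * \<beta> - \<mu>) * s))"
    by (rule integral_mult_right)
  finally show ?thesis
    using integral_exp_neg[of "\<mu> - \<beta> / 4"] \<mu> by (simp add: F_const_def distrib_left)
qed

lemma F_lip: "norm (F x - F y) \<le> l * norm (x - y)" unfolding F_def by (rule f)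

sublocale lyapunov_perron K1 K3 U2 k1 k3 e2 M "\<beta> / 4" \<mu> F l
  by (intro lyapunov_perron.intro lyapunov_perron_axioms.intro K1_kernel K3_kernel U2_kernel F_lip l)
    (simp only: F_const_eq small)

definition is_mild where
  "is_mild u0 u \<longleftrightarrow> (\<forall>t\<ge>0. u t \<in> range B) \<and> continuous_on {0..} (\<lambda>t. \<Lambda> (u t)) \<and>
     (\<forall>t\<ge>0. u t = T t u0 + integral {0..t} (\<lambda>s. T (t - s) (f (u s))))"

lemma P_simps: "P1 (P1 x) = P1 x" "P2 (P2 x) = P2 x" "P3 (P3 x) = P3 x"
  by (rule PP)+

lemma T_apply_continuous:
  assumes "continuous_on Y \<rho>" "\<And>s. s \<in> Y \<Longrightarrow> 0 \<le> \<rho> s \<and> \<rho> s \<le> b" "continuous_on Y \<psi>"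
  shows "continuous_on Y (\<lambda>s. T (\<rho> s) (\<psi> s))"
proof -
  obtain C where C: "1 \<le> C" "\<And>s x. 0 \<le> s \<Longrightarrow> s \<le> b \<Longrightarrow> norm (T s x) \<le> C * norm x"
    using c0_locally_bounded[OF T] by blast
  show ?thesis
    by (rule continuous_on_operator_apply[where I = "{0..b}" and k = "\<lambda>r. C"])
      (use assms C in \<open>auto intro!: c0_lin[OF T] continuous_on_subset[OF c0_continuous_on[OF T]]\<close>)
qed

text \<open>The times may have either sign but are bounded above by \<open>b\<close>: factoring out
  the fixed operator \<open>U1 b\<close> leaves times at most \<open>0\<close>, where the decay
  estimate applies.\<close>

lemma U1_apply_continuous:
  assumes "continuous_on Y \<rho>" "\<And>s. s \<in> Y \<Longrightarrow> \<rho> s \<le> b" "continuous_on Y \<psi>"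
  shows "continuous_on Y (\<lambda>s. U1 (\<rho> s) (\<psi> s))"
proof -
  obtain C where C: "\<And>x. norm (U1 b x) \<le> norm x * C" "0 < C"
    using bounded_linear.pos_bounded[OF U_lin(1)] by blast
  have U: "U1 s x = U1 b (B (K1 (b - s) x))" for s x
    using U_add(1)[of b "s - b" x] by (simp add: B_K1)
  have BK: "bounded_linear (\<lambda>x. U1 b (B x))" by (rule bounded_linear_compose[OF U_lin(1) B])
  have c: "continuous_on Y (\<lambda>s. K1 (b - \<rho> s) (\<psi> s))"
  proof (rule continuous_on_operator_apply[where I = "{0..}" and k = k1 and E = K1])
    show "bounded_linear (K1 r)" for r
      unfolding K1_def[abs_def] by (rule bounded_linear_compose[OF U_lin(1) e_lin(1)])
    show "continuous_on {0..} (\<lambda>r. K1 r x)" for x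
      unfolding K1_def by (rule continuous_on_compose2[OF U_cont(1)]) (auto intro!: continuous_intros)
    show "norm (K1 r x) \<le> k1 r * norm x" if "r \<in> {0..}" for r x
      using E1[of "- r" x] that by (simp add: K1_def U1_e1 k1_def)
    show "continuous_on {0..} k1" unfolding k1_def[abs_def] by (intro continuous_intros)
    show "continuous_on Y (\<lambda>s. b - \<rho> s)" by (intro continuous_intros assms)
    show "(\<lambda>s. b - \<rho> s) ` Y \<subseteq> {0..}" using assms(2) by auto
  qed (rule assms)
  show ?thesis
    using bounded_linear.continuous_on[OF BK c] by (simp add: U[symmetric])
qed

lemma T_decompose: "0 \<le> t \<Longrightarrow> T t x = U1 t x + U2 t x + T t (P3 x)"
proof -
  assume t: "0 \<le> t"
  have "T t x = T t (P1 x + P2 x + P3 x)" by (simp add: P_sum)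
  also have "\<dots> = T t (P1 x) + T t (P2 x) + T t (P3 x)"
    by (simp add: linear_add[OF c0_linear[OF T t]])
  finally show ?thesis by (simp add: U_T[OF t])
qed

text \<open>\<open>a\<close>, the middle term and \<open>d\<close> are the components of the
  solution after applying \<open>B\<close>. Each satisfies a variation of constants formula of its
  own, and the three kernels add up to the full semigroup by \<open>T_decompose\<close>.\<close>

lemma solution_range:
  assumes h: "solves k h"
  defines "\<phi> \<equiv> \<lambda>s. F (h s)"
  defines "a t \<equiv> - B (conv K1 (\<lambda>s. \<phi> (- s)) (- t))"
    and "d t \<equiv> B (conv K3 \<phi> t)"
  shows "B (h t) = a t + B (U2 t k + G.Q \<phi> t) + d t"
    and "P1 (a t) = a t" and "P3 (d t) = d t"
    and "0 \<le> t \<Longrightarrow> B (h t) = T t (B (h 0)) + integral {0..t} (\<lambda>s. T (t - s) (\<phi> s))"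
proof -
  obtain C where "weight_bounded \<mu> C h" using h unfolding solves_def by blast
  from F_weight_bounded[OF this] obtain C' where \<phi>: "weight_bounded \<mu> C' \<phi>" unfolding \<phi>_def by blast
  have c: "continuous_on UNIV \<phi>" using \<phi> by (simp add: weight_bounded_def)
  have cS: "continuous_on Y (\<lambda>s. \<phi> (g s))" if "continuous_on Y g" for Y :: "real set" and g
    by (rule continuous_on_compose2[OF c that]) auto
  have hLP: "h t = LP k \<phi> t" for t using h unfolding solves_def \<phi>_def by blast
  show dec: "B (h t) = a t + B (U2 t k + G.Q \<phi> t) + d t" for t
    unfolding hLP LP_def a_def d_def by (simp add: B_simps)
  have a_int: "((\<lambda>r. U1 (- r) (\<phi> (t + r))) has_integral - a t) {0<..}" for t
  proof -
    have "((\<lambda>r. B (K1 r (\<phi> (- (- t - r))))) has_integral B (conv K1 (\<lambda>s. \<phi> (- s)) (- t))) {0<..}"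
      unfolding conv_def
      by (rule has_integral_linear[OF integrable_integral[OF K1.integrable[OF weight_bounded_reflect[OF \<phi>]]] B, unfolded o_def])
    then show ?thesis by (simp add: B_K1 a_def add.commute)
  qed
  have d_int: "((\<lambda>r. T r (P3 (\<phi> (t - r)))) has_integral d t) {0<..}" for t
  proof -
    have "((\<lambda>r. B (K3 r (\<phi> (t - r)))) has_integral d t) {0<..}"
      unfolding conv_def d_def
      by (rule has_integral_linear[OF integrable_integral[OF K3.integrable[OF \<phi>]] B, unfolded o_def])
    then show ?thesis by (rule has_integral_eq[rotated]) (simp add: B_K3)
  qed
  show Pa: "P1 (a t) = a t" for t
  proof -
    have "((\<lambda>r. P1 (U1 (- r) (\<phi> (t + r)))) has_integral P1 (- a t)) {0<..}"
      by (rule has_integral_linear[OF a_int P(1), unfolded o_def])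
    then have "P1 (- a t) = - a t" unfolding U_P using a_int has_integral_unique by blast
    then show ?thesis by (simp add: linear_simps[OF P(1)])
  qed
  show Pd: "P3 (d t) = d t" for t
  proof -
    have "((\<lambda>r. P3 (T r (P3 (\<phi> (t - r))))) has_integral P3 (d t)) {0<..}"
      by (rule has_integral_linear[OF d_int P(3), unfolded o_def])
    then have "((\<lambda>r. T r (P3 (\<phi> (t - r)))) has_integral P3 (d t)) {0<..}"
      by (rule has_integral_eq[rotated]) (simp add: T_P3[symmetric] P_simps)
    then show ?thesis using d_int has_integral_unique by blast
  qed
  assume t: "0 \<le> t"
  define g1 where "g1 s = U1 (t - s) (\<phi> s)" for s
  define g2 where "g2 s = U2 (t - s) (\<phi> s)" for s
  define g3 where "g3 s = T (t - s) (P3 (\<phi> s))" for s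
  have g1c: "continuous_on {0..t} g1" unfolding g1_def[abs_def]
    by (rule U1_apply_continuous[where b = t]) (auto intro!: continuous_intros cS)
  have g2c: "continuous_on {0..t} g2" unfolding g2_def[abs_def]
    by (rule G.apply_continuous) (auto intro!: continuous_intros cS)
  have g3c: "continuous_on {0..t} g3" unfolding g3_def[abs_def]
    by (rule T_apply_continuous[where b = t])
      (auto intro!: continuous_intros cS bounded_linear.continuous_on[OF P(3)])
  \<comment> \<open>The integral over the future is split at \<open>t\<close>; its tail is
    \<open>U1 (- t)\<close> applied to \<open>- a t\<close>, and \<open>U1 t\<close> undoes this up
    to \<open>P1\<close>.\<close>
  have a_eq: "a t = T t (a 0) + integral {0..t} g1"
  proof -
    let ?f = "\<lambda>r. U1 (- r) (\<phi> r)"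
    have fc: "continuous_on {0..t} ?f"
      by (rule U1_apply_continuous[where b = 0]) (auto intro!: continuous_intros cS)
    have a0: "(?f has_integral - a 0) {0<..}" using a_int[of 0] by (simp only: add_0_left)
    have "integral {0<..} ?f = integral {0..t} ?f + integral {0<..} (\<lambda>r. ?f (t + r))"
      by (rule integral_greaterThan_split[OF has_integral_integrable[OF a0] integrable_continuous_real[OF fc] t])
    then have "- a 0 = integral {0..t} ?f + integral {0<..} (\<lambda>r. ?f (t + r))"
      by (simp only: integral_unique[OF a0])
    moreover have "integral {0<..} (\<lambda>r. ?f (t + r)) = U1 (- t) (- a t)"
    proof (rule integral_unique)
      have "((\<lambda>r. U1 (- t) (U1 (- r) (\<phi> (t + r)))) has_integral U1 (- t) (- a t)) {0<..}"
        by (rule has_integral_linear[OF a_int U_lin(1), unfolded o_def])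
      then show "((\<lambda>r. ?f (t + r)) has_integral U1 (- t) (- a t)) {0<..}"
        by (simp only: U_add(1)[symmetric] minus_add_distrib)
    qed
    ultimately have "U1 t (- a 0) = U1 t (integral {0..t} ?f + U1 (- t) (- a t))" by (simp only:)
    then have "U1 t (- a 0) = U1 t (integral {0..t} ?f) + U1 t (U1 (- t) (- a t))"
      by (simp only: linear_add[OF bounded_linear.linear[OF U_lin(1)]])
    moreover have "U1 t (integral {0..t} ?f) = integral {0..t} g1"
    proof (rule integral_unique[symmetric])
      have "((\<lambda>r. U1 t (?f r)) has_integral U1 t (integral {0..t} ?f)) {0..t}"
        by (rule has_integral_linear[OF integrable_integral[OF integrable_continuous_real[OF fc]] U_lin(1), unfolded o_def])
      then show "(g1 has_integral U1 t (integral {0..t} ?f)) {0..t}"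
        by (simp only: U_add(1)[symmetric] g1_def[abs_def] diff_conv_add_uminus)
    qed
    moreover have "U1 t (U1 (- t) (- a t)) = - a t"
    proof -
      have "U1 t (U1 (- t) (- a t)) = P1 (- a t)" by (simp only: U_add(1)[symmetric] right_minus U_zero)
      then show ?thesis by (simp only: linear_neg[OF bounded_linear.linear[OF P(1)]] Pa)
    qed
    moreover have "U1 t (- a 0) = - T t (a 0)"
      unfolding linear_neg[OF bounded_linear.linear[OF U_lin(1)]] U_T(1)[OF t, symmetric] Pa ..
    ultimately have "- T t (a 0) = integral {0..t} g1 + - a t" by (simp only:)
    moreover have "y = x + z" if "- x = z + - y" for x y z :: 'a
      using that by (metis add.commute add_diff_cancel_right' diff_conv_add_uminus minus_diff_eq)
    ultimately show ?thesis by blast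
  qed
  \<comment> \<open>The integral over the past is split at age \<open>t\<close>: the older part is
    \<open>T t\<close> applied to \<open>d 0\<close>, the recent one the integral from
    \<open>0\<close> to \<open>t\<close>.\<close>
  have d_eq: "d t = T t (d 0) + integral {0..t} g3"
  proof -
    let ?f = "\<lambda>r. T r (P3 (\<phi> (t - r)))"
    have fc: "continuous_on {0..t} ?f"
      by (rule T_apply_continuous[where b = t])
        (auto intro!: continuous_intros cS bounded_linear.continuous_on[OF P(3)])
    have "d t = integral {0..t} ?f + integral {0<..} (\<lambda>r. ?f (t + r))"
      unfolding integral_greaterThan_split[OF has_integral_integrable[OF d_int[of t]] integrable_continuous_real[OF fc] t, symmetric]
      by (rule integral_unique[OF d_int, symmetric])
    moreover have "integral {0<..} (\<lambda>r. ?f (t + r)) = T t (d 0)"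
    proof -
      have "((\<lambda>r. T t (T r (P3 (\<phi> (0 - r))))) has_integral T t (d 0)) {0<..}"
        by (rule has_integral_linear[OF d_int c0_lin[OF T t], unfolded o_def])
      then have "((\<lambda>r. ?f (t + r)) has_integral T t (d 0)) {0<..}"
        by (rule has_integral_eq[rotated]) (use t in \<open>simp add: c0_add[OF T]\<close>)
      then show ?thesis by (rule integral_unique)
    qed
    moreover have "integral {0..t} ?f = integral {0..t} g3"
      using integral_reflect_interval[of t g3] by (simp add: g3_def)
    ultimately show ?thesis by simp
  qed
  have b_eq: "B (U2 t k + G.Q \<phi> t) = T t (B (U2 0 k + G.Q \<phi> 0)) + integral {0..t} g2"
  proof -
    have "G.Q \<phi> 0 = 0" by (simp add: G.Q_def linear_simps[OF U_lin(2)])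
    then have "T t (B (U2 0 k + G.Q \<phi> 0)) = B (U2 t k)"
      by (simp add: U_zero B_P U_T[OF t] B_U)
    moreover have "G.Q \<phi> t = integral {0..t} (\<lambda>s. U2 (t - s) (e2 (\<phi> s)))"
      unfolding G.Q_eq_integral[OF c] using t by (cases "t = 0") auto
    moreover have "B (integral {0..t} (\<lambda>s. U2 (t - s) (e2 (\<phi> s)))) = integral {0..t} g2"
    proof -
      have "((\<lambda>s. B (U2 (t - s) (e2 (\<phi> s)))) has_integral B (integral {0..t} (\<lambda>s. U2 (t - s) (e2 (\<phi> s))))) {0..t}"
        by (rule has_integral_linear[OF integrable_integral[OF integrable_continuous_real[OF G.integrand_cont[OF c]]] B, unfolded o_def])
      then show ?thesis by (simp add: B_U B_e U_P g2_def[abs_def] integral_unique)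
    qed
    ultimately show ?thesis by (simp add: B_simps)
  qed
  have "integral {0..t} (\<lambda>s. T (t - s) (\<phi> s)) = integral {0..t} g1 + integral {0..t} g2 + integral {0..t} g3"
  proof -
    have "((\<lambda>s. g1 s + g2 s + g3 s) has_integral integral {0..t} g1 + integral {0..t} g2 + integral {0..t} g3) {0..t}"
      by (intro has_integral_add integrable_integral integrable_continuous_real g1c g2c g3c)
    then have "((\<lambda>s. T (t - s) (\<phi> s)) has_integral integral {0..t} g1 + integral {0..t} g2 + integral {0..t} g3) {0..t}"
    proof (rule has_integral_eq[rotated])
      fix s assume "s \<in> {0..t}"
      then have "0 \<le> t - s" by simp
      then show "g1 s + g2 s + g3 s = T (t - s) (\<phi> s)"
        unfolding g1_def g2_def g3_def by (rule T_decompose[symmetric])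
    qed
    then show ?thesis by (rule integral_unique)
  qed
  moreover have "T t (B (h 0)) = T t (a 0) + T t (B (U2 0 k + G.Q \<phi> 0)) + T t (d 0)"
    unfolding dec[of 0] by (simp only: linear_add[OF c0_linear[OF T t]])
  ultimately show "B (h t) = T t (B (h 0)) + integral {0..t} (\<lambda>s. T (t - s) (\<phi> s))"
    unfolding dec[of t] b_eq a_eq d_eq by (simp only: ac_simps)
qed

lemma solution_is_mild:
  assumes h: "solves k h"
  shows "is_mild (B (h 0)) (\<lambda>t. B (h t))"
  unfolding is_mild_def
proof (intro conjI allI impI)
  obtain C where "weight_bounded \<mu> C h" using h unfolding solves_def by blast
  then show "continuous_on {0..} (\<lambda>t. \<Lambda> (B (h t)))"
    by (auto simp: weight_bounded_def intro: continuous_on_subset)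
  fix t :: real assume t: "0 \<le> t"
  show "B (h t) = T t (B (h 0)) + integral {0..t} (\<lambda>s. T (t - s) (f (B (h s))))"
    using solution_range(4)[OF h t] by (simp add: F_def)
qed simp

section \<open>Uniqueness of mild solutions\<close>

definition \<kappa> where "\<kappa> r = N * exp (c * r) * M + M * exp (\<beta> / 4 * r) + M * r powr (- \<alpha>)"
text \<open>\<open>E r\<close> is the inverse of \<open>B\<close> applied to \<open>T r\<close>. It
  is assembled from three parts because each has its own estimate: forward growth for
  \<open>U1\<close>, the central bound for \<open>U2\<close>, smoothing for \<open>K3\<close>.
  \<open>\<kappa>\<close> adds up these bounds.\<close>

definition E where "E r x = U1 r (e1 x) + U2 r (e2 x) + K3 r x"

lemma e1_norm: "norm (e1 x) \<le> M * norm x"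
  using E1[of 0 x] by (simp add: e1_def U_zero)

lemma E_norm: assumes r: "0 < r" shows "norm (E r x) \<le> \<kappa> r * norm x"
proof -
  have "norm (U1 r (e1 x)) \<le> N * exp (c * r) * norm (e1 x)" using U1_growth r by simp
  also have "\<dots> \<le> N * exp (c * r) * (M * norm x)" using N by (intro mult_left_mono e1_norm) auto
  finally have 1: "norm (U1 r (e1 x)) \<le> N * exp (c * r) * M * norm x" by (simp add: mult.assoc)
  have 2: "norm (U2 r (e2 x)) \<le> M * exp (\<beta> / 4 * r) * norm x" using E2[of r x] r by (simp add: U2_e2)
  have "norm (K3 r x) \<le> M * r powr (- \<alpha>) * exp (- (3 / 4 * \<beta> * r)) * norm x" using E3[OF r, of x] by (simp add: K3_def)
  also have "\<dots> \<le> M * r powr (- \<alpha>) * 1 * norm x" using M r \<beta> by (intro mult_right_mono mult_left_mono) auto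
  finally have 3: "norm (K3 r x) \<le> M * r powr (- \<alpha>) * norm x" by simp
  have "norm (E r x) \<le> norm (U1 r (e1 x)) + norm (U2 r (e2 x)) + norm (K3 r x)"
    unfolding E_def by (intro order_trans[OF norm_triangle_ineq] add_right_mono norm_triangle_ineq)
  then show ?thesis using 1 2 3 by (simp add: \<kappa>_def distrib_right)
qed

lemma E_lin: "0 < r \<Longrightarrow> bounded_linear (E r)"
  unfolding E_def[abs_def]
  by (intro bounded_linear_add bounded_linear_compose[OF U_lin(1) e_lin(1)] bounded_linear_compose[OF U_lin(2) e_lin(2)] K3_lin)

lemma E_cont: "continuous_on {0<..} (\<lambda>r. E r x)"
  unfolding E_def
  by (intro continuous_on_add K3_cont continuous_on_subset[OF U_cont(1)] continuous_on_subset[OF U_cont(2)]) auto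

lemma B_E: "0 < r \<Longrightarrow> B (E r x) = T r x"
  by (simp add: E_def B_simps B_U B_e U_P B_K3 T_decompose[of r x])

lemma \<kappa>_nonneg: "0 \<le> \<kappa> r" using N M by (simp add: \<kappa>_def)

text \<open>Along the rates \<open>w + real n\<close> the weighted kernel decreases to
  \<open>0\<close> pointwise, and dominated convergence makes its integral as small as
  desired.\<close>

lemma \<kappa>_small:
  obtains \<omega> where "0 < \<omega>" "(\<lambda>r. \<kappa> r * exp (- (\<omega> * r))) integrable_on {0<..}"
    "l * integral {0<..} (\<lambda>r. \<kappa> r * exp (- (\<omega> * r))) \<le> 1 / 2"
proof -
  \<comment> \<open>\<open>w\<close> exceeds both growth rates \<open>c\<close> and
    \<open>\<beta> / 4\<close>, so that the weighted kernel is integrable already for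
    \<open>n = 0\<close>.\<close>
  define w where "w = c + \<beta> / 4 + 1"
  have w: "0 < w - c" "0 < w - \<beta> / 4" "0 < w" using c \<beta> by (auto simp: w_def)
  define g where "g n r = \<kappa> r * exp (- ((w + real n) * r))" for n :: nat and r
  have gi: "g n integrable_on {0<..}" for n
  proof -
    have "(\<lambda>r. N * M * (r powr (1 - 1) * exp (- ((w + n - c) * r))) + M * (r powr (1 - 1) * exp (- ((w + n - \<beta> / 4) * r)))
        + M * (r powr ((1 - \<alpha>) - 1) * exp (- ((w + n) * r)))) integrable_on {0<..}"
      using w \<alpha> by (intro integrable_add integrable_on_mult_right powr_exp_integrable) auto
    then show ?thesis
    proof (rule integrable_eq)
      fix r :: real assume r: "r \<in> {0<..}"
      have "exp (c * r) * exp (- ((w + n) * r)) = exp (- ((w + n - c) * r))"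
        "exp (\<beta> / 4 * r) * exp (- ((w + n) * r)) = exp (- ((w + n - \<beta> / 4) * r))"
        by (simp_all add: exp_add[symmetric] algebra_simps)
      then show "N * M * (r powr (1 - 1) * exp (- ((w + n - c) * r))) + M * (r powr (1 - 1) * exp (- ((w + n - \<beta> / 4) * r)))
        + M * (r powr ((1 - \<alpha>) - 1) * exp (- ((w + n) * r))) = g n r"
        using r unfolding g_def \<kappa>_def distrib_right by (simp add: mult_ac)
    qed
  qed
  have "(\<lambda>n. integral {0<..} (g n)) \<longlonglongrightarrow> integral {0<..} (\<lambda>r::real. 0 :: real)"
  proof (rule dominated_convergence(2)[where h = "g 0"])
    show "g n integrable_on {0<..}" "g 0 integrable_on {0<..}" for n by (rule gi)+
  next
    fix n r assume r: "r \<in> {0::real<..}"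
    have "exp (- ((w + real n) * r)) \<le> exp (- ((w + real 0) * r))" using r by (simp add: mult_right_mono)
    then show "norm (g n r) \<le> g 0 r" unfolding g_def using \<kappa>_nonneg[of r] by (simp add: mult_left_mono)
  next
    fix r assume r: "r \<in> {0::real<..}"
    have "(\<lambda>n. exp (- r) ^ n) \<longlonglongrightarrow> 0" by (rule LIMSEQ_realpow_zero) (use r in simp_all)
    then have "(\<lambda>n. \<kappa> r * exp (- (w * r)) * exp (- r) ^ n) \<longlonglongrightarrow> \<kappa> r * exp (- (w * r)) * 0"
      by (rule tendsto_mult[OF tendsto_const])
    moreover have "\<kappa> r * exp (- (w * r)) * exp (- r) ^ n = g n r" for n
    proof -
      have 1: "exp (- r) ^ n = exp (- (real n * r))" by (simp add: exp_of_nat_mult[symmetric])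
      have 2: "exp (- (w * r)) * exp (- (real n * r)) = exp (- ((w + real n) * r))"
        by (simp add: exp_add[symmetric] algebra_simps)
      show ?thesis unfolding g_def 1 mult.assoc 2 ..
    qed
    ultimately show "(\<lambda>n. g n r) \<longlonglongrightarrow> 0" by simp
  qed
  then have "(\<lambda>n. l * integral {0<..} (g n)) \<longlonglongrightarrow> l * 0" by (intro tendsto_mult tendsto_const) (simp only: integral_0)
  then have "\<forall>\<^sub>F n in sequentially. l * integral {0<..} (g n) < 1 / 2" by (rule order_tendstoD) simp
  then obtain n where n: "l * integral {0<..} (g n) < 1 / 2" by (auto simp: eventually_sequentially)
  show ?thesis
    by (rule that[of "w + real n"]) (use w gi[of n] n in \<open>auto simp: g_def[abs_def]\<close>)
qed

text \<open>Uniqueness holds because the kernel \<open>L\<^sup>\<alpha> T(r)\<close> is integrable at \<open>0\<close>, so that the variation of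
  constants formula is a contraction for a norm with weight \<open>exp (- \<omega> t)\<close>, \<open>\<omega>\<close> large.\<close>

lemma mild_unique:
  assumes u: "is_mild u0 u" and v: "is_mild u0 v" and t0: "0 \<le> t0"
  shows "u t0 = v t0"
proof -
  define w where "w t = \<Lambda> (u t) - \<Lambda> (v t)" for t
  define \<phi> where "\<phi> s = f (u s) - f (v s)" for s
  have ru: "B (\<Lambda> (u t)) = u t" "B (\<Lambda> (v t)) = v t" if "0 \<le> t" for t
    using u v that unfolding is_mild_def by (blast intro: B_\<Lambda>)+
  have cont: "continuous_on {0..} (\<lambda>t. \<Lambda> (u t))" "continuous_on {0..} (\<lambda>t. \<Lambda> (v t))"
    and eqn: "0 \<le> t \<Longrightarrow> u t = T t u0 + integral {0..t} (\<lambda>s. T (t - s) (f (u s)))"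
      "0 \<le> t \<Longrightarrow> v t = T t u0 + integral {0..t} (\<lambda>s. T (t - s) (f (v s)))" for t
    using u v unfolding is_mild_def by blast+
  have Bw: "B (w t) = u t - v t" if "0 \<le> t" for t using ru[OF that] by (simp add: w_def B_simps)
  have wc: "continuous_on {0..} w"
    unfolding w_def[abs_def] by (intro continuous_on_diff cont)
  have F\<Lambda>: "F (\<Lambda> (u t)) = f (u t)" "F (\<Lambda> (v t)) = f (v t)" if "0 \<le> t" for t
    using ru[OF that] by (simp_all add: F_def)
  have fc: "continuous_on {0..} (\<lambda>s. f (u s))" "continuous_on {0..} (\<lambda>s. f (v s))"
  proof -
    have Fc: "continuous_on {0..} (\<lambda>s. F (\<Lambda> (u s)))" "continuous_on {0..} (\<lambda>s. F (\<Lambda> (v s)))"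
      by (rule continuous_on_compose2[OF F_continuous cont(1)], simp, rule continuous_on_compose2[OF F_continuous cont(2)], simp)
    show "continuous_on {0..} (\<lambda>s. f (u s))" by (rule continuous_on_eq[OF Fc(1)]) (simp add: F\<Lambda>)
    show "continuous_on {0..} (\<lambda>s. f (v s))" by (rule continuous_on_eq[OF Fc(2)]) (simp add: F\<Lambda>)
  qed
  then have \<phi>c: "continuous_on {0..} \<phi>" unfolding \<phi>_def[abs_def] by (intro continuous_on_diff)
  have \<phi>n: "norm (\<phi> s) \<le> l * norm (w s)" if "0 \<le> s" for s
    using F_lip[of "\<Lambda> (u s)" "\<Lambda> (v s)"] F\<Lambda>[OF that] by (simp add: \<phi>_def w_def)
  have uv: "u t - v t = integral {0..t} (\<lambda>s. T (t - s) (\<phi> s))" if t: "0 \<le> t" for t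
  proof -
    have i: "(\<lambda>s. T (t - s) (f (u s))) integrable_on {0..t}" "(\<lambda>s. T (t - s) (f (v s))) integrable_on {0..t}"
      by (intro integrable_continuous_real T_apply_continuous[where b = t];
          auto intro!: continuous_intros continuous_on_subset[OF fc(1)] continuous_on_subset[OF fc(2)])+
    have "u t - v t = integral {0..t} (\<lambda>s. T (t - s) (f (u s))) - integral {0..t} (\<lambda>s. T (t - s) (f (v s)))"
      by (subst eqn(1)[OF t], subst eqn(2)[OF t]) (rule add_diff_cancel_left)
    also have "\<dots> = integral {0..t} (\<lambda>s. T (t - s) (f (u s)) - T (t - s) (f (v s)))"
      by (rule integral_diff[OF i, symmetric])
    also have "\<dots> = integral {0..t} (\<lambda>s. T (t - s) (\<phi> s))"
      by (rule integral_cong) (simp add: \<phi>_def linear_diff[OF c0_linear[OF T]])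
    finally show ?thesis .
  qed
  have "u 0 = v 0" using uv[of 0] by simp
  then have \<phi>0: "\<phi> 0 = 0" by (simp add: \<phi>_def)
  obtain \<omega> where \<omega>: "0 < \<omega>" "(\<lambda>r. \<kappa> r * exp (- (\<omega> * r))) integrable_on {0<..}"
    "l * integral {0<..} (\<lambda>r. \<kappa> r * exp (- (\<omega> * r))) \<le> 1 / 2" by (rule \<kappa>_small)
  have "continuous_on {0..t0} (\<lambda>s. exp (- (\<omega> * s)) * norm (w s))"
    by (intro continuous_intros continuous_on_subset[OF wc]) auto
  \<comment> \<open>\<open>t\<close> maximises the weighted difference on \<open>{0..t0}\<close>; it
    suffices to bound the maximum \<open>m\<close> by half of itself.\<close>
  then obtain t where t: "t \<in> {0..t0}" and max: "\<And>s. s \<in> {0..t0} \<Longrightarrow> exp (- (\<omega> * s)) * norm (w s) \<le> exp (- (\<omega> * t)) * norm (w t)"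
    using continuous_attains_sup[of "{0..t0}" "\<lambda>s. exp (- (\<omega> * s)) * norm (w s)"] t0 by auto
  define m where "m = exp (- (\<omega> * t)) * norm (w t)"
  have m0: "0 \<le> m" by (simp add: m_def)
  have t': "0 \<le> t" "t \<le> t0" using t by auto
  have wb: "norm (w s) \<le> m * exp (\<omega> * s)" if "s \<in> {0..t0}" for s
    using mult_right_mono[OF max[OF that], of "exp (\<omega> * s)"] by (simp add: m_def mult_ac exp_minus)
  \<comment> \<open>\<open>\<psi>\<close> extends \<open>\<phi> (t - r)\<close> by
    \<open>\<phi> 0 = 0\<close> for \<open>r\<close> beyond \<open>t\<close>. This keeps it
    continuous and turns the integral up to \<open>t\<close> into one over the half line.\<close>
  define \<psi> where "\<psi> r = \<phi> (max 0 (t - r))" for r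
  have \<psi>0: "\<psi> r = 0" if "t \<le> r" for r using that \<phi>0 by (simp add: \<psi>_def)
  have \<psi>c: "continuous_on {0<..} \<psi>"
    unfolding \<psi>_def[abs_def] by (rule continuous_on_compose2[OF \<phi>c]) (auto intro!: continuous_intros)
  let ?g = "\<lambda>r. (l * m * exp (\<omega> * t)) * (\<kappa> r * exp (- (\<omega> * r)))"
  have Ec: "continuous_on {0<..} (\<lambda>r. E r (\<psi> r))"
  proof (rule continuous_on_operator_apply[where I = "{0<..}" and k = \<kappa> and E = E])
    show "continuous_on {0<..} \<kappa>" unfolding \<kappa>_def[abs_def] by (intro continuous_intros) auto
  qed (use E_lin E_cont E_norm \<psi>c in \<open>auto intro: continuous_on_id\<close>)
  have Eb: "norm (E r (\<psi> r)) \<le> ?g r" if r: "0 < r" for r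
  proof (cases "r \<le> t")
    case True
    have "norm (\<psi> r) \<le> l * norm (w (t - r))" using \<phi>n True by (simp add: \<psi>_def)
    also have "\<dots> \<le> l * (m * exp (\<omega> * (t - r)))" using True r t' l by (intro mult_left_mono wb) auto
    finally have \<psi>n: "norm (\<psi> r) \<le> l * (m * exp (\<omega> * (t - r)))" .
    have "norm (E r (\<psi> r)) \<le> \<kappa> r * norm (\<psi> r)" by (rule E_norm[OF r])
    also have "\<dots> \<le> \<kappa> r * (l * (m * exp (\<omega> * (t - r))))" by (rule mult_left_mono[OF \<psi>n \<kappa>_nonneg])
    also have "exp (\<omega> * (t - r)) = exp (\<omega> * t) * exp (- (\<omega> * r))" by (simp add: exp_add[symmetric] algebra_simps)
    also have "\<kappa> r * (l * (m * (exp (\<omega> * t) * exp (- (\<omega> * r))))) = ?g r" by (simp only: ac_simps)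
    finally show ?thesis .
  next
    case False
    then have "norm (E r (\<psi> r)) \<le> 0" using \<psi>0[of r] E_norm[OF r, of "\<psi> r"] by simp
    also have "0 \<le> ?g r" using l m0 \<kappa>_nonneg[of r] by (intro mult_nonneg_nonneg) auto
    finally show ?thesis .
  qed
  have gi: "?g integrable_on {0<..}" by (rule integrable_on_mult_right[OF \<omega>(2)])
  have Ei: "(\<lambda>r. E r (\<psi> r)) integrable_on {0<..}" by (rule integrable_dominated_continuous[OF Ec Eb gi])
  have "B (integral {0<..} (\<lambda>r. E r (\<psi> r))) = B (w t)"
  proof -
    have "((\<lambda>r. B (E r (\<psi> r))) has_integral B (integral {0<..} (\<lambda>r. E r (\<psi> r)))) {0<..}"
      by (rule has_integral_linear[OF integrable_integral[OF Ei] B, unfolded o_def])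
    then have "((\<lambda>r. if r \<in> {0<..t} then T r (\<phi> (t - r)) else 0) has_integral B (integral {0<..} (\<lambda>r. E r (\<psi> r)))) {0<..}"
    proof (rule has_integral_eq[rotated])
      fix r assume "r \<in> {0::real<..}"
      then have r: "0 < r" by simp
      show "B (E r (\<psi> r)) = (if r \<in> {0<..t} then T r (\<phi> (t - r)) else 0)"
      proof (cases "r \<le> t")
        case True
        then have "\<psi> r = \<phi> (t - r)" by (simp add: \<psi>_def)
        then show ?thesis using r True by (simp add: B_E)
      next
        case False
        then have "\<psi> r = 0" by (simp add: \<psi>0)
        then show ?thesis using False r linear_0[OF c0_linear[OF T]] by (simp add: B_E)
      qed
    qed
    then have "((\<lambda>r. T r (\<phi> (t - r))) has_integral B (integral {0<..} (\<lambda>r. E r (\<psi> r)))) ({0<..t} \<inter> {0<..})"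
      by (simp only: has_integral_restrict_Int)
    moreover have "{0<..t} \<inter> {0<..} = {0<..t}" by auto
    ultimately have i0: "((\<lambda>r. T r (\<phi> (t - r))) has_integral B (integral {0<..} (\<lambda>r. E r (\<psi> r)))) {0<..t}"
      by (simp only:)
    have "((\<lambda>r. T r (\<phi> (t - r))) has_integral B (integral {0<..} (\<lambda>r. E r (\<psi> r)))) {0..t}"
      by (rule iffD1[OF has_integral_spike_set_eq i0]; rule negligible_subset[OF negligible_sing[of 0]]; auto)
    then have "B (integral {0<..} (\<lambda>r. E r (\<psi> r))) = integral {0..t} (\<lambda>r. T r (\<phi> (t - r)))"
      by (rule integral_unique[symmetric])
    also have "\<dots> = integral {0..t} (\<lambda>s. T (t - s) (\<phi> s))"
      using integral_reflect_interval[of t "\<lambda>s. T (t - s) (\<phi> s)"] by simp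
    also have "\<dots> = B (w t)" unfolding uv[OF t'(1), symmetric] Bw[OF t'(1)] ..
    finally show ?thesis .
  qed
  then have "w t = integral {0<..} (\<lambda>r. E r (\<psi> r))" by (rule B_eqD[symmetric])
  also have "norm \<dots> \<le> integral {0<..} ?g"
    by (rule integral_norm_bound_integral[OF Ei gi]) (use Eb in simp)
  also have "\<dots> = m * exp (\<omega> * t) * (l * integral {0<..} (\<lambda>r. \<kappa> r * exp (- (\<omega> * r))))"
    unfolding integral_mult_right by (simp only: ac_simps)
  also have "\<dots> \<le> m * exp (\<omega> * t) * (1 / 2)" using m0 by (intro mult_left_mono \<omega>) auto
  finally have "exp (- (\<omega> * t)) * norm (w t) \<le> exp (- (\<omega> * t)) * (m * exp (\<omega> * t) * (1 / 2))"
    by (rule mult_left_mono) simp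
  also have "\<dots> = m / 2" by (simp add: exp_minus)
  finally have "m \<le> m / 2" by (simp only: m_def[symmetric])
  then have "m = 0" using m0 by simp
  then have "w t0 = 0" using wb[of t0] t0 by simp
  then show ?thesis using Bw[OF t0] by (simp add: B_simps(5))
qed

section \<open>The graph and its invariance\<close>

definition \<Phi> where "\<Phi> t u0 = (THE y. \<exists>u. is_mild u0 u \<and> y = u t)"

lemma \<Phi>_solution:
  assumes h: "solves k h" and t: "0 \<le> t"
  shows "\<Phi> t (B (h 0)) = B (h t)"
  unfolding \<Phi>_def
proof (rule the_equality)
  show "\<exists>u. is_mild (B (h 0)) u \<and> B (h t) = u t" using solution_is_mild[OF h] by blast
  show "y = B (h t)" if "\<exists>u. is_mild (B (h 0)) u \<and> y = u t" for y
    using that mild_unique[OF _ solution_is_mild[OF h] t] by blast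
qed

definition sol where "sol k = (SOME h. solves k h)"

lemma sol: "solves k (sol k)" unfolding sol_def using someI_ex[OF solves_ex] .

text \<open>Subtracting \<open>w\<close>, the central component at time \<open>0\<close>, leaves the
  components of the solution in the other two subspaces.\<close>

definition \<xi> where "\<xi> w = B (sol (\<Lambda> w) 0) - w"

lemma P2_\<Lambda>: assumes "w \<in> range P2 \<inter> range B" shows "P2 (\<Lambda> w) = \<Lambda> w" "B (\<Lambda> w) = w"
proof -
  show 1: "B (\<Lambda> w) = w" using assms B_\<Lambda> by blast
  have "P2 w = w" using assms P_simps by auto
  then have "B (P2 (\<Lambda> w)) = B (\<Lambda> w)" by (simp add: B_P 1)
  then show "P2 (\<Lambda> w) = \<Lambda> w" by (rule B_eqD)
qed

text \<open>At time \<open>0\<close> the term \<open>G.Q\<close> vanishes and \<open>U2 0\<close> is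
  \<open>P2\<close>, so the middle part of the solution is exactly \<open>w\<close>; the outer parts
  are convolutions fixed by \<open>P1\<close> and \<open>P3\<close>.\<close>

lemma \<xi>_decomposition:
  assumes w: "w \<in> range P2 \<inter> range B"
  shows "\<exists>x \<in> range P1 \<inter> range B. \<exists>y \<in> range P3 \<inter> range B. \<xi> w = x + y"
proof -
  let ?\<phi> = "\<lambda>s. F (sol (\<Lambda> w) s)"
  let ?a = "- B (conv K1 (\<lambda>s. ?\<phi> (- s)) (- 0))" and ?d = "B (conv K3 ?\<phi> 0)"
  note r = solution_range[OF sol[of "\<Lambda> w"], of 0]
  have "B (U2 0 (\<Lambda> w) + G.Q ?\<phi> 0) = w"
    by (simp add: G.Q_def linear_simps[OF U_lin(2)] U_zero P2_\<Lambda>[OF w])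
  then have "\<xi> w = ?a + ?d" using r(1) by (simp add: \<xi>_def)
  moreover have "?a \<in> range P1 \<inter> range B"
  proof
    show "?a \<in> range P1" using r(2) by (metis rangeI)
    show "?a \<in> range B" unfolding B_simps(4)[symmetric] by (rule rangeI)
  qed
  moreover have "?d \<in> range P3 \<inter> range B" using r(3) by (metis IntI rangeI)
  ultimately show ?thesis by blast
qed

text \<open>The constant is that of \<open>solves_lipschitz\<close> at time \<open>0\<close>, plus
  \<open>1\<close> for the subtracted \<open>w\<close>.\<close>

lemma \<xi>_lipschitz:
  assumes w: "w \<in> range P2 \<inter> range B" and w': "w' \<in> range P2 \<inter> range B"
  shows "norm (\<Lambda> (\<xi> w - \<xi> w')) \<le> (M / (1 - S * l) + 1) * norm (\<Lambda> (w - w'))"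
proof -
  let ?k = "\<Lambda> w" and ?k' = "\<Lambda> w'"
  have "w - w' = B (?k - ?k')" using w w' by (simp add: B_simps P2_\<Lambda>)
  then have k: "\<Lambda> (w - w') = ?k - ?k'" by simp
  have "\<xi> w - \<xi> w' = B ((sol ?k 0 - sol ?k' 0) - (?k - ?k'))"
    using w w' by (simp add: \<xi>_def B_simps P2_\<Lambda>)
  then have "\<Lambda> (\<xi> w - \<xi> w') = (sol ?k 0 - sol ?k' 0) - (?k - ?k')" by simp
  then have "norm (\<Lambda> (\<xi> w - \<xi> w')) \<le> norm (sol ?k 0 - sol ?k' 0) + norm (?k - ?k')"
    by (simp add: norm_triangle_ineq4)
  then show ?thesis using solves_lipschitz[OF sol[of ?k] sol[of ?k'], of 0] by (simp add: k distrib_right)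
qed

lemma graph_eq: "graph_over (range P2 \<inter> range B) \<xi> = {B (sol k 0) |k. P2 k = k}"
proof (intro set_eqI iffI)
  fix x assume "x \<in> graph_over (range P2 \<inter> range B) \<xi>"
  then obtain w where w: "w \<in> range P2 \<inter> range B" "x = w + \<xi> w" by (auto simp: graph_over_def)
  then have "x = B (sol (\<Lambda> w) 0)" by (simp add: \<xi>_def)
  then show "x \<in> {B (sol k 0) |k. P2 k = k}" using P2_\<Lambda>[OF w(1)] by blast
next
  fix x assume "x \<in> {B (sol k 0) |k. P2 k = k}"
  then obtain k where k: "x = B (sol k 0)" "P2 k = k" by blast
  have "B k = P2 (B k)" unfolding B_P(2)[symmetric] k(2) ..
  then have "B k \<in> range P2" by (rule image_eqI) simp
  then have "B k \<in> range P2 \<inter> range B" by (rule IntI[OF _ rangeI])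
  moreover have "x = B k + \<xi> (B k)" by (simp add: \<xi>_def k)
  ultimately show "x \<in> graph_over (range P2 \<inter> range B) \<xi>" unfolding graph_over_def by blast
qed

text \<open>The solution shifted by \<open>t\<close> is again a fixed point, with its central
  component at time \<open>t\<close> as the new parameter. So every point of the orbit, past or
  future, lies on the graph.\<close>

lemma solution_on_graph: "B (sol k t) \<in> {B (sol k 0) |k. P2 k = k}"
proof -
  let ?k' = "U2 t k + G.Q (\<lambda>s. F (sol k s)) t"
  have "sol k (t + 0) = sol ?k' 0"
    by (rule solves_unique[OF solves_shift[OF sol] sol])
  then have "B (sol k t) = B (sol ?k' 0)" by (simp only: add_0_right)
  moreover have "P2 ?k' = ?k'"
    by (simp only: G.Q_def linear_add[OF bounded_linear.linear[OF P(2)]] U_P)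
  ultimately show ?thesis by blast
qed

text \<open>One inclusion follows an orbit for time \<open>t\<close>; for the other, a point of the
  graph is reached from the point of its own orbit at time \<open>- t\<close>.\<close>

lemma graph_invariant:
  assumes t: "0 \<le> t"
  shows "\<Phi> t ` graph_over (range P2 \<inter> range B) \<xi> = graph_over (range P2 \<inter> range B) \<xi>"
  unfolding graph_eq
proof
  show "\<Phi> t ` {B (sol k 0) |k. P2 k = k} \<subseteq> {B (sol k 0) |k. P2 k = k}"
  proof
    fix x assume "x \<in> \<Phi> t ` {B (sol k 0) |k. P2 k = k}"
    then obtain k where "x = \<Phi> t (B (sol k 0))" by blast
    then have x: "x = B (sol k t)" by (simp only: \<Phi>_solution[OF sol t])
    show "x \<in> {B (sol k 0) |k. P2 k = k}" unfolding x by (rule solution_on_graph)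
  qed
  show "{B (sol k 0) |k. P2 k = k} \<subseteq> \<Phi> t ` {B (sol k 0) |k. P2 k = k}"
  proof
    fix x assume "x \<in> {B (sol k 0) |k. P2 k = k}"
    then obtain k where k: "x = B (sol k 0)" by blast
    have "\<Phi> t (B (sol k (- t + 0))) = B (sol k (- t + t))"
      by (rule \<Phi>_solution[OF solves_shift[OF sol[of k], of "- t"] t])
    then have x: "x = \<Phi> t (B (sol k (- t)))" by (simp only: k add_0_right left_minus)
    show "x \<in> \<Phi> t ` {B (sol k 0) |k. P2 k = k}" unfolding x by (rule imageI[OF solution_on_graph])
  qed
qed

text \<open>Mild solutions and the semiflow are written out, so that the statement matches the
  unfolded definitions for a concrete operator.\<close>

theorem ex_invariant_graph:
  "\<exists>\<xi>. (\<forall>w \<in> range P2 \<inter> range B. \<exists>x \<in> range P1 \<inter> range B. \<exists>y \<in> range P3 \<inter> range B. \<xi> w = x + y) \<and>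
    (\<exists>K\<ge>0. \<forall>w \<in> range P2 \<inter> range B. \<forall>w' \<in> range P2 \<inter> range B. norm (\<Lambda> (\<xi> w - \<xi> w')) \<le> K * norm (\<Lambda> (w - w'))) \<and>
    (\<forall>t\<ge>0. (\<lambda>u0. THE y. \<exists>u. ((\<forall>t\<ge>0. u t \<in> range B) \<and> continuous_on {0..} (\<lambda>t. \<Lambda> (u t)) \<and>
        (\<forall>t\<ge>0. u t = T t u0 + integral {0..t} (\<lambda>s. T (t - s) (f (u s))))) \<and> y = u t)
        ` graph_over (range P2 \<inter> range B) \<xi> = graph_over (range P2 \<inter> range B) \<xi>)"
proof (intro exI[of _ \<xi>] conjI ballI allI impI)
  show "\<exists>x \<in> range P1 \<inter> range B. \<exists>y \<in> range P3 \<inter> range B. \<xi> w = x + y" if "w \<in> range P2 \<inter> range B" for w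
    by (rule \<xi>_decomposition[OF that])
  let ?K = "M / (1 - S * l) + 1"
  have "norm (\<Lambda> (\<xi> w - \<xi> w')) \<le> max 0 ?K * norm (\<Lambda> (w - w'))"
    if "w \<in> range P2 \<inter> range B" "w' \<in> range P2 \<inter> range B" for w w'
    by (rule order_trans[OF \<xi>_lipschitz[OF that] mult_right_mono[OF max.cobounded2 norm_ge_zero]])
  then show "\<exists>K\<ge>0. \<forall>w \<in> range P2 \<inter> range B. \<forall>w' \<in> range P2 \<inter> range B. norm (\<Lambda> (\<xi> w - \<xi> w')) \<le> K * norm (\<Lambda> (w - w'))"
    by (intro exI[of _ "max 0 ?K"]) (simp only: max.cobounded1, blast)
  fix t :: real assume t: "0 \<le> t"
  show "(\<lambda>u0. THE y. \<exists>u. ((\<forall>t\<ge>0. u t \<in> range B) \<and> continuous_on {0..} (\<lambda>t. \<Lambda> (u t)) \<and>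
        (\<forall>t\<ge>0. u t = T t u0 + integral {0..t} (\<lambda>s. T (t - s) (f (u s))))) \<and> y = u t)
        ` graph_over (range P2 \<inter> range B) \<xi> = graph_over (range P2 \<inter> range B) \<xi>"
    using graph_invariant[OF t] unfolding \<Phi>_def[abs_def] is_mild_def .
qed

end

section \<open>Fractional powers of sectorial operators\<close>

context
  fixes D :: "'a::complex_banach set" and A :: "'a \<Rightarrow> 'a" and a :: real
  assumes sec: "sectorial D A" and spec: "\<forall>z \<in> spectrum UNIV D (op_shift A a). 0 < Re z"
begin

lemma sectorial_domain: "csubspace D" "clinear_on D A" "closure D = UNIV"
  using sec by (simp_all add: sectorial_def closed_densely_defined_def)

text \<open>A semigroup is constructed for one shift of \<open>A\<close>; scalar exponential factors
  give one for every other shift, so the choice in \<open>semigroup_exp\<close> is justified for all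
  \<open>c\<close>.\<close>

lemma sectorial_semigroup:
  "c0_semigroup (semigroup_exp D (op_shift A c))"
  "neg_generator D (op_shift A c) (semigroup_exp D (op_shift A c))"
proof -
  obtain \<delta> Mh where H: "half_plane_resolvent D (op_shift A (a - \<delta>)) Mh"
    by (rule sectorial_half_plane_resolvent[OF sec spec])
  obtain T0 where T0: "c0_semigroup T0" "neg_generator D (op_shift A (a - \<delta>)) T0"
    using half_plane_resolvent.half_plane_resolvent_generates[OF H] by blast
  have eq: "op_shift (op_shift A (a - \<delta>)) (c - (a - \<delta>)) = op_shift A c"
    unfolding op_shift_op_shift by simp
  note S = c0_semigroup_scale[OF T0, of "c - (a - \<delta>)", unfolded eq]
  show "c0_semigroup (semigroup_exp D (op_shift A c))"
    "neg_generator D (op_shift A c) (semigroup_exp D (op_shift A c))"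
    by (rule semigroup_exp_I[OF S])+
qed

lemma semigroup_exp_shift:
  assumes t: "0 \<le> t"
  shows "semigroup_exp D (op_shift A (b + c)) t x = exp (- (c * t)) *\<^sub>R semigroup_exp D (op_shift A b) t x"
proof (rule c0_semigroup_unique[OF _ _ sectorial_semigroup sectorial_domain(3) t])
  note S = c0_semigroup_scale[OF sectorial_semigroup[of b], of c, unfolded op_shift_op_shift]
  show "c0_semigroup (\<lambda>t x. exp (- (c * t)) *\<^sub>R semigroup_exp D (op_shift A b) t x)"
    "neg_generator D (op_shift A (b + c)) (\<lambda>t x. exp (- (c * t)) *\<^sub>R semigroup_exp D (op_shift A b) t x)"
    by (rule S)+
qed

text \<open>The margin \<open>\<delta>\<close> becomes the decay rate: the semigroup for the shift
  \<open>a - \<delta>\<close> is bounded, and the one for \<open>a\<close> carries the extra factor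
  exp (- \<delta> t).\<close>

lemma sectorial_exp_stable:
  obtains K \<delta> C R where "exp_stable_semigroup (semigroup_exp D (op_shift A a)) D (op_shift A a) K \<delta> C R"
proof -
  obtain \<delta> Mh where \<delta>: "0 < \<delta>" and H: "half_plane_resolvent D (op_shift A (a - \<delta>)) Mh"
    by (rule sectorial_half_plane_resolvent[OF sec spec])
  obtain T0 K where T0: "c0_semigroup T0" "neg_generator D (op_shift A (a - \<delta>)) T0"
    and K: "\<forall>t\<ge>0. \<forall>x. norm (T0 t x) \<le> K * norm x"
    using half_plane_resolvent.half_plane_resolvent_generates[OF H] by blast
  let ?T = "semigroup_exp D (op_shift A a)"
  \<comment> \<open>The argument \<open>z + \<delta>\<close> makes up for the shift
    \<open>a - \<delta>\<close>, so that \<open>R z\<close> inverts z + A + a, also at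
    \<open>z = 0\<close>.\<close>
  define R where "R z = half_plane_resolvent.R D (op_shift A (a - \<delta>)) (complex_of_real (z + \<delta>))" for z
  have Re: "0 < Re (complex_of_real (z + \<delta>))" if "0 \<le> z" for z using that \<delta> by simp
  have eq: "complex_of_real (z + \<delta>) *\<^sub>C y + op_shift A (a - \<delta>) y = z *\<^sub>R y + op_shift A a y" for z y
    unfolding scaleC_of_real by (simp add: op_shift_def scaleR_add_left scaleR_diff_left)
  have R_lin: "bounded_linear (R z)" if "0 \<le> z" for z
    unfolding R_def by (rule half_plane_resolvent.R_bounded_linear[OF H Re[OF that]])
  have R_in: "R z x \<in> D" if "0 \<le> z" for z x
    unfolding R_def by (rule half_plane_resolvent.R_in[OF H Re[OF that]])
  have R_eq: "z *\<^sub>R R z x + op_shift A a (R z x) = x" if "0 \<le> z" for z x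
    using half_plane_resolvent.R_right[OF H Re[OF that], of x] unfolding eq R_def .
  have R_left: "R z (z *\<^sub>R x + op_shift A a x) = x" if "0 \<le> z" "x \<in> D" for z x
    using half_plane_resolvent.R_left[OF H Re[OF that(1)] that(2)] unfolding eq R_def .
  have comm: "?T t (R z x) = R z (?T t x)" if z: "0 \<le> z" and t: "0 \<le> t" for z t x
  proof (rule c0_commute[OF sectorial_semigroup R_lin[OF z] _ sectorial_domain(3) t])
    fix x assume x: "x \<in> D"
    have "z *\<^sub>R R z x + R z (op_shift A a x) = x"
      using R_left[OF z x]
      by (simp only: linear_add[OF bounded_linear.linear[OF R_lin[OF z]]] linear_scale[OF bounded_linear.linear[OF R_lin[OF z]]])
    then have "z *\<^sub>R R z x + op_shift A a (R z x) = z *\<^sub>R R z x + R z (op_shift A a x)" by (simp only: R_eq[OF z])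
    then show "R z x \<in> D \<and> op_shift A a (R z x) = R z (op_shift A a x)" using R_in[OF z] by (simp only: add_left_cancel)
  qed
  have Tn: "norm (?T t x) \<le> max K 1 * exp (- (\<delta> * t)) * norm x" if t: "0 \<le> t" for t x
  proof -
    have e: "op_shift (op_shift A (a - \<delta>)) \<delta> = op_shift A a" unfolding op_shift_op_shift by simp
    note S = c0_semigroup_scale[OF T0, of \<delta>, unfolded e]
    have "?T t x = exp (- (\<delta> * t)) *\<^sub>R T0 t x"
      by (rule c0_semigroup_unique[OF S sectorial_semigroup sectorial_domain(3) t])
    then have "norm (?T t x) = exp (- (\<delta> * t)) * norm (T0 t x)" by simp
    also have "norm (T0 t x) \<le> max K 1 * norm x"
      using K t by (intro order_trans[OF _ mult_right_mono[OF max.cobounded1 norm_ge_zero]]) auto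
    finally show ?thesis by (simp add: mult_ac)
  qed
  have Rn: "norm (R z x) \<le> Mh / \<delta> * norm x" if z: "0 \<le> z" for z x
  proof -
    have "norm (R z x) \<le> Mh / cmod (complex_of_real (z + \<delta>)) * norm x"
      unfolding R_def by (rule half_plane_resolvent.R_norm[OF H Re[OF z]])
    also have "\<dots> \<le> Mh / \<delta> * norm x"
      unfolding norm_of_real using z \<delta> half_plane_resolvent.M_pos[OF H]
      by (intro mult_right_mono divide_left_mono) auto
    finally show ?thesis .
  qed
  have "exp_stable_semigroup ?T D (op_shift A a) (max K 1) \<delta> (Mh / \<delta>) R"
    by (rule exp_stable_semigroup.intro[OF sectorial_semigroup Tn \<delta> _ R_lin Rn R_in R_eq comm]) auto
  then show ?thesis by (rule that)
qed

lemma neg_frac_pow_\<Phi>: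
  assumes \<alpha>: "\<alpha> \<noteq> 0" and st: "exp_stable_semigroup (semigroup_exp D (op_shift A a)) D (op_shift A a) K \<delta> C R"
  shows "neg_frac_pow \<alpha> D (op_shift A a) x
    = (1 / Gamma \<alpha>) *\<^sub>R exp_stable_semigroup.\<Phi> (semigroup_exp D (op_shift A a)) \<alpha> 0 x"
  using \<alpha> by (simp add: neg_frac_pow_def exp_stable_semigroup.\<Phi>_def[OF st])

lemma neg_frac_pow_bounded_linear:
  assumes \<alpha>: "0 \<le> \<alpha>"
  shows "bounded_linear (neg_frac_pow \<alpha> D (op_shift A a))"
proof (cases "\<alpha> = 0")
  case True
  then have "neg_frac_pow \<alpha> D (op_shift A a) = (\<lambda>x. x)" by (simp add: neg_frac_pow_def fun_eq_iff)
  then show ?thesis by (simp only: bounded_linear_ident)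
next
  case False
  obtain K \<delta> C R where st: "exp_stable_semigroup (semigroup_exp D (op_shift A a)) D (op_shift A a) K \<delta> C R"
    by (rule sectorial_exp_stable)
  have "bounded_linear (exp_stable_semigroup.\<Phi> (semigroup_exp D (op_shift A a)) \<alpha> 0)"
    by (rule exp_stable_semigroup.\<Phi>_bounded_linear[OF st]) (use \<alpha> False in auto)
  from bounded_linear_compose[OF bounded_linear_scaleR_right this] show ?thesis
    unfolding neg_frac_pow_\<Phi>[OF False st, abs_def] .
qed

lemma neg_frac_pow_injective:
  assumes \<alpha>: "0 \<le> \<alpha>" and x: "neg_frac_pow \<alpha> D (op_shift A a) x = 0"
  shows "x = 0"
proof (cases "\<alpha> = 0")
  case True
  then show ?thesis using x by (simp add: neg_frac_pow_def)
next
  case False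
  obtain K \<delta> C R where st: "exp_stable_semigroup (semigroup_exp D (op_shift A a)) D (op_shift A a) K \<delta> C R"
    by (rule sectorial_exp_stable)
  have p: "0 < \<alpha>" using \<alpha> False by simp
  have "Gamma \<alpha> \<noteq> 0" using Gamma_real_pos[OF p] by simp
  then have "exp_stable_semigroup.\<Phi> (semigroup_exp D (op_shift A a)) \<alpha> 0 x = 0"
    using x unfolding neg_frac_pow_\<Phi>[OF False st] by simp
  then show ?thesis by (rule exp_stable_semigroup.\<Phi>_injective[OF st p])
qed

text \<open>Semigroups of different shifts differ by scalar factors, so commutation may be checked
  for any shift \<open>b\<close>.\<close>

lemma neg_frac_pow_commute:
  assumes \<alpha>: "0 \<le> \<alpha>" and Q: "bounded_linear Q"
    and comm: "\<And>t x. 0 \<le> t \<Longrightarrow> semigroup_exp D (op_shift A b) t (Q x) = Q (semigroup_exp D (op_shift A b) t x)"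
  shows "neg_frac_pow \<alpha> D (op_shift A a) (Q x) = Q (neg_frac_pow \<alpha> D (op_shift A a) x)"
proof (cases "\<alpha> = 0")
  case True
  then show ?thesis by (simp add: neg_frac_pow_def)
next
  case False
  obtain K \<delta> C R where st: "exp_stable_semigroup (semigroup_exp D (op_shift A a)) D (op_shift A a) K \<delta> C R"
    by (rule sectorial_exp_stable)
  have ab: "b + (a - b) = a" by simp
  have scale: "Q (r *\<^sub>R y) = r *\<^sub>R Q y" for r y by (rule linear_scale[OF bounded_linear.linear[OF Q]])
  have "semigroup_exp D (op_shift A a) t (Q x) = Q (semigroup_exp D (op_shift A a) t x)" if "0 < t" for t
    using that by (simp only: semigroup_exp_shift[of t b "a - b", unfolded ab] less_imp_le comm scale)
  then have "exp_stable_semigroup.\<Phi> (semigroup_exp D (op_shift A a)) \<alpha> 0 (Q x)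
      = Q (exp_stable_semigroup.\<Phi> (semigroup_exp D (op_shift A a)) \<alpha> 0 x)"
    using \<alpha> False by (intro exp_stable_semigroup.\<Phi>_commute[OF st _ _ Q]) auto
  then show ?thesis unfolding neg_frac_pow_\<Phi>[OF False st] scale by (rule arg_cong)
qed

end

theorem theorem3p1:
  fixes A :: "'a::complex_banach \<Rightarrow> 'a" and D :: "'a set" and f :: "'a \<Rightarrow> 'a"
    and P :: "nat \<Rightarrow> 'a \<Rightarrow> 'a"
    and lam0 :: complex
    and a \<alpha> Lf \<beta>\<^sub>1 \<beta>\<^sub>2 \<beta> M \<mu> :: real
  assumes sectorial: "sectorial D A"
    and a: "0 < a" "\<forall>z \<in> spectrum UNIV D (op_shift A a). 0 < Re z"
    and \<alpha>: "0 \<le> \<alpha>" "\<alpha> < 1"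
    and f: "frac_lipschitz_into_X \<alpha> D (op_shift A a) Lf f"
    and eigenvalue: "eigenvalue D A lam0" "lam0 isolated_in spectrum UNIV D A"
    and gap: "\<beta>\<^sub>1 < Re lam0" "Re lam0 < \<beta>\<^sub>2"
    and spectrum: "spectrum UNIV D A =
      {z \<in> spectrum UNIV D A. Re z \<le> \<beta>\<^sub>1} \<union> {lam0} \<union> {z \<in> spectrum UNIV D A. \<beta>\<^sub>2 \<le> Re z}"
    and decomposition: "spectral_decomposition D A {1, 2, 3}
      (\<lambda>i. if i = 1 then {z \<in> spectrum UNIV D A. Re z \<le> \<beta>\<^sub>1}
           else if i = 2 then {lam0}
           else {z \<in> spectrum UNIV D A. \<beta>\<^sub>2 \<le> Re z}) P"
    and finite_dim: "finite_dim (range (P 1))" "finite_dim (range (P 2))"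
    and \<beta>: "0 < \<beta>" "\<beta> < min (Re lam0 - \<beta>\<^sub>1) (\<beta>\<^sub>2 - Re lam0)"
    and M: "0 < M"
    and M1: "\<forall>lam \<in> J_interval lam0 \<beta>. \<forall>t\<le>0.
      frac_op_norm_le \<alpha> D (op_shift A a) (\<lambda>x. group_exp (op_shift A (- lam)) t (P 1 x))
        (M * exp (3 / 4 * \<beta> * t)) \<and>
      op_norm_le (\<lambda>x. group_exp (op_shift A (- lam)) t (P 1 x)) (M * exp (3 / 4 * \<beta> * t))"
    and M2: "\<forall>lam \<in> J_interval lam0 \<beta>. \<forall>t.
      frac_op_norm_le \<alpha> D (op_shift A a) (\<lambda>x. group_exp (op_shift A (- lam)) t (P 2 x))
        (M * exp (1 / 4 * \<beta> * \<bar>t\<bar>)) \<and>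
      op_norm_le (\<lambda>x. group_exp (op_shift A (- lam)) t (P 2 x)) (M * exp (1 / 4 * \<beta> * \<bar>t\<bar>))"
    and M3: "\<forall>lam \<in> J_interval lam0 \<beta>. \<forall>t>0.
      frac_op_norm_le \<alpha> D (op_shift A a)
        (\<lambda>x. semigroup_exp D (op_shift A (- lam)) t (P 3 (neg_frac_pow \<alpha> D (op_shift A a) x)))
        (M * exp (- (3 / 4) * \<beta> * t)) \<and>
      frac_op_norm_le \<alpha> D (op_shift A a) (\<lambda>x. semigroup_exp D (op_shift A (- lam)) t (P 3 x))
        (M * t powr (- \<alpha>) * exp (- (3 / 4) * \<beta> * t))"
    and \<mu>: "\<beta> / 4 < \<mu>" "\<mu> < 3 / 4 * \<beta>"
    and small: "F_const M \<alpha> \<beta> \<mu> * Lf < 1"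
  shows "\<exists>\<xi> :: real \<Rightarrow> 'a \<Rightarrow> 'a. \<forall>lam \<in> J_interval lam0 \<beta>.
    (\<forall>w \<in> range (P 2) \<inter> frac_dom \<alpha> D (op_shift A a).
       \<exists>x \<in> range (P 1) \<inter> frac_dom \<alpha> D (op_shift A a).
       \<exists>y \<in> range (P 3) \<inter> frac_dom \<alpha> D (op_shift A a). \<xi> lam w = x + y) \<and>
    (\<exists>K. frac_lipschitz_on \<alpha> D (op_shift A a) K
       (range (P 2) \<inter> frac_dom \<alpha> D (op_shift A a)) (\<xi> lam)) \<and>
    (\<forall>t\<ge>0. semiflow \<alpha> D (op_shift A a) (op_shift A (- lam)) f t `
         graph_over (range (P 2) \<inter> frac_dom \<alpha> D (op_shift A a)) (\<xi> lam) =
       graph_over (range (P 2) \<inter> frac_dom \<alpha> D (op_shift A a)) (\<xi> lam))"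
proof -
  let ?L = "op_shift A a"
  let ?B = "neg_frac_pow \<alpha> D (op_shift A a)"
  note dom = sectorial_domain[OF sectorial a(2)]
  have sd: "i \<in> {1, 2, 3} \<Longrightarrow> bounded_clinear (P i)"
    "i \<in> {1, 2, 3} \<Longrightarrow> j \<in> {1, 2, 3} \<Longrightarrow> P i (P j x) = (if i = j then P i x else 0)"
    "(\<Sum>i\<in>{1, 2, 3}. P i x) = x"
    "i \<in> {1, 2, 3} \<Longrightarrow> x \<in> D \<Longrightarrow> P i x \<in> D" "i \<in> {1, 2, 3} \<Longrightarrow> x \<in> D \<Longrightarrow> A (P i x) = P i (A x)" for i j x
    using decomposition unfolding spectral_decomposition_def by blast+
  have mem: "1 \<in> {1, 2, 3::nat}" "2 \<in> {1, 2, 3::nat}" "3 \<in> {1, 2, 3::nat}" by simp_all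
  have P: "bounded_linear (P i)" if "i \<in> {1, 2, 3}" for i by (rule bounded_clinear_bounded_linear[OF sd(1)[OF that]])
  have PP: "P i (P i x) = P i x" if "i \<in> {1, 2, 3}" for i x using sd(2)[OF that that] by simp
  have B: "bounded_linear ?B" by (rule neg_frac_pow_bounded_linear[OF sectorial a(2) \<alpha>(1)])
  have B_inj: "x = 0" if "?B x = 0" for x by (rule neg_frac_pow_injective[OF sectorial a(2) \<alpha>(1) that])
  have inv_B: "inv ?B (?B x) = x" for x
  proof (rule inv_f_f, rule injI)
    fix x y assume "?B x = ?B y"
    then have "?B (x - y) = 0" by (simp add: linear_diff[OF bounded_linear.linear[OF B]])
    then show "x = y" using B_inj[of "x - y"] by simp
  qed
  \<comment> \<open>Because \<open>?B\<close> is injective, the fractional norm of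
    \<open>?B x - ?B y\<close> is the norm of \<open>x - y\<close>, and the Lipschitz condition
    becomes one on the whole space.\<close>
  have f_B: "norm (f (?B x) - f (?B y)) \<le> Lf * norm (x - y)" for x y
  proof -
    have "norm (f (?B x) - f (?B y)) \<le> Lf * frac_norm \<alpha> D ?L (?B x - ?B y)"
      using f unfolding frac_lipschitz_into_X_def frac_dom_def by blast
    also have "?B x - ?B y = ?B (x - y)" by (rule linear_diff[OF bounded_linear.linear[OF B], symmetric])
    finally show ?thesis by (simp only: frac_norm_def frac_pow_def inv_B)
  qed
  have Lf: "0 \<le> Lf" using f by (simp add: frac_lipschitz_into_X_def)
  let ?V = "range (P 2) \<inter> frac_dom \<alpha> D ?L"
  let ?Q = "\<lambda>lam \<xi>. (\<forall>w \<in> ?V. \<exists>x \<in> range (P 1) \<inter> frac_dom \<alpha> D ?L. \<exists>y \<in> range (P 3) \<inter> frac_dom \<alpha> D ?L. \<xi> w = x + y) \<and>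
    (\<exists>K. frac_lipschitz_on \<alpha> D ?L K ?V \<xi>) \<and>
    (\<forall>t\<ge>0. semiflow \<alpha> D ?L (op_shift A (- lam)) f t ` graph_over ?V \<xi> = graph_over ?V \<xi>)"
  \<comment> \<open>The manifold is constructed for each \<open>lam\<close> separately; a choice at
    the end collects the maps into one family.\<close>
  have "\<exists>\<xi>. ?Q lam \<xi>" if lam: "lam \<in> J_interval lam0 \<beta>" for lam
  proof -
    let ?S = "op_shift A (- lam)"
    let ?T = "semigroup_exp D ?S"
    note T = sectorial_semigroup[OF sectorial a(2), of "- lam"]
    have range_D: "range (P i) \<subseteq> D" if "i \<in> {1, 2, 3}" "finite_dim (range (P i))" for i
      by (rule finite_dim_range_subset_domain[OF sd(1)[OF that(1)] that(2) dom(1,3) sd(4)[OF that(1)]])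
    obtain C1 where bp1: "bounded_part (P 1) ?S C1"
      by (rule finite_dim_bounded_part[where c = "- lam", OF sd(1)[OF mem(1)] PP[OF mem(1)] finite_dim(1) dom(1)
          range_D[OF mem(1) finite_dim(1)] dom(2) sd(5)[OF mem(1)]])
    obtain C2 where bp2: "bounded_part (P 2) ?S C2"
      by (rule finite_dim_bounded_part[where c = "- lam", OF sd(1)[OF mem(2)] PP[OF mem(2)] finite_dim(2) dom(1)
          range_D[OF mem(2) finite_dim(2)] dom(2) sd(5)[OF mem(2)]])
    \<comment> \<open>The projection is built into \<open>U i\<close>, so that the bounds
      \<open>M1\<close> and \<open>M2\<close> speak about it literally.\<close>
    define U where "U i = bounded_part.U (P i) ?S" for i
    note U1_def = bounded_part.U_def[OF bp1, folded U_def] and U2_def = bounded_part.U_def[OF bp2, folded U_def]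
    have SP: "?S (P i x) = P i (?S x)" if "i \<in> {1, 2, 3}" "x \<in> D" for i x
      unfolding op_shift_def sd(5)[OF that]
      by (simp only: linear_add[OF bounded_linear.linear[OF P[OF that(1)]]] linear_scale[OF bounded_linear.linear[OF P[OF that(1)]]])
    have T_P: "?T t (P i x) = P i (?T t x)" if "0 \<le> t" "i \<in> {1, 2, 3}" for t i x
      by (rule c0_commute[OF T P[OF that(2)] _ dom(3) that(1)]) (use sd(4) SP that(2) in blast)
    have T_U: "?T t (U i s x) = U i s (?T t x)"
      if t: "0 \<le> t" and i: "i \<in> {1, 2, 3}" "finite_dim (range (P i))" and bp: "bounded_part (P i) ?S C" for t s i C x
    proof (rule c0_commute[OF T _ _ dom(3) t])
      show "bounded_linear (U i s)" unfolding U_def by (rule bounded_part.U_bl[OF bp])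
      fix x assume x: "x \<in> D"
      have "U i s x \<in> range (P i)"
        using rangeI[of "P i" "U i s x"] by (simp only: bounded_part.P_U[OF bp, folded U_def])
      moreover have "?S (U i s x) = U i s (?S x)"
        using bounded_part.S_U[OF bp, of s x, folded U_def] bounded_part.U_P[OF bp, of s "?S x", folded U_def]
        by (simp only: SP[OF i(1) x])
      ultimately show "U i s x \<in> D \<and> ?S (U i s x) = U i s (?S x)" using range_D[OF i] by blast
    qed
    \<comment> \<open>\<open>?B\<close> is built from the semigroup of \<open>op_shift A a\<close>,
      while the commutation relations are available for the semigroup of \<open>?S\<close>; hence
      the shift \<open>- lam\<close>.\<close>
    note B_commute = neg_frac_pow_commute[OF sectorial a(2) \<alpha>(1), of _ "- lam"]
    obtain N where N: "\<And>x. norm (P 1 x) \<le> norm x * N" "0 < N"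
      using bounded_linear.pos_bounded[OF P[OF mem(1)]] by blast
    have im: "invariant_manifold ?T ?B (P 1) (P 2) (P 3) (U 1) (U 2) f \<alpha> \<beta> \<mu> M Lf N C1"
    proof (rule invariant_manifold.intro)
      show "c0_semigroup ?T" by (rule T)
      show "?B (?T t x) = ?T t (?B x)" if "0 \<le> t" for t x
      proof (rule B_commute[OF c0_lin[OF T(1) that]])
        show "?T s (?T t x) = ?T t (?T s x)" if "0 \<le> s" for s x
          using c0_add[OF T(1) that \<open>0 \<le> t\<close>, of x] c0_add[OF T(1) \<open>0 \<le> t\<close> that, of x] by (simp only: add.commute)
      qed
      show "P 1 x + P 2 x + P 3 x = x" for x using sd(3)[of x] by (simp add: add.assoc)
      show "?B (P 1 x) = P 1 (?B x)" "?B (P 2 x) = P 2 (?B x)" for x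
        by (rule B_commute[OF P[OF mem(1)] T_P[OF _ mem(1)]], assumption,
            rule B_commute[OF P[OF mem(2)] T_P[OF _ mem(2)]], assumption)
      show "?T t (P 3 x) = P 3 (?T t x)" if "0 \<le> t" for t x by (rule T_P[OF that mem(3)])
      show "bounded_linear (U 1 t)" "bounded_linear (U 2 t)" for t
        unfolding U_def by (rule bounded_part.U_bl[OF bp1] bounded_part.U_bl[OF bp2])+
      show "continuous_on UNIV (\<lambda>t. U 1 t x)" "continuous_on UNIV (\<lambda>t. U 2 t x)" for x
        unfolding U_def by (rule bounded_part.U_continuous_on[OF bp1] bounded_part.U_continuous_on[OF bp2])+
      show "U 1 (s + t) x = U 1 s (U 1 t x)" "U 2 (s + t) x = U 2 s (U 2 t x)" for s t x
        unfolding U_def by (rule bounded_part.U_group[OF bp1] bounded_part.U_group[OF bp2])+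
      show "U 1 0 x = P 1 x" "U 2 0 x = P 2 x" for x
        unfolding U_def by (rule bounded_part.U_zero[OF bp1] bounded_part.U_zero[OF bp2])+
      show "?T t (P 1 x) = U 1 t x" "?T t (P 2 x) = U 2 t x" if "0 \<le> t" for t x
        unfolding U_def
        by (rule bounded_part_semigroup[OF T bp1 range_D[OF mem(1) finite_dim(1)] that]
            bounded_part_semigroup[OF T bp2 range_D[OF mem(2) finite_dim(2)] that])+
      have U_bl: "bounded_linear (U 1 t)" "bounded_linear (U 2 t)" for t
        unfolding U_def by (rule bounded_part.U_bl[OF bp1] bounded_part.U_bl[OF bp2])+
      show "?B (U 1 t x) = U 1 t (?B x)" for t x
        by (rule B_commute[OF U_bl(1) T_U[OF _ mem(1) finite_dim(1) bp1]])
      show "?B (U 2 t x) = U 2 t (?B x)" for t x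
        by (rule B_commute[OF U_bl(2) T_U[OF _ mem(2) finite_dim(2) bp2]])
      \<comment> \<open>The forward growth rate on the range of \<open>P 1\<close> is the bound
        \<open>C1\<close> of the operator there, and \<open>N\<close> bounds the projection.\<close>
      show "norm (U 1 t x) \<le> N * exp (C1 * t) * norm x" if "0 \<le> t" for t x
      proof -
        have "\<bar>t\<bar> \<le> t" using that by simp
        then have "norm (U 1 t x) \<le> exp (t * C1) * norm (P 1 x)" unfolding U_def by (rule bounded_part.U_norm[OF bp1])
        also have "\<dots> \<le> exp (t * C1) * (norm x * N)" by (rule mult_left_mono[OF N(1)]) simp
        also have "\<dots> = N * exp (C1 * t) * norm x" by (simp only: ac_simps)
        finally show ?thesis .
      qed
      show "0 \<le> N" using N(2) by simp
      show "0 \<le> C1" using bp1 by (simp only: bounded_part_def)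
      show "U 1 t x \<in> range ?B \<and> norm (inv ?B (U 1 t x)) \<le> M * exp (3 / 4 * \<beta> * t) * norm x" if "t \<le> 0" for t x
        using M1 lam that unfolding U1_def frac_op_norm_le_def frac_dom_def frac_pow_def by blast
      show "U 2 t x \<in> range ?B \<and> norm (inv ?B (U 2 t x)) \<le> M * exp (1 / 4 * \<beta> * \<bar>t\<bar>) * norm x" for t x
        using M2 lam unfolding U2_def frac_op_norm_le_def frac_dom_def frac_pow_def by blast
      show "norm (U 2 t x) \<le> M * exp (1 / 4 * \<beta> * \<bar>t\<bar>) * norm x" for t x
        using M2 lam unfolding U2_def op_norm_le_def by blast
      show "?T t (P 3 x) \<in> range ?B \<and> norm (inv ?B (?T t (P 3 x)))
          \<le> M * t powr (- \<alpha>) * exp (- (3 / 4) * \<beta> * t) * norm x" if "0 < t" for t x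
        using M3 lam that unfolding frac_op_norm_le_def frac_dom_def frac_pow_def by blast
    qed (fact B B_inj P[OF mem(1)] P[OF mem(2)] P[OF mem(3)] PP[OF mem(1)] PP[OF mem(2)] PP[OF mem(3)]
        f_B Lf \<alpha> \<beta>(1) \<mu> M small)+
    from invariant_manifold.ex_invariant_graph[OF im] show ?thesis
      unfolding frac_lipschitz_on_def frac_norm_def semiflow_def[abs_def] mild_solution_def frac_dom_def frac_pow_def
      by blast
  qed
  then have "\<forall>lam \<in> J_interval lam0 \<beta>. \<exists>\<xi>. ?Q lam \<xi>" by blast
  from bchoice[OF this] show ?thesis .
qed

end
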